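(* Let $1\leq l\leq l'<n$ and $r,r'\in\mathbb{Z}_n$. Assume that $l+l'\leq n$. Then for all $m\geq 1$ (and for each choice of sign), as $H_n(1,q)$-modules, $$\begin{aligned}P(l,r)\otimes\Omega^{\pm m}V(l',r')\cong&\Big(\bigoplus_{i=0}^{l-1}\big(m+\tfrac{1+(-1)^m}{2}\big)P(l+l'-1-2i,\,r+r'+i)\Big)\\&\oplus\Big(\bigoplus_{i=l'}^{l+l'-1}\big(m+\tfrac{1-(-1)^m}{2}\big)P(n+l+l'-1-2i,\,r+r'+i)\Big)\\&\oplus\Big(\bigoplus_{c(l+l'-1)\leq i\leq l'-1}2\big(m+\tfrac{1+(-1)^m}{2}\big)P(n+l+l'-1-2i,\,r+r'+i)\Big)\\&\oplus\Big(\bigoplus_{1\leq i\leq c(n-l-l')}2\big(m+\tfrac{1-(-1)^m}{2}\big)P(l+l'-1+2i,\,r+r'-i)\Big).\end{aligned}$$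
   Context: Setting: $k$ is an algebraically closed field, $n>2$ is a fixed integer, $q\in k$ is a primitive $n$-th root of unity, $\mathbb{Z}_n=\mathbb{Z}/n\mathbb{Z}$, and $(i)_q=1+q+\cdots+q^{i-1}$. $H_n(1,q)$ is the Hopf algebra over $k$ (isomorphic to the Drinfeld double of the Taft algebra $H_n(q)$) generated as an algebra by $a,b,c,d$ with relations $ba=qab$, $db=qbd$, $ca=qac$, $dc=qcd$, $bc=cb$, $a^n=0$, $b^n=1$, $c^n=1$, $d^n=0$, $da-qad=1-bc$, with comultiplication $\Delta(a)=a\otimes b+1\otimes a$, $\Delta(b)=b\otimes b$, $\Delta(c)=c\otimes c$, $\Delta(d)=d\otimes c+1\otimes d$, counit $\varepsilon(a)=\varepsilon(d)=0$, $\varepsilon(b)=\varepsilon(c)=1$, and antipode $S(a)=-ab^{-1}$, $S(b)=b^{-1}$, $S(c)=c^{-1}$, $S(d)=-dc^{-1}$. All modules are finite-dimensional left $H_n(1,q)$-modules, $\otimes=\otimes_k$ with action through $\Delta$, and $sM$ is the direct sum of $s$ copies of $M$ ($sM=0$ if $s=0$). Simple modules: for $1\leq l\leq n$, $r\in\mathbb{Z}_n$, $V(l,r)$ has basis $v_1,\dots,v_l$ with $av_i=v_{i+1}$ for $i<l$, $av_l=0$, $bv_i=q^{r+i-1}v_i$, $cv_i=q^{i-r-l}v_i$, $dv_1=0$, $dv_i=\alpha_{i-1}(l)v_{i-1}$ for $1<i\leq l$, where $\alpha_i(l)=(i)_q(1-q^{i-l})$. For $1\leq l<n$, $P(l,r)$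 is the projective cover of $V(l,r)$, and $P(n,r)=V(n,r)$ (which is projective). Syzygies: $\Omega M$ is the kernel of a projective cover of $M$, $\Omega^{-1}M$ is the cokernel of an injective envelope of $M$, and $\Omega^{\pm m}$ are the iterates. Conventions: integers in the second argument of $V$ and $P$ are read modulo $n$; $c(t)=\lfloor (t+1)/2\rfloor$ for $t\in\mathbb{Z}$ (the function $c(\cdot)$ is not to be confused with the generator $c$); a direct sum over an empty range of indices is zero. *)

theory Defs
  imports
    "HOL-Computational_Algebra.Polynomial"
    "Jordan_Normal_Form.Matrix"
    "Jordan_Normal_Form.Matrix_Kernel"
begin

text \<open>
  A finite-dimensional left module over \<open>H\<^sub>n(1,q)\<close> is given in coordinates: the underlying space is
  the column space \<open>k\<^sup>d\<close>, and since the algebra is presented by generators and relations, an action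
  on it is the same as four \<open>d \<times> d\<close> matrices satisfying the defining relations. Every
  finite-dimensional module is of this form after choosing a basis, and all finite-dimensional
  modules then live in a single type.
\<close>

datatype gen = Gen_a | Gen_b | Gen_c | Gen_d

record 'k rep =
  rdim :: nat
  ract :: "gen \<Rightarrow> 'k mat"

abbreviation rspace :: "('k, 'm) rep_scheme \<Rightarrow> 'k vec set" where
  "rspace M \<equiv> carrier_vec (rdim M)"

definition H_module :: "nat \<Rightarrow> 'k::field \<Rightarrow> 'k rep \<Rightarrow> bool" where
  "H_module n q M \<longleftrightarrow>
    (\<forall>g. ract M g \<in> carrier_mat (rdim M) (rdim M)) \<and>
    (let a = ract M Gen_a; b = ract M Gen_b; c = ract M Gen_c; d = ract M Gen_d;
         one = 1\<^sub>m (rdim M); zero = 0\<^sub>m (rdim M) (rdim M)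
     in b * a = q \<cdot>\<^sub>m (a * b) \<and> d * b = q \<cdot>\<^sub>m (b * d) \<and>
        c * a = q \<cdot>\<^sub>m (a * c) \<and> d * c = q \<cdot>\<^sub>m (c * d) \<and>
        b * c = c * b \<and>
        a ^\<^sub>m n = zero \<and> b ^\<^sub>m n = one \<and> c ^\<^sub>m n = one \<and> d ^\<^sub>m n = zero \<and>
        d * a - q \<cdot>\<^sub>m (a * d) = one - b * c)"

definition H_hom :: "'k::field rep \<Rightarrow> 'k rep \<Rightarrow> 'k mat \<Rightarrow> bool" where
  "H_hom M N f \<longleftrightarrow> f \<in> carrier_mat (rdim N) (rdim M) \<and> (\<forall>g. f * ract M g = ract N g * f)"

definition H_inj :: "'k::field rep \<Rightarrow> 'k rep \<Rightarrow> 'k mat \<Rightarrow> bool" where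
  "H_inj M N f \<longleftrightarrow> H_hom M N f \<and> inj_on ((*\<^sub>v) f) (rspace M)"

definition H_surj :: "'k::field rep \<Rightarrow> 'k rep \<Rightarrow> 'k mat \<Rightarrow> bool" where
  "H_surj M N f \<longleftrightarrow> H_hom M N f \<and> (*\<^sub>v) f ` rspace M = rspace N"

definition H_iso :: "'k::field rep \<Rightarrow> 'k rep \<Rightarrow> bool" where
  "H_iso M N \<longleftrightarrow> (\<exists>f. H_hom M N f \<and> bij_betw ((*\<^sub>v) f) (rspace M) (rspace N))"

definition H_submodule :: "'k::field rep \<Rightarrow> 'k vec set \<Rightarrow> bool" where
  "H_submodule M U \<longleftrightarrow>
    U \<subseteq> rspace M \<and> 0\<^sub>v (rdim M) \<in> U \<and>
    (\<forall>u\<in>U. \<forall>v\<in>U. u + v \<in> U) \<and> (\<forall>x. \<forall>u\<in>U. x \<cdot>\<^sub>v u \<in> U) \<and>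
    (\<forall>g. \<forall>u\<in>U. ract M g *\<^sub>v u \<in> U)"

definition H_projective :: "nat \<Rightarrow> 'k::field \<Rightarrow> 'k rep \<Rightarrow> bool" where
  "H_projective n q P \<longleftrightarrow> H_module n q P \<and>
    (\<forall>M N p f. H_module n q M \<and> H_module n q N \<and> H_surj M N p \<and> H_hom P N f
       \<longrightarrow> (\<exists>h. H_hom P M h \<and> p * h = f))"

definition H_injective :: "nat \<Rightarrow> 'k::field \<Rightarrow> 'k rep \<Rightarrow> bool" where
  "H_injective n q E \<longleftrightarrow> H_module n q E \<and>
    (\<forall>M N i f. H_module n q M \<and> H_module n q N \<and> H_inj M N i \<and> H_hom M E f
       \<longrightarrow> (\<exists>h. H_hom N E h \<and> h * i = f))"

text \<open>A projective cover is an essential epimorphism from a projective module: no proper submodule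
  of \<open>P\<close> is mapped onto \<open>M\<close>. Dually, in an injective envelope every nonzero submodule of \<open>E\<close> meets
  the image of \<open>M\<close> nontrivially.\<close>

definition projective_cover :: "nat \<Rightarrow> 'k::field \<Rightarrow> 'k rep \<Rightarrow> 'k rep \<Rightarrow> 'k mat \<Rightarrow> bool" where
  "projective_cover n q M P f \<longleftrightarrow> H_module n q M \<and> H_projective n q P \<and> H_surj P M f \<and>
    (\<forall>U. H_submodule P U \<and> (*\<^sub>v) f ` U = rspace M \<longrightarrow> U = rspace P)"

definition injective_envelope :: "nat \<Rightarrow> 'k::field \<Rightarrow> 'k rep \<Rightarrow> 'k rep \<Rightarrow> 'k mat \<Rightarrow> bool" where
  "injective_envelope n q M E f \<longleftrightarrow> H_module n q M \<and> H_injective n q E \<and> H_inj M E f \<and>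
    (\<forall>U. H_submodule E U \<and> U \<inter> (*\<^sub>v) f ` rspace M = {0\<^sub>v (rdim E)} \<longrightarrow> U = {0\<^sub>v (rdim E)})"

text \<open>Syzygies are relations, as they are only determined up to isomorphism: \<open>syzygy n q M K\<close> says
  that \<open>K\<close> is (via some embedding \<open>i\<close>) the kernel of a projective cover of \<open>M\<close>, and
  \<open>cosyzygy n q M C\<close> that \<open>C\<close> is (via some quotient map \<open>p\<close>) the cokernel of an injective envelope
  of \<open>M\<close>. The \<open>m\<close>-fold iterates are the relational powers.\<close>

definition syzygy :: "nat \<Rightarrow> 'k::field \<Rightarrow> 'k rep \<Rightarrow> 'k rep \<Rightarrow> bool" where
  "syzygy n q M K \<longleftrightarrow> H_module n q K \<and>
    (\<exists>P f i. projective_cover n q M P f \<and> H_inj K P i \<and> (*\<^sub>v) i ` rspace K = mat_kernel f)"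

definition cosyzygy :: "nat \<Rightarrow> 'k::field \<Rightarrow> 'k rep \<Rightarrow> 'k rep \<Rightarrow> bool" where
  "cosyzygy n q M C \<longleftrightarrow> H_module n q C \<and>
    (\<exists>E f p. injective_envelope n q M E f \<and> H_surj E C p \<and> mat_kernel p = (*\<^sub>v) f ` rspace M)"

text \<open>\<open>kron A B\<close> is the matrix of \<open>A \<otimes> B\<close> in the basis \<open>e\<^sub>i \<otimes> f\<^sub>j\<close>, which has index \<open>i * N + j\<close>
  (with \<open>N\<close> the dimension of the second factor).\<close>

definition kron :: "'k::semiring_1 mat \<Rightarrow> 'k mat \<Rightarrow> 'k mat" where
  "kron A B = mat (dim_row A * dim_row B) (dim_col A * dim_col B)
    (\<lambda>(i, j). A $$ (i div dim_row B, j div dim_col B) * B $$ (i mod dim_row B, j mod dim_col B))"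

text \<open>The action on a tensor product is through the comultiplication:
  \<open>\<Delta>(a) = a \<otimes> b + 1 \<otimes> a\<close>, \<open>\<Delta>(b) = b \<otimes> b\<close>, \<open>\<Delta>(c) = c \<otimes> c\<close>, \<open>\<Delta>(d) = d \<otimes> c + 1 \<otimes> d\<close>.\<close>

fun tensor_act :: "'k::field rep \<Rightarrow> 'k rep \<Rightarrow> gen \<Rightarrow> 'k mat" where
  "tensor_act M N Gen_a = kron (ract M Gen_a) (ract N Gen_b) + kron (1\<^sub>m (rdim M)) (ract N Gen_a)"
| "tensor_act M N Gen_b = kron (ract M Gen_b) (ract N Gen_b)"
| "tensor_act M N Gen_c = kron (ract M Gen_c) (ract N Gen_c)"
| "tensor_act M N Gen_d = kron (ract M Gen_d) (ract N Gen_c) + kron (1\<^sub>m (rdim M)) (ract N Gen_d)"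

definition H_tensor :: "'k::field rep \<Rightarrow> 'k rep \<Rightarrow> 'k rep" where
  "H_tensor M N = \<lparr>rdim = rdim M * rdim N, ract = tensor_act M N\<rparr>"

definition H_direct_sum :: "'k::field rep list \<Rightarrow> 'k rep" where
  "H_direct_sum Ms =
    \<lparr>rdim = sum_list (map rdim Ms), ract = (\<lambda>g. diag_block_mat (map (\<lambda>M. ract M g) Ms))\<rparr>"

definition H_copies :: "nat \<Rightarrow> 'k::field rep \<Rightarrow> 'k rep" where
  "H_copies s M = H_direct_sum (replicate s M)"

definition V_alpha :: "'k::field \<Rightarrow> nat \<Rightarrow> nat \<Rightarrow> 'k" where
  "V_alpha q l i = (\<Sum>t<i. q ^ t) * (1 - q powi (int i - int l))"

text \<open>Matrices are indexed from 0, so \<open>v\<^sub>1, \<dots>, v\<^sub>l\<close> are the unit vectors with index \<open>0, \<dots>, l - 1\<close>.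
  The second argument is an integer; as \<open>q\<close> will be an \<open>n\<close>-th root of unity, it only matters
  modulo \<open>n\<close>.\<close>

fun V_act :: "'k::field \<Rightarrow> nat \<Rightarrow> int \<Rightarrow> gen \<Rightarrow> 'k mat" where
  "V_act q l r Gen_a = mat l l (\<lambda>(i, j). if i = j + 1 then 1 else 0)"
| "V_act q l r Gen_b = mat l l (\<lambda>(i, j). if i = j then q powi (r + int (j + 1) - 1) else 0)"
| "V_act q l r Gen_c = mat l l (\<lambda>(i, j). if i = j then q powi (int (j + 1) - r - int l) else 0)"
| "V_act q l r Gen_d = mat l l (\<lambda>(i, j). if j = i + 1 then V_alpha q l j else 0)"

definition V_mod :: "'k::field \<Rightarrow> nat \<Rightarrow> int \<Rightarrow> 'k rep" where
  "V_mod q l r = \<lparr>rdim = l, ract = V_act q l r\<rparr>"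

text \<open>\<open>half_up t\<close> is \<open>c(t) = \<lfloor>(t + 1) / 2\<rfloor>\<close>, needed here for \<open>t \<ge> 0\<close> only.\<close>

definition half_up :: "nat \<Rightarrow> nat" where
  "half_up t = (t + 1) div 2"

end

theory Submission
  imports Defs "HOL-Library.Nat_Bijection"
begin

text \<open>Since \<open>P(l,r)\<close> is projective, \<open>P(l,r) \<otimes> W\<close> is projective for every \<open>W\<close>, hence determined by
  the dimensions of its spaces of homomorphisms to the simple modules, and these are additive in
  \<open>W\<close>: only the composition factors of \<open>W\<close> matter. With the \<open>n\<close>-dimensional Verma modules \<open>Z(s,t)\<close>
  there are exact sequences \<open>0 \<rightarrow> V(n-s,t+s) \<rightarrow> Z(s,t) \<rightarrow> V(s,t) \<rightarrow> 0\<close> and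
  \<open>0 \<rightarrow> Z(n-s,t+s) \<rightarrow> P(s,t) \<rightarrow> Z(s,t) \<rightarrow> 0\<close>. By the horseshoe lemma \<open>\<Omega>\<^sup>m V(s,t)\<close> is therefore
  filtered by \<open>m\<close> Verma modules and one simple module, and has \<open>m + [m even]\<close> composition factors
  \<open>V(s,t)\<close> and \<open>m + [m odd]\<close> composition factors \<open>V(n-s,t+s)\<close>. The duality exchanging \<open>a\<close> and \<open>d\<close>
  fixes the simple modules and reduces cosyzygies to syzygies. Finally the multiplicities in
  \<open>P(l,r) \<otimes> V(k,u)\<close> follow by recursion on \<open>k\<close> from the decomposition of \<open>V(k,u) \<otimes> V(2,0)\<close>.\<close>

section \<open>Finitely supported matrices\<close>

text \<open>The covers P(l,r) are given only by their universal property, so no matrices for them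
  are at hand, and their dimension and Verma filtration have to be deduced. Pushing the generator of
  a cover down by powers of d yields two Verma modules that map onto the two layers, so dim P(s,t)
  <= 2n for s < n. Equality comes from tensoring with V(2,0), downwards from V(n,t), which is
  projective by an explicit lifting; only then are the layers known to be Verma modules. The same
  adjunction makes P \<otimes> W projective and moves V(2,0) over to simple modules, where the
  product is computed from highest weight vectors. That Hom dimensions determine a projective module
  requires the V(s,t) to exhaust the simple modules. They do: b and c are diagonalizable with powers
  of q as eigenvalues, because n is invertible in k, and a suitable power of d takes a nonzero
  weight vector to a highest weight vector.\<close>

typedef (overloaded) 'k fm =
    "{f :: nat \<Rightarrow> nat \<Rightarrow> 'k::zero. \<exists>N. \<forall>i j. N \<le> i \<or> N \<le> j \<longrightarrow> f i j = 0}"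
  morphisms ent Abs_fm
  by (rule exI[of _ "\<lambda>_ _. 0"]) auto

setup_lifting type_definition_fm

lemma fm_eqI: "(\<And>i j. ent x i j = ent y i j) \<Longrightarrow> x = y"
  by (metis ent_inject ext)

lemma ent_bound: obtains N where "\<And>i j. N \<le> i \<or> N \<le> j \<Longrightarrow> ent x i j = 0"
  using ent[of x] by auto

instantiation fm :: (field) ring
begin

lift_definition zero_fm :: "'a fm" is "\<lambda>_ _. 0" by auto

lift_definition plus_fm :: "'a fm \<Rightarrow> 'a fm \<Rightarrow> 'a fm" is "\<lambda>f g i j. f i j + g i j"
proof -
  fix f g :: "nat \<Rightarrow> nat \<Rightarrow> 'a"
  assume "\<exists>N. \<forall>i j. N \<le> i \<or> N \<le> j \<longrightarrow> f i j = 0" "\<exists>N. \<forall>i j. N \<le> i \<or> N \<le> j \<longrightarrow> g i j = 0"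
  then obtain N M where "\<forall>i j. N \<le> i \<or> N \<le> j \<longrightarrow> f i j = 0" "\<forall>i j. M \<le> i \<or> M \<le> j \<longrightarrow> g i j = 0"
    by blast
  then show "\<exists>N. \<forall>i j. N \<le> i \<or> N \<le> j \<longrightarrow> f i j + g i j = 0"
    by (intro exI[of _ "max N M"]) auto
qed

lift_definition uminus_fm :: "'a fm \<Rightarrow> 'a fm" is "\<lambda>f i j. - f i j" by auto

definition minus_fm :: "'a fm \<Rightarrow> 'a fm \<Rightarrow> 'a fm" where "minus_fm x y = x + - y"

text \<open>Summing over the support of column \<open>j\<close> of \<open>g\<close>, a finite set,
  gives the matrix product without choosing a common bound for the factors; a sum over all indices
  would be 0 by convention.\<close>

lift_definition times_fm :: "'a fm \<Rightarrow> 'a fm \<Rightarrow> 'a fm"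
  is "\<lambda>f g i j. \<Sum>k | g k j \<noteq> 0. f i k * g k j"
proof -
  fix f g :: "nat \<Rightarrow> nat \<Rightarrow> 'a"
  assume "\<exists>N. \<forall>i j. N \<le> i \<or> N \<le> j \<longrightarrow> f i j = 0" "\<exists>N. \<forall>i j. N \<le> i \<or> N \<le> j \<longrightarrow> g i j = 0"
  then obtain N M where "\<forall>i j. N \<le> i \<or> N \<le> j \<longrightarrow> f i j = 0" "\<forall>i j. M \<le> i \<or> M \<le> j \<longrightarrow> g i j = 0"
    by blast
  then show "\<exists>N. \<forall>i j. N \<le> i \<or> N \<le> j \<longrightarrow> (\<Sum>k | g k j \<noteq> 0. f i k * g k j) = 0"
    by (intro exI[of _ "max N M"]) auto
qed

text \<open>Any finite set that contains all indices with a nonzero product will do. Later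
  computations use initial segments, single indices and images of rectangles under
  \<open>prod_encode\<close>.\<close>

lemma ent_times_on:
  fixes x y :: "'a fm"
  assumes "finite S" and "\<And>k. k \<notin> S \<Longrightarrow> ent x i k = 0 \<or> ent y k j = 0"
  shows "ent (x * y) i j = (\<Sum>k\<in>S. ent x i k * ent y k j)"
proof -
  obtain N where N: "\<And>i j. N \<le> i \<or> N \<le> j \<Longrightarrow> ent y i j = 0" by (rule ent_bound[of y]) blast
  have fin: "finite {k. ent y k j \<noteq> 0}"
    by (rule finite_subset[of _ "{..<N}"]) (use N in \<open>auto simp: not_le[symmetric]\<close>)
  have "ent (x * y) i j = (\<Sum>k | ent y k j \<noteq> 0. ent x i k * ent y k j)" by transfer simp
  also have "\<dots> = (\<Sum>k\<in>S. ent x i k * ent y k j)"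
    by (rule sum.mono_neutral_cong[OF assms(1) fin]) (use assms(2) in auto)
  finally show ?thesis .
qed

lemma ent_times_bound:
  fixes x y :: "'a fm"
  assumes "\<And>i j. N \<le> i \<or> N \<le> j \<Longrightarrow> ent x i j = 0"
  shows "ent (x * y) i j = (\<Sum>k<N. ent x i k * ent y k j)"
  by (rule ent_times_on) (use assms in \<open>auto simp: not_less\<close>)

lemma ent_times_bound':
  fixes x y :: "'a fm"
  assumes "\<And>i j. N \<le> i \<or> N \<le> j \<Longrightarrow> ent y i j = 0"
  shows "ent (x * y) i j = (\<Sum>k<N. ent x i k * ent y k j)"
  by (rule ent_times_on) (use assms in \<open>auto simp: not_less\<close>)

instance
proof
  fix a b c :: "'a fm"
  show "a + b + c = a + (b + c)" by transfer (simp add: add.assoc)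
  show "a + b = b + a" by transfer (simp add: add.commute)
  show "0 + a = a" by transfer simp
  show "- a + a = 0" by transfer simp
  show "a - b = a + - b" by (simp add: minus_fm_def)
  obtain N where N: "\<And>i j. N \<le> i \<or> N \<le> j \<Longrightarrow> ent a i j = 0" by (rule ent_bound[of a]) blast
  obtain M where M: "\<And>i j. M \<le> i \<or> M \<le> j \<Longrightarrow> ent c i j = 0" by (rule ent_bound[of c]) blast
  have eplus: "ent (x + y) i j = ent x i j + ent y i j" for x y :: "'a fm" and i j by transfer simp
  show "a * b * c = a * (b * c)"
  proof (rule fm_eqI)
    fix i j
    have "ent (a * b * c) i j = (\<Sum>l<M. (\<Sum>k<N. ent a i k * ent b k l) * ent c l j)"
      by (simp add: ent_times_bound'[OF M] ent_times_bound[OF N])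
    also have "\<dots> = (\<Sum>l<M. \<Sum>k<N. ent a i k * ent b k l * ent c l j)"
      by (simp add: sum_distrib_right)
    also have "\<dots> = (\<Sum>k<N. \<Sum>l<M. ent a i k * ent b k l * ent c l j)" by (rule sum.swap)
    also have "\<dots> = ent (a * (b * c)) i j"
      by (simp add: ent_times_bound'[OF M] ent_times_bound[OF N] sum_distrib_left mult.assoc)
    finally show "ent (a * b * c) i j = ent (a * (b * c)) i j" .
  qed
  show "(a + b) * c = a * c + b * c"
    by (rule fm_eqI) (simp add: ent_times_bound'[OF M] eplus distrib_right sum.distrib)
  show "a * (b + c) = a * b + a * c"
    by (rule fm_eqI) (simp add: ent_times_bound[OF N] eplus distrib_left sum.distrib)
qed

end

lemma ent_add [simp]: "ent (x + y) i j = ent x i j + ent y i j" by transfer simp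
lemma ent_zero [simp]: "ent 0 i j = 0" by transfer simp
lemma ent_uminus [simp]: "ent (- x) i j = - ent x i j" by transfer simp
lemma ent_diff [simp]: "ent (x - y) i j = ent x i j - ent y i j"
  using ent_add[of x "- y" i j] by simp
lemma ent_sum: "ent (sum f S) i j = (\<Sum>s\<in>S. ent (f s) i j)"
  by (induction S rule: infinite_finite_induct) auto

lift_definition smul :: "'k::field \<Rightarrow> 'k fm \<Rightarrow> 'k fm" (infixr "*\<^sub>k" 75)
  is "\<lambda>c f i j. c * f i j" by auto

lemma ent_smul [simp]: "ent (c *\<^sub>k x) i j = c * ent x i j" by transfer simp

interpretation fm: vector_space smul
  by unfold_locales (auto intro!: fm_eqI simp: algebra_simps)

lemma smul_mult [simp]: "(c *\<^sub>k x) * y = c *\<^sub>k (x * y)"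
proof (rule fm_eqI)
  fix i j
  obtain N where N: "\<And>i j. N \<le> i \<or> N \<le> j \<Longrightarrow> ent x i j = 0" by (rule ent_bound[of x]) blast
  show "ent (c *\<^sub>k x * y) i j = ent (c *\<^sub>k (x * y)) i j"
    by (simp add: ent_times_bound[of N] N sum_distrib_left mult.assoc)
qed

lemma mult_smul [simp]: "x * (c *\<^sub>k y) = c *\<^sub>k (x * y)"
proof (rule fm_eqI)
  fix i j
  obtain N where N: "\<And>i j. N \<le> i \<or> N \<le> j \<Longrightarrow> ent x i j = 0" by (rule ent_bound[of x]) blast
  show "ent (x * c *\<^sub>k y) i j = ent (c *\<^sub>k (x * y)) i j"
    by (simp add: ent_times_bound[of N] N sum_distrib_left mult.left_commute)
qed

lift_definition munit :: "nat \<Rightarrow> nat \<Rightarrow> 'k::field fm"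
  is "\<lambda>a b i j. if i = a \<and> j = b then 1 else 0"
proof -
  show "\<exists>N. \<forall>i j. N \<le> i \<or> N \<le> j \<longrightarrow> (if i = a \<and> j = b then 1 else (0::'k)) = 0" for a b :: nat
    by (rule exI[of _ "Suc (max a b)"]) auto
qed

lemma ent_munit: "ent (munit a b) i j = (if i = a \<and> j = b then 1 else 0)" by transfer simp

lemma ent_mult_munit: "ent (x * munit j k) i l = (if l = k then ent x i j else 0)"
  by (subst ent_times_on[of "{j}"]) (auto simp: ent_munit)

lemma ent_munit_mult: "ent (munit i j * x) k l = (if k = i then ent x j l else 0)"
  by (subst ent_times_on[of "{j}"]) (auto simp: ent_munit)

lemma munit_mult: "munit i j * munit k l = (if j = k then munit i l else 0)"
  by (rule fm_eqI) (auto simp: ent_mult_munit ent_munit)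

lemma munit_mult_same [simp]: "munit i j * munit j l = munit i l"
  by (simp add: munit_mult)

lemma munit_neq_0 [simp]: "munit i j \<noteq> (0 :: 'k::field fm)"
  by (metis ent_munit ent_zero one_neq_zero)

text \<open>The ring \<open>'k fm\<close> has no unit; \<open>idm r\<close> is the unit of the
  corner of r x r matrices.\<close>

definition idm :: "nat \<Rightarrow> 'k::field fm" where "idm r = (\<Sum>i<r. munit i i)"

lemma ent_idm: "ent (idm r) i j = (if i = j \<and> i < r then 1 else 0)"
proof -
  have "ent (idm r) i j = (\<Sum>k<r. if k = i then (if j = i then 1 else 0) else (0::'a))"
    unfolding idm_def ent_sum by (rule sum.cong) (auto simp: ent_munit)
  then show ?thesis by (auto simp: sum.delta)
qed

lemma ent_idm_mult: "ent (idm r * x) i j = (if i < r then ent x i j else 0)"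
  by (subst ent_times_on[of "{i}"]) (auto simp: ent_idm)

lemma ent_mult_idm: "ent (x * idm r) i j = (if j < r then ent x i j else 0)"
  by (subst ent_times_on[of "{j}"]) (auto simp: ent_idm)

lemma idm_idem [simp]: "idm r * idm r = idm r"
  by (rule fm_eqI) (simp add: ent_idm_mult ent_idm)

lemma idm_munit: "idm r * munit i j = (if i < r then munit i j else 0)"
  by (rule fm_eqI) (auto simp: ent_idm_mult ent_munit)

lemma munit_idm: "munit i j * idm r = (if j < r then munit i j else 0)"
  by (rule fm_eqI) (auto simp: ent_mult_idm ent_munit)

lemma idm_bound: obtains N where "idm N * x = x" "x * idm N = x"
proof -
  obtain N where "\<And>i j. N \<le> i \<or> N \<le> j \<Longrightarrow> ent x i j = 0" by (rule ent_bound[of x]) blast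
  then have "idm N * x = x" "x * idm N = x"
    by (auto intro!: fm_eqI simp: ent_idm_mult ent_mult_idm)
  then show thesis by (rule that)
qed

text \<open>Vectors are matrices supported in column 0, that is \<open>x * munit 0 0 = x\<close>,
  and \<open>x * munit j 0\<close> is column \<open>j\<close> of \<open>x\<close> written as such a
  vector.\<close>

lemma column_ext:
  assumes "\<And>j. x * munit j 0 = y * munit j 0" shows "x = y"
proof (rule fm_eqI)
  fix i j
  show "ent x i j = ent y i j"
    using arg_cong[OF assms[of j], of "\<lambda>z. ent z i 0"] by (simp add: ent_mult_munit)
qed

lemma column_ext_idm:
  assumes "x * idm r = x" "y * idm r = y" and "\<And>j. j < r \<Longrightarrow> x * munit j 0 = y * munit j 0"
  shows "x = y"
proof (rule column_ext)
  fix j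
  show "x * munit j 0 = y * munit j 0"
  proof (cases "j < r")
    case False
    then have "x * (idm r * munit j 0) = 0" "y * (idm r * munit j 0) = 0" by (auto simp: idm_munit)
    then show ?thesis by (metis assms(1,2) mult.assoc)
  qed (use assms(3) in auto)
qed

lemma column_expand:
  assumes "idm r * x = x" and "x * munit 0 0 = x"
  shows "x = (\<Sum>i<r. ent x i 0 *\<^sub>k munit i 0)"
proof (rule fm_eqI)
  fix i j
  have "ent x i j = (if j = 0 \<and> i < r then ent x i 0 else 0)"
    using arg_cong[OF assms(1), of "\<lambda>z. ent z i j"] arg_cong[OF assms(2), of "\<lambda>z. ent z i j"]
    by (auto simp: ent_idm_mult ent_mult_munit split: if_splits)
  also have "\<dots> = (\<Sum>k<r. if k = i then (if j = 0 then ent x k 0 else 0) else 0)"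
    by (auto simp: sum.delta)
  also have "\<dots> = ent (\<Sum>i<r. ent x i 0 *\<^sub>k munit i 0) i j"
    unfolding ent_sum by (rule sum.cong) (auto simp: ent_munit)
  finally show "ent x i j = ent (\<Sum>i<r. ent x i 0 *\<^sub>k munit i 0) i j" .
qed

lift_definition tr :: "'k::zero fm \<Rightarrow> 'k fm" is "\<lambda>f i j. f j i" by auto

lemma ent_tr [simp]: "ent (tr x) i j = ent x j i" by transfer simp
lemma tr_tr [simp]: "tr (tr x) = x" by (rule fm_eqI) simp
lemma tr_add [simp]: "tr (x + y) = tr x + tr y" for x :: "'k::field fm" by (rule fm_eqI) simp
lemma tr_diff [simp]: "tr (x - y) = tr x - tr y" for x :: "'k::field fm" by (rule fm_eqI) simp
lemma tr_zero [simp]: "tr (0 :: 'k::field fm) = 0" by (rule fm_eqI) simp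
lemma tr_smul [simp]: "tr (c *\<^sub>k x) = c *\<^sub>k tr x" by (rule fm_eqI) simp
lemma tr_munit [simp]: "tr (munit i j) = munit j i" by (rule fm_eqI) (auto simp: ent_munit)
lemma tr_idm [simp]: "tr (idm r) = idm r" by (rule fm_eqI) (auto simp: ent_idm)
lemma tr_inject [simp]: "tr x = tr y \<longleftrightarrow> x = y" by (metis tr_tr)
lemma tr_eq_0 [simp]: "tr x = 0 \<longleftrightarrow> x = (0 :: 'k::field fm)" by (metis tr_tr tr_zero)

lemma tr_mult [simp]: "tr (x * y) = tr y * tr x" for x :: "'k::field fm"
proof (rule fm_eqI)
  fix i j
  obtain N where N: "\<And>i j. N \<le> i \<or> N \<le> j \<Longrightarrow> ent x i j = 0" by (rule ent_bound[of x]) blast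
  then have N': "\<And>i j. N \<le> i \<or> N \<le> j \<Longrightarrow> ent (tr x) i j = 0" by auto
  show "ent (tr (x * y)) i j = ent (tr y * tr x) i j"
    by (simp add: ent_times_bound[OF N] ent_times_bound'[OF N'] mult.commute)
qed

text \<open>Induction on the number of columns, with \<open>f\<close> split into \<open>f'\<close>
  and its last column \<open>u\<close>. An inner inverse \<open>g'\<close> of \<open>f'\<close>
  still works if \<open>u\<close> lies in the column space of \<open>f'\<close>; otherwise a
  rank-one correction accounts for the part of \<open>u\<close> outside it. Regularity replaces all
  choices of complements for kernels and images.\<close>

theorem regular: "\<exists>g. f * g * f = (f :: 'k::field fm)"
proof -
  obtain N where "f * idm N = f" by (rule idm_bound[of f]) blast
  then show ?thesis
  proof (induction N arbitrary: f)
    case 0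
    then have "f = 0" by (simp add: idm_def)
    then show ?case by simp
  next
    case (Suc N)
    define f' u e where "f' = f * idm N" and "u = f * munit N N" and "e = (munit N N :: 'k fm)"
    have idS: "idm (Suc N) = idm N + (munit N N :: 'k fm)" by (simp add: idm_def)
    have f: "f = f' + u" using Suc.prems by (simp add: f'_def u_def idS distrib_left)
    have ff: "f' * idm N = f'" by (simp add: f'_def mult.assoc)
    obtain g0 where g0: "f' * g0 * f' = f'" using Suc.IH[OF ff] by blast
    define g' where "g' = idm N * g0"
    have g': "f' * (g' * f') = f'" using g0 ff by (metis g'_def mult.assoc)
    have fe: "f' * e = 0" by (simp add: f'_def e_def mult.assoc idm_munit)
    have ue: "u * e = u" by (simp add: u_def e_def mult.assoc)
    have eg: "e * g' = 0" by (simp add: e_def g'_def mult.assoc[symmetric] munit_idm)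
    have ug0: "u * g' = 0" by (metis eg mult.assoc mult_zero_right ue)
    have ug: "u * (g' * x) = 0" for x by (simp add: mult.assoc[symmetric] ug0)
    \<comment> \<open>\<open>f' * g'\<close> projects onto the column space of \<open>f'\<close>, so
      \<open>v\<close> is the component of \<open>u\<close> outside that space.\<close>
    define v where "v = u - f' * g' * u"
    have ve: "v * e = v" by (simp add: v_def left_diff_distrib mult.assoc ue)
    show ?case
    proof (cases "v = 0")
      case True
      then have "f' * (g' * u) = u" by (simp add: v_def mult.assoc)
      then have "f * g' * f = f" by (simp add: f algebra_simps g' ug ug0)
      then show ?thesis by blast
    next
      case False
      then obtain k j where kj: "ent v k j \<noteq> 0" by (metis ent_zero fm_eqI)
      have vent: "ent v i l = (if l = N then ent v i N else 0)" for i l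
      proof -
        have "ent v i l = ent (v * munit N N) i l" using ve by (simp only: e_def)
        then show ?thesis by (simp only: ent_mult_munit)
      qed
      have kN: "ent v k N \<noteq> 0" using kj vent[of k j] by (simp split: if_splits)
      define w where "w = (1 / ent v k N) *\<^sub>k munit N k"
      have wv: "w * v = e"
        unfolding w_def e_def
      proof (rule fm_eqI)
        fix i l
        show "ent ((1 / ent v k N) *\<^sub>k munit N k * v) i l = ent (munit N N) i l"
          using kN vent[of k l] by (simp add: ent_munit_mult ent_munit)
      qed
      have ew: "e * w = w" by (simp add: w_def e_def)
      \<comment> \<open>\<open>w\<close> sends \<open>v\<close> to \<open>e\<close>; the correction
        makes it vanish on the column space of \<open>f'\<close>, so that it sends \<open>u\<close>
        itself to \<open>e\<close>.\<close>
      define w0 where "w0 = w - w * f' * g'"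
      have w0f: "w0 * f' = 0" by (simp add: w0_def left_diff_distrib mult.assoc g')
      have w0u: "w0 * u = e" using wv by (simp add: w0_def v_def algebra_simps)
      have ew0: "e * w0 = w0" using ew by (simp add: w0_def right_diff_distrib mult.assoc[symmetric])
      have fw: "f' * w0 = 0" by (metis ew0 fe mult.assoc mult_zero_left)
      have fw0: "f' * (w0 * x) = 0" for x by (simp add: mult.assoc[symmetric] fw)
      have "f * (g' - g' * u * w0 + w0) * f = f"
        unfolding f by (simp add: algebra_simps g' ug ug0 fw fw0 w0f w0u ue)
      then show ?thesis by blast
    qed
  qed
qed

section \<open>Tensor products and currying of matrices\<close>

lemma sum_prod_encode:
  "(\<Sum>m\<in>prod_encode ` ({..<N} \<times> {..<M}). F m) = (\<Sum>k<N. \<Sum>l<M. F (prod_encode (k, l)))"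
  by (subst sum.reindex[OF inj_prod_encode]) (simp add: sum.cartesian_product case_prod_unfold)

lemma prod_decode_notin:
  assumes "k \<notin> prod_encode ` ({..<N} \<times> {..<M})"
  shows "N \<le> fst (prod_decode k) \<or> M \<le> snd (prod_decode k)"
proof (rule ccontr)
  assume "\<not> ?thesis"
  then have "prod_decode k \<in> {..<N} \<times> {..<M}" by (cases "prod_decode k") auto
  then have "prod_encode (prod_decode k) \<in> prod_encode ` ({..<N} \<times> {..<M})" by (rule imageI)
  then show False using assms by simp
qed

lemma prod_decode_unbounded:
  obtains B where "\<And>i. B \<le> i \<Longrightarrow> N \<le> fst (prod_decode i) \<or> M \<le> snd (prod_decode i)"
proof -
  have "finite (prod_encode ` ({..<N} \<times> {..<M}))" by simp
  then obtain B where "\<forall>i\<in>prod_encode ` ({..<N} \<times> {..<M}). i < B"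
    using finite_nat_set_iff_bounded by meson
  then show thesis using prod_decode_notin by (intro that[of B]) (metis not_less)
qed

text \<open>Pairs of indices are coded by \<open>prod_decode\<close> instead of
  \<open>i * N + j\<close>. The product then does not depend on the sizes of its factors, and
  \<open>tens_mult\<close> holds without side conditions.\<close>

lift_definition tens :: "'k::field fm \<Rightarrow> 'k fm \<Rightarrow> 'k fm" (infixl "\<otimes>\<^sub>k" 72)
  is "\<lambda>f g i j. f (fst (prod_decode i)) (fst (prod_decode j)) * g (snd (prod_decode i)) (snd (prod_decode j))"
proof -
  fix f g :: "nat \<Rightarrow> nat \<Rightarrow> 'k"
  assume "\<exists>N. \<forall>i j. N \<le> i \<or> N \<le> j \<longrightarrow> f i j = 0" "\<exists>N. \<forall>i j. N \<le> i \<or> N \<le> j \<longrightarrow> g i j = 0"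
  then obtain N M where N: "\<forall>i j. N \<le> i \<or> N \<le> j \<longrightarrow> f i j = 0"
    and M: "\<forall>i j. M \<le> i \<or> M \<le> j \<longrightarrow> g i j = 0" by blast
  obtain B where B: "\<And>i. B \<le> i \<Longrightarrow> N \<le> fst (prod_decode i) \<or> M \<le> snd (prod_decode i)"
    by (rule prod_decode_unbounded[of N M]) blast
  show "\<exists>N. \<forall>i j. N \<le> i \<or> N \<le> j \<longrightarrow>
      f (fst (prod_decode i)) (fst (prod_decode j)) * g (snd (prod_decode i)) (snd (prod_decode j)) = 0"
  proof (intro exI[of _ B] allI impI)
    fix i j assume "B \<le> i \<or> B \<le> j"
    then show "f (fst (prod_decode i)) (fst (prod_decode j)) * g (snd (prod_decode i)) (snd (prod_decode j)) = 0"
      using N M B[of i] B[of j] by auto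
  qed
qed

lemma ent_tens: "ent (x \<otimes>\<^sub>k y) i j =
    ent x (fst (prod_decode i)) (fst (prod_decode j)) * ent y (snd (prod_decode i)) (snd (prod_decode j))"
  by transfer simp

lemma ent_tens_enc [simp]: "ent (x \<otimes>\<^sub>k y) (prod_encode (i, i')) (prod_encode (j, j')) = ent x i j * ent y i' j'"
  by (simp add: ent_tens)

lemma tens_mult [simp]: "(x \<otimes>\<^sub>k y) * (z \<otimes>\<^sub>k w) = (x * z) \<otimes>\<^sub>k (y * w)"
proof (rule fm_eqI)
  fix i j
  obtain N where N: "\<And>i j. N \<le> i \<or> N \<le> j \<Longrightarrow> ent x i j = 0" by (rule ent_bound[of x]) blast
  obtain M where M: "\<And>i j. M \<le> i \<or> M \<le> j \<Longrightarrow> ent y i j = 0" by (rule ent_bound[of y]) blast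
  let ?S = "prod_encode ` ({..<N} \<times> {..<M})"
  have "ent ((x \<otimes>\<^sub>k y) * (z \<otimes>\<^sub>k w)) i j = (\<Sum>k\<in>?S. ent (x \<otimes>\<^sub>k y) i k * ent (z \<otimes>\<^sub>k w) k j)"
  proof (rule ent_times_on)
    fix k assume k: "k \<notin> ?S"
    from prod_decode_notin[OF k] show "ent (x \<otimes>\<^sub>k y) i k = 0 \<or> ent (z \<otimes>\<^sub>k w) k j = 0" by (auto simp: ent_tens N M)
  qed auto
  also have "\<dots> = (\<Sum>(k, l)\<in>{..<N} \<times> {..<M}.
      (ent x (fst (prod_decode i)) k * ent z k (fst (prod_decode j))) *
      (ent y (snd (prod_decode i)) l * ent w l (snd (prod_decode j))))"
    by (subst sum.reindex[OF inj_prod_encode]) (auto intro!: sum.cong simp: ent_tens)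
  also have "\<dots> = ent ((x * z) \<otimes>\<^sub>k (y * w)) i j"
    by (simp add: ent_tens ent_times_bound[OF N] ent_times_bound[OF M] sum_product sum.cartesian_product)
  finally show "ent ((x \<otimes>\<^sub>k y) * (z \<otimes>\<^sub>k w)) i j = ent ((x * z) \<otimes>\<^sub>k (y * w)) i j" .
qed

lemma tens_add_left: "(x + y) \<otimes>\<^sub>k z = x \<otimes>\<^sub>k z + y \<otimes>\<^sub>k z" by (rule fm_eqI) (simp add: ent_tens algebra_simps)
lemma tens_add_right: "x \<otimes>\<^sub>k (y + z) = x \<otimes>\<^sub>k y + x \<otimes>\<^sub>k z" by (rule fm_eqI) (simp add: ent_tens algebra_simps)
lemma tens_diff_left: "(x - y) \<otimes>\<^sub>k z = x \<otimes>\<^sub>k z - y \<otimes>\<^sub>k z" by (rule fm_eqI) (simp add: ent_tens algebra_simps)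
lemma tens_diff_right: "x \<otimes>\<^sub>k (y - z) = x \<otimes>\<^sub>k y - x \<otimes>\<^sub>k z" by (rule fm_eqI) (simp add: ent_tens algebra_simps)
lemma tens_smul_left [simp]: "(c *\<^sub>k x) \<otimes>\<^sub>k y = c *\<^sub>k (x \<otimes>\<^sub>k y)" by (rule fm_eqI) (simp add: ent_tens)
lemma tens_smul_right [simp]: "x \<otimes>\<^sub>k (c *\<^sub>k y) = c *\<^sub>k (x \<otimes>\<^sub>k y)" by (rule fm_eqI) (simp add: ent_tens)
lemma tens_zero [simp]: "0 \<otimes>\<^sub>k y = 0" "x \<otimes>\<^sub>k 0 = 0" by (rule fm_eqI, simp add: ent_tens)+
lemma tens_minus [simp]: "(- x) \<otimes>\<^sub>k y = - (x \<otimes>\<^sub>k y)" "x \<otimes>\<^sub>k (- y) = - (x \<otimes>\<^sub>k y)"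
  by (rule fm_eqI, simp add: ent_tens)+

text \<open>A matrix \<open>f\<close> from \<open>P \<otimes> B\<close> to \<open>A\<close> becomes \<open>curry_fm f\<close> from \<open>P\<close> to \<open>A \<otimes> B\<^sup>*\<close>; tensor products of
  index sets are encoded by \<open>prod_encode\<close>.\<close>

lift_definition curry_fm :: "'k::field fm \<Rightarrow> 'k fm"
  is "\<lambda>f i p. f (fst (prod_decode i)) (prod_encode (p, snd (prod_decode i)))"
proof -
  fix f :: "nat \<Rightarrow> nat \<Rightarrow> 'k"
  assume "\<exists>N. \<forall>i j. N \<le> i \<or> N \<le> j \<longrightarrow> f i j = 0"
  then obtain N where N: "\<forall>i j. N \<le> i \<or> N \<le> j \<longrightarrow> f i j = 0" by blast
  obtain B where B: "\<And>i. B \<le> i \<Longrightarrow> N \<le> fst (prod_decode i) \<or> N \<le> snd (prod_decode i)"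
    by (rule prod_decode_unbounded[of N N]) blast
  show "\<exists>N. \<forall>i j. N \<le> i \<or> N \<le> j \<longrightarrow> f (fst (prod_decode i)) (prod_encode (j, snd (prod_decode i))) = 0"
  proof (intro exI[of _ "max B N"] allI impI)
    fix i j assume "max B N \<le> i \<or> max B N \<le> j"
    then have "N \<le> fst (prod_decode i) \<or> N \<le> prod_encode (j, snd (prod_decode i))"
      using B[of i] order_trans[OF _ le_prod_encode_1, of N j] order_trans[OF _ le_prod_encode_2, of N "snd (prod_decode i)"]
      by (meson max.boundedE)
    then show "f (fst (prod_decode i)) (prod_encode (j, snd (prod_decode i))) = 0" using N by blast
  qed
qed

lift_definition uncurry_fm :: "'k::field fm \<Rightarrow> 'k fm"
  is "\<lambda>f x y. f (prod_encode (x, snd (prod_decode y))) (fst (prod_decode y))"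
proof -
  fix f :: "nat \<Rightarrow> nat \<Rightarrow> 'k"
  assume "\<exists>N. \<forall>i j. N \<le> i \<or> N \<le> j \<longrightarrow> f i j = 0"
  then obtain N where N: "\<forall>i j. N \<le> i \<or> N \<le> j \<longrightarrow> f i j = 0" by blast
  obtain B where B: "\<And>i. B \<le> i \<Longrightarrow> N \<le> fst (prod_decode i) \<or> N \<le> snd (prod_decode i)"
    by (rule prod_decode_unbounded[of N N]) blast
  show "\<exists>N. \<forall>i j. N \<le> i \<or> N \<le> j \<longrightarrow> f (prod_encode (i, snd (prod_decode j))) (fst (prod_decode j)) = 0"
  proof (intro exI[of _ "max B N"] allI impI)
    fix i j assume "max B N \<le> i \<or> max B N \<le> j"
    then have "N \<le> fst (prod_decode j) \<or> N \<le> prod_encode (i, snd (prod_decode j))"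
      using B[of j] order_trans[OF _ le_prod_encode_1, of N i] order_trans[OF _ le_prod_encode_2, of N "snd (prod_decode j)"]
      by (meson max.boundedE)
    then show "f (prod_encode (i, snd (prod_decode j))) (fst (prod_decode j)) = 0" using N by blast
  qed
qed

lemma ent_curry: "ent (curry_fm f) i p = ent f (fst (prod_decode i)) (prod_encode (p, snd (prod_decode i)))"
  by transfer simp
lemma ent_uncurry: "ent (uncurry_fm f) x y = ent f (prod_encode (x, snd (prod_decode y))) (fst (prod_decode y))"
  by transfer simp
lemma curry_uncurry [simp]: "curry_fm (uncurry_fm f) = f" by (rule fm_eqI) (simp add: ent_curry ent_uncurry)
lemma uncurry_curry [simp]: "uncurry_fm (curry_fm f) = f" by (rule fm_eqI) (simp add: ent_curry ent_uncurry)
lemma curry_add: "curry_fm (x + y) = curry_fm x + curry_fm y" by (rule fm_eqI) (simp add: ent_curry)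
lemma curry_smul: "curry_fm (c *\<^sub>k x) = c *\<^sub>k curry_fm x" by (rule fm_eqI) (simp add: ent_curry)

text \<open>Naturality of currying: a factor \<open>v\<close> on the second tensor position becomes
  \<open>tr v\<close> on the dual. Both directions of the adjunction are read off from this
  identity.\<close>

lemma curry_mult:
  "curry_fm (g * f * (u \<otimes>\<^sub>k v)) = (g \<otimes>\<^sub>k tr v) * curry_fm f * u"
proof (rule fm_eqI)
  fix i p
  obtain N1 where N1: "\<And>i j. N1 \<le> i \<or> N1 \<le> j \<Longrightarrow> ent g i j = 0" by (rule ent_bound[of g]) blast
  obtain N2 where N2: "\<And>i j. N2 \<le> i \<or> N2 \<le> j \<Longrightarrow> ent u i j = 0" by (rule ent_bound[of u]) blast
  obtain N3 where N3: "\<And>i j. N3 \<le> i \<or> N3 \<le> j \<Longrightarrow> ent v i j = 0" by (rule ent_bound[of v]) blast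
  obtain x w where i: "prod_decode i = (x, w)" by (cases "prod_decode i")
  let ?S = "prod_encode ` ({..<N2} \<times> {..<N3})" and ?T = "prod_encode ` ({..<N1} \<times> {..<N3})"
  have "ent (g * f * (u \<otimes>\<^sub>k v)) x (prod_encode (p, w)) =
      (\<Sum>k\<in>?S. ent (g * f) x k * ent (u \<otimes>\<^sub>k v) k (prod_encode (p, w)))"
  proof (rule ent_times_on)
    fix k assume k: "k \<notin> ?S"
    from prod_decode_notin[OF k] show "ent (g * f) x k = 0 \<or> ent (u \<otimes>\<^sub>k v) k (prod_encode (p, w)) = 0"
      by (auto simp: ent_tens N2 N3)
  qed auto
  also have "\<dots> = (\<Sum>k<N2. \<Sum>l<N3. \<Sum>y<N1. ent g x y * ent f y (prod_encode (k, l)) * (ent u k p * ent v l w))"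
    by (simp add: sum_prod_encode ent_times_bound[OF N1] sum_distrib_right)
  finally have L: "ent (curry_fm (g * f * (u \<otimes>\<^sub>k v))) i p =
    (\<Sum>k<N2. \<Sum>l<N3. \<Sum>y<N1. ent g x y * ent f y (prod_encode (k, l)) * (ent u k p * ent v l w))"
    by (simp add: ent_curry i)
  have "ent ((g \<otimes>\<^sub>k tr v) * curry_fm f * u) i p = (\<Sum>k<N2. ent ((g \<otimes>\<^sub>k tr v) * curry_fm f) i k * ent u k p)"
    by (simp add: ent_times_bound'[OF N2])
  also have "\<dots> = (\<Sum>k<N2. (\<Sum>m\<in>?T. ent (g \<otimes>\<^sub>k tr v) i m * ent (curry_fm f) m k) * ent u k p)"
  proof (rule sum.cong[OF refl], rule arg_cong[of _ _ "\<lambda>z. z * _"], rule ent_times_on)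
    fix k m assume k: "m \<notin> ?T"
    from prod_decode_notin[OF k] show "ent (g \<otimes>\<^sub>k tr v) i m = 0 \<or> ent (curry_fm f) m k = 0"
      by (auto simp: ent_tens N1 N3)
  qed auto
  also have "\<dots> = (\<Sum>k<N2. (\<Sum>y<N1. \<Sum>l<N3. ent g x y * ent v l w * ent f y (prod_encode (k, l))) * ent u k p)"
    by (simp add: sum_prod_encode ent_curry ent_tens i)
  also have "\<dots> = (\<Sum>k<N2. (\<Sum>l<N3. \<Sum>y<N1. ent g x y * ent v l w * ent f y (prod_encode (k, l))) * ent u k p)"
    by (subst sum.swap) simp
  also have "\<dots> = (\<Sum>k<N2. \<Sum>l<N3. \<Sum>y<N1. ent g x y * ent f y (prod_encode (k, l)) * (ent u k p * ent v l w))"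
    by (simp add: sum_distrib_left sum_distrib_right mult_ac)
  finally show "ent (curry_fm (g * f * (u \<otimes>\<^sub>k v))) i p = ent ((g \<otimes>\<^sub>k tr v) * curry_fm f * u) i p"
    using L by simp
qed

section \<open>Partial permutation matrices\<close>

definition perm_fm :: "(nat \<Rightarrow> nat) \<Rightarrow> nat set \<Rightarrow> 'k::field fm" where
  "perm_fm \<sigma> S = (\<Sum>i\<in>S. munit (\<sigma> i) i)"

lemma perm_fm_intertwine:
  fixes x y :: "'k::field fm"
  assumes "finite S" "finite S'" "inj_on \<sigma> S" "inj_on \<sigma>' S'"
    and "\<And>i j. i \<notin> S \<or> j \<notin> S' \<Longrightarrow> ent x i j = 0"
    and "\<And>i j. i \<in> S \<Longrightarrow> j \<in> S' \<Longrightarrow> ent y (\<sigma> i) (\<sigma>' j) = ent x i j"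
    and "\<And>i j. i \<notin> \<sigma> ` S \<or> j \<notin> \<sigma>' ` S' \<Longrightarrow> ent y i j = 0"
  shows "perm_fm \<sigma> S * x = y * perm_fm \<sigma>' S'"
proof (rule fm_eqI)
  fix k j
  have R: "ent (y * perm_fm \<sigma>' S') k j = (if j \<in> S' then ent y k (\<sigma>' j) else 0)"
  proof -
    have "ent (y * perm_fm \<sigma>' S') k j = (\<Sum>i\<in>S'. if i = j then ent y k (\<sigma>' i) else 0)"
      unfolding perm_fm_def sum_distrib_left ent_sum by (rule sum.cong) (auto simp: ent_mult_munit)
    then show ?thesis using assms(2) by (simp add: sum.delta)
  qed
  have L: "ent (perm_fm \<sigma> S * x) k j = (\<Sum>i\<in>S. if \<sigma> i = k then ent x i j else 0)"
    unfolding perm_fm_def sum_distrib_right ent_sum by (rule sum.cong) (auto simp: ent_munit_mult)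
  show "ent (perm_fm \<sigma> S * x) k j = ent (y * perm_fm \<sigma>' S') k j"
  proof (cases "k \<in> \<sigma> ` S")
    case True
    then obtain i0 where i0: "i0 \<in> S" "k = \<sigma> i0" by auto
    have "(\<Sum>i\<in>S. if \<sigma> i = k then ent x i j else 0) = (\<Sum>i\<in>S. if i = i0 then ent x i j else 0)"
      by (rule sum.cong) (use i0 assms(3) in \<open>auto simp: inj_on_def\<close>)
    then show ?thesis unfolding L R using i0 assms(1,5,6) by (auto simp: sum.delta)
  next
    case False
    then have "(\<Sum>i\<in>S. if \<sigma> i = k then ent x i j else 0) = 0" by (intro sum.neutral) auto
    then show ?thesis unfolding L R using False assms(7) by auto
  qed
qed

lemma tr_perm_fm: "tr (perm_fm \<sigma> S) = (\<Sum>i\<in>S. munit i (\<sigma> i))"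
  unfolding perm_fm_def by (induction S rule: infinite_finite_induct) auto

lemma tr_perm_fm_mult:
  assumes "finite S" "inj_on \<sigma> S"
  shows "tr (perm_fm \<sigma> S) * perm_fm \<sigma> S = (\<Sum>i\<in>S. munit i i :: 'k::field fm)"
proof -
  have "tr (perm_fm \<sigma> S) * perm_fm \<sigma> S = (\<Sum>i\<in>S. \<Sum>j\<in>S. munit i (\<sigma> i) * munit (\<sigma> j) j :: 'k fm)"
    unfolding tr_perm_fm by (simp add: perm_fm_def sum_product)
  also have "\<dots> = (\<Sum>i\<in>S. \<Sum>j\<in>S. if i = j then munit i i else 0)"
    by (intro sum.cong refl) (use assms(2) in \<open>auto simp: munit_mult inj_on_def\<close>)
  finally show ?thesis using assms(1) by (simp add: sum.delta)
qed

lemma perm_fm_tr_mult: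
  assumes "finite S" "inj_on \<sigma> S"
  shows "perm_fm \<sigma> S * tr (perm_fm \<sigma> S) = (\<Sum>i\<in>\<sigma> ` S. munit i i :: 'k::field fm)"
proof -
  have "perm_fm \<sigma> S * tr (perm_fm \<sigma> S) = (\<Sum>i\<in>S. \<Sum>j\<in>S. munit (\<sigma> i) i * munit j (\<sigma> j) :: 'k fm)"
    unfolding tr_perm_fm by (simp add: perm_fm_def sum_product)
  also have "\<dots> = (\<Sum>i\<in>S. \<Sum>j\<in>S. if i = j then munit (\<sigma> i) (\<sigma> i) else 0)"
    by (intro sum.cong refl) (auto simp: munit_mult)
  finally show ?thesis using assms by (simp add: sum.delta sum.reindex)
qed

text \<open>\<open>dimk\<close> is the dimension of a linear subspace of \<open>'k fm\<close>; only subspaces contained in some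
  corner \<open>idm N * _ * idm N\<close> occur, and those are finite-dimensional.\<close>

definition fm_subspace :: "'k::field fm set \<Rightarrow> bool" where
  "fm_subspace S \<longleftrightarrow> fm.subspace S \<and> (\<exists>N. \<forall>x\<in>S. idm N * x = x \<and> x * idm N = x)"

abbreviation dimk :: "'k::field fm set \<Rightarrow> nat" where "dimk \<equiv> fm.dim"

lemma fm_subspace_finite_span:
  assumes "fm_subspace S"
  obtains T where "finite T" "S \<subseteq> fm.span T"
proof -
  from assms obtain N where N: "\<forall>x\<in>S. idm N * x = x \<and> x * idm N = x" by (auto simp: fm_subspace_def)
  let ?T = "(\<lambda>(i, j). munit i j) ` ({..<N} \<times> {..<N})"
  have "S \<subseteq> fm.span ?T"
  proof
    fix x assume "x \<in> S"
    with N have x: "idm N * x = x" "x * idm N = x" by auto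
    have "x = (\<Sum>i<N. \<Sum>j<N. ent x i j *\<^sub>k munit i j)"
    proof (rule fm_eqI)
      fix i j
      have "ent (\<Sum>i<N. \<Sum>j<N. ent x i j *\<^sub>k munit i j) i j
          = (\<Sum>a<N. if a = i then (\<Sum>b<N. if b = j then ent x a b else 0) else 0)"
      proof -
        have "ent (ent x a b *\<^sub>k munit a b) i j = (if a = i then (if b = j then ent x a b else 0) else 0)"
          for a b by (auto simp: ent_munit)
        moreover have "(\<Sum>b<N. if a = i then (if b = j then ent x a b else 0) else 0)
            = (if a = i then (\<Sum>b<N. if b = j then ent x a b else 0) else 0)" for a by simp
        ultimately show ?thesis unfolding ent_sum by simp
      qed
      also have "\<dots> = (\<Sum>a<N. if a = i then (if j < N then ent x a j else 0) else 0)"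
        by (simp add: sum.delta)
      also have "\<dots> = (if i < N \<and> j < N then ent x i j else 0)" by (simp add: sum.delta)
      also have "\<dots> = ent x i j"
        using arg_cong[OF x(1), of "\<lambda>z. ent z i j"] arg_cong[OF x(2), of "\<lambda>z. ent z i j"]
        by (auto simp: ent_idm_mult ent_mult_idm split: if_splits)
      finally show "ent x i j = ent (\<Sum>i<N. \<Sum>j<N. ent x i j *\<^sub>k munit i j) i j" by simp
    qed
    also have "\<dots> \<in> fm.span ?T"
      by (intro fm.span_sum fm.span_scale fm.span_base) auto
    finally show "x \<in> fm.span ?T" .
  qed
  then show thesis by (intro that[of ?T]) auto
qed

text \<open>A basis \<open>B\<close> of the kernel is extended to a basis \<open>C\<close> of
  \<open>S\<close>; then \<open>\<phi>\<close> is injective on the span of \<open>C - B\<close> and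
  maps \<open>C - B\<close> to a basis of the image.\<close>

lemma dim_rank_nullity:
  fixes \<phi> :: "'k::field fm \<Rightarrow> 'k fm"
  assumes S: "fm_subspace S" and lin: "Vector_Spaces.linear smul smul \<phi>"
  shows "dimk S = dimk {x \<in> S. \<phi> x = 0} + dimk (\<phi> ` S)"
proof -
  interpret l: Vector_Spaces.linear smul smul \<phi> by (rule lin)
  have sub: "fm.subspace S" using S by (simp add: fm_subspace_def)
  obtain T where T: "finite T" "S \<subseteq> fm.span T" by (rule fm_subspace_finite_span[OF S])
  let ?K = "{x \<in> S. \<phi> x = 0}"
  have subK: "fm.subspace ?K"
    using sub by (auto simp: fm.subspace_def l.add l.scale l.zero)
  obtain B where B: "B \<subseteq> ?K" "fm.independent B" "?K \<subseteq> fm.span B" "card B = dimk ?K"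
    by (rule fm.basis_exists)
  from B have "B \<subseteq> S" by auto
  then obtain C where C: "B \<subseteq> C" "C \<subseteq> S" "fm.independent C" "S \<subseteq> fm.span C"
    using fm.maximal_independent_subset_extend[OF _ B(2)] by blast
  have finC: "finite C" using fm.independent_span_bound[OF T(1) C(3)] C(2) T(2) by auto
  let ?D = "C - B"
  have spanC: "fm.span C \<subseteq> S" using C(2) sub by (simp add: fm.span_minimal)
  have spanB: "fm.span B \<subseteq> ?K" using B(1) subK by (simp add: fm.span_minimal)
  have inj: "inj_on \<phi> (fm.span ?D)"
  proof (rule inj_onI)
    fix x y assume xy: "x \<in> fm.span ?D" "y \<in> fm.span ?D" "\<phi> x = \<phi> y"
    have d: "x - y \<in> fm.span ?D" using xy by (simp add: fm.span_diff)
    then have "x - y \<in> S" using spanC fm.span_mono[of ?D C] by auto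
    moreover have "\<phi> (x - y) = 0" using xy(3) by (simp add: l.diff)
    ultimately have dB: "x - y \<in> fm.span B" using B(3) by auto
    \<comment> \<open>The difference lies in the span of \<open>C - B\<close> and in the span of
      \<open>B\<close>; subtracting the two expansions gives a linear relation on
      \<open>C\<close>.\<close>
    have "x - y = 0"
    proof (rule ccontr)
      assume nz: "x - y \<noteq> 0"
      obtain u where u: "x - y = (\<Sum>a\<in>?D. u a *\<^sub>k a)"
        using d finC by (auto simp: fm.span_finite)
      obtain w where w: "x - y = (\<Sum>a\<in>B. w a *\<^sub>k a)"
        using dB finC C(1) by (auto simp: fm.span_finite finite_subset)
      let ?z = "\<lambda>a. if a \<in> B then - w a else u a"
      have "(\<Sum>a\<in>C. ?z a *\<^sub>k a) = (\<Sum>a\<in>?D. ?z a *\<^sub>k a) + (\<Sum>a\<in>B. ?z a *\<^sub>k a)"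
        using finC C(1) by (simp add: sum.subset_diff)
      also have "\<dots> = (x - y) - (x - y)"
      proof -
        have "(\<Sum>a\<in>?D. ?z a *\<^sub>k a) = x - y" unfolding u by (rule sum.cong) auto
        moreover have "(\<Sum>a\<in>B. ?z a *\<^sub>k a) = - (x - y)" unfolding w
          by (simp add: sum_negf[symmetric])
        ultimately show ?thesis by simp
      qed
      finally have "(\<Sum>a\<in>C. ?z a *\<^sub>k a) = 0" by simp
      then have "\<forall>a\<in>C. ?z a = 0"
      proof (rule_tac ccontr)
        assume "\<not> (\<forall>a\<in>C. ?z a = 0)"
        then have "\<exists>v\<in>C. ?z v \<noteq> 0" by blast
        with \<open>(\<Sum>a\<in>C. ?z a *\<^sub>k a) = 0\<close> have "fm.dependent C"
          using fm.dependent_finite[OF finC, THEN iffD2, OF exI[of _ ?z]] by blast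
        then show False using C(3) by simp
      qed
      then have "\<forall>a\<in>?D. u a = 0" by auto
      then show False using nz u by simp
    qed
    then show "x = y" by simp
  qed
  have indD: "fm.independent ?D" using C(3) fm.independent_mono by blast
  interpret vp: vector_space_pair smul smul by unfold_locales
  have ind: "fm.independent (\<phi> ` ?D)"
    by (rule vp.linear_independent_injective_image[OF lin indD inj])
  have "dimk (\<phi> ` S) = card (\<phi> ` ?D)"
  proof (rule fm.dim_unique)
    show "\<phi> ` ?D \<subseteq> \<phi> ` S" using C(2) by auto
    show "fm.independent (\<phi> ` ?D)" by (rule ind)
    show "\<phi> ` S \<subseteq> fm.span (\<phi> ` ?D)"
    proof
      fix y assume "y \<in> \<phi> ` S"
      then obtain x where "x \<in> S" "y = \<phi> x" by auto
      then have "y \<in> \<phi> ` fm.span C" using C(4) by auto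
      then have "y \<in> fm.span (\<phi> ` C)" by (simp add: vp.linear_span_image[OF lin])
      moreover have "\<phi> ` C \<subseteq> fm.span (\<phi> ` ?D)"
      proof
        fix z assume "z \<in> \<phi> ` C"
        then obtain c where c: "c \<in> C" "z = \<phi> c" by auto
        show "z \<in> fm.span (\<phi> ` ?D)"
        proof (cases "c \<in> B")
          case True
          then have "z = 0" using B(1) c by auto
          then show ?thesis by (simp add: fm.span_zero)
        qed (use c in \<open>auto intro: fm.span_base\<close>)
      qed
      ultimately show "y \<in> fm.span (\<phi> ` ?D)"
        using fm.span_minimal[OF _ fm.subspace_span] by blast
    qed
  qed simp
  also have "\<dots> = card ?D"
    by (rule card_image[OF inj_on_subset[OF inj fm.span_superset]])
  finally have "dimk (\<phi> ` S) = card ?D" .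
  moreover have "dimk S = card C" using C by (intro fm.dim_unique) auto
  moreover have "card C = card B + card ?D"
    using card_Un_disjoint[of B ?D] C(1) finC by (simp add: finite_subset Un_absorb1)
  ultimately show ?thesis using B(4) by simp
qed

lemma dimk_zero: "dimk {0 :: 'k::field fm} = 0"
proof -
  have "dimk (fm.span {} :: 'k fm set) = card ({} :: 'k fm set)"
    by (rule fm.dim_span_eq_card_independent) (rule fm.independent_empty)
  then show ?thesis by simp
qed

lemma dim_image_inj:
  fixes \<phi> :: "'k::field fm \<Rightarrow> 'k fm"
  assumes "fm_subspace S" "Vector_Spaces.linear smul smul \<phi>" "\<And>x. x \<in> S \<Longrightarrow> \<phi> x = 0 \<Longrightarrow> x = 0"
  shows "dimk (\<phi> ` S) = dimk S"
proof -
  have "0 \<in> S" using assms(1) by (simp add: fm_subspace_def fm.subspace_0)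
  moreover have "\<phi> 0 = 0" by (rule module_hom.zero[OF Vector_Spaces.linear.axioms(3)[OF assms(2)]])
  ultimately have "{x \<in> S. \<phi> x = 0} = {0}" using assms(3) by auto
  moreover note dimk_zero[where ?'k = 'k]
  ultimately show ?thesis using dim_rank_nullity[OF assms(1,2)] by simp
qed

lemma linear_left_mult: "Vector_Spaces.linear smul smul (\<lambda>x. (u :: 'k::field fm) * x)"
  by unfold_locales (simp_all add: distrib_left)
lemma linear_right_mult: "Vector_Spaces.linear smul smul (\<lambda>x. x * (u :: 'k::field fm))"
  by unfold_locales (simp_all add: distrib_right)
lemma linear_curry: "Vector_Spaces.linear smul smul (curry_fm :: 'k::field fm \<Rightarrow> 'k fm)"
  by unfold_locales (simp_all add: curry_add curry_smul)

lemma dim_eq_0_iff: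
  assumes "fm_subspace S" shows "dimk S = 0 \<longleftrightarrow> S \<subseteq> {0}"
proof
  assume "dimk S = 0"
  obtain T where T: "finite T" "S \<subseteq> fm.span T" by (rule fm_subspace_finite_span[OF assms])
  obtain B where B: "B \<subseteq> S" "fm.independent B" "S \<subseteq> fm.span B" "card B = dimk S" by (rule fm.basis_exists)
  have "finite B" using fm.independent_span_bound[OF T(1) B(2)] B(1) T(2) by auto
  with B(4) \<open>dimk S = 0\<close> have "B = {}" by simp
  with B(3) show "S \<subseteq> {0}" by simp
next
  assume "S \<subseteq> {0}"
  then have "S \<subseteq> fm.span {}" by simp
  then show "dimk S = 0" using fm.dim_le_card[of S "{}"] by simp
qed

lemma dim_line:
  assumes "f \<noteq> (0 :: 'k::field fm)" "S = range (\<lambda>c. c *\<^sub>k f)" shows "dimk S = 1"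
proof -
  have "S = fm.span {f}" using assms(2) by (auto simp: fm.span_singleton)
  then show ?thesis using assms(1) fm.dim_span_eq_card_independent[of "{f}"] by simp
qed

section \<open>Modules and exact sequences\<close>

text \<open>Products are normalized to nest on the right, so an equation for \<open>a * b\<close> is
  also needed in front of a further factor. The rules with \<open>z\<close> in \<open>homD\<close>
  and \<open>premoduleD\<close> serve the same purpose.\<close>

lemma mult_eq_assoc: "a * b = c \<Longrightarrow> a * (b * z) = c * (z :: 'r::ring)"
  by (simp add: mult.assoc[symmetric])

lemma idm_mono:
  assumes "idm N * x = x" "N \<le> M" shows "idm M * x = x"
proof -
  have "idm M * idm N = (idm N :: 'a fm)"
    using assms(2) by (intro fm_eqI) (auto simp: ent_idm_mult ent_idm)
  then show ?thesis by (metis assms(1) mult.assoc)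
qed

lemma idm_mono':
  assumes "x * idm N = x" "N \<le> M" shows "x * idm M = x"
proof -
  have "idm N * tr x = tr (x * idm N)" by simp
  then have "idm N * tr x = tr x" by (simp only: assms(1))
  from idm_mono[OF this assms(2)] have "idm M * tr x = tr x" .
  then have "tr (x * idm M) = tr x" by simp
  then show ?thesis by (simp only: tr_inject)
qed

lemma fm_subspaceI:
  assumes "fm.subspace S" "\<And>x. x \<in> S \<Longrightarrow> u * x = x" "\<And>x. x \<in> S \<Longrightarrow> x * v = x"
  shows "fm_subspace S"
proof -
  obtain N where N: "idm N * u = u" by (rule idm_bound)
  obtain M where M: "v * idm M = v" by (rule idm_bound)
  have "idm (max N M) * x = x \<and> x * idm (max N M) = x" if "x \<in> S" for x
    using assms(2,3)[OF that] idm_mono[OF N, of "max N M"] idm_mono'[OF M, of "max N M"]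
    by (metis max.cobounded1 max.cobounded2 mult.assoc)
  then show ?thesis using assms(1) unfolding fm_subspace_def by blast
qed

text \<open>The power \<open>x^m\<close> applied to \<open>y\<close>. Without a unit in
  \<open>'k fm\<close> the power 0 exists only as an operator, hence the extra argument.\<close>

primrec pw :: "'k::field fm \<Rightarrow> nat \<Rightarrow> 'k fm \<Rightarrow> 'k fm" where
  "pw x 0 y = y"
| "pw x (Suc m) y = x * pw x m y"

lemma pw_mult: "pw x m y * z = pw x m (y * z)"
  by (induction m) (simp_all add: mult.assoc)
lemma pw_add: "pw x (m + k) y = pw x m (pw x k y)"
  by (induction m) simp_all
lemma pw_Suc': "pw x (Suc m) y = pw x m (x * y)"
  by (induction m) simp_all
lemma pw_zero [simp]: "pw x m 0 = 0"
  by (induction m) simp_all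
lemma pw_smul: "pw x m (c *\<^sub>k y) = c *\<^sub>k pw x m y"
  by (induction m) simp_all
lemma pw_sum: "pw x m (\<Sum>i\<in>S. f i) = (\<Sum>i\<in>S. pw x m (f i))"
  by (induction m) (simp_all add: sum_distrib_left)
lemma pw_plus: "pw x m (y + z) = pw x m y + pw x m z"
  by (induction m) (simp_all add: distrib_left)
lemma pw_le_zero: "pw x m y = 0 \<Longrightarrow> m \<le> k \<Longrightarrow> pw x k y = 0"
  by (metis le_add_diff_inverse2 pw_add pw_zero)
lemma pw_closed: "e * x = x \<Longrightarrow> e * y = y \<Longrightarrow> e * pw x m y = pw x m y"
  by (induction m) (simp_all add: mult.assoc[symmetric])
lemma pw_intertwine: "f * x = x' * f \<Longrightarrow> f * pw x m y = pw x' m (f * y)"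
  by (induction m) (simp_all add: mult.assoc[symmetric], simp add: mult.assoc)
lemma pw_comm: "x * z = z * x \<Longrightarrow> pw x m (z * y) = z * pw x m y"
  by (metis pw_intertwine)
lemma pw_tr:
  assumes "e * x = x" "x * e = x" shows "tr (pw x m e) = pw (tr x) m (tr e)"
proof (induction m)
  case (Suc m)
  have "pw x (Suc m) e = pw x m e * x"
    using assms by (simp add: pw_Suc' pw_mult del: pw.simps)
  then have "tr (pw x (Suc m) e) = tr x * tr (pw x m e)" by simp
  then show ?case by (simp add: Suc)
qed simp

text \<open>A module is an idempotent together with operators absorbing it on both sides, so that modules
  of all dimensions, images and kernels live in the one ring \<open>'k fm\<close>.\<close>

type_synonym 'k rmod = "'k fm \<times> (gen \<Rightarrow> 'k fm)"

abbreviation ide :: "'k rmod \<Rightarrow> 'k fm" where "ide \<equiv> fst"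
abbreviation act :: "'k rmod \<Rightarrow> gen \<Rightarrow> 'k fm" where "act \<equiv> snd"

definition premodule :: "'k::field rmod \<Rightarrow> bool" where
  "premodule M \<longleftrightarrow> ide M * ide M = ide M \<and> (\<forall>g. ide M * act M g = act M g \<and> act M g * ide M = act M g)"

definition rhom :: "'k::field rmod \<Rightarrow> 'k rmod \<Rightarrow> 'k fm \<Rightarrow> bool" where
  "rhom M N f \<longleftrightarrow> f * ide M = f \<and> ide N * f = f \<and> (\<forall>g. f * act M g = act N g * f)"

text \<open>Injectivity, surjectivity and exactness are expressed through generalized elements, that is,
  arbitrary \<open>y\<close> with \<open>ide M * y = y\<close>; kernels and cokernels split off as idempotents because the ring
  \<open>'k fm\<close> is von Neumann regular.\<close>

definition rmono :: "'k::field rmod \<Rightarrow> 'k rmod \<Rightarrow> 'k fm \<Rightarrow> bool" where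
  "rmono M N f \<longleftrightarrow> rhom M N f \<and> (\<forall>y. ide M * y = y \<longrightarrow> f * y = 0 \<longrightarrow> y = 0)"

definition repi :: "'k::field rmod \<Rightarrow> 'k rmod \<Rightarrow> 'k fm \<Rightarrow> bool" where
  "repi M N f \<longleftrightarrow> rhom M N f \<and> (\<exists>r. ide M * r = r \<and> f * r = ide N)"

definition riso :: "'k::field rmod \<Rightarrow> 'k rmod \<Rightarrow> bool" where
  "riso M N \<longleftrightarrow> (\<exists>f g. rhom M N f \<and> rhom N M g \<and> g * f = ide M \<and> f * g = ide N)"

lemma homD: 
  assumes "rhom M N f"
  shows "f * ide M = f" "ide N * f = f" "f * act M g = act N g * f"
    "f * (ide M * z) = f * z" "ide N * (f * z) = f * z" "f * (act M g * z) = act N g * (f * z)"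
proof -
  show 1: "f * ide M = f" "ide N * f = f" "f * act M g = act N g * f" using assms by (simp_all add: rhom_def)
  show "f * (ide M * z) = f * z" "ide N * (f * z) = f * z"
    by (rule mult_eq_assoc[OF 1(1)], rule mult_eq_assoc[OF 1(2)])
  show "f * (act M g * z) = act N g * (f * z)" using mult_eq_assoc[OF 1(3)] by (simp add: mult.assoc)
qed

lemma premoduleD:
  assumes "premodule M"
  shows "ide M * ide M = ide M" "ide M * act M g = act M g" "act M g * ide M = act M g"
    "ide M * (ide M * z) = ide M * z" "ide M * (act M g * z) = act M g * z" "act M g * (ide M * z) = act M g * z"
proof -
  show 1: "ide M * ide M = ide M" "ide M * act M g = act M g" "act M g * ide M = act M g"
    using assms unfolding premodule_def by blast+
  show "ide M * (ide M * z) = ide M * z" "ide M * (act M g * z) = act M g * z"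
      "act M g * (ide M * z) = act M g * z"
    by (rule mult_eq_assoc[OF 1(1)], rule mult_eq_assoc[OF 1(2)], rule mult_eq_assoc[OF 1(3)])
qed

lemma hom_comp:
  assumes "rhom M N f" "rhom N K g" shows "rhom M K (g * f)"
  unfolding rhom_def using homD[OF assms(1)] homD[OF assms(2)] by (simp add: mult.assoc)
lemma hom_zero [simp]: "rhom M N 0" by (simp add: rhom_def)
lemma hom_add: "rhom M N f \<Longrightarrow> rhom M N g \<Longrightarrow> rhom M N (f + g)"
  by (simp add: rhom_def distrib_left distrib_right)
lemma hom_smul: "rhom M N f \<Longrightarrow> rhom M N (c *\<^sub>k f)" by (simp add: rhom_def)
lemma hom_diff: "rhom M N f \<Longrightarrow> rhom M N g \<Longrightarrow> rhom M N (f - g)"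
  by (simp add: rhom_def left_diff_distrib right_diff_distrib)
lemma hom_ide: "premodule M \<Longrightarrow> rhom M M (ide M)" by (simp add: rhom_def premodule_def)

lemma rmonoD: "rmono M N f \<Longrightarrow> rhom M N f" by (simp add: rmono_def)
lemma repiD: "repi M N f \<Longrightarrow> rhom M N f" by (simp add: repi_def)
lemma repiE:
  assumes "repi M N f" obtains r where "ide M * r = r" "f * r = ide N"
  using assms by (auto simp: repi_def)

lemma rmono_cancel:
  assumes "rmono M N f" "ide M * x = x" "ide M * y = y" "f * x = f * y" shows "x = y"
proof -
  have "ide M * (x - y) = x - y" "f * (x - y) = 0" using assms by (auto simp: right_diff_distrib)
  then have "x - y = 0" using assms(1) unfolding rmono_def by blast
  then show ?thesis by simp
qed

lemma repi_cancel:
  assumes "repi M N f" "x * ide N = x" "y * ide N = y" "x * f = y * f" shows "x = y"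
proof -
  obtain r where "f * r = ide N" using assms(1) by (rule repiE)
  then show ?thesis using assms(2-4) by (metis mult.assoc)
qed

text \<open>If \<open>f * g * f = f\<close>, then \<open>ide M - ide M * g * f\<close> is killed by
  \<open>f\<close> and therefore 0, so \<open>ide M * g\<close> is a left inverse. It is only
  linear, not an intertwiner.\<close>

lemma left_inverse:
  assumes "rhom M N f" "ide M * ide M = ide M" "\<And>y. ide M * y = y \<Longrightarrow> f * y = 0 \<Longrightarrow> y = 0"
  shows "\<exists>l. l * f = ide M \<and> ide M * l = l"
proof -
  note h = homD[OF assms(1)]
  obtain g where g: "f * g * f = f" using regular by blast
  let ?y = "ide M - ide M * g * f"
  have "ide M * ?y = ?y" by (simp add: right_diff_distrib mult.assoc[symmetric] assms(2))
  moreover have "f * ?y = 0" using g by (simp add: right_diff_distrib h mult.assoc)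
  ultimately have "?y = 0" using assms(3) by blast
  then show ?thesis
    by (intro exI[of _ "ide M * g"]) (simp add: mult.assoc[symmetric] assms(2))
qed

lemma rmono_left_inverse:
  assumes "rmono M N f" "premodule M" obtains l where "l * f = ide M" "ide M * l = l"
  using left_inverse[of M N f] assms by (auto simp: rmono_def premoduleD)

lemma repiI:
  assumes "rhom M N f" "\<And>x. ide N * x = x \<Longrightarrow> \<exists>y. ide M * y = y \<and> f * y = x" "premodule N"
  shows "repi M N f"
  using assms(1) assms(2)[of "ide N"] premoduleD(1)[OF assms(3)] by (auto simp: repi_def)

lemma repi_surj:
  assumes "repi M N f" "ide N * x = x" shows "\<exists>y. ide M * y = y \<and> f * y = x"
proof -
  obtain r where r: "ide M * r = r" "f * r = ide N" using assms(1) by (rule repiE)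
  then show ?thesis using assms(2) by (intro exI[of _ "r * x"]) (simp add: mult.assoc[symmetric])
qed

lemma rmonoI_inverse: "rhom M N f \<Longrightarrow> l * f = ide M \<Longrightarrow> rmono M N f"
  unfolding rmono_def by (metis mult.assoc mult_zero_right)

lemma rmono_comp: "rmono M N f \<Longrightarrow> rmono N K g \<Longrightarrow> rmono M K (g * f)"
  by (auto simp: rmono_def mult.assoc homD intro: hom_comp)
lemma repi_comp:
  assumes "repi M N f" "repi N K g" shows "repi M K (g * f)"
proof -
  obtain r where r: "ide M * r = r" "f * r = ide N" using assms(1) by (rule repiE)
  obtain s where s: "ide N * s = s" "g * s = ide K" using assms(2) by (rule repiE)
  have "g * f * (r * s) = ide K" using r s by (simp add: mult.assoc mult_eq_assoc[OF r(2)])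
  moreover have "ide M * (r * s) = r * s" by (rule mult_eq_assoc[OF r(1)])
  ultimately show ?thesis using hom_comp[OF repiD[OF assms(1)] repiD[OF assms(2)]]
    unfolding repi_def by blast
qed

lemma riso_refl: "premodule M \<Longrightarrow> riso M M"
  unfolding riso_def using hom_ide by (metis premoduleD(1))
lemma riso_sym: "riso M N \<Longrightarrow> riso N M"
  unfolding riso_def by blast
lemma riso_trans: "riso M N \<Longrightarrow> riso N K \<Longrightarrow> riso M K"
  unfolding riso_def
proof (elim exE conjE)
  fix f g f' g' assume h: "rhom M N f" "rhom N M g" "g * f = ide M" "f * g = ide N"
    "rhom N K f'" "rhom K N g'" "g' * f' = ide N" "f' * g' = ide K"
  have "(g * g') * (f' * f) = ide M" "(f' * f) * (g * g') = ide K"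
    using h by (simp_all add: mult.assoc mult_eq_assoc[OF h(7)] mult_eq_assoc[OF h(4)] homD)
  then show "\<exists>f g. rhom M K f \<and> rhom K M g \<and> g * f = ide M \<and> f * g = ide K"
    using hom_comp h by blast
qed

text \<open>Whether \<open>y\<close> intertwines may be tested after composing with the injective
  \<open>i\<close>, and there it is the intertwining property of \<open>u\<close>.\<close>

lemma mono_factor:
  assumes "premodule K" "rmono K M i" "rhom X M u" "ide K * y = y" "i * y = u"
  shows "rhom X K y"
proof -
  note hi = homD[OF rmonoD[OF assms(2)]] and hu = homD[OF assms(3)]
  have "y * ide X = y"
    by (rule rmono_cancel[OF assms(2)]) (simp_all add: assms(4,5) mult.assoc[symmetric] hu)
  moreover have "y * act X g = act K g * y" for g
  proof (rule rmono_cancel[OF assms(2)])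
    show "i * (y * act X g) = i * (act K g * y)" using hu(3) by (simp add: hi assms(5) mult.assoc[symmetric])
      (simp add: mult.assoc assms(5))
  qed (simp_all add: assms(4) mult.assoc[symmetric] premoduleD[OF assms(1)])
  ultimately show ?thesis using assms(4) by (simp add: rhom_def)
qed

text \<open>With a linear section \<open>r\<close> of \<open>p\<close>, the matrix
  \<open>ide M - r * p\<close> maps into the kernel of \<open>p\<close>, hence
  \<open>u * r * p = u\<close>. That the factor intertwines is tested after composing with the
  surjective \<open>p\<close>.\<close>

lemma epi_factor:
  assumes "premodule C" "premodule M" "repi M C p" "rhom M X u"
    and "\<And>x. ide M * x = x \<Longrightarrow> p * x = 0 \<Longrightarrow> u * x = 0"
  shows "\<exists>v. rhom C X v \<and> v * p = u"
proof -
  obtain r where r: "ide M * r = r" "p * r = ide C" using assms(3) by (rule repiE)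
  note hp = homD[OF repiD[OF assms(3)]] and hu = homD[OF assms(4)]
  have "ide M * (ide M - r * p) = ide M - r * p"
    using r by (simp add: right_diff_distrib mult.assoc[symmetric] premoduleD[OF assms(2)])
  moreover have "p * (ide M - r * p) = 0"
    using r by (simp add: right_diff_distrib mult.assoc[symmetric] hp)
  ultimately have "u * (ide M - r * p) = 0" by (rule assms(5))
  then have urp: "u * (r * p) = u" by (simp add: right_diff_distrib hu)
  define v where "v = u * r * ide C"
  have vp: "v * p = u" by (simp add: v_def mult.assoc hp urp)
  have ve: "v * ide C = v" by (simp add: v_def mult.assoc premoduleD[OF assms(1)])
  have "v * act C g = act X g * v" for g
  proof (rule repi_cancel[OF assms(3)])
    have "v * act C g * p = v * p * act M g" by (simp add: mult.assoc hp)
    then show "v * act C g * p = act X g * v * p" by (simp add: vp hu mult.assoc)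
  qed (simp_all add: mult.assoc ve premoduleD[OF assms(1)])
  moreover have "ide X * v = v" by (simp add: v_def mult.assoc[symmetric] hu)
  ultimately show ?thesis using vp ve by (auto simp: rhom_def)
qed

text \<open>The linear right inverse of \<open>f\<close> is a factorization of the identity through
  the injective \<open>f\<close>, hence an intertwiner by \<open>mono_factor\<close>.\<close>

lemma mono_epi_iso:
  assumes "premodule M" "premodule N" "rmono M N f" "repi M N f" shows "riso M N"
proof -
  obtain r where r: "ide M * r = r" "f * r = ide N" using assms(4) by (rule repiE)
  note hf = homD[OF rmonoD[OF assms(3)]]
  have "rhom N M r" using mono_factor[OF assms(1,3) hom_ide[OF assms(2)] r] .
  moreover have "r * f = ide M"
    by (rule rmono_cancel[OF assms(3)])
      (use r in \<open>simp_all add: mult.assoc[symmetric] premoduleD[OF assms(1)] hf\<close>)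
  ultimately show ?thesis using r rmonoD[OF assms(3)] by (auto simp: riso_def)
qed

lemma riso_mono_epi:
  assumes "riso M N" obtains f where "rmono M N f" "repi M N f"
proof -
  from assms obtain f g where "rhom M N f" "rhom N M g" "g * f = ide M" "f * g = ide N"
    by (auto simp: riso_def)
  then have "rmono M N f" "repi M N f" by (auto simp: repi_def dest: homD intro: rmonoI_inverse)
  then show thesis by (rule that)
qed

definition biprod :: "'k::field rmod \<Rightarrow> 'k rmod \<Rightarrow> 'k rmod \<Rightarrow> 'k fm \<Rightarrow> 'k fm \<Rightarrow> 'k fm \<Rightarrow> 'k fm \<Rightarrow> bool" where
  "biprod M N B i1 i2 p1 p2 \<longleftrightarrow> rhom M B i1 \<and> rhom N B i2 \<and> rhom B M p1 \<and> rhom B N p2 \<and>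
     p1 * i1 = ide M \<and> p2 * i2 = ide N \<and> p1 * i2 = 0 \<and> p2 * i1 = 0 \<and> i1 * p1 + i2 * p2 = ide B"

lemma biprod_cancel:
  assumes "biprod M N B i1 i2 p1 p2" "ide B * x = x" "ide B * y = y" "p1 * x = p1 * y" "p2 * x = p2 * y"
  shows "x = y"
proof -
  have "(i1 * p1 + i2 * p2) * x = (i1 * p1 + i2 * p2) * y"
    using assms(4,5) by (simp add: distrib_right mult.assoc)
  then show ?thesis using assms by (simp add: biprod_def)
qed

section \<open>Dimensions of modules and of spaces of homomorphisms\<close>

definition rk :: "'k::field rmod \<Rightarrow> nat" where
  "rk M = dimk {x. ide M * x = x \<and> x * munit 0 0 = x}"

definition hdim :: "'k::field rmod \<Rightarrow> 'k rmod \<Rightarrow> nat" where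
  "hdim M N = dimk {f. rhom M N f}"

lemma subspace_columns: "fm_subspace {x. u * x = x \<and> x * munit 0 0 = x}"
  by (rule fm_subspaceI[of _ u "munit 0 0"]) (auto simp: fm.subspace_def distrib_left distrib_right)

lemma subspace_hom: "fm_subspace {f. rhom M N f}"
  by (rule fm_subspaceI[of _ "ide N" "ide M"])
    (auto simp: fm.subspace_def hom_add hom_smul homD)

lemma hdim_eq_0: "hdim M N = 0 \<longleftrightarrow> (\<forall>f. rhom M N f \<longrightarrow> f = 0)"
  unfolding hdim_def dim_eq_0_iff[OF subspace_hom] by auto

lemma rk_eq_0: "ide M * ide M = ide M \<Longrightarrow> rk M = 0 \<longleftrightarrow> ide M = 0"
proof
  assume e: "ide M * ide M = ide M" and z: "rk M = 0"
  from z have *: "{x. ide M * x = x \<and> x * munit 0 0 = x} \<subseteq> {0}"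
    unfolding rk_def dim_eq_0_iff[OF subspace_columns] .
  show "ide M = 0"
  proof (rule column_ext)
    fix j
    have "ide M * munit j 0 \<in> {x. ide M * x = x \<and> x * munit 0 0 = x}"
      using e by (simp add: mult.assoc[symmetric]) (simp add: mult.assoc)
    with * show "ide M * munit j 0 = 0 * munit j 0" by auto
  qed
next
  assume "ide M = 0"
  then show "rk M = 0" unfolding rk_def dim_eq_0_iff[OF subspace_columns] by auto
qed

lemma hdim_iso_right:
  assumes "riso N N'" shows "hdim M N = hdim M N'"
proof -
  from assms obtain u v where u: "rhom N N' u" "rhom N' N v" "v * u = ide N" "u * v = ide N'"
    by (auto simp: riso_def)
  have "{f. rhom M N' f} = (\<lambda>f. u * f) ` {f. rhom M N f}"
  proof (intro equalityI subsetI)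
    fix f assume "f \<in> {f. rhom M N' f}"
    then have f: "rhom M N' f" by simp
    have "rhom M N (v * f)" by (rule hom_comp[OF f u(2)])
    moreover have "f = u * (v * f)" using u(4) homD[OF f] by (simp add: mult.assoc[symmetric])
    ultimately show "f \<in> (\<lambda>f. u * f) ` {f. rhom M N f}" by auto
  qed (auto intro: hom_comp[OF _ u(1)])
  moreover have "dimk ((\<lambda>f. u * f) ` {f. rhom M N f}) = dimk {f. rhom M N f}"
  proof (rule dim_image_inj[OF subspace_hom linear_left_mult])
    fix x assume "x \<in> {f. rhom M N f}" "u * x = 0"
    then have "v * (u * x) = 0" "ide N * x = x" by (auto simp: homD)
    then show "x = 0" using u(3) by (simp add: mult.assoc[symmetric])
  qed
  ultimately show ?thesis by (simp add: hdim_def)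
qed

lemma hdim_iso_left:
  assumes "riso N N'" shows "hdim N M = hdim N' M"
proof -
  from assms obtain u v where u: "rhom N N' u" "rhom N' N v" "v * u = ide N" "u * v = ide N'"
    by (auto simp: riso_def)
  have "{f. rhom N M f} = (\<lambda>f. f * u) ` {f. rhom N' M f}"
  proof (intro equalityI subsetI)
    fix f assume "f \<in> {f. rhom N M f}"
    then have f: "rhom N M f" by simp
    have "rhom N' M (f * v)" by (rule hom_comp[OF u(2) f])
    moreover have "f = f * v * u" using u(3) homD[OF f] by (simp add: mult.assoc)
    ultimately show "f \<in> (\<lambda>f. f * u) ` {f. rhom N' M f}" by auto
  qed (auto intro: hom_comp[OF u(1)])
  moreover have "dimk ((\<lambda>f. f * u) ` {f. rhom N' M f}) = dimk {f. rhom N' M f}"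
  proof (rule dim_image_inj[OF subspace_hom linear_right_mult])
    fix x assume "x \<in> {f. rhom N' M f}" "x * u = 0"
    then have "x * u * v = 0" "x * ide N' = x" by (auto simp: homD)
    then show "x = 0" using u(4) by (simp add: mult.assoc)
  qed
  ultimately show ?thesis by (simp add: hdim_def)
qed

section \<open>Modules over H_n(1,q), their kernels and cokernels\<close>

locale taft_double =
  fixes n :: nat and q :: "'k::field"
  assumes n_gt_2: "n > 2" and q_root: "q ^ n = 1" and q_prim: "\<And>j. 0 < j \<Longrightarrow> j < n \<Longrightarrow> q ^ j \<noteq> 1"
begin

definition rmodule :: "'k rmod \<Rightarrow> bool" where
  "rmodule M \<longleftrightarrow> premodule M \<and>
    (let e = ide M; a = act M Gen_a; b = act M Gen_b; c = act M Gen_c; d = act M Gen_d in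
      b * a = q *\<^sub>k (a * b) \<and> d * b = q *\<^sub>k (b * d) \<and> c * a = q *\<^sub>k (a * c) \<and> d * c = q *\<^sub>k (c * d) \<and>
      b * c = c * b \<and> pw a n e = 0 \<and> pw b n e = e \<and> pw c n e = e \<and> pw d n e = 0 \<and>
      d * a - q *\<^sub>k (a * d) = e - b * c)"

lemma rmoduleD:
  assumes "rmodule M"
  shows "premodule M"
    "act M Gen_b * act M Gen_a = q *\<^sub>k (act M Gen_a * act M Gen_b)"
    "act M Gen_d * act M Gen_b = q *\<^sub>k (act M Gen_b * act M Gen_d)"
    "act M Gen_c * act M Gen_a = q *\<^sub>k (act M Gen_a * act M Gen_c)"
    "act M Gen_d * act M Gen_c = q *\<^sub>k (act M Gen_c * act M Gen_d)"
    "act M Gen_b * act M Gen_c = act M Gen_c * act M Gen_b"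
    "pw (act M Gen_a) n (ide M) = 0" "pw (act M Gen_b) n (ide M) = ide M"
    "pw (act M Gen_c) n (ide M) = ide M" "pw (act M Gen_d) n (ide M) = 0"
    "act M Gen_d * act M Gen_a - q *\<^sub>k (act M Gen_a * act M Gen_d) = ide M - act M Gen_b * act M Gen_c"
  using assms by (simp_all add: rmodule_def Let_def)

lemma rmoduleI:
  assumes "premodule M"
    "act M Gen_b * act M Gen_a = q *\<^sub>k (act M Gen_a * act M Gen_b)"
    "act M Gen_d * act M Gen_b = q *\<^sub>k (act M Gen_b * act M Gen_d)"
    "act M Gen_c * act M Gen_a = q *\<^sub>k (act M Gen_a * act M Gen_c)"
    "act M Gen_d * act M Gen_c = q *\<^sub>k (act M Gen_c * act M Gen_d)"
    "act M Gen_b * act M Gen_c = act M Gen_c * act M Gen_b"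
    "pw (act M Gen_a) n (ide M) = 0" "pw (act M Gen_b) n (ide M) = ide M"
    "pw (act M Gen_c) n (ide M) = ide M" "pw (act M Gen_d) n (ide M) = 0"
    "act M Gen_d * act M Gen_a - q *\<^sub>k (act M Gen_a * act M Gen_d) = ide M - act M Gen_b * act M Gen_c"
  shows "rmodule M"
  using assms by (simp add: rmodule_def Let_def)

text \<open>The defining relations hold after every \<open>f j\<close>, and the \<open>f j\<close>
  together separate elements. One map gives the case of submodules, two projections the case of
  direct sums.\<close>

lemma rmodule_joint_mono:
  assumes pre: "premodule M" and mod: "\<And>j. rmodule (N j)" and f: "\<And>j. rhom M (N j) (f j)"
    and inj: "\<And>x. ide M * x = x \<Longrightarrow> (\<And>j. f j * x = 0) \<Longrightarrow> x = 0"
  shows "rmodule M"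
proof (rule rmoduleI[OF pre])
  note p = premoduleD[OF pre] and h = homD[OF f] and r = rmoduleD[OF mod]
  have pN: "premodule (N j)" for j using r(1) .
  note pn = premoduleD[OF pN]
  have cancel: "x = y" if "ide M * x = x" "ide M * y = y" "\<And>j. f j * x = f j * y" for x y
  proof -
    have "x - y = 0" by (rule inj) (use that in \<open>auto simp: right_diff_distrib\<close>)
    then show ?thesis by simp
  qed
  have hp: "f j * pw (act M g) m (ide M) = pw (act (N j) g) m (ide (N j)) * f j" for j g m
    by (simp add: pw_mult h pw_intertwine[OF h(3)])
  have pp: "ide M * pw (act M g) m (ide M) = pw (act M g) m (ide M)" for g m
    by (rule pw_closed) (simp_all add: p)
  note ext = r(2-6)[THEN mult_eq_assoc]
  have c: "ide M * x = x" if "x = act M g * act M g' \<or> x = q *\<^sub>k (act M g * act M g')" for x g g'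
    using that by (auto simp: p)
  show "act M Gen_b * act M Gen_a = q *\<^sub>k (act M Gen_a * act M Gen_b)"
    by (rule cancel) (simp_all add: p h ext mult.assoc)
  show "act M Gen_d * act M Gen_b = q *\<^sub>k (act M Gen_b * act M Gen_d)"
    by (rule cancel) (simp_all add: p h ext mult.assoc)
  show "act M Gen_c * act M Gen_a = q *\<^sub>k (act M Gen_a * act M Gen_c)"
    by (rule cancel) (simp_all add: p h ext mult.assoc)
  show "act M Gen_d * act M Gen_c = q *\<^sub>k (act M Gen_c * act M Gen_d)"
    by (rule cancel) (simp_all add: p h ext mult.assoc)
  show "act M Gen_b * act M Gen_c = act M Gen_c * act M Gen_b"
    by (rule cancel) (simp_all add: p h ext mult.assoc)
  show "pw (act M Gen_a) n (ide M) = 0" by (rule cancel) (simp_all add: pp hp r)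
  show "pw (act M Gen_b) n (ide M) = ide M" by (rule cancel) (simp_all add: pp hp r p h)
  show "pw (act M Gen_c) n (ide M) = ide M" by (rule cancel) (simp_all add: pp hp r p h)
  show "pw (act M Gen_d) n (ide M) = 0" by (rule cancel) (simp_all add: pp hp r)
  show "act M Gen_d * act M Gen_a - q *\<^sub>k (act M Gen_a * act M Gen_d) = ide M - act M Gen_b * act M Gen_c"
  proof (rule cancel)
    fix j
    have "f j * (act M Gen_d * act M Gen_a - q *\<^sub>k (act M Gen_a * act M Gen_d))
        = (act (N j) Gen_d * act (N j) Gen_a - q *\<^sub>k (act (N j) Gen_a * act (N j) Gen_d)) * f j"
      by (simp add: right_diff_distrib left_diff_distrib h mult.assoc)
    also have "\<dots> = f j * (ide M - act M Gen_b * act M Gen_c)"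
      by (subst r(11)) (simp add: right_diff_distrib left_diff_distrib h mult.assoc)
    finally show "f j * (act M Gen_d * act M Gen_a - q *\<^sub>k (act M Gen_a * act M Gen_d))
        = f j * (ide M - act M Gen_b * act M Gen_c)" .
  qed (simp_all add: right_diff_distrib p)
qed

lemma rmodule_mono:
  assumes "premodule K" "rmodule M" "rmono K M i" shows "rmodule K"
  by (rule rmodule_joint_mono[of K "\<lambda>_::unit. M" "\<lambda>_. i"]) (use assms in \<open>auto simp: rmono_def\<close>)

lemma rmodule_biprod:
  assumes "premodule B" "rmodule M" "rmodule N" "biprod M N B i1 i2 p1 p2" shows "rmodule B"
proof (rule rmodule_joint_mono[of B "\<lambda>j. if j then M else N" "\<lambda>j. if j then p1 else p2"])
  fix x assume x: "ide B * x = x" "\<And>j. (if j then p1 else p2) * x = 0"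
  show "x = 0" by (rule biprod_cancel[OF assms(4) x(1)]) (use x(2)[of True] x(2)[of False] in auto)
qed (use assms in \<open>auto simp: biprod_def\<close>)

lemma rmodule_epi:
  assumes pre: "premodule C" and mod: "rmodule M" and p: "repi M C p"
  shows "rmodule C"
proof (rule rmoduleI[OF pre])
  note pc = premoduleD[OF pre] and h = homD[OF repiD[OF p]] and r = rmoduleD[OF mod]
  note pm = premoduleD[OF r(1)]
  have cancel: "x = y" if "x * ide C = x" "y * ide C = y" "x * p = y * p" for x y
    by (rule repi_cancel[OF p that])
  have hp: "pw (act C g) m (ide C) * p = p * pw (act M g) m (ide M)" for g m
    by (simp add: pw_mult h pw_intertwine[OF h(3)])
  have pp: "pw (act C g) m (ide C) * ide C = pw (act C g) m (ide C)" for g m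
    by (simp add: pw_mult pc)
  note hs = h(3)[symmetric] h(6)[symmetric]
  have two: "act C g * act C g' * p = p * (act M g * act M g')" for g g'
    by (simp add: mult.assoc hs)
  show "act C Gen_b * act C Gen_a = q *\<^sub>k (act C Gen_a * act C Gen_b)"
    by (rule cancel) (simp_all add: two r(2-6), simp_all add: mult.assoc pc)
  show "act C Gen_d * act C Gen_b = q *\<^sub>k (act C Gen_b * act C Gen_d)"
    by (rule cancel) (simp_all add: two r(2-6), simp_all add: mult.assoc pc)
  show "act C Gen_c * act C Gen_a = q *\<^sub>k (act C Gen_a * act C Gen_c)"
    by (rule cancel) (simp_all add: two r(2-6), simp_all add: mult.assoc pc)
  show "act C Gen_d * act C Gen_c = q *\<^sub>k (act C Gen_c * act C Gen_d)"
    by (rule cancel) (simp_all add: two r(2-6), simp_all add: mult.assoc pc)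
  show "act C Gen_b * act C Gen_c = act C Gen_c * act C Gen_b"
    by (rule cancel) (simp_all add: two r(2-6), simp_all add: mult.assoc pc)
  show "pw (act C Gen_a) n (ide C) = 0" by (rule cancel) (simp_all add: pp hp r)
  show "pw (act C Gen_b) n (ide C) = ide C" by (rule cancel) (simp_all add: pp hp r pc h)
  show "pw (act C Gen_c) n (ide C) = ide C" by (rule cancel) (simp_all add: pp hp r pc h)
  show "pw (act C Gen_d) n (ide C) = 0" by (rule cancel) (simp_all add: pp hp r)
  show "act C Gen_d * act C Gen_a - q *\<^sub>k (act C Gen_a * act C Gen_d) = ide C - act C Gen_b * act C Gen_c"
  proof (rule cancel)
    have "(act C Gen_d * act C Gen_a - q *\<^sub>k (act C Gen_a * act C Gen_d)) * p
        = p * (act M Gen_d * act M Gen_a - q *\<^sub>k (act M Gen_a * act M Gen_d))"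
      by (simp add: right_diff_distrib left_diff_distrib two)
    also have "\<dots> = (ide C - act C Gen_b * act C Gen_c) * p"
      by (subst r(11)) (simp add: right_diff_distrib left_diff_distrib two h)
    finally show "(act C Gen_d * act C Gen_a - q *\<^sub>k (act C Gen_a * act C Gen_d)) * p
        = (ide C - act C Gen_b * act C Gen_c) * p" .
  qed (simp_all add: left_diff_distrib pc mult.assoc)
qed

definition rses :: "'k rmod \<Rightarrow> 'k rmod \<Rightarrow> 'k rmod \<Rightarrow> 'k fm \<Rightarrow> 'k fm \<Rightarrow> bool" where
  "rses A B C i p \<longleftrightarrow> rmodule A \<and> rmodule B \<and> rmodule C \<and> rmono A B i \<and> repi B C p \<and> p * i = 0 \<and>
     (\<forall>x. ide B * x = x \<longrightarrow> p * x = 0 \<longrightarrow> (\<exists>y. ide A * y = y \<and> i * y = x))"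

text \<open>For an inner inverse \<open>g\<close> of \<open>f\<close>, the idempotent
  \<open>ide M - ide M * g * f\<close> projects onto the kernel of \<open>f\<close>. Its image is
  invariant although its complement need not be, so the action on the kernel is
  \<open>act M g * \<pi>\<close>.\<close>

lemma kernel:
  assumes "rmodule M" "rhom M N f"
  shows "\<exists>K i. rmodule K \<and> rmono K M i \<and> f * i = 0 \<and>
    (\<forall>x. ide M * x = x \<longrightarrow> f * x = 0 \<longrightarrow> (\<exists>y. ide K * y = y \<and> i * y = x))"
proof -
  note m = premoduleD[OF rmoduleD(1)[OF assms(1)]] and h = homD[OF assms(2)]
  obtain g where g: "f * g * f = f" using regular by blast
  define \<pi> where "\<pi> = ide M - ide M * g * f"
  have e\<pi>: "ide M * \<pi> = \<pi>" "\<pi> * ide M = \<pi>"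
    by (simp_all add: \<pi>_def algebra_simps h m)
  have f\<pi>: "f * \<pi> = 0" using g by (simp add: \<pi>_def right_diff_distrib h mult.assoc)
  have ker: "\<pi> * x = x" if "ide M * x = x" "f * x = 0" for x
    using that by (simp add: \<pi>_def left_diff_distrib mult.assoc)
  have \<pi>a: "\<pi> * (act M g * \<pi>) = act M g * \<pi>" for g
    by (rule ker) (simp_all add: m h f\<pi>)
  define K :: "'k rmod" where "K = (\<pi>, \<lambda>g. act M g * \<pi>)"
  have pp: "\<pi> * \<pi> = \<pi>" by (rule ker[OF e\<pi>(1) f\<pi>])
  have pre: "premodule K" by (simp add: premodule_def K_def \<pi>a pp mult.assoc)
  have rhom: "rhom K M \<pi>" by (simp add: rhom_def K_def e\<pi> pp \<pi>a)
  have mono: "rmono K M \<pi>" using rhom by (simp add: rmono_def K_def)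
  have "rmodule K" by (rule rmodule_mono[OF pre assms(1) mono])
  then show ?thesis using mono f\<pi> ker by (intro exI[of _ K] exI[of _ \<pi>]) (auto simp: K_def)
qed

text \<open>Dually, \<open>ide N - f * g * ide N\<close> projects along the image of
  \<open>f\<close>. Here the kernel of the projection is invariant, so the action is compressed from
  the left.\<close>

lemma cokernel:
  assumes "rmodule N" "rhom M N f" "rmodule M"
  shows "\<exists>C p. rmodule C \<and> repi N C p \<and> p * f = 0 \<and>
    (\<forall>x. ide N * x = x \<longrightarrow> p * x = 0 \<longrightarrow> (\<exists>y. ide M * y = y \<and> f * y = x))"
proof -
  note m = premoduleD[OF rmoduleD(1)[OF assms(1)]] and h = homD[OF assms(2)]
  obtain g where g: "f * g * f = f" using regular by blast
  define \<pi> where "\<pi> = ide N - f * g * ide N"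
  have e\<pi>: "ide N * \<pi> = \<pi>" "\<pi> * ide N = \<pi>"
    by (simp_all add: \<pi>_def algebra_simps h m)
  have \<pi>f: "\<pi> * f = 0" "\<pi> * (f * z) = 0" for z
    using g by (simp_all add: \<pi>_def left_diff_distrib h mult.assoc) (simp add: mult.assoc[symmetric])
  have pp: "\<pi> * \<pi> = \<pi>" "\<pi> * (\<pi> * z) = \<pi> * z" for z
  proof -
    show "\<pi> * \<pi> = \<pi>" by (subst (2) \<pi>_def) (simp add: right_diff_distrib mult.assoc e\<pi> \<pi>f)
    then show "\<pi> * (\<pi> * z) = \<pi> * z" by (rule mult_eq_assoc)
  qed
  have \<pi>a: "\<pi> * (act N x * \<pi>) = \<pi> * act N x" for x
  proof -
    have "act N x * (f * g * ide N) = f * (act M x * (g * ide N))" by (simp add: h mult.assoc)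
    then show ?thesis by (subst (2) \<pi>_def) (simp add: right_diff_distrib m \<pi>f)
  qed
  define C :: "'k rmod" where "C = (\<pi>, \<lambda>g. \<pi> * act N g)"
  have pre: "premodule C" by (simp add: premodule_def C_def \<pi>a pp mult.assoc)
  have rhom: "rhom N C \<pi>" by (simp add: rhom_def C_def e\<pi> pp \<pi>a mult.assoc)
  have epi: "repi N C \<pi>" using rhom e\<pi> pp by (auto simp: repi_def C_def)
  have "rmodule C" by (rule rmodule_epi[OF pre assms(1) epi])
  moreover have "\<exists>y. ide M * y = y \<and> f * y = x" if "ide N * x = x" "\<pi> * x = 0" for x
    using that by (intro exI[of _ "ide M * (g * x)"])
      (simp add: \<pi>_def left_diff_distrib h mult.assoc premoduleD[OF rmoduleD(1)[OF assms(3)]])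
  ultimately show ?thesis using epi \<pi>f by (intro exI[of _ C] exI[of _ \<pi>]) auto
qed

lemma epi_ses:
  assumes "rmodule M" "rmodule N" "repi M N p" shows "\<exists>K i. rses K M N i p"
  using kernel[OF assms(1) repiD[OF assms(3)]] assms unfolding rses_def by blast

end

section \<open>Duality and projective modules\<close>

lemma rk_hwm_idm: "dimk {x :: 'k::field fm. idm p * x = x \<and> x * munit 0 0 = x} = p"
proof (rule fm.dim_unique)
  let ?B = "(\<lambda>i. munit i 0 :: 'k fm) ` {..<p}"
  have inj: "inj_on (\<lambda>i. munit i 0 :: 'k fm) {..<p}"
  proof (rule inj_onI)
    fix i j assume "munit i 0 = (munit j 0 :: 'k fm)"
    then have "ent (munit i 0 :: 'k fm) i 0 = ent (munit j 0 :: 'k fm) i 0" by simp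
    then show "i = j" by (simp add: ent_munit split: if_splits)
  qed
  show "?B \<subseteq> {x. idm p * x = x \<and> x * munit 0 0 = x}" by (auto simp: idm_munit)
  show "{x. idm p * x = x \<and> x * munit 0 0 = x} \<subseteq> fm.span ?B"
  proof
    fix x :: "'k fm" assume "x \<in> {x. idm p * x = x \<and> x * munit 0 0 = x}"
    then have "x = (\<Sum>i<p. ent x i 0 *\<^sub>k munit i 0)" by (intro column_expand) auto
    moreover have "\<dots> \<in> fm.span ?B" by (intro fm.span_sum fm.span_scale fm.span_base) auto
    ultimately show "x \<in> fm.span ?B" by metis
  qed
  show "fm.independent ?B"
    unfolding fm.dependent_finite[OF finite_imageI[OF finite_lessThan]]
  proof
    assume "\<exists>u. (\<exists>v\<in>?B. u v \<noteq> 0) \<and> (\<Sum>v\<in>?B. u v *\<^sub>k v) = 0"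
    then obtain u i where u: "(\<Sum>v\<in>?B. u v *\<^sub>k v) = 0" "i < p" "u (munit i 0) \<noteq> 0" by auto
    have "ent (\<Sum>v\<in>?B. u v *\<^sub>k v) i 0 = (\<Sum>j<p. if j = i then u (munit i 0) else 0)"
      unfolding sum.reindex[OF inj] ent_sum by (rule sum.cong) (auto simp: ent_munit)
    then show False using u by (simp add: sum.delta)
  qed
  show "card ?B = p" using inj by (simp add: card_image)
qed

definition swap_gen :: "gen \<Rightarrow> gen" where
  "swap_gen g = (case g of Gen_a \<Rightarrow> Gen_d | Gen_b \<Rightarrow> Gen_b | Gen_c \<Rightarrow> Gen_c | Gen_d \<Rightarrow> Gen_a)"

lemma swap_gen_simps [simp]: "swap_gen Gen_a = Gen_d" "swap_gen Gen_b = Gen_b"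
  "swap_gen Gen_c = Gen_c" "swap_gen Gen_d = Gen_a" "swap_gen (swap_gen g) = g"
  by (auto simp: swap_gen_def split: gen.split)

text \<open>Exchanging \<open>a\<close> and \<open>d\<close> while fixing \<open>b\<close> and \<open>c\<close> is an anti-automorphism of the algebra, so
  transposition gives a duality. Unlike the antipode dual it is strictly involutive and fixes every
  simple module.\<close>

definition flip :: "'k::field rmod \<Rightarrow> 'k rmod" where
  "flip M = (tr (ide M), \<lambda>g. tr (act M (swap_gen g)))"

lemma flip_simps [simp]: "ide (flip M) = tr (ide M)" "act (flip M) g = tr (act M (swap_gen g))"
  by (simp_all add: flip_def)

lemma flip_flip [simp]: "flip (flip M) = M"
  by (simp add: flip_def prod_eq_iff)

lemma premodule_flip: "premodule M \<Longrightarrow> premodule (flip M)"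
  unfolding premodule_def flip_simps tr_mult[symmetric] by simp

lemma rhom_flip: "rhom M N f \<Longrightarrow> rhom (flip N) (flip M) (tr f)"
  unfolding rhom_def flip_simps tr_mult[symmetric] by simp

lemma repi_flip:
  assumes "repi M N f" shows "rmono (flip N) (flip M) (tr f)"
proof -
  obtain r where r: "f * r = ide N" by (rule repiE[OF assms])
  show ?thesis
  proof (rule rmonoI_inverse[OF rhom_flip[OF repiD[OF assms]]])
    show "tr r * tr f = ide (flip N)" unfolding flip_simps tr_mult[symmetric] r ..
  qed
qed

lemma rmono_flip:
  assumes "rmono M N f" "premodule M" "premodule N" shows "repi (flip N) (flip M) (tr f)"
proof -
  obtain l where l: "l * f = ide M" by (rule rmono_left_inverse[OF assms(1,2)])
  note h = homD[OF rmonoD[OF assms(1)]]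
  have "l * ide N * f = ide M" using l h(2) by (simp only: mult.assoc)
  then have "tr f * tr (l * ide N) = ide (flip M)" by (simp only: tr_mult[symmetric] flip_simps)
  moreover have "ide (flip N) * tr (l * ide N) = tr (l * ide N)"
    unfolding flip_simps tr_mult[symmetric] using premoduleD(1)[OF assms(3)] by (simp only: mult.assoc)
  ultimately show ?thesis using rhom_flip[OF rmonoD[OF assms(1)]] unfolding repi_def by blast
qed

lemma rk_iso:
  assumes "riso M N" shows "rk M = rk N"
proof -
  from assms obtain f g where fg: "rhom M N f" "rhom N M g" "g * f = ide M" "f * g = ide N"
    by (auto simp: riso_def)
  note hf = homD[OF fg(1)] and hg = homD[OF fg(2)]
  let ?S = "\<lambda>M. {x. ide M * x = x \<and> x * munit 0 0 = x}"
  have "?S N = (\<lambda>x. f * x) ` ?S M"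
  proof (intro equalityI subsetI)
    fix x assume x: "x \<in> ?S N"
    then have "f * (g * x) = x" using fg(4) by (simp add: mult.assoc[symmetric])
    moreover have "g * x \<in> ?S M" using x by (simp add: hg mult.assoc)
    ultimately show "x \<in> (\<lambda>x. f * x) ` ?S M" using image_eqI[of x "\<lambda>x. f * x" "g * x" "?S M"] by simp
  qed (auto simp: hf mult.assoc)
  moreover have "dimk ((\<lambda>x. f * x) ` ?S M) = dimk (?S M)"
  proof (rule dim_image_inj[OF subspace_columns linear_left_mult])
    fix x assume "x \<in> ?S M" "f * x = 0"
    then have "g * (f * x) = 0" "ide M * x = x" by auto
    then show "x = 0" using fg(3) by (simp add: mult.assoc[symmetric])
  qed
  ultimately show ?thesis by (simp add: rk_def)
qed

context taft_double
begin

lemma rmodule_flip: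
  assumes "rmodule M" shows "rmodule (flip M)"
proof -
  note r = rmoduleD[OF assms] and p = premoduleD[OF rmoduleD(1)[OF assms]]
  have t: "tr x * tr y = tr (y * x)" for x y :: "'k fm" by simp
  have pt: "pw (tr (act M g)) m (tr (ide M)) = tr (pw (act M g) m (ide M))" for g m
    by (rule pw_tr[symmetric]) (simp_all add: p)
  have "act (flip M) Gen_d * act (flip M) Gen_a - q *\<^sub>k (act (flip M) Gen_a * act (flip M) Gen_d)
      = ide (flip M) - act (flip M) Gen_b * act (flip M) Gen_c"
    using arg_cong[OF r(11), of tr] r(6) by (simp del: tr_mult add: t)
  then show ?thesis
    by (intro rmoduleI premodule_flip[OF r(1)]) (simp_all del: tr_mult add: t r pt)
qed

text \<open>Exactness seen from the other side: a row operator that vanishes on \<open>A\<close>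
  factors through \<open>C\<close>. After transposition this is exactness of the dual sequence in
  the middle.\<close>

lemma rses_left_split:
  assumes "rses A B C i p" "z * ide B = z" "z * i = 0" 
  shows "\<exists>w. w * ide C = w \<and> w * p = z"
proof -
  from assms(1) have B: "premodule B" and C: "premodule C" and p: "repi B C p"
    and ex: "\<And>x. ide B * x = x \<Longrightarrow> p * x = 0 \<Longrightarrow> (\<exists>y. ide A * y = y \<and> i * y = x)"
    by (auto simp: rses_def rmoduleD)
  obtain r where r: "ide B * r = r" "p * r = ide C" using p by (rule repiE)
  note hp = homD[OF repiD[OF p]]
  have "ide B * (ide B - r * p) = ide B - r * p" "p * (ide B - r * p) = 0"
    using r by (simp_all add: right_diff_distrib mult.assoc[symmetric] premoduleD(1)[OF B] hp(1,2))
  from ex[OF this] obtain y where y: "i * y = ide B - r * p" by auto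
  have "z * (i * y) = 0" using assms(3) by (simp add: mult.assoc[symmetric])
  then have "z * (r * p) = z" by (simp add: y right_diff_distrib assms(2))
  then show ?thesis
    by (intro exI[of _ "z * r * ide C"]) (simp add: mult.assoc hp premoduleD(1)[OF C])
qed

text \<open>Common core of dualizing by \<open>flip\<close> and by the antipode: both transpose
  idempotents and maps, and the action enters only through the last hypotheses.\<close>

lemma rses_tr:
  assumes "rses A B C i p" and m': "rmodule A'" "rmodule B'" "rmodule C'"
    and e: "ide A' = tr (ide A)" "ide B' = tr (ide B)" "ide C' = tr (ide C)"
    and h: "rhom C' B' (tr p)" "rhom B' A' (tr i)"
  shows "rses C' B' A' (tr p) (tr i)"
  unfolding rses_def
proof (intro conjI allI impI m')
  from assms have m: "rmodule A" "rmodule B" "rmodule C" and i: "rmono A B i" and p: "repi B C p" and pi: "p * i = 0"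
    by (auto simp: rses_def)
  obtain r where r: "p * r = ide C" using p by (rule repiE)
  show "rmono C' B' (tr p)"
    by (rule rmonoI_inverse[OF h(1), of "tr r"]) (simp only: e tr_mult[symmetric] r)
  obtain l where l: "l * i = ide A" by (rule rmono_left_inverse[OF i rmoduleD(1)[OF m(1)]])
  have "l * ide B * i = ide A" using l homD(2)[OF rmonoD[OF i]] by (simp only: mult.assoc)
  then have "tr i * tr (l * ide B) = ide A'" by (simp only: e tr_mult[symmetric])
  moreover have "ide B' * tr (l * ide B) = tr (l * ide B)"
    unfolding e tr_mult[symmetric] using premoduleD(1)[OF rmoduleD(1)[OF m(2)]] by (simp only: mult.assoc)
  ultimately show "repi B' A' (tr i)" using h(2) unfolding repi_def by blast
  show "tr i * tr p = 0" unfolding tr_mult[symmetric] pi by simp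
  fix x assume x: "ide B' * x = x" "tr i * x = 0"
  have "tr x * ide B = tr x" "tr x * i = 0"
    using arg_cong[OF x(1), of tr] arg_cong[OF x(2), of tr] by (simp_all add: e)
  from rses_left_split[OF assms(1) this] obtain w where w: "w * ide C = w" "w * p = tr x" by auto
  have "ide C' * tr w = tr w" "tr p * tr w = x"
    using arg_cong[OF w(1), of tr] arg_cong[OF w(2), of tr] by (simp_all add: e)
  then show "\<exists>y. ide C' * y = y \<and> tr p * y = x" by blast
qed

lemma rses_flip:
  assumes "rses A B C i p" shows "rses (flip C) (flip B) (flip A) (tr p) (tr i)"
  using assms by (intro rses_tr[OF assms] rmodule_flip rhom_flip) (auto simp: rses_def dest: rmonoD repiD)

lemma rk_ses:
  assumes "rses A B C i p" shows "rk B = rk A + rk C"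
proof -
  from assms have A: "premodule A" and C: "premodule C" and p: "repi B C p" and i: "rmono A B i"
    and pi: "p * i = 0"
    and ex: "\<And>x. ide B * x = x \<Longrightarrow> p * x = 0 \<Longrightarrow> (\<exists>y. ide A * y = y \<and> i * y = x)"
    by (auto simp: rses_def rmoduleD)
  note hp = homD[OF repiD[OF p]] and hi = homD[OF rmonoD[OF i]]
  let ?S = "\<lambda>M. {x. ide M * x = x \<and> x * munit 0 0 = x}"
  have "(\<lambda>x. p * x) ` ?S B = ?S C"
  proof (intro equalityI subsetI)
    fix x assume x: "x \<in> ?S C"
    then obtain y where y: "ide B * y = y" "p * y = x" using repi_surj[OF p] by auto
    then have "y * munit 0 0 \<in> ?S B" by (simp add: mult.assoc mult_eq_assoc[OF y(1)])
    moreover have "p * (y * munit 0 0) = x" using x y by (simp add: mult.assoc[symmetric])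
    ultimately show "x \<in> (\<lambda>x. p * x) ` ?S B" using image_eqI[of x "\<lambda>x. p * x" "y * munit 0 0" "?S B"] by simp
  qed (auto simp: hp mult.assoc)
  moreover have "{x \<in> ?S B. p * x = 0} = (\<lambda>x. i * x) ` ?S A"
  proof (intro equalityI subsetI)
    fix x assume x: "x \<in> {x \<in> ?S B. p * x = 0}"
    then obtain y where y: "ide A * y = y" "i * y = x" using ex by auto
    have "y * munit 0 0 = y"
      by (rule rmono_cancel[OF i]) (use x y in \<open>simp_all add: mult.assoc[symmetric]\<close>)
    with y show "x \<in> (\<lambda>x. i * x) ` ?S A" by auto
  qed (auto simp: hi mult.assoc mult_eq_assoc[OF pi])
  moreover have "dimk ((\<lambda>x. i * x) ` ?S A) = dimk (?S A)"
    by (rule dim_image_inj[OF subspace_columns linear_left_mult]) (use i in \<open>auto simp: rmono_def\<close>)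
  ultimately show ?thesis
    using dim_rank_nullity[OF subspace_columns[of "ide B"] linear_left_mult[of p]] by (simp add: rk_def)
qed

lemma mono_ses:
  assumes "rmodule M" "rmodule N" "rmono M N f" shows "\<exists>C p. rses M N C f p"
  using cokernel[OF assms(2) rmonoD[OF assms(3)] assms(1)] assms unfolding rses_def by blast

lemma rk_epi_le:
  assumes "rmodule M" "rmodule N" "repi M N f" shows "rk N \<le> rk M"
  using epi_ses[OF assms] rk_ses by fastforce

text \<open>The cokernel has dimension 0, hence its idempotent vanishes.\<close>

lemma mono_rk_iso:
  assumes "rmodule M" "rmodule N" "rmono M N f" "rk N \<le> rk M"
  shows "repi M N f" "riso M N"
proof -
  obtain C p where s: "rses M N C f p" using mono_ses[OF assms(1-3)] by auto
  then have C: "premodule C" and p: "repi N C p" by (auto simp: rses_def rmoduleD)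
  have "rk C = 0" using rk_ses[OF s] assms(4) by simp
  then have "ide C = 0" using rk_eq_0 premoduleD(1)[OF C] by blast
  then have "p = 0" using homD(2)[OF repiD[OF p]] by simp
  then show "repi M N f" using s by (intro repiI[OF rmonoD[OF assms(3)]]) (auto simp: rses_def rmoduleD)
  then show "riso M N" by (rule mono_epi_iso[OF rmoduleD(1)[OF assms(1)] rmoduleD(1)[OF assms(2)] assms(3)])
qed

lemma epi_rk_iso:
  assumes "rmodule M" "rmodule N" "repi M N f" "rk M \<le> rk N"
  shows "rmono M N f" "riso M N"
proof -
  obtain K i where s: "rses K M N i f" using epi_ses[OF assms(1-3)] by auto
  then have K: "premodule K" and i: "rmono K M i" by (auto simp: rses_def rmoduleD)
  have "rk K = 0" using rk_ses[OF s] assms(4) by simp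
  then have "ide K = 0" using rk_eq_0 premoduleD(1)[OF K] by blast
  then have z: "i = 0" using homD(1)[OF rmonoD[OF i]] by simp
  show "rmono M N f" unfolding rmono_def
  proof (intro conjI allI impI)
    fix y assume "ide M * y = y" "f * y = 0"
    then show "y = 0" using s z unfolding rses_def by auto
  qed (rule repiD[OF assms(3)])
  then show "riso M N" using mono_epi_iso[OF rmoduleD(1)[OF assms(1)] rmoduleD(1)[OF assms(2)]] assms(3) by blast
qed

section \<open>Projective modules and direct summands\<close>

definition rproj :: "'k rmod \<Rightarrow> bool" where
  "rproj Q \<longleftrightarrow> rmodule Q \<and> (\<forall>M N p f. rmodule M \<and> rmodule N \<and> repi M N p \<and> rhom Q N f
     \<longrightarrow> (\<exists>g. rhom Q M g \<and> p * g = f))"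

lemma rprojD: "rproj Q \<Longrightarrow> rmodule Q" by (simp add: rproj_def)

lemma rproj_lift:
  assumes "rproj Q" "rmodule M" "rmodule N" "repi M N p" "rhom Q N f"
  obtains g where "rhom Q M g" "p * g = f"
  using assms unfolding rproj_def by blast

text \<open>Rank and nullity of composition with \<open>p\<close>: projectivity makes it surjective,
  and its kernel consists of the maps that factor through \<open>i\<close>.\<close>

lemma hdim_ses_right:
  assumes "rproj M" "rses A B C i p" shows "hdim M B = hdim M A + hdim M C"
proof -
  from assms(2) have A: "premodule A" and p: "repi B C p" and i: "rmono A B i" and mod: "rmodule B" "rmodule C"
    and pi: "p * i = 0"
    and ex: "\<And>x. ide B * x = x \<Longrightarrow> p * x = 0 \<Longrightarrow> (\<exists>y. ide A * y = y \<and> i * y = x)"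
    by (auto simp: rses_def rmoduleD)
  have "(\<lambda>f. p * f) ` {f. rhom M B f} = {f. rhom M C f}"
  proof (intro equalityI subsetI)
    fix f assume "f \<in> {f. rhom M C f}"
    then obtain g where "rhom M B g" "p * g = f"
      using rproj_lift[OF assms(1) mod p] by blast
    then show "f \<in> (\<lambda>f. p * f) ` {f. rhom M B f}" by auto
  qed (auto intro: hom_comp[OF _ repiD[OF p]])
  moreover have "{f \<in> {f. rhom M B f}. p * f = 0} = (\<lambda>f. i * f) ` {f. rhom M A f}"
  proof (intro equalityI subsetI)
    fix f assume "f \<in> {f \<in> {f. rhom M B f}. p * f = 0}"
    then have f: "rhom M B f" "p * f = 0" by auto
    then obtain y where y: "ide A * y = y" "i * y = f" using ex[OF homD(2)[OF f(1)] f(2)] by auto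
    then have "rhom M A y" using mono_factor[OF A i f(1)] by blast
    with y show "f \<in> (\<lambda>f. i * f) ` {f. rhom M A f}" by auto
  qed (auto simp: mult_eq_assoc[OF pi] intro: hom_comp[OF _ rmonoD[OF i]])
  moreover have "dimk ((\<lambda>f. i * f) ` {f. rhom M A f}) = dimk {f. rhom M A f}"
    by (rule dim_image_inj[OF subspace_hom linear_left_mult]) (use i in \<open>auto simp: rmono_def homD\<close>)
  ultimately show ?thesis
    using dim_rank_nullity[OF subspace_hom[of M B] linear_left_mult[of p]] by (simp add: hdim_def)
qed

lemma biprod_rses:
  assumes "biprod M N B i1 i2 p1 p2" "rmodule M" "rmodule N" "rmodule B"
  shows "rses M B N i1 p2"
  unfolding rses_def
proof (intro conjI allI impI)
  note b = assms(1)[unfolded biprod_def]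
  show "rmono M B i1" using b by (blast intro: rmonoI_inverse)
  have "ide B * i2 = i2" using b by (blast dest: homD(2))
  then show "repi B N p2" using b unfolding repi_def by blast
  show "p2 * i1 = 0" using b by blast
  fix x assume x: "ide B * x = x" "p2 * x = 0"
  have "(i1 * p1 + i2 * p2) * x = x" using b x by simp
  then have "i1 * (p1 * x) = x" using x(2) by (simp add: distrib_right mult.assoc)
  moreover have "ide M * (p1 * x) = p1 * x" using b by (blast dest: homD(5))
  ultimately show "\<exists>y. ide M * y = y \<and> i1 * y = x" by blast
qed (use assms in auto)

lemma hdim_biprod_left:
  assumes "biprod M N B i1 i2 p1 p2" shows "hdim B V = hdim M V + hdim N V"
proof -
  note b = assms[unfolded biprod_def]
  have "(\<lambda>f. f * i1) ` {f. rhom B V f} = {f. rhom M V f}"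
  proof (intro equalityI subsetI)
    fix f assume "f \<in> {f. rhom M V f}"
    then have f: "rhom M V f" by simp
    have "rhom B V (f * p1)" using hom_comp b f by blast
    moreover have "f = f * p1 * i1" using b f by (simp add: mult.assoc homD)
    ultimately show "f \<in> (\<lambda>f. f * i1) ` {f. rhom B V f}" by blast
  qed (use b hom_comp in blast)
  moreover have "{f \<in> {f. rhom B V f}. f * i1 = 0} = (\<lambda>f. f * p2) ` {f. rhom N V f}"
  proof (intro equalityI subsetI)
    fix f assume "f \<in> {f \<in> {f. rhom B V f}. f * i1 = 0}"
    then have f: "rhom B V f" "f * i1 = 0" by auto
    have "f = f * (i1 * p1 + i2 * p2)" using b f by (simp add: homD)
    then have "f = f * i2 * p2" using f(2) by (simp add: distrib_left mult.assoc[symmetric])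
    moreover have "rhom N V (f * i2)" using hom_comp b f(1) by blast
    ultimately show "f \<in> (\<lambda>f. f * p2) ` {f. rhom N V f}" by blast
  next
    fix f assume "f \<in> (\<lambda>f. f * p2) ` {f. rhom N V f}"
    then obtain g where g: "rhom N V g" "f = g * p2" by auto
    then have "rhom B V f" using hom_comp b by blast
    moreover have "f * i1 = 0" using b g by (simp add: mult.assoc)
    ultimately show "f \<in> {f \<in> {f. rhom B V f}. f * i1 = 0}" by simp
  qed
  moreover have "dimk ((\<lambda>f. f * p2) ` {f. rhom N V f}) = dimk {f. rhom N V f}"
  proof (rule dim_image_inj[OF subspace_hom linear_right_mult])
    fix f assume f: "f \<in> {f. rhom N V f}" "f * p2 = 0"
    then have "f * p2 * i2 = 0" by simp
    then have "f * (p2 * i2) = 0" by (simp only: mult.assoc)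
    then show "f = 0" using b f homD(1)[of N V f] by simp
  qed
  ultimately show ?thesis
    using dim_rank_nullity[OF subspace_hom[of B V] linear_right_mult[of i1]] by (simp add: hdim_def)
qed

lemma rproj_biprod:
  assumes "rproj M" "rproj N" "biprod M N B i1 i2 p1 p2" "rmodule B" shows "rproj B"
  unfolding rproj_def
proof (intro conjI allI impI)
  note b = assms(3)[unfolded biprod_def]
  fix X Y p f assume "rmodule X \<and> rmodule Y \<and> repi X Y p \<and> rhom B Y f"
  then have h: "rmodule X" "rmodule Y" "repi X Y p" "rhom B Y f" by auto
  have "rhom M Y (f * i1)" "rhom N Y (f * i2)" using hom_comp b h(4) by blast+
  then obtain g1 g2 where g: "rhom M X g1" "p * g1 = f * i1" "rhom N X g2" "p * g2 = f * i2"
    using rproj_lift[OF assms(1) h(1-3)] rproj_lift[OF assms(2) h(1-3)] by metis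
  have "rhom B X (g1 * p1 + g2 * p2)" using g b hom_comp hom_add by blast
  moreover have "p * (g1 * p1 + g2 * p2) = f * (i1 * p1 + i2 * p2)"
    using g by (simp add: distrib_left mult.assoc[symmetric])
  then have "p * (g1 * p1 + g2 * p2) = f" using b homD(1)[OF h(4)] by simp
  ultimately show "\<exists>g. rhom B X g \<and> p * g = f" by blast
qed (rule assms(4))

lemma rproj_retract:
  assumes "rproj B" "rmodule M" "rhom M B i" "rhom B M p" "p * i = ide M" shows "rproj M"
  unfolding rproj_def
proof (intro conjI allI impI)
  fix X Y e f assume "rmodule X \<and> rmodule Y \<and> repi X Y e \<and> rhom M Y f"
  then have h: "rmodule X" "rmodule Y" "repi X Y e" "rhom M Y f" by auto
  obtain g where g: "rhom B X g" "e * g = f * p"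
    using rproj_lift[OF assms(1) h(1-3) hom_comp[OF assms(4) h(4)]] by blast
  have "e * (g * i) = f" using g(2) assms(5) homD(1)[OF h(4)] by (simp add: mult.assoc[symmetric]) (simp add: mult.assoc)
  then show "\<exists>g. rhom M X g \<and> e * g = f" using hom_comp[OF assms(3) g(1)] by blast
qed (rule assms(2))

text \<open>The complement is the kernel of \<open>p\<close>, and its projection is the
  factorization of \<open>ide B - i * p\<close> through that kernel.\<close>

lemma retract_biprod:
  assumes "rmodule M" "rmodule B" "rhom M B i" "rhom B M p" "p * i = ide M"
  shows "\<exists>N i2 p2. rmodule N \<and> biprod M N B i i2 p p2"
proof -
  note hi = homD[OF assms(3)] and hp = homD[OF assms(4)] and pb = premoduleD[OF rmoduleD(1)[OF assms(2)]]
  obtain N i2 where N: "rmodule N" "rmono N B i2" "p * i2 = 0"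
    "\<And>x. ide B * x = x \<Longrightarrow> p * x = 0 \<Longrightarrow> \<exists>y. ide N * y = y \<and> i2 * y = x"
    using kernel[OF assms(2,4)] by blast
  note h2 = homD[OF rmonoD[OF N(2)]]
  have hu: "rhom B B (ide B - i * p)"
    using hom_diff[OF hom_ide[OF rmoduleD(1)[OF assms(2)]] hom_comp[OF assms(4,3)]] .
  have "p * (ide B - i * p) = 0" by (simp add: right_diff_distrib hp mult_eq_assoc[OF assms(5)])
  from N(4)[OF homD(2)[OF hu] this] obtain p2 where p2: "ide N * p2 = p2" "i2 * p2 = ide B - i * p" by auto
  have hp2: "rhom B N p2" by (rule mono_factor[OF rmoduleD(1)[OF N(1)] N(2) hu p2])
  have ii: "i2 * (p2 * x) = ide B * x - i * (p * x)" for x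
    using mult_eq_assoc[OF p2(2)] by (simp add: left_diff_distrib mult.assoc)
  have "p2 * i2 = ide N"
    by (rule rmono_cancel[OF N(2)])
      (simp_all add: ii N(3) h2 mult_eq_assoc[OF p2(1)] premoduleD(1)[OF rmoduleD(1)[OF N(1)]])
  moreover have "p2 * i = 0"
    by (rule rmono_cancel[OF N(2)]) (simp_all add: ii hi mult_eq_assoc[OF p2(1)] assms(5))
  ultimately have "biprod M N B i i2 p p2"
    using N p2 hp2 assms rmonoD[OF N(2)] by (simp add: biprod_def)
  then show ?thesis using N(1) by blast
qed

text \<open>Both modules live on the same index set, so the first is moved to the even and the
  second to the odd indices; there they are orthogonal.\<close>

lemma biprod_exists:
  assumes "rmodule M" "rmodule N"
  shows "\<exists>B i1 i2 p1 p2. rmodule B \<and> biprod M N B i1 i2 p1 p2"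
proof -
  obtain K where K: "idm K * ide M = ide M" by (rule idm_bound)
  obtain L where L: "idm L * ide N = ide N" by (rule idm_bound)
  define R where "R = max K L"
  have R: "idm R * ide M = ide M" "idm R * ide N = ide N"
    using idm_mono[OF K] idm_mono[OF L] by (auto simp: R_def)
  define u v where "u = (perm_fm (\<lambda>j. 2 * j) {..<R} :: 'k fm)" and "v = (perm_fm (\<lambda>j. 2 * j + 1) {..<R} :: 'k fm)"
  have uu: "tr u * u = idm R" unfolding u_def idm_def by (rule tr_perm_fm_mult) (auto simp: inj_on_def)
  have vv: "tr v * v = idm R" unfolding v_def idm_def by (rule tr_perm_fm_mult) (auto simp: inj_on_def)
  have "tr u * v = (\<Sum>i<R. \<Sum>j<R. munit i (2 * i) * munit (2 * j + 1) j)"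
    unfolding u_def v_def tr_perm_fm by (simp add: perm_fm_def sum_product)
  also have "\<dots> = 0" by (intro sum.neutral ballI) (simp add: munit_mult, presburger)
  finally have uv1: "tr u * v = 0" .
  have "tr v * u = tr (tr u * v)" by simp
  then have uv: "tr u * v = 0" "tr v * u = 0" using uv1 by (simp_all only: tr_zero)
  note m = premoduleD[OF rmoduleD(1)[OF assms(1)]] premoduleD[OF rmoduleD(1)[OF assms(2)]]
  note ext = uu[THEN mult_eq_assoc] vv[THEN mult_eq_assoc] uv[THEN mult_eq_assoc] R[THEN mult_eq_assoc]
  have RM: "idm R * act M g = act M g" "idm R * act N g = act N g" for g
    using ext(5)[of "act M g"] ext(6)[of "act N g"] by (simp_all add: m)
  note ext' = RM(1)[THEN mult_eq_assoc] RM(2)[THEN mult_eq_assoc]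
  define B :: "'k rmod" where
    "B = (u * ide M * tr u + v * ide N * tr v, \<lambda>g. u * act M g * tr u + v * act N g * tr v)"
  have pre: "premodule B"
    by (simp add: premodule_def B_def distrib_left distrib_right mult.assoc ext ext' R RM m)
  have bi: "biprod M N B (u * ide M) (v * ide N) (ide M * tr u) (ide N * tr v)"
    by (simp add: biprod_def rhom_def B_def distrib_left distrib_right mult.assoc ext ext' R RM m)
  show ?thesis using rmodule_biprod[OF pre assms bi] bi by blast
qed

text \<open>Instead of quantifying over submodules of \<open>P\<close>, essentiality requires that an intertwiner \<open>g\<close>
  into \<open>P\<close> is onto as soon as \<open>f * g\<close> is; the right inverse \<open>r\<close> need not be an intertwiner.\<close>

definition rcover :: "'k rmod \<Rightarrow> 'k rmod \<Rightarrow> 'k fm \<Rightarrow> bool" where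
  "rcover M P f \<longleftrightarrow> rmodule M \<and> rproj P \<and> repi P M f \<and>
    (\<forall>X g r. rmodule X \<and> rhom X P g \<and> f * (g * r) = ide M \<longrightarrow> repi X P g)"

section \<open>Highest weight modules\<close>

lemma q_nz: "q \<noteq> 0"
  using q_root n_gt_2 by (auto simp: power_0_left)

lemma qpow_add: "q powi (i + j) = q powi i * q powi j"
  using q_nz by (simp add: power_int_add)

lemma qpow_eq_1_iff: "q powi i = 1 \<longleftrightarrow> int n dvd i"
proof -
  have n: "q powi (int n * k) = 1" for k
    using q_root by (simp add: power_int_mult power_int_of_nat)
  have "q powi i = q powi (int n * (i div int n)) * q powi (i mod int n)"
    unfolding qpow_add[symmetric] by simp
  also have "\<dots> = q powi (i mod int n)" by (simp only: n mult_1)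
  also have "\<dots> = q ^ nat (i mod int n)" using n_gt_2 by (simp add: power_int_def)
  finally have e: "q powi i = q ^ nat (i mod int n)" .
  have nn: "0 \<le> i mod int n" using n_gt_2 by simp
  have "nat (i mod int n) < n" using n_gt_2 by (simp add: nat_less_iff)
  then show ?thesis using e q_prim[of "nat (i mod int n)"] n_gt_2

    by (cases "nat (i mod int n) = 0") (auto simp: dvd_eq_mod_eq_0 intro: order.antisym[OF _ nn])
qed

lemma qpow_eq_iff: "q powi i = q powi j \<longleftrightarrow> int n dvd (i - j)"
proof -
  have "q powi i = q powi (i - j) * q powi j" by (simp add: qpow_add[symmetric])
  then show ?thesis using q_nz by (simp add: qpow_eq_1_iff[symmetric])
qed

lemma qpow_minus: "q powi (i - j) = q powi i * q powi (- j)"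
  using qpow_add[of i "- j"] by simp

definition qint :: "nat \<Rightarrow> 'k" where "qint i = (\<Sum>t<i. q ^ t)"

lemma qint_0 [simp]: "qint 0 = 0" by (simp add: qint_def)
lemma qint_Suc: "qint (Suc i) = qint i + q ^ i" by (simp add: qint_def)
lemma qint_Suc': "qint (Suc i) = 1 + q * qint i"
  unfolding qint_def sum.lessThan_Suc_shift by (simp add: sum_distrib_left)
lemma qint_mult: "(1 - q) * qint i = 1 - q ^ i"
  unfolding qint_def by (rule one_diff_power_eq[symmetric])
lemma q_neq_1: "q \<noteq> 1" using q_prim[of 1] n_gt_2 by auto
lemma qint_n [simp]: "qint n = 0" using qint_mult[of n] q_root q_neq_1 by auto
lemma qint_nz: "0 < i \<Longrightarrow> i < n \<Longrightarrow> qint i \<noteq> 0"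
  using qint_mult[of i] q_prim[of i] by auto

abbreviation alpha :: "nat \<Rightarrow> nat \<Rightarrow> 'k" where "alpha s i \<equiv> V_alpha q s i"

lemma alpha_qint: "alpha s i = qint i * (1 - q powi (int i - int s))"
  by (simp add: V_alpha_def qint_def)

lemma alpha_0 [simp]: "alpha s 0 = 0" by (simp add: alpha_qint)
lemma alpha_n [simp]: "alpha s n = 0" by (simp add: alpha_qint)
lemma alpha_same [simp]: "alpha s s = 0" by (simp add: alpha_qint)
lemma alpha_nz: "0 < i \<Longrightarrow> i < n \<Longrightarrow> 1 \<le> s \<Longrightarrow> s \<le> n \<Longrightarrow> i \<noteq> s \<Longrightarrow> alpha s i \<noteq> 0"
proof -
  assume h: "0 < i" "i < n" "1 \<le> s" "s \<le> n" "i \<noteq> s"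
  have "\<not> int n dvd (int i - int s)"
  proof
    assume "int n dvd (int i - int s)"
    then have "int n \<le> \<bar>int i - int s\<bar>" using h(5) by (intro zdvd_imp_le[of "int n" "\<bar>int i - int s\<bar>"]) auto
    then show False using h by auto
  qed
  then have "q powi (int i - int s) \<noteq> 1" by (simp add: qpow_eq_1_iff)
  then show ?thesis using qint_nz[OF h(1,2)] by (simp add: alpha_qint)
qed

text \<open>This recursion is the relation between \<open>d\<close> and \<open>a\<close> on the
  chain of vectors \<open>a^i v\<close> over a highest weight vector \<open>v\<close>, where
  \<open>b * c\<close> acts on \<open>a^i v\<close> by q^(2i + 1 - s). It makes
  \<open>alpha s\<close> the coefficients of \<open>d\<close> in
  \<open>hwvec_d_pw_a\<close>.\<close>

lemma alpha_step: "alpha s (Suc i) - q * alpha s i = 1 - q powi (2 * int i + 1 - int s)"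
proof -
  have e: "q powi (int (Suc i) - int s) = q * q powi (int i - int s)"
  proof -
    have "int (Suc i) - int s = 1 + (int i - int s)" by simp
    then show ?thesis using qpow_add[of 1 "int i - int s"] by (simp only: power_int_1_right)
  qed
  have f: "q powi (2 * int i + 1 - int s) = q * (q ^ i * q powi (int i - int s))"
    using qpow_add[of 1 "int i + (int i - int s)"] qpow_add[of "int i" "int i - int s"]
    by (simp add: algebra_simps)
  show ?thesis unfolding alpha_qint e f qint_Suc
    using qint_Suc[of i, unfolded qint_Suc'] by (simp add: algebra_simps)
qed

text \<open>\<open>hwm p s t\<close> is the module of dimension \<open>p\<close> generated by a highest weight vector of the weight of
  \<open>V(s,t)\<close>: it is \<open>V(s,t)\<close> for \<open>p = s\<close> and the Verma module for \<open>p = n\<close>.\<close>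

fun hw_act :: "nat \<Rightarrow> nat \<Rightarrow> int \<Rightarrow> gen \<Rightarrow> 'k fm" where
  "hw_act p s t Gen_a = (\<Sum>j<p - 1. munit (Suc j) j)"
| "hw_act p s t Gen_b = (\<Sum>j<p. q powi (t + int j) *\<^sub>k munit j j)"
| "hw_act p s t Gen_c = (\<Sum>j<p. q powi (1 - t - int s + int j) *\<^sub>k munit j j)"
| "hw_act p s t Gen_d = (\<Sum>j<p - 1. alpha s (Suc j) *\<^sub>k munit j (Suc j))"

definition hwm :: "nat \<Rightarrow> nat \<Rightarrow> int \<Rightarrow> 'k rmod" where
  "hwm p s t = (idm p, hw_act p s t)"

abbreviation V :: "nat \<Rightarrow> int \<Rightarrow> 'k rmod" where "V s t \<equiv> hwm s s t"
abbreviation Z :: "nat \<Rightarrow> int \<Rightarrow> 'k rmod" where "Z s t \<equiv> hwm n s t"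

lemma hwm_simps [simp]: "ide (hwm p s t) = idm p" "act (hwm p s t) = hw_act p s t"
  by (simp_all add: hwm_def)

declare hw_act.simps [simp del]

lemma hw_a_col: "j < p \<Longrightarrow> hw_act p s t Gen_a * munit j 0 = (if Suc j < p then munit (Suc j) 0 else 0)"
proof -
  assume "j < p"
  have "hw_act p s t Gen_a * munit j 0 = (\<Sum>i<p - 1. if i = j then munit (Suc j) 0 else 0)"
    unfolding hw_act.simps sum_distrib_right by (rule sum.cong) (auto simp: munit_mult)
  then show ?thesis using \<open>j < p\<close> by (auto simp: sum.delta)
qed

lemma hw_d_col: "j < p \<Longrightarrow> hw_act p s t Gen_d * munit j 0 = alpha s j *\<^sub>k munit (j - 1) 0"
proof -
  assume "j < p"
  have "hw_act p s t Gen_d * munit j 0 = (\<Sum>i<p - 1. if i = j - 1 then (if j = 0 then 0 else alpha s j *\<^sub>k munit (j - 1) 0) else 0)"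
    unfolding hw_act.simps sum_distrib_right by (rule sum.cong) (auto simp: munit_mult)
  then show ?thesis using \<open>j < p\<close> by (auto simp: sum.delta)
qed

lemma hw_b_col: "j < p \<Longrightarrow> hw_act p s t Gen_b * munit j 0 = q powi (t + int j) *\<^sub>k munit j 0"
proof -
  assume "j < p"
  have "hw_act p s t Gen_b * munit j 0 = (\<Sum>i<p. if i = j then q powi (t + int j) *\<^sub>k munit j 0 else 0)"
    unfolding hw_act.simps sum_distrib_right by (rule sum.cong) (auto simp: munit_mult)
  then show ?thesis using \<open>j < p\<close> by (simp add: sum.delta)
qed

lemma hw_c_col: "j < p \<Longrightarrow> hw_act p s t Gen_c * munit j 0 = q powi (1 - t - int s + int j) *\<^sub>k munit j 0"
proof -
  assume "j < p"
  have "hw_act p s t Gen_c * munit j 0 = (\<Sum>i<p. if i = j then q powi (1 - t - int s + int j) *\<^sub>k munit j 0 else 0)"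
    unfolding hw_act.simps sum_distrib_right by (rule sum.cong) (auto simp: munit_mult)
  then show ?thesis using \<open>j < p\<close> by (simp add: sum.delta)
qed

lemmas hw_col = hw_a_col hw_b_col hw_c_col hw_d_col

lemma premodule_hwm: "premodule (hwm p s t)"
proof -
  have "hw_act p s t g * idm p = hw_act p s t g \<and> idm p * hw_act p s t g = hw_act p s t g" for g
    by (cases g) (auto simp: hw_act.simps sum_distrib_left sum_distrib_right munit_idm idm_munit intro!: sum.cong)
  then show ?thesis by (simp add: premodule_def)
qed

lemma hw_pw_a: "j < p \<Longrightarrow> pw (hw_act p s t Gen_a) m (munit j 0) = (if j + m < p then munit (j + m) 0 else 0)"
  by (induction m) (auto simp: hw_col)

lemma hw_pw_d: "j < p \<Longrightarrow> j < m \<Longrightarrow> pw (hw_act p s t Gen_d) m (munit j 0) = 0"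
proof (induction m arbitrary: j)
  case (Suc m)
  show ?case
  proof (cases "j = 0")
    case True
    then show ?thesis using Suc.prems by (simp only: pw_Suc' hw_col) (simp add: pw_smul)
  next
    case False
    then show ?thesis using Suc by (simp only: pw_Suc' hw_col) (simp add: pw_smul)
  qed
qed simp

lemma hw_pw_b: "j < p \<Longrightarrow> pw (hw_act p s t Gen_b) m (munit j 0) = (q powi (t + int j)) ^ m *\<^sub>k munit j 0"
  by (induction m) (auto simp: hw_col mult.commute)

lemma hw_pw_c: "j < p \<Longrightarrow> pw (hw_act p s t Gen_c) m (munit j 0) = (q powi (1 - t - int s + int j)) ^ m *\<^sub>k munit j 0"
  by (induction m) (auto simp: hw_col mult.commute)

lemma qpow_pow_n [simp]: "(q powi i) ^ n = 1"
proof -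
  have "(q powi i) ^ n = q powi (i * int n)" by (simp add: power_int_mult power_int_of_nat)
  then show ?thesis by (simp add: qpow_eq_1_iff)
qed

text \<open>Cutting the chain after \<open>p\<close> vectors is compatible with the relation between
  \<open>d\<close> and \<open>a\<close> on the last one when \<open>alpha s p = 0\<close>. This is
  the case for \<open>p = s\<close> and, since (n)_q = 0, for \<open>p = n\<close>.\<close>

lemma rmodule_hwm:
  assumes "1 \<le> p" "p \<le> n" "alpha s p = 0" shows "rmodule (hwm p s t)"
proof (rule rmoduleI[OF premodule_hwm])
  let ?M = "hwm p s t"
  note pm = premoduleD[OF premodule_hwm[of p s t], simplified]
  have pwe: "pw (act ?M g) m (idm p) * munit j 0 = pw (act ?M g) m (munit j 0)" if "j < p" for g m j
    using that by (simp add: pw_mult idm_munit)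
  have pwi: "pw (act ?M g) m (idm p) * idm p = pw (act ?M g) m (idm p)" for g m
    by (simp add: pw_mult)
  have q1: "q powi (t + 1 + int j) = q * q powi (t + int j)"
    "q powi (1 + (t + int j)) = q * q powi (t + int j)"
    "q powi (1 - t - int s + (1 + int j)) = q * q powi (1 - t - int s + int j)" for j
    using qpow_add[of 1 "t + int j"] qpow_add[of 1 "1 - t - int s + int j"] by (simp_all add: algebra_simps)
  have bcd: "q powi (t + int j) = q * q powi (t + int (j - 1))"
    "q powi (1 - t - int s + int j) = q * q powi (1 - t - int s + int (j - 1))" if "j > 0" for j
  proof -
    have j: "int j = int (j - 1) + 1" using that by simp
    show "q powi (t + int j) = q * q powi (t + int (j - 1))"
      using qpow_add[of 1 "t + int (j - 1)"] unfolding j by (simp add: algebra_simps)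
    show "q powi (1 - t - int s + int j) = q * q powi (1 - t - int s + int (j - 1))"
      using qpow_add[of 1 "1 - t - int s + int (j - 1)"] unfolding j by (simp add: algebra_simps)
  qed
  show "act ?M Gen_b * act ?M Gen_a = q *\<^sub>k (act ?M Gen_a * act ?M Gen_b)"
    by (rule column_ext_idm[of _ p]) (auto simp: mult.assoc pm hw_col q1 add_ac)
  show "act ?M Gen_c * act ?M Gen_a = q *\<^sub>k (act ?M Gen_a * act ?M Gen_c)"
    by (rule column_ext_idm[of _ p]) (auto simp: mult.assoc pm hw_col simp flip: q1(3))
  show "act ?M Gen_d * act ?M Gen_b = q *\<^sub>k (act ?M Gen_b * act ?M Gen_d)"
  proof (rule column_ext_idm[of _ p])
    fix j assume "j < p"
    then show "act ?M Gen_d * act ?M Gen_b * munit j 0 = q *\<^sub>k (act ?M Gen_b * act ?M Gen_d) * munit j 0"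
      using bcd(1)[of j] by (cases "j = 0") (auto simp: mult.assoc hw_col)
  qed (simp_all add: mult.assoc pm)
  show "act ?M Gen_d * act ?M Gen_c = q *\<^sub>k (act ?M Gen_c * act ?M Gen_d)"
  proof (rule column_ext_idm[of _ p])
    fix j assume "j < p"
    then show "act ?M Gen_d * act ?M Gen_c * munit j 0 = q *\<^sub>k (act ?M Gen_c * act ?M Gen_d) * munit j 0"
      using bcd(2)[of j] by (cases "j = 0") (auto simp: mult.assoc hw_col)
  qed (simp_all add: mult.assoc pm)
  show "act ?M Gen_b * act ?M Gen_c = act ?M Gen_c * act ?M Gen_b"
    by (rule column_ext_idm[of _ p]) (auto simp: mult.assoc pm hw_col mult.commute)
  show "pw (act ?M Gen_a) n (ide ?M) = 0"
    unfolding hwm_simps(1)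
    by (rule column_ext_idm[of _ p], unfold pwi pwe) (use assms in \<open>auto simp: pwe[simplified] hw_pw_a\<close>)
  show "pw (act ?M Gen_d) n (ide ?M) = 0"
    unfolding hwm_simps(1)
    by (rule column_ext_idm[of _ p], unfold pwi pwe) (use assms in \<open>auto simp: pwe[simplified] hw_pw_d\<close>)
  show "pw (act ?M Gen_b) n (ide ?M) = ide ?M"
    unfolding hwm_simps(1)
    by (rule column_ext_idm[of _ p], unfold pwi pwe) (auto simp: pwe[simplified] hw_pw_b idm_munit)
  show "pw (act ?M Gen_c) n (ide ?M) = ide ?M"
    unfolding hwm_simps(1)
    by (rule column_ext_idm[of _ p], unfold pwi pwe) (auto simp: pwe[simplified] hw_pw_c idm_munit)
  show "act ?M Gen_d * act ?M Gen_a - q *\<^sub>k (act ?M Gen_a * act ?M Gen_d) = ide ?M - act ?M Gen_b * act ?M Gen_c"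
  proof (rule column_ext_idm[of _ p])
    fix j assume j: "j < p"
    have bc: "q powi (1 - t - int s + int j) * q powi (t + int j) = q powi (2 * int j + 1 - int s)"
      unfolding qpow_add[symmetric] by (simp add: algebra_simps)
    have da: "act ?M Gen_d * (act ?M Gen_a * munit j 0) = alpha s (Suc j) *\<^sub>k munit j 0"
    proof (cases "Suc j < p")
      case False
      then have "p = Suc j" using j by simp
      then show ?thesis using assms(3) j by (simp add: hw_col)
    qed (use j in \<open>simp add: hw_col\<close>)
    have ad: "act ?M Gen_a * (act ?M Gen_d * munit j 0) = alpha s j *\<^sub>k munit j 0"
      using j by (cases "j = 0") (auto simp: hw_col)
    have "(act ?M Gen_d * act ?M Gen_a - q *\<^sub>k (act ?M Gen_a * act ?M Gen_d)) * munit j 0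
        = (alpha s (Suc j) - q * alpha s j) *\<^sub>k munit j 0"
      by (simp add: left_diff_distrib mult.assoc da[simplified] ad[simplified] fm.scale_left_diff_distrib)
    also have "\<dots> = (ide ?M - act ?M Gen_b * act ?M Gen_c) * munit j 0"
      using j unfolding alpha_step
      by (simp add: left_diff_distrib mult.assoc hw_col idm_munit bc fm.scale_left_diff_distrib)
    finally show "(act ?M Gen_d * act ?M Gen_a - q *\<^sub>k (act ?M Gen_a * act ?M Gen_d)) * munit j 0
      = (ide ?M - act ?M Gen_b * act ?M Gen_c) * munit j 0" .
  qed (simp_all add: left_diff_distrib mult.assoc pm)
qed

lemma rmodule_V: "1 \<le> s \<Longrightarrow> s \<le> n \<Longrightarrow> rmodule (V s t)" by (rule rmodule_hwm) auto
lemma rmodule_Z: "rmodule (Z s t)" using n_gt_2 by (intro rmodule_hwm) auto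

lemma rk_hwm [simp]: "rk (hwm p s t) = p"
  by (simp add: rk_def rk_hwm_idm)

text \<open>An equality of modules, so labels can be changed modulo n without passing through
  isomorphisms.\<close>

lemma hwm_cong:
  assumes "q powi t = q powi t'" shows "hwm p s t = hwm p s t'"
proof -
  have d: "int n dvd t - t'" using assms by (simp add: qpow_eq_iff)
  have "q powi (t + i) = q powi (t' + i)" "q powi (1 - t - int s + i) = q powi (1 - t' - int s + i)" for i
  proof -
    have "1 - t - int s + i - (1 - t' - int s + i) = - (t - t')" by simp
    then show "q powi (1 - t - int s + i) = q powi (1 - t' - int s + i)"
      unfolding qpow_eq_iff using d by (metis dvd_minus_iff)
  qed (use d in \<open>simp add: qpow_eq_iff\<close>)
  then have "hw_act p s t g = hw_act p s t' g" for g by (cases g) (simp_all add: hw_act.simps)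
  then show ?thesis by (auto simp: hwm_def)
qed

section \<open>Weight vectors and maps out of highest weight modules\<close>

definition wvec :: "'k rmod \<Rightarrow> int \<Rightarrow> int \<Rightarrow> 'k fm \<Rightarrow> bool" where
  "wvec M t u x \<longleftrightarrow> ide M * x = x \<and> x * munit 0 0 = x \<and>
     act M Gen_b * x = q powi t *\<^sub>k x \<and> act M Gen_c * x = q powi u *\<^sub>k x"

text \<open>On the generator of V(s,t) the eigenvalues of \<open>b\<close> and \<open>c\<close>
  multiply to q^(1 - s). So \<open>t\<close> records the eigenvalue of \<open>b\<close>, and
  \<open>s\<close> the product of the two.\<close>

definition hwvec :: "'k rmod \<Rightarrow> nat \<Rightarrow> int \<Rightarrow> 'k fm \<Rightarrow> bool" where
  "hwvec M s t x \<longleftrightarrow> wvec M t (1 - t - int s) x \<and> act M Gen_d * x = 0"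

lemma wvecD: "wvec M t u x \<Longrightarrow> ide M * x = x" "wvec M t u x \<Longrightarrow> x * munit 0 0 = x"
  "wvec M t u x \<Longrightarrow> act M Gen_b * x = q powi t *\<^sub>k x" "wvec M t u x \<Longrightarrow> act M Gen_c * x = q powi u *\<^sub>k x"
  by (simp_all add: wvec_def)

lemma wvec_cong: "wvec M t u x \<Longrightarrow> q powi t = q powi t' \<Longrightarrow> q powi u = q powi u' \<Longrightarrow> wvec M t' u' x"
  by (simp add: wvec_def)

lemma wvec_a:
  assumes "rmodule M" "wvec M t u x" shows "wvec M (t + 1) (u + 1) (act M Gen_a * x)"
  unfolding wvec_def
proof (intro conjI)
  note r = rmoduleD[OF assms(1)] and w = wvecD[OF assms(2)]
  show "ide M * (act M Gen_a * x) = act M Gen_a * x" by (simp add: premoduleD[OF r(1)])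
  show "act M Gen_a * x * munit 0 0 = act M Gen_a * x" by (simp add: mult.assoc w)
  show "act M Gen_b * (act M Gen_a * x) = q powi (t + 1) *\<^sub>k (act M Gen_a * x)"
    using mult_eq_assoc[OF r(2), of x] by (simp add: mult.assoc w qpow_add mult.commute)
  show "act M Gen_c * (act M Gen_a * x) = q powi (u + 1) *\<^sub>k (act M Gen_a * x)"
    using mult_eq_assoc[OF r(4), of x] by (simp add: mult.assoc w qpow_add mult.commute)
qed

lemma wvec_d:
  assumes "rmodule M" "wvec M t u x" shows "wvec M (t - 1) (u - 1) (act M Gen_d * x)"
  unfolding wvec_def
proof (intro conjI)
  note r = rmoduleD[OF assms(1)] and w = wvecD[OF assms(2)]
  have i: "q powi (k - 1) = inverse q * q powi k" for k
    using qpow_add[of "- 1" k] by (simp add: power_int_minus)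
  show "ide M * (act M Gen_d * x) = act M Gen_d * x" by (simp add: premoduleD[OF r(1)])
  show "act M Gen_d * x * munit 0 0 = act M Gen_d * x" by (simp add: mult.assoc w)
  have "q powi t *\<^sub>k (act M Gen_d * x) = q *\<^sub>k (act M Gen_b * (act M Gen_d * x))"
    using mult_eq_assoc[OF r(3), of x] by (simp add: mult.assoc w)
  then have "inverse q *\<^sub>k (q powi t *\<^sub>k (act M Gen_d * x)) = inverse q *\<^sub>k (q *\<^sub>k (act M Gen_b * (act M Gen_d * x)))"
    by simp
  then show "act M Gen_b * (act M Gen_d * x) = q powi (t - 1) *\<^sub>k (act M Gen_d * x)"
    using q_nz by (simp add: i)
  have "q powi u *\<^sub>k (act M Gen_d * x) = q *\<^sub>k (act M Gen_c * (act M Gen_d * x))"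
    using mult_eq_assoc[OF r(5), of x] by (simp add: mult.assoc w)
  then have "inverse q *\<^sub>k (q powi u *\<^sub>k (act M Gen_d * x)) = inverse q *\<^sub>k (q *\<^sub>k (act M Gen_c * (act M Gen_d * x)))"
    by simp
  then show "act M Gen_c * (act M Gen_d * x) = q powi (u - 1) *\<^sub>k (act M Gen_d * x)"
    using q_nz by (simp add: i)
qed

lemma wvec_pw_a: "rmodule M \<Longrightarrow> wvec M t u x \<Longrightarrow> wvec M (t + int j) (u + int j) (pw (act M Gen_a) j x)"
proof (induction j)
  case (Suc j)
  from wvec_a[OF Suc(2) Suc(1)[OF Suc(2,3)]] show ?case by (simp add: add_ac)
qed simp

lemma wvec_pw_d: "rmodule M \<Longrightarrow> wvec M t u x \<Longrightarrow> wvec M (t - int j) (u - int j) (pw (act M Gen_d) j x)"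
proof (induction j)
  case (Suc j)
  from wvec_d[OF Suc(2) Suc(1)[OF Suc(2,3)]] show ?case by (simp add: algebra_simps)
qed simp

lemma da_wvec:
  assumes "rmodule M" "wvec M t u x"
  shows "act M Gen_d * (act M Gen_a * x) = q *\<^sub>k (act M Gen_a * (act M Gen_d * x)) + (1 - q powi (t + u)) *\<^sub>k x"
proof -
  note r = rmoduleD[OF assms(1)] and w = wvecD[OF assms(2)]
  have "(act M Gen_d * act M Gen_a - q *\<^sub>k (act M Gen_a * act M Gen_d)) * x = (ide M - act M Gen_b * act M Gen_c) * x"
    by (simp only: r(11))
  then have "act M Gen_d * (act M Gen_a * x) - q *\<^sub>k (act M Gen_a * (act M Gen_d * x)) = x - q powi (t + u) *\<^sub>k x"
    by (simp add: left_diff_distrib mult.assoc w qpow_add mult.commute)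
  then show ?thesis by (simp add: fm.scale_left_diff_distrib algebra_simps)
qed

lemma hwvec_d_pw_a:
  assumes "rmodule M" "hwvec M s t x"
  shows "act M Gen_d * pw (act M Gen_a) (Suc j) x = alpha s (Suc j) *\<^sub>k pw (act M Gen_a) j x"
proof (induction j)
  case 0
  have w: "wvec M t (1 - t - int s) x" and d: "act M Gen_d * x = 0" using assms(2) by (auto simp: hwvec_def)
  show ?case using da_wvec[OF assms(1) w] d alpha_step[of s 0] by simp
next
  case (Suc j)
  have w: "wvec M t (1 - t - int s) x" using assms(2) by (auto simp: hwvec_def)
  from da_wvec[OF assms(1) wvec_pw_a[OF assms(1) w, of "Suc j"]]
  have "act M Gen_d * pw (act M Gen_a) (Suc (Suc j)) x = (q * alpha s (Suc j)) *\<^sub>k pw (act M Gen_a) (Suc j) x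
      + (1 - q powi (2 * int (Suc j) + 1 - int s)) *\<^sub>k pw (act M Gen_a) (Suc j) x"
    using Suc by (simp add: algebra_simps)
  also have "\<dots> = alpha s (Suc (Suc j)) *\<^sub>k pw (act M Gen_a) (Suc j) x"
    unfolding alpha_step[symmetric] fm.scale_left_distrib[symmetric] by simp
  finally show ?case .
qed

lemma hwvec_pw_d_a:
  assumes "rmodule M" "hwvec M s t x"
  shows "pw (act M Gen_d) j (pw (act M Gen_a) j x) = (\<Prod>i<j. alpha s (Suc i)) *\<^sub>k x"
proof (induction j)
  case (Suc j)
  have "pw (act M Gen_d) (Suc j) (pw (act M Gen_a) (Suc j) x)
      = pw (act M Gen_d) j (act M Gen_d * pw (act M Gen_a) (Suc j) x)"
    by (simp only: pw_Suc')
  also have "\<dots> = (\<Prod>i<Suc j. alpha s (Suc i)) *\<^sub>k x"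
    unfolding hwvec_d_pw_a[OF assms] pw_smul Suc by (simp add: mult.commute)
  finally show ?case .
qed simp

text \<open>Universal property: sending basis vector \<open>j\<close> to \<open>a^j x\<close>
  respects \<open>d\<close> because the coefficients in \<open>hwvec_d_pw_a\<close> depend only on
  the weight of \<open>x\<close>. For \<open>p = n\<close> the condition on \<open>a\<close> is one
  of the defining relations.\<close>

lemma hw_hom:
  assumes M: "rmodule M" and x: "hwvec M s t x" and p: "pw (act M Gen_a) p x = 0" and "1 \<le> p"
  shows "\<exists>f. rhom (hwm p s t) M f \<and> (\<forall>j<p. f * munit j 0 = pw (act M Gen_a) j x)"
proof -
  have w: "wvec M t (1 - t - int s) x" and d: "act M Gen_d * x = 0" using x by (auto simp: hwvec_def)
  define f where "f = (\<Sum>i<p. pw (act M Gen_a) i x * munit 0 i)"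
  note wj = wvec_pw_a[OF M w]
  have col: "f * munit j 0 = pw (act M Gen_a) j x" if "j < p" for j
  proof -
    have "f * munit j 0 = (\<Sum>i<p. if i = j then pw (act M Gen_a) j x else 0)"
      unfolding f_def sum_distrib_right by (rule sum.cong) (auto simp: mult.assoc munit_mult wvecD(2)[OF wj])
    then show ?thesis using that by (simp add: sum.delta)
  qed
  have fi: "f * idm p = f"
    unfolding f_def sum_distrib_right by (rule sum.cong) (auto simp: mult.assoc munit_idm)
  have ef: "ide M * f = f"
    unfolding f_def sum_distrib_left by (rule sum.cong) (auto simp: mult.assoc[symmetric] wvecD(1)[OF wj])
  have "f * act (hwm p s t) g = act M g * f" for g
  proof (rule column_ext_idm[of _ p])
    fix j assume j: "j < p"
    show "f * act (hwm p s t) g * munit j 0 = act M g * f * munit j 0"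
    proof (cases g)
      case Gen_a
      have "pw (act M Gen_a) (Suc j) x = 0" if "\<not> Suc j < p"
        using that j p pw_le_zero[OF p, of "Suc j"] by simp
      then show ?thesis using Gen_a j by (auto simp: mult.assoc hw_col col)
    next
      case Gen_b
      then show ?thesis using j wvecD(3)[OF wj] by (simp add: mult.assoc hw_col col)
    next
      case Gen_c
      then show ?thesis using j wvecD(4)[OF wj] by (simp add: mult.assoc hw_col col)
    next
      case Gen_d
      have "act M Gen_d * pw (act M Gen_a) j x = alpha s j *\<^sub>k pw (act M Gen_a) (j - 1) x"
        using d hwvec_d_pw_a[OF M x, of "j - 1"] by (cases j) auto
      then show ?thesis using Gen_d j by (simp add: mult.assoc hw_col col)
    qed
  qed (simp_all add: mult.assoc fi premoduleD[OF premodule_hwm[of p s t], simplified])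
  then show ?thesis using fi ef col by (auto simp: rhom_def)
qed

lemma hw_hom_cols:
  assumes "rhom (hwm p s t) M f" "j < p" shows "f * munit j 0 = pw (act M Gen_a) j (f * munit 0 0)"
  using assms(2)
proof (induction j)
  case (Suc j)
  have "munit (Suc j) 0 = act (hwm p s t) Gen_a * munit j 0" using Suc(2) by (simp add: hw_col)
  then have "f * munit (Suc j) 0 = act M Gen_a * (f * munit j 0)"
    using homD(6)[OF assms(1)] by simp
  then show ?case using Suc by simp
qed simp

lemma hw_hom_eqI:
  assumes "rhom (hwm p s t) M f" "rhom (hwm p s t) M g" "f * munit 0 0 = g * munit 0 0"
  shows "f = g"
proof (rule column_ext_idm[of _ p])
  show "f * idm p = f" "g * idm p = g" using homD(1)[OF assms(1)] homD(1)[OF assms(2)] by simp_all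
  fix j assume "j < p"
  from hw_hom_cols[OF assms(1) this] hw_hom_cols[OF assms(2) this]
  show "f * munit j 0 = g * munit j 0" by (simp only: assms(3))
qed

lemma hw_hom_nz:
  assumes "rhom (hwm p s t) M f" "f \<noteq> 0" shows "f * munit 0 0 \<noteq> 0"
  using hw_hom_eqI[OF assms(1) hom_zero] assms(2) by auto

lemma hw_hom_hwvec:
  assumes "rhom (hwm p s t) M f" "1 \<le> p" shows "hwvec M s t (f * munit 0 0)"
proof -
  note h = homD[OF assms(1)]
  have "act M g * (f * munit 0 0) = f * (hw_act p s t g * munit 0 0)" for g
    using h(6)[of g "munit 0 0"] by simp
  then show ?thesis using assms(2)
    by (simp add: hwvec_def wvec_def hw_col mult.assoc h(5))
qed

text \<open>If \<open>k\<close> is the least index in a nonzero combination of basis vectors, then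
  \<open>a^(p - 1 - k)\<close> takes the combination to a nonzero multiple of the last basis vector.
  Hence it is enough that the last one is not killed.\<close>

lemma hw_mono:
  assumes f: "rhom (hwm p s t) M f" and nz: "pw (act M Gen_a) (p - 1) (f * munit 0 0) \<noteq> 0"
  shows "rmono (hwm p s t) M f"
  unfolding rmono_def
proof (intro conjI allI impI f)
  have col: "z = 0" if z: "idm p * z = z" "z * munit 0 0 = z" "f * z = 0" for z
  proof (rule ccontr)
    assume "z \<noteq> 0"
    have ze: "z = (\<Sum>i<p. ent z i 0 *\<^sub>k munit i 0)" by (rule column_expand[OF z(1,2)])
    have "\<exists>i. i < p \<and> ent z i 0 \<noteq> 0"
    proof (rule ccontr)
      assume "\<not> ?thesis"
      then have "(\<Sum>i<p. ent z i 0 *\<^sub>k munit i 0) = (0 :: 'k fm)" by (intro sum.neutral) auto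
      then show False using ze \<open>z \<noteq> 0\<close> by simp
    qed
    then obtain k where k: "k < p" "ent z k 0 \<noteq> 0" and less: "\<And>i. i < k \<Longrightarrow> \<not> (i < p \<and> ent z i 0 \<noteq> 0)"
      using exists_least_iff[of "\<lambda>i. i < p \<and> ent z i 0 \<noteq> 0"] by blast
    let ?a = "hw_act p s t Gen_a"
    have "pw ?a (p - 1 - k) z = (\<Sum>i<p. ent z i 0 *\<^sub>k pw ?a (p - 1 - k) (munit i 0))"
      by (subst ze) (simp only: pw_sum pw_smul)
    also have "\<dots> = (\<Sum>i<p. if i = k then ent z k 0 *\<^sub>k munit (p - 1) 0 else 0)"
    proof (rule sum.cong[OF refl])
      fix i assume i: "i \<in> {..<p}"
      show "ent z i 0 *\<^sub>k pw ?a (p - 1 - k) (munit i 0) = (if i = k then ent z k 0 *\<^sub>k munit (p - 1) 0 else 0)"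
        using i k less[of i] by (cases i k rule: linorder_cases) (auto simp: hw_pw_a)
    qed
    also have "\<dots> = ent z k 0 *\<^sub>k munit (p - 1) 0" using k by (simp add: sum.delta)
    finally have "f * (pw ?a (p - 1 - k) z) = ent z k 0 *\<^sub>k (f * munit (p - 1) 0)" by simp
    moreover have "f * pw ?a (p - 1 - k) z = pw (act M Gen_a) (p - 1 - k) (f * z)"
      by (rule pw_intertwine) (use homD(3)[OF f] in simp)
    ultimately have "f * munit (p - 1) 0 = 0" using k z(3) by simp
    then show False using nz hw_hom_cols[OF f, of "p - 1"] k by simp
  qed
  fix y assume y: "ide (hwm p s t) * y = y" "f * y = 0"
  show "y = 0"
  proof (rule column_ext)
    fix j
    have "y * munit j 0 = 0"
    proof (rule col)
      show "idm p * (y * munit j 0) = y * munit j 0" using y(1) by (simp add: mult.assoc[symmetric])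
      show "f * (y * munit j 0) = 0" using y(2) by (simp add: mult.assoc[symmetric])
    qed (simp add: mult.assoc)
    then show "y * munit j 0 = 0 * munit j 0" by simp
  qed
qed

lemma prod_alpha_nz: "j < s \<Longrightarrow> s \<le> n \<Longrightarrow> (\<Prod>i<j. alpha s (Suc i)) \<noteq> 0"
proof -
  assume "j < s" "s \<le> n"
  then have "alpha s (Suc i) \<noteq> 0" if "i < j" for i using that by (intro alpha_nz) auto
  then show ?thesis by auto
qed

text \<open>\<open>d^(s-1) a^(s-1)\<close> multiplies the image of the generator by a product of
  nonzero \<open>alpha s i\<close>, so the last basis vector survives. This is the simplicity of
  V(s,t), stated for maps out of it.\<close>

lemma V_mono:
  assumes M: "rmodule M" and f: "rhom (V s t) M f" "f \<noteq> 0" and s: "1 \<le> s" "s \<le> n"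
  shows "rmono (V s t) M f"
proof (rule hw_mono[OF f(1)])
  have "pw (act M Gen_d) (s - 1) (pw (act M Gen_a) (s - 1) (f * munit 0 0)) \<noteq> 0"
    unfolding hwvec_pw_d_a[OF M hw_hom_hwvec[OF f(1) s(1)]]
    using prod_alpha_nz[of "s - 1" s] s hw_hom_nz[OF f] by simp
  then show "pw (act M Gen_a) (s - 1) (f * munit 0 0) \<noteq> 0" by auto
qed

text \<open>In \<open>V s' t'\<close> only multiples of the first basis vector are killed by
  \<open>d\<close>, so the generator must go there; comparing eigenvalues of \<open>b\<close> and
  \<open>c\<close> gives the labels. As \<open>p\<close> is free, the lemma also finds the simple
  quotients of Verma modules.\<close>

lemma hom_hwm_V:
  assumes f: "rhom (hwm p s t) (V s' t') f" "f \<noteq> 0" and s: "1 \<le> p" "1 \<le> s" "s \<le> n" "1 \<le> s'" "s' \<le> n"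
  shows "s = s'" "q powi t = q powi t'" "\<exists>\<kappa>. \<kappa> \<noteq> 0 \<and> f * munit 0 0 = \<kappa> *\<^sub>k munit 0 0"
proof -
  let ?x = "f * munit 0 0"
  from hw_hom_hwvec[OF f(1) s(1)] have w: "wvec (V s' t') t (1 - t - int s) ?x"
    and d: "hw_act s' s' t' Gen_d * ?x = 0" by (auto simp: hwvec_def)
  have xe: "?x = (\<Sum>i<s'. ent ?x i 0 *\<^sub>k munit i 0)"
    using wvecD(1,2)[OF w] by (intro column_expand) auto
  have ent0: "ent ?x i 0 = 0" if i: "0 < i" "i < s'" for i
  proof -
    have "0 = ent (hw_act s' s' t' Gen_d * ?x) (i - 1) 0" by (simp add: d)
    also have "hw_act s' s' t' Gen_d * ?x = (\<Sum>j<s'. ent ?x j 0 *\<^sub>k (hw_act s' s' t' Gen_d * munit j 0))"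
      by (subst xe) (simp add: sum_distrib_left)
    also have "ent \<dots> (i - 1) 0 = (\<Sum>j<s'. if j = i then ent ?x i 0 * alpha s' i else 0)"
      unfolding ent_sum
    proof (rule sum.cong[OF refl])
      fix j assume "j \<in> {..<s'}"
      then show "ent (ent ?x j 0 *\<^sub>k (hw_act s' s' t' Gen_d * munit j 0)) (i - 1) 0
          = (if j = i then ent ?x i 0 * alpha s' i else 0)"
        using i by (cases j) (auto simp: hw_col ent_munit)
    qed
    also have "\<dots> = ent ?x i 0 * alpha s' i" using i by (simp add: sum.delta)
    finally show ?thesis using alpha_nz[of i s'] i s by auto
  qed
  have xk: "?x = ent ?x 0 0 *\<^sub>k munit 0 0"
  proof -
    have "(\<Sum>i<s'. ent ?x i 0 *\<^sub>k munit i 0) = (\<Sum>i<s'. if i = 0 then ent ?x 0 0 *\<^sub>k munit 0 0 else (0 :: 'k fm))"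
      by (rule sum.cong) (auto simp: ent0)
    then show ?thesis using xe s by (simp add: sum.delta)
  qed
  have nz: "ent ?x 0 0 \<noteq> 0" using hw_hom_nz[OF f] xk by auto
  then show "\<exists>\<kappa>. \<kappa> \<noteq> 0 \<and> ?x = \<kappa> *\<^sub>k munit 0 0" using xk by blast
  have s0: "0 < s'" using s by simp
  have cmp: "\<beta> = \<gamma>" if "g * ?x = \<beta> *\<^sub>k ?x" "g * munit 0 0 = \<gamma> *\<^sub>k munit 0 0" for g \<beta> \<gamma>
  proof -
    have "ent (g * ?x) 0 0 = ent ?x 0 0 * \<gamma>" by (subst xk) (simp add: that(2) ent_munit)
    then show ?thesis using that(1) nz by simp
  qed
  show b: "q powi t = q powi t'"
    by (rule cmp[of "hw_act s' s' t' Gen_b"]) (use wvecD(3)[OF w] s0 in \<open>simp_all add: hw_col\<close>)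
  have "q powi (1 - t - int s) = q powi (1 - t' - int s')"
    by (rule cmp[of "hw_act s' s' t' Gen_c"]) (use wvecD(4)[OF w] s0 in \<open>simp_all add: hw_col\<close>)
  then have "int n dvd ((1 - t - int s) - (1 - t' - int s'))" "int n dvd (t - t')" using b by (simp_all add: qpow_eq_iff)
  then have "int n dvd ((1 - t - int s) - (1 - t' - int s')) + (t - t')" by (rule dvd_add)
  then have "int n dvd (int s' - int s)" by (simp add: algebra_simps)
  show "s = s'"
  proof (rule ccontr)
    assume "s \<noteq> s'"
    then have "int n \<le> \<bar>int s' - int s\<bar>" using \<open>int n dvd (int s' - int s)\<close>
      by (intro zdvd_imp_le[of "int n" "\<bar>int s' - int s\<bar>"]) auto
    then show False using s by auto
  qed
qed

text \<open>\<open>munit 0 0\<close> is a highest weight vector of the transposed module because row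
  0 of \<open>a\<close> vanishes, and the transposed \<open>d\<close> raises indices up to scalars.
  The resulting map is injective by \<open>V_mono\<close>, and the dimensions agree.\<close>

lemma flip_V_iso: "1 \<le> s \<Longrightarrow> s \<le> n \<Longrightarrow> riso (V s t) (flip (V s t))"
proof -
  assume s: "1 \<le> s" "s \<le> n"
  let ?F = "flip (V s t)"
  have F: "rmodule ?F" by (rule rmodule_flip[OF rmodule_V[OF s]])
  have row: "munit 0 0 * hw_act s s t Gen_a = 0"
    "munit 0 0 * hw_act s s t Gen_b = q powi t *\<^sub>k munit 0 0"
    "munit 0 0 * hw_act s s t Gen_c = q powi (1 - t - int s) *\<^sub>k munit 0 0"
  proof -
    show "munit 0 0 * hw_act s s t Gen_a = 0" by (simp add: hw_act.simps sum_distrib_left munit_mult)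
    have "munit 0 0 * hw_act s s t Gen_b = (\<Sum>j<s. if j = 0 then q powi t *\<^sub>k munit 0 0 else 0)"
      unfolding hw_act.simps sum_distrib_left by (rule sum.cong) (auto simp: munit_mult)
    then show "munit 0 0 * hw_act s s t Gen_b = q powi t *\<^sub>k munit 0 0" using s by (simp add: sum.delta)
    have "munit 0 0 * hw_act s s t Gen_c = (\<Sum>j<s. if j = 0 then q powi (1 - t - int s) *\<^sub>k munit 0 0 else 0)"
      unfolding hw_act.simps sum_distrib_left by (rule sum.cong) (auto simp: munit_mult)
    then show "munit 0 0 * hw_act s s t Gen_c = q powi (1 - t - int s) *\<^sub>k munit 0 0" using s by (simp add: sum.delta)
  qed
  have t: "tr x * munit 0 0 = tr (munit 0 0 * x)" for x :: "'k fm" by simp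
  have hw: "hwvec ?F s t (munit 0 0)"
    using s by (simp del: tr_mult add: hwvec_def wvec_def t row idm_munit)
  have drow: "tr (hw_act s s t Gen_d) * munit j 0 = (if Suc j < s then alpha s (Suc j) *\<^sub>k munit (Suc j) 0 else 0)" for j
  proof -
    have "tr (hw_act s s t Gen_d) * munit j 0 = tr (munit 0 j * hw_act s s t Gen_d)" by simp
    also have "munit 0 j * hw_act s s t Gen_d = (\<Sum>i<s - 1. if i = j then alpha s (Suc j) *\<^sub>k munit 0 (Suc j) else 0)"
      unfolding hw_act.simps sum_distrib_left by (rule sum.cong) (auto simp: munit_mult)
    finally show ?thesis by (auto simp: sum.delta)
  qed
  have "\<exists>\<kappa>. pw (act ?F Gen_a) m (munit 0 0) = (if m < s then \<kappa> *\<^sub>k munit m 0 else 0)" for m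
  proof (induction m)
    case 0
    then show ?case using s by (intro exI[of _ 1]) simp
  next
    case (Suc m)
    then obtain \<kappa> where "pw (act ?F Gen_a) m (munit 0 0) = (if m < s then \<kappa> *\<^sub>k munit m 0 else 0)" by blast
    then show ?case by (intro exI[of _ "\<kappa> * alpha s (Suc m)"]) (auto simp: drow)
  qed
  from this[of s] have "pw (act ?F Gen_a) s (munit 0 0) = 0" by simp
  from hw_hom[OF F hw this s(1)] obtain f where f: "rhom (V s t) ?F f"
    "\<And>j. j < s \<Longrightarrow> f * munit j 0 = pw (act ?F Gen_a) j (munit 0 0)" by blast
  have "f * munit 0 0 = munit 0 0" using f(2)[of 0] s by simp
  then have "f \<noteq> 0" by auto
  from mono_rk_iso(2)[OF rmodule_V[OF s] F V_mono[OF F f(1) this s]]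
  show ?thesis by (simp add: rk_def rk_hwm_idm)
qed

section \<open>Weight components by averaging over powers of \<open>b\<close> and
  \<open>c\<close>\<close>

lemma of_nat_n_nz: "of_nat n \<noteq> (0 :: 'k)"
proof
  assume z: "of_nat n = (0 :: 'k)"
  \<comment> \<open>If n were 0 in k, then 1 + X + ... + X^(n-1) would vanish at 1 as well as at the
    other n - 1 powers of q, more roots than its degree permits.\<close>
  let ?p = "(\<Sum>i<n. monom 1 i) :: 'k poly"
  have c: "coeff ?p k = (if k < n then 1 else 0)" for k
    by (simp add: coeff_sum coeff_monom if_distrib[of "\<lambda>x. x = k"] sum.delta)
  have nz: "?p \<noteq> 0" using c[of 0] n_gt_2 by auto
  have deg: "degree ?p \<le> n - 1" by (rule degree_le) (use c in auto)
  have "(\<lambda>j. q ^ j) ` {..<n} \<subseteq> {x. poly ?p x = 0}"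
  proof
    fix x assume "x \<in> (\<lambda>j. q ^ j) ` {..<n}"
    then obtain j where j: "j < n" "x = q ^ j" by auto
    have px: "poly ?p x = (\<Sum>i<n. x ^ i)" by (simp add: poly_sum poly_monom)
    show "x \<in> {x. poly ?p x = 0}"
    proof (cases "j = 0")
      case True
      then show ?thesis using z j px by simp
    next
      case False
      then have x1: "x \<noteq> 1" using q_prim j by simp
      have "x ^ n = 1" using q_root j by (metis mult.commute power_mult power_one)
      then have "(1 - x) * (\<Sum>i<n. x ^ i) = 0" by (simp add: one_diff_power_eq[symmetric])
      then show ?thesis using x1 px by simp
    qed
  qed
  moreover have "inj_on (\<lambda>j. q ^ j) {..<n}"
  proof (rule linorder_inj_onI)
    fix i j assume ij: "i < j" "i \<in> {..<n}" "j \<in> {..<n}"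
    then have "q ^ j = q ^ i * q ^ (j - i)" by (simp add: power_add[symmetric])
    then show "q ^ i \<noteq> q ^ j" using q_prim[of "j - i"] ij q_nz by auto
  qed auto
  ultimately have "n \<le> card {x. poly ?p x = 0}"
    using card_mono[OF poly_roots_finite[OF nz]] by (metis card_image card_lessThan)
  also have "\<dots> \<le> degree ?p" by (rule card_poly_roots_bound[OF nz])
  finally show False using deg n_gt_2 by simp
qed

text \<open>A discrete Fourier sum: if \<open>g^n\<close> fixes \<open>x\<close>, this is n times
  the component of \<open>x\<close> in the eigenspace of \<open>g\<close> for q^t. The factor n is
  divided out only in \<open>wvec_lift\<close>.\<close>

definition eigproj :: "'k fm \<Rightarrow> int \<Rightarrow> 'k fm \<Rightarrow> 'k fm" where
  "eigproj g t x = (\<Sum>i<n. q powi (- t * int i) *\<^sub>k pw g i x)"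

lemma eigproj_eigen:
  assumes "pw g n x = x" shows "g * eigproj g t x = q powi t *\<^sub>k eigproj g t x"
proof -
  let ?F = "\<lambda>i. q powi (t - t * int i) *\<^sub>k pw g i x"
  have "g * eigproj g t x = (\<Sum>i<n. ?F (Suc i))"
    unfolding eigproj_def sum_distrib_left by (rule sum.cong) (auto simp: algebra_simps)
  also have "\<dots> = (\<Sum>i<n. ?F i)"
  proof -
    have "q powi (t - t * int n) = q powi t" by (simp add: qpow_eq_iff)
    then have "?F n = ?F 0" by (simp add: assms)
    moreover have "?F 0 + (\<Sum>i<n. ?F (Suc i)) = (\<Sum>i<n. ?F i) + ?F n"
      using sum.lessThan_Suc_shift[of ?F n] sum.lessThan_Suc[of ?F n] by simp
    ultimately show ?thesis by simp
  qed
  also have "\<dots> = q powi t *\<^sub>k eigproj g t x"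
    unfolding eigproj_def fm.scale_sum_right
    by (rule sum.cong) (auto simp: qpow_add[symmetric])
  finally show ?thesis .
qed

lemma eigproj_sum: "(\<Sum>t<n. eigproj g (int t) x) = of_nat n *\<^sub>k x"
proof -
  have "(\<Sum>t<n. eigproj g (int t) x) = (\<Sum>i<n. (\<Sum>t<n. q powi (- int t * int i)) *\<^sub>k pw g i x)"
    unfolding eigproj_def by (subst sum.swap) (simp add: fm.scale_sum_left)
  also have "\<dots> = (\<Sum>i<n. if i = 0 then of_nat n *\<^sub>k x else 0)"
  proof (rule sum.cong[OF refl])
    fix i assume i: "i \<in> {..<n}"
    show "(\<Sum>t<n. q powi (- int t * int i)) *\<^sub>k pw g i x = (if i = 0 then of_nat n *\<^sub>k x else 0)"
    proof (cases "i = 0")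
      case False
      let ?y = "q powi (- int i)"
      have e: "q powi (- int t * int i) = ?y ^ t" for t
        by (metis minus_mult_commute mult.commute power_int_mult power_int_of_nat)
      have "\<not> int n dvd - int i" using i False by (auto dest: nat_dvd_not_less simp: int_dvd_int_iff)
      then have "?y \<noteq> 1" by (simp only: qpow_eq_1_iff not_False_eq_True)
      moreover have "(1 - ?y) * (\<Sum>t<n. ?y ^ t) = 0"
        unfolding one_diff_power_eq[symmetric] by simp
      ultimately have "(\<Sum>t<n. ?y ^ t) = 0" by simp
      then show ?thesis using False by (simp only: e) simp
    qed simp
  qed
  also have "\<dots> = of_nat n *\<^sub>k x" using n_gt_2 by (simp add: sum.delta)
  finally show ?thesis .
qed

lemma eigproj_mult: "eigproj g t x * z = eigproj g t (x * z)"
  by (simp add: eigproj_def sum_distrib_right pw_mult)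
lemma eigproj_intertwine: "f * g = g' * f \<Longrightarrow> f * eigproj g t x = eigproj g' t (f * x)"
  by (simp add: eigproj_def sum_distrib_left pw_intertwine)
lemma sum_const_fm: "(\<Sum>i<m. x) = of_nat m *\<^sub>k (x :: 'k fm)"
  by (induction m) (simp_all add: fm.scale_left_distrib add.commute)
lemma eigproj_fix:
  assumes "g * x = q powi t *\<^sub>k x" shows "eigproj g t x = of_nat n *\<^sub>k x"
proof -
  have "pw g i x = q powi (t * int i) *\<^sub>k x" for i
    by (induction i) (auto simp: assms algebra_simps qpow_add mult.commute)
  then have "q powi (- t * int i) *\<^sub>k pw g i x = x" for i by (simp add: qpow_add[symmetric])
  then show ?thesis by (simp add: eigproj_def sum_const_fm)
qed

definition wproj :: "'k rmod \<Rightarrow> int \<Rightarrow> int \<Rightarrow> 'k fm \<Rightarrow> 'k fm" where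
  "wproj M t u x = eigproj (act M Gen_b) t (eigproj (act M Gen_c) u x)"

lemma wvec_wproj:
  assumes "rmodule M" "ide M * x = x" "x * munit 0 0 = x" shows "wvec M t u (wproj M t u x)"
proof -
  note r = rmoduleD[OF assms(1)] and p = premoduleD[OF rmoduleD(1)[OF assms(1)]]
  have pwx: "pw (act M Gen_b) n y = y" "pw (act M Gen_c) n y = y" if "ide M * y = y" for y
    using that r(8,9) pw_mult[of "act M Gen_b" n "ide M" y] pw_mult[of "act M Gen_c" n "ide M" y] by simp_all
  have ee: "ide M * eigproj (act M g) t y = eigproj (act M g) t (ide M * y)" for g t y
    by (rule eigproj_intertwine) (simp add: p)
  let ?y = "eigproj (act M Gen_c) u x"
  have y: "ide M * ?y = ?y" by (simp add: ee assms)
  have yc: "act M Gen_c * ?y = q powi u *\<^sub>k ?y" by (rule eigproj_eigen[OF pwx(2)[OF assms(2)]])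
  have sm: "eigproj g t (k *\<^sub>k z) = k *\<^sub>k eigproj g t z" for g t k z
    by (simp add: eigproj_def pw_smul fm.scale_sum_right mult.commute)
  show ?thesis unfolding wvec_def wproj_def
    by (simp add: ee y assms(2) eigproj_mult assms(3) eigproj_eigen[OF pwx(1)[OF y]]
        eigproj_intertwine[OF r(6)[symmetric]] yc sm)
qed

text \<open>The sums \<open>eigproj\<close> over all t add up to n times the vector, so one of them
  is nonzero. This is used for \<open>c\<close> and then for \<open>b\<close>.\<close>

lemma weight_vector_exists:
  assumes "rmodule M" "ide M * x = x" "x * munit 0 0 = x" "x \<noteq> 0"
  shows "\<exists>t u y. wvec M t u y \<and> y \<noteq> 0"
proof -
  have nz: "\<exists>t. eigproj g (int t) y \<noteq> 0" if "y \<noteq> 0" for g y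
  proof (rule ccontr)
    assume "\<not> ?thesis"
    then have "(\<Sum>t<n. eigproj g (int t) y) = 0" by simp
    then show False using that of_nat_n_nz by (simp add: eigproj_sum)
  qed
  from nz[OF assms(4), of "act M Gen_c"] obtain u where "eigproj (act M Gen_c) (int u) x \<noteq> 0" by blast
  from nz[OF this, of "act M Gen_b"] obtain t where "wproj M (int t) (int u) x \<noteq> 0" by (auto simp: wproj_def)
  then show ?thesis using wvec_wproj[OF assms(1-3)] by blast
qed

text \<open>Averaging commutes with intertwiners, so replacing an arbitrary preimage of
  \<open>v\<close> by its weight component changes the image only by the factor n^2.\<close>

lemma wvec_lift:
  assumes M: "rmodule M" and N: "rmodule N" and f: "repi M N f" and v: "wvec N t u v"
  shows "\<exists>y. wvec M t u y \<and> f * y = v"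
proof -
  obtain x where x: "ide M * x = x" "f * x = v" using repi_surj[OF f wvecD(1)[OF v]] by blast
  note h = homD[OF repiD[OF f]] and p = premoduleD[OF rmoduleD(1)[OF M]]
  let ?x = "x * munit 0 0"
  have x': "ide M * ?x = ?x" "?x * munit 0 0 = ?x" "f * ?x = v"
    using mult_eq_assoc[OF x(1), of "munit 0 0"] mult_eq_assoc[OF x(2), of "munit 0 0"] wvecD(2)[OF v]
    by (simp_all only: mult.assoc munit_mult_same)
  have "f * wproj M t u ?x = wproj N t u (f * ?x)"
    unfolding wproj_def eigproj_intertwine[OF h(3)] ..
  also have "\<dots> = (of_nat n * of_nat n) *\<^sub>k v"
  proof -
    have "act N Gen_b * (of_nat n *\<^sub>k v) = q powi t *\<^sub>k (of_nat n *\<^sub>k v)"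
      using wvecD(3)[OF v] by (simp add: mult.commute)
    then show ?thesis using wvecD(4)[OF v] by (simp add: x' wproj_def eigproj_fix)
  qed
  finally have "f * ((1 / (of_nat n * of_nat n)) *\<^sub>k wproj M t u ?x) = v" using of_nat_n_nz by simp
  moreover have "wvec M t u ((1 / (of_nat n * of_nat n)) *\<^sub>k wproj M t u ?x)"
    using wvec_wproj[OF M x'(1,2), of t u] by (simp add: wvec_def mult.commute)
  ultimately show ?thesis by blast
qed

text \<open>A last nonzero vector \<open>x\<close> among the powers of \<open>d\<close> on a weight
  vector is a highest weight vector for some label \<open>s\<close>. If \<open>a^s x = 0\<close>, it
  generates a copy of V(s,t1). Otherwise \<open>a^s x\<close> is again killed by \<open>d\<close>,
  since \<open>alpha s s = 0\<close>; it has the weight for n - s, and \<open>a^n = 0\<close> closes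
  the chain.\<close>

lemma socle_hom:
  assumes M: "rmodule M" and nz: "ide M \<noteq> 0"
  shows "\<exists>s t f. 1 \<le> s \<and> s \<le> n \<and> rhom (V s t) M f \<and> f \<noteq> 0"
proof -
  note p = premoduleD[OF rmoduleD(1)[OF M]] and r = rmoduleD[OF M]
  have "\<exists>j. ide M * munit j 0 \<noteq> 0"
  proof (rule ccontr)
    assume "\<not> ?thesis"
    then have "ide M * munit j 0 = 0 * munit j 0" for j by simp
    then have "ide M = 0" by (rule column_ext)
    then show False using nz by simp
  qed
  then obtain j where "ide M * munit j 0 \<noteq> 0" by blast
  then obtain t u y where y: "wvec M t u y" "y \<noteq> 0"
    using weight_vector_exists[OF M, of "ide M * munit j 0"] by (auto simp: mult.assoc p)
  have "pw (act M Gen_d) n y = 0"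
    using r(10) pw_mult[of "act M Gen_d" n "ide M" y] wvecD(1)[OF y(1)] by simp
  then obtain k where k: "pw (act M Gen_d) k y = 0" "\<And>i. i < k \<Longrightarrow> pw (act M Gen_d) i y \<noteq> 0"
    using exists_least_iff[of "\<lambda>k. pw (act M Gen_d) k y = 0"] by blast
  have k0: "k > 0" using k(1) y(2) by (cases k) auto
  define x where "x = pw (act M Gen_d) (k - 1) y"
  have x0: "x \<noteq> 0" using k(2)[of "k - 1"] k0 by (simp add: x_def)
  have dx: "act M Gen_d * x = 0" using k(1) k0 by (cases k) (auto simp: x_def)
  obtain t1 u1 where w: "wvec M t1 u1 x" using wvec_pw_d[OF M y(1)] by (auto simp: x_def)
  \<comment> \<open>The representative in 1, ..., n of the class for which q^(1 - s) is the
    eigenvalue q^(t1 + u1) of \<open>b * c\<close> on \<open>x\<close>.\<close>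
  define s where "s = nat ((- t1 - u1) mod int n) + 1"
  have s: "1 \<le> s" "s \<le> n" using n_gt_2 pos_mod_bound[of "int n" "- t1 - u1"] pos_mod_sign[of "int n" "- t1 - u1"]
    by (auto simp: s_def nat_less_iff Suc_le_eq)
  have si: "int s = (- t1 - u1) mod int n + 1" using n_gt_2 by (simp add: s_def)
  have "int n dvd u1 - (1 - t1 - int s)"
  proof -
    have "u1 - (1 - t1 - int s) = - ((- t1 - u1) - (- t1 - u1) mod int n)" by (simp add: si)
    then show ?thesis by (metis dvd_minus_iff dvd_minus_mod)
  qed
  then have hw: "hwvec M s t1 x" using wvec_cong[OF w refl] dx by (simp add: hwvec_def qpow_eq_iff)
  have an: "pw (act M Gen_a) n z = 0" if "ide M * z = z" for z
    using r(7) pw_mult[of "act M Gen_a" n "ide M" z] that by simp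
  show ?thesis
  proof (cases "pw (act M Gen_a) s x = 0")
    case True
    from hw_hom[OF M hw True s(1)] obtain f where f: "rhom (V s t1) M f"
      "\<And>j. j < s \<Longrightarrow> f * munit j 0 = pw (act M Gen_a) j x" by blast
    have "f \<noteq> 0" using f(2)[of 0] s x0 by auto
    with f(1) s show ?thesis by blast
  next
    case False
    let ?x = "pw (act M Gen_a) s x"
    have sn: "s < n" using False an[OF wvecD(1)[OF w]] s by (cases "s = n") auto
    have "wvec M (t1 + int s) (1 - (t1 + int s) - int (n - s)) ?x"
    proof (rule wvec_cong[OF wvec_pw_a[OF M]])
      show "wvec M t1 (1 - t1 - int s) x" using hw by (simp add: hwvec_def)
    qed (use sn in \<open>simp_all add: qpow_eq_iff of_nat_diff\<close>)
    moreover have "act M Gen_d * ?x = 0"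
      using hwvec_d_pw_a[OF M hw, of "s - 1"] s by simp
    ultimately have hw': "hwvec M (n - s) (t1 + int s) ?x" by (simp add: hwvec_def)
    have "pw (act M Gen_a) (n - s) ?x = 0"
      using an[OF wvecD(1)[OF w]] sn by (simp add: pw_add[symmetric])
    moreover have "1 \<le> n - s" using sn by simp
    ultimately obtain f where f: "rhom (V (n - s) (t1 + int s)) M f"
      "\<And>j. j < n - s \<Longrightarrow> f * munit j 0 = pw (act M Gen_a) j ?x" using hw_hom[OF M hw'] by blast
    have "f \<noteq> 0" using f(2)[of 0] sn False by auto
    with f(1) sn show ?thesis by (intro exI[of _ "n - s"] exI[of _ "t1 + int s"] exI[of _ f]) auto
  qed
qed

text \<open>The transpose of \<open>V_mono\<close>, using that \<open>flip\<close> fixes V(s,t) up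
  to isomorphism.\<close>

lemma V_epi:
  assumes M: "rmodule M" and f: "rhom M (V s t) f" "f \<noteq> 0" and s: "1 \<le> s" "s \<le> n"
  shows "repi M (V s t) f"
proof -
  obtain u where u: "rmono (V s t) (flip (V s t)) u" "repi (V s t) (flip (V s t)) u"
    using riso_mono_epi[OF flip_V_iso[OF s]] by blast
  have F: "rmodule (flip M)" by (rule rmodule_flip[OF M])
  have h: "rhom (V s t) (flip M) (tr f * u)"
    using hom_comp[OF rmonoD[OF u(1)] rhom_flip[OF f(1)]] .
  have "tr f * u \<noteq> 0"
  proof
    assume "tr f * u = 0"
    then have "tr f * u = 0 * u" by simp
    from repi_cancel[OF u(2) _ _ this] homD(1)[OF rhom_flip[OF f(1)]] have "tr f = 0" by simp
    then show False using f(2) by simp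
  qed
  from V_mono[OF F h this s] have m: "rmono (V s t) (flip M) (tr f * u)" .
  have "rmono (flip (V s t)) (flip M) (tr f)"
    unfolding rmono_def
  proof (intro conjI allI impI rhom_flip[OF f(1)])
    fix y assume y: "ide (flip (V s t)) * y = y" "tr f * y = 0"
    obtain z where z: "ide (V s t) * z = z" "u * z = y" using repi_surj[OF u(2) y(1)] by blast
    then have "tr f * u * z = 0" using y(2) by (simp add: mult.assoc)
    then have "z = 0" using m z(1) by (simp add: rmono_def)
    then show "y = 0" using z(2) by simp
  qed
  from rmono_flip[OF this] show ?thesis
    using rmoduleD(1)[OF rmodule_flip[OF rmodule_V[OF s]]] rmoduleD(1)[OF F] by simp
qed

lemma top_hom:
  assumes M: "rmodule M" and nz: "ide M \<noteq> 0"
  shows "\<exists>s t f. 1 \<le> s \<and> s \<le> n \<and> rhom M (V s t) f \<and> f \<noteq> 0"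
proof -
  have "ide (flip M) \<noteq> 0" using nz by simp
  from socle_hom[OF rmodule_flip[OF M] this] obtain s t f where
    f: "1 \<le> s" "s \<le> n" "rhom (V s t) (flip M) f" "f \<noteq> 0" by blast
  have h: "rhom M (flip (V s t)) (tr f)" using rhom_flip[OF f(3)] by simp
  obtain u where u: "rmono (flip (V s t)) (V s t) u"
    using riso_mono_epi[OF riso_sym[OF flip_V_iso[OF f(1,2)]]] by blast
  have "u * tr f \<noteq> 0"
  proof
    assume "u * tr f = 0"
    then have "tr f = 0" using u homD(2)[OF h] unfolding rmono_def by blast
    then show False using f(4) by simp
  qed
  then show ?thesis using f(1,2) hom_comp[OF h rmonoD[OF u]] by blast
qed

text \<open>A preimage of the generator can be taken of the right weight, but \<open>d\<close> need
  not kill it. Applying \<open>d^(n-1) a^(n-1)\<close> repairs this because \<open>d^n = 0\<close>,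
  and on the generator this operator is a nonzero scalar since no \<open>alpha n i\<close> with 0 <
  i < n vanishes.\<close>

lemma rproj_V_n: "rproj (V n t)"
  unfolding rproj_def
proof (intro conjI allI impI)
  show Vn: "rmodule (V n t)" using n_gt_2 by (intro rmodule_V) auto
  fix M N p f assume "rmodule M \<and> rmodule N \<and> repi M N p \<and> rhom (V n t) N f"
  then have M: "rmodule M" and N: "rmodule N" and p: "repi M N p" and f: "rhom (V n t) N f" by auto
  let ?v = "f * munit 0 0"
  have v: "hwvec N n t ?v" using hw_hom_hwvec[OF f] n_gt_2 by simp
  then have wv: "wvec N t (1 - t - int n) ?v" by (simp add: hwvec_def)
  obtain y where y: "wvec M t (1 - t - int n) y" "p * y = ?v" using wvec_lift[OF M N p wv] by blast
  define \<kappa> where "\<kappa> = (\<Prod>i<n - 1. alpha n (Suc i))"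
  have \<kappa>: "\<kappa> \<noteq> 0" unfolding \<kappa>_def by (rule prod_alpha_nz) (use n_gt_2 in auto)
  define y' where "y' = (1 / \<kappa>) *\<^sub>k pw (act M Gen_d) (n - 1) (pw (act M Gen_a) (n - 1) y)"
  note h = homD[OF repiD[OF p]]
  have "p * y' = (1 / \<kappa>) *\<^sub>k pw (act N Gen_d) (n - 1) (pw (act N Gen_a) (n - 1) ?v)"
    by (simp add: y'_def pw_intertwine[OF h(3)] y)
  also have "\<dots> = ?v" using \<kappa> unfolding hwvec_pw_d_a[OF N v] by (simp add: \<kappa>_def)
  finally have py: "p * y' = ?v" .
  from wvec_pw_d[OF M wvec_pw_a[OF M y(1), of "n - 1"], of "n - 1"]
  have wy: "wvec M t (1 - t - int n) y'" by (simp add: y'_def wvec_def mult.commute)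
  have "pw (act M Gen_d) n z = 0" if "ide M * z = z" for z
    using rmoduleD(10)[OF M] pw_mult[of "act M Gen_d" n "ide M" z] that by simp
  from this[OF wvecD(1)[OF wvec_pw_a[OF M y(1), of "n - 1"]]]
  have "act M Gen_d * y' = 0" using n_gt_2 by (cases n) (auto simp: y'_def)
  then have hw: "hwvec M n t y'" using wy by (simp add: hwvec_def)
  have "pw (act M Gen_a) n y' = 0"
    using rmoduleD(7)[OF M] pw_mult[of "act M Gen_a" n "ide M" y'] wvecD(1)[OF wy] by simp
  from hw_hom[OF M hw this] n_gt_2 obtain g where g: "rhom (V n t) M g"
    "\<And>j. j < n \<Longrightarrow> g * munit j 0 = pw (act M Gen_a) j y'" by auto
  have "p * g = f"
  proof (rule hw_hom_eqI[OF hom_comp[OF g(1) repiD[OF p]] f])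
    show "p * g * munit 0 0 = ?v" using g(2)[of 0] n_gt_2 py by (simp add: mult.assoc)
  qed
  then show "\<exists>g. rhom (V n t) M g \<and> p * g = f" using g(1) by blast
qed

end

section \<open>Tensor products and their adjunction\<close>

lemma pw_tens: "pw (x \<otimes>\<^sub>k y) m (u \<otimes>\<^sub>k v) = pw x m u \<otimes>\<^sub>k pw y m v"
  by (induction m) simp_all

lemma pw_scaled: "pw (c *\<^sub>k x) m y = c ^ m *\<^sub>k pw x m y"
  by (induction m) simp_all

lemma fm_uminus: "- x = (- 1) *\<^sub>k (x :: 'k::field fm)"
  by (rule fm_eqI) simp

lemma pw_skew: "x * z = k *\<^sub>k (z * x) \<Longrightarrow> x * pw z m y = k ^ m *\<^sub>k pw z m (x * y)"
proof (induction m)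
  case (Suc m)
  have "x * pw z (Suc m) y = k *\<^sub>k (z * (x * pw z m y))"
    using mult_eq_assoc[OF Suc(2)] by (simp add: mult.assoc)
  then show ?case using Suc by simp
qed simp

text \<open>Used only to see that a power vanishes, so the scalar stays unspecified.\<close>

lemma pw_mult_skew:
  assumes "x * z = k *\<^sub>k (z * x)" shows "\<exists>\<kappa>. pw (x * z) m y = \<kappa> *\<^sub>k pw z m (pw x m y)"
proof (induction m)
  case 0
  show ?case by (intro exI[of _ 1]) simp
next
  case (Suc m)
  then obtain \<kappa> where "pw (x * z) m y = \<kappa> *\<^sub>k pw z m (pw x m y)" by blast
  then have "pw (x * z) (Suc m) y = \<kappa> *\<^sub>k (x * pw z (Suc m) (pw x m y))" by (simp add: mult.assoc)
  also have "\<dots> = (\<kappa> * k ^ Suc m) *\<^sub>k pw z (Suc m) (pw x (Suc m) y)"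
    by (subst pw_skew[OF assms]) simp
  finally show ?case by blast
qed

definition rtens :: "'k::field rmod \<Rightarrow> 'k rmod \<Rightarrow> 'k rmod" where
  "rtens M N = (ide M \<otimes>\<^sub>k ide N, \<lambda>g. case g of
     Gen_a \<Rightarrow> act M Gen_a \<otimes>\<^sub>k act N Gen_b + ide M \<otimes>\<^sub>k act N Gen_a
   | Gen_b \<Rightarrow> act M Gen_b \<otimes>\<^sub>k act N Gen_b
   | Gen_c \<Rightarrow> act M Gen_c \<otimes>\<^sub>k act N Gen_c
   | Gen_d \<Rightarrow> act M Gen_d \<otimes>\<^sub>k act N Gen_c + ide M \<otimes>\<^sub>k act N Gen_d)"

lemma rtens_simps [simp]:
  "ide (rtens M N) = ide M \<otimes>\<^sub>k ide N"
  "act (rtens M N) Gen_a = act M Gen_a \<otimes>\<^sub>k act N Gen_b + ide M \<otimes>\<^sub>k act N Gen_a"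
  "act (rtens M N) Gen_b = act M Gen_b \<otimes>\<^sub>k act N Gen_b"
  "act (rtens M N) Gen_c = act M Gen_c \<otimes>\<^sub>k act N Gen_c"
  "act (rtens M N) Gen_d = act M Gen_d \<otimes>\<^sub>k act N Gen_c + ide M \<otimes>\<^sub>k act N Gen_d"
  by (simp_all add: rtens_def)

lemma premodule_tens: "premodule M \<Longrightarrow> premodule N \<Longrightarrow> premodule (rtens M N)"
proof -
  assume m: "premodule M" "premodule N"
  note p = premoduleD[OF m(1)] premoduleD[OF m(2)]
  have "ide (rtens M N) * act (rtens M N) g = act (rtens M N) g \<and>
      act (rtens M N) g * ide (rtens M N) = act (rtens M N) g" for g
    by (cases g) (simp_all add: distrib_left distrib_right p)
  then show ?thesis by (simp add: premodule_def p)
qed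

lemma rhom_tens:
  assumes "rhom M M' f" "rhom N N' g" shows "rhom (rtens M N) (rtens M' N') (f \<otimes>\<^sub>k g)"
proof -
  note h = homD[OF assms(1)] homD[OF assms(2)]
  have "f \<otimes>\<^sub>k g * act (rtens M N) x = act (rtens M' N') x * (f \<otimes>\<^sub>k g)" for x
    by (cases x) (simp_all add: distrib_left distrib_right h)
  then show ?thesis by (simp add: rhom_def h)
qed

lemma riso_tens:
  assumes "riso M M'" "riso N N'" shows "riso (rtens M N) (rtens M' N')"
proof -
  obtain f f' where f: "rhom M M' f" "rhom M' M f'" "f' * f = ide M" "f * f' = ide M'"
    using assms(1) by (auto simp: riso_def)
  obtain g g' where g: "rhom N N' g" "rhom N' N g'" "g' * g = ide N" "g * g' = ide N'"
    using assms(2) by (auto simp: riso_def)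
  show ?thesis unfolding riso_def
    by (rule exI[of _ "f \<otimes>\<^sub>k g"], rule exI[of _ "f' \<otimes>\<^sub>k g'"]) (simp add: rhom_tens f g)
qed

text \<open>The full permutation matrix is not finitely supported, so it is restricted to the first
  \<open>K\<close> indices, on which \<open>M\<close> lives.\<close>

lemma riso_reindex:
  assumes M: "premodule M" and M': "premodule M'" and \<sigma>: "bij \<sigma>"
    and e: "\<And>i j. ent (ide M') (\<sigma> i) (\<sigma> j) = ent (ide M) i j"
    and a: "\<And>g i j. ent (act M' g) (\<sigma> i) (\<sigma> j) = ent (act M g) i j"
  shows "riso M M'"
proof -
  obtain K where K: "idm K * ide M = ide M" "ide M * idm K = ide M" by (rule idm_bound)
  note p = premoduleD[OF M] and p' = premoduleD[OF M']
  let ?S = "{..<K}"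
  define u where "u = (perm_fm \<sigma> ?S :: 'a fm)"
  have inj: "inj_on \<sigma> ?S" using \<sigma> by (simp add: bij_def inj_on_subset[OF _ subset_UNIV])
  have supp: "ent x i j = 0" if "ide M * x = x" "x * ide M = x" "i \<notin> ?S \<or> j \<notin> ?S" for x i j
  proof -
    have "idm K * x = x" using mult_eq_assoc[OF K(1), of x] that(1) by simp
    moreover have "x * (ide M * idm K) = x" using that(2) K(2) by simp
    then have "x * idm K = x" using that(2) by (simp add: mult.assoc[symmetric])
    ultimately show ?thesis using that(3) ent_idm_mult[of K x i j] ent_mult_idm[of x K i j] by auto
  qed
  have supp': "ent y k l = 0" if "\<And>i j. ent y (\<sigma> i) (\<sigma> j) = ent x i j" "ide M * x = x" "x * ide M = x"
    "k \<notin> \<sigma> ` ?S \<or> l \<notin> \<sigma> ` ?S" for x y k l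
  proof -
    obtain i j where ij: "k = \<sigma> i" "l = \<sigma> j" using \<sigma> by (metis bij_pointE)
    then have "i \<notin> ?S \<or> j \<notin> ?S" using that(4) by auto
    then show ?thesis using supp[OF that(2,3)] that(1) ij by simp
  qed
  have inter: "u * x = y * u" if "\<And>i j. ent y (\<sigma> i) (\<sigma> j) = ent x i j" "ide M * x = x" "x * ide M = x" for x y
    unfolding u_def
    by (rule perm_fm_intertwine[OF _ _ inj inj supp[OF that(2,3)] that(1) supp'[OF that]]) auto
  have ue: "u * ide M = ide M' * u" by (rule inter[OF e]) (simp_all add: p)
  have ua: "u * act M g = act M' g * u" for g by (rule inter[OF a]) (simp_all add: p)
  have uu: "tr u * u = idm K" unfolding u_def idm_def by (rule tr_perm_fm_mult[OF _ inj]) simp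
  have uu': "u * tr u * ide M' = ide M'"
  proof (rule fm_eqI)
    fix k l
    have "ent (u * tr u * ide M') k l = (\<Sum>i\<in>\<sigma> ` ?S. if i = k then ent (ide M') k l else 0)"
      unfolding u_def perm_fm_tr_mult[OF finite_lessThan inj] sum_distrib_right ent_sum
      by (rule sum.cong) (auto simp: ent_munit_mult)
    then show "ent (u * tr u * ide M') k l = ent (ide M') k l"
      using supp'[OF e p(1,1)] by (auto simp: sum.delta)
  qed
  have h1: "rhom M M' (u * ide M)"
    unfolding rhom_def by (simp add: mult.assoc p ua[symmetric] mult_eq_assoc[OF ue[symmetric]] p)
      (simp add: mult_eq_assoc[OF ua[symmetric]] mult.assoc p)
  obtain r where "r = ide M * tr u * ide M'" by simp
  have i1: "ide M * tr u * ide M' * (u * ide M) = ide M"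
    by (simp add: mult.assoc mult_eq_assoc[OF ue[symmetric]] p mult_eq_assoc[OF uu] K)
  have i2: "u * ide M * (ide M * tr u * ide M') = ide M'"
  proof -
    have "u * ide M * (ide M * tr u * ide M') = u * ide M * (tr u * ide M')" by (simp add: mult.assoc p)
    also have "\<dots> = ide M' * (u * tr u * ide M')" by (simp only: ue mult.assoc)
    also have "\<dots> = ide M'" by (simp only: uu' p')
    finally show ?thesis .
  qed
  have mono: "rmono M M' (u * ide M)" by (rule rmonoI_inverse[OF h1 i1])
  have "repi M M' (u * ide M)" unfolding repi_def
    using h1 i2 by (intro conjI exI[of _ "ide M * tr u * ide M'"]) (simp_all add: mult.assoc p)
  then show ?thesis by (rule mono_epi_iso[OF M M' mono])
qed

definition tens_assoc :: "nat \<Rightarrow> nat" where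
  "tens_assoc i = (case prod_decode i of (u, k) \<Rightarrow> case prod_decode u of (x, y) \<Rightarrow> prod_encode (x, prod_encode (y, k)))"

lemma bij_tens_assoc: "bij tens_assoc"
proof (rule o_bij)
  define \<tau> where "\<tau> i = (case prod_decode i of (x, u) \<Rightarrow> case prod_decode u of (y, k) \<Rightarrow> prod_encode (prod_encode (x, y), k))" for i
  have split: "\<exists>x y. i = prod_encode (x, y)" for i by (metis prod_decode_inverse surj_pair)
  show "\<tau> \<circ> tens_assoc = id"
  proof
    fix i
    obtain u k where u: "i = prod_encode (u, k)" using split by blast
    obtain x y where x: "u = prod_encode (x, y)" using split by blast
    show "(\<tau> \<circ> tens_assoc) i = id i" by (simp add: u x \<tau>_def tens_assoc_def)
  qed
  show "tens_assoc \<circ> \<tau> = id"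
  proof
    fix i
    obtain u k where u: "i = prod_encode (k, u)" using split by blast
    obtain x y where x: "u = prod_encode (x, y)" using split by blast
    show "(tens_assoc \<circ> \<tau>) i = id i" by (simp add: u x \<tau>_def tens_assoc_def)
  qed
qed

lemma ent_tens_assoc: "ent (x \<otimes>\<^sub>k (y \<otimes>\<^sub>k z)) (tens_assoc i) (tens_assoc j) = ent (x \<otimes>\<^sub>k y \<otimes>\<^sub>k z) i j"
  by (simp add: ent_tens tens_assoc_def case_prod_unfold mult.assoc)

lemma rtens_assoc:
  assumes "premodule M" "premodule N" "premodule L"
  shows "riso (rtens (rtens M N) L) (rtens M (rtens N L))"
proof (rule riso_reindex[OF _ _ bij_tens_assoc])
  fix g i j
  show "ent (act (rtens M (rtens N L)) g) (tens_assoc i) (tens_assoc j) = ent (act (rtens (rtens M N) L) g) i j"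
    by (cases g) (simp_all add: tens_add_left tens_add_right ent_tens_assoc)
qed (use assms in \<open>simp_all add: premodule_tens ent_tens_assoc\<close>)

context taft_double
begin

section \<open>Gaussian binomials and the relations on tensor products\<close>

fun qbinom :: "nat \<Rightarrow> nat \<Rightarrow> 'k" where
  "qbinom m 0 = 1"
| "qbinom 0 (Suc j) = 0"
| "qbinom (Suc m) (Suc j) = q ^ Suc j * qbinom m (Suc j) + qbinom m j"

lemma qbinom_gt: "m < j \<Longrightarrow> qbinom m j = 0"
proof (induction m arbitrary: j)
  case 0
  then show ?case by (cases j) auto
next
  case (Suc m)
  then show ?case by (cases j) auto
qed

lemma qint_add: "qint (i + j) = qint i + q ^ i * qint j"
  by (induction j) (simp_all add: qint_Suc power_add algebra_simps)

text \<open>The factorial formula for Gaussian binomials with denominators cleared, so that it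
  remains valid when a q-factorial is 0.\<close>

lemma qbinom_fact:
  "j \<le> m \<Longrightarrow> qbinom m j * (\<Prod>i<j. qint (Suc i)) * (\<Prod>i<m - j. qint (Suc i)) = (\<Prod>i<m. qint (Suc i))"
proof (induction m arbitrary: j)
  case (Suc m)
  let ?f = "\<lambda>j. \<Prod>i<j. qint (Suc i)"
  show ?case
  proof (cases j)
    case (Suc l)
    show ?thesis
    proof (cases "Suc l \<le> m")
      case True
      have 1: "qbinom m (Suc l) * ?f (Suc l) * ?f (m - Suc l) = ?f m" by (rule Suc.IH[OF True])
      have 2: "qbinom m l * ?f l * ?f (m - l) = ?f m" by (rule Suc.IH) (use True in simp)
      have ml: "?f (m - l) = qint (m - l) * ?f (m - Suc l)"
      proof -
        have "m - l = Suc (m - Suc l)" using True by simp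
        then show ?thesis by (simp add: mult.commute)
      qed
      have "qbinom (Suc m) (Suc l) * ?f (Suc l) * ?f (m - l)
          = q ^ Suc l * qint (m - l) * (qbinom m (Suc l) * ?f (Suc l) * ?f (m - Suc l))
            + qint (Suc l) * (qbinom m l * ?f l * ?f (m - l))"
        unfolding qbinom.simps distrib_right by (simp add: ml algebra_simps)
      also have "\<dots> = ?f m * (qint (Suc l) + q ^ Suc l * qint (m - l))"
        unfolding 1 2 by (simp add: algebra_simps)
      also have "\<dots> = ?f (Suc m)"
        unfolding qint_add[symmetric] using True by simp
      finally show ?thesis using Suc by simp
    next
      case False
      then have l: "l = m" using Suc Suc.prems by simp
      have "qbinom m m * ?f m * ?f (m - m) = ?f m" by (rule Suc.IH) simp
      then have "qbinom m m * ?f m = ?f m" by simp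
      then have "qbinom m m * (?f m * qint (Suc m)) = ?f m * qint (Suc m)" by (simp only: mult.assoc[symmetric])
      moreover have "qbinom (Suc m) (Suc m) = qbinom m m" by (simp add: qbinom_gt)
      ultimately show ?thesis using Suc l by (simp only: prod.lessThan_Suc diff_self_eq_0 lessThan_0 prod.empty mult_1_right)
    qed
  qed simp
qed simp

text \<open>The q-factorial of n is 0, while those of j and n - j are not.\<close>

lemma qbinom_n: "0 < j \<Longrightarrow> j < n \<Longrightarrow> qbinom n j = 0"
proof -
  assume j: "0 < j" "j < n"
  have a: "(\<Prod>i<n. qint (Suc i)) = 0"
    using n_gt_2 by (intro prod_zero) (auto intro!: bexI[of _ "n - 1"])
  have nz: "(\<Prod>i<k. qint (Suc i)) \<noteq> 0" if "k < n" for k using that qint_nz by auto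
  have "n - j < n" using j by simp
  note z = nz[OF j(2)] nz[OF this]
  show ?thesis using qbinom_fact[of j n] j(2) z unfolding a by (simp del: prod_zero_iff)
qed

lemma qbinom_expand:
  assumes "X * Y = q *\<^sub>k (Y * X)"
  shows "pw (X + Y) m e = (\<Sum>j\<le>m. qbinom m j *\<^sub>k pw Y j (pw X (m - j) e))"
proof (induction m)
  case (Suc m)
  let ?T = "\<lambda>m j. pw Y j (pw X (m - j) e)"
  have X: "X * ?T m j = q ^ j *\<^sub>k ?T (Suc m) j" if "j \<le> m" for j
    using that by (simp add: pw_skew[OF assms] Suc_diff_le)
  have "pw (X + Y) (Suc m) e = (\<Sum>j\<le>m. qbinom m j *\<^sub>k (X * ?T m j)) + (\<Sum>j\<le>m. qbinom m j *\<^sub>k (Y * ?T m j))"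
    by (simp add: Suc distrib_right sum_distrib_left fm.scale_right_distrib sum.distrib)
  also have "(\<Sum>j\<le>m. qbinom m j *\<^sub>k (X * ?T m j)) = (\<Sum>j\<le>m. (q ^ j * qbinom m j) *\<^sub>k ?T (Suc m) j)"
    by (rule sum.cong) (auto simp: X mult.commute)
  also have "\<dots> = (\<Sum>j\<le>Suc m. (q ^ j * qbinom m j) *\<^sub>k ?T (Suc m) j)"
    by (simp add: qbinom_gt)
  also have "\<dots> = ?T (Suc m) 0 + (\<Sum>j\<le>m. (q ^ Suc j * qbinom m (Suc j)) *\<^sub>k ?T (Suc m) (Suc j))"
    by (subst sum.atMost_Suc_shift) simp
  also have "(\<Sum>j\<le>m. qbinom m j *\<^sub>k (Y * ?T m j)) = (\<Sum>j\<le>m. qbinom m j *\<^sub>k ?T (Suc m) (Suc j))"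
    by simp
  finally have "pw (X + Y) (Suc m) e = ?T (Suc m) 0 + (\<Sum>j\<le>m. qbinom (Suc m) (Suc j) *\<^sub>k ?T (Suc m) (Suc j))"
    by (simp only: add.assoc sum.distrib[symmetric] qbinom.simps fm.scale_left_distrib)
  also have "\<dots> = (\<Sum>j\<le>Suc m. qbinom (Suc m) j *\<^sub>k ?T (Suc m) j)"
    by (subst sum.atMost_Suc_shift) simp
  finally show ?case .
qed simp

text \<open>In the q-binomial theorem only the two extreme terms survive for the exponent n. The two
  summands of the coproduct of \<open>a\<close>, and of \<open>d\<close>, commute up to q, so this
  gives their nilpotency on tensor products.\<close>

lemma qbinom_nilpotent:
  assumes "X * Y = q *\<^sub>k (Y * X)" "pw X n e = 0" "pw Y n e = 0"
  shows "pw (X + Y) n e = 0"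
  unfolding qbinom_expand[OF assms(1)]
proof (rule sum.neutral, rule ballI)
  fix j assume "j \<in> {..n}"
  then consider "j = 0" | "j = n" | "0 < j" "j < n" by fastforce
  then show "qbinom n j *\<^sub>k pw Y j (pw X (n - j) e) = 0"
    by cases (use assms qbinom_n in auto)
qed

lemma rmodule_tens:
  assumes "rmodule M" "rmodule N" shows "rmodule (rtens M N)"
proof -
  note r1 = rmoduleD[OF assms(1)] and r2 = rmoduleD[OF assms(2)]
  note p = premoduleD[OF r1(1)] premoduleD[OF r2(1)]
  have da1: "act M Gen_d * act M Gen_a = q *\<^sub>k (act M Gen_a * act M Gen_d) + (ide M - act M Gen_c * act M Gen_b)"
    using r1(11) r1(6) by (simp add: algebra_simps)
  have da2: "act N Gen_d * act N Gen_a = q *\<^sub>k (act N Gen_a * act N Gen_d) + (ide N - act N Gen_c * act N Gen_b)"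
    using r2(11) r2(6) by (simp add: algebra_simps)
  have ie: "pw (ide M) m (ide M) = ide M" for m by (induction m) (simp_all add: p)
  show ?thesis
  proof (rule rmoduleI[OF premodule_tens[OF r1(1) r2(1)]])
    show "pw (act (rtens M N) Gen_a) n (ide (rtens M N)) = 0"
      unfolding rtens_simps
      by (rule qbinom_nilpotent) (simp_all add: p r2 pw_tens r1(7))
    \<comment> \<open>The two summands for \<open>d\<close> commute up to q in the opposite order to
      those for \<open>a\<close>, hence the exchange.\<close>
    show "pw (act (rtens M N) Gen_d) n (ide (rtens M N)) = 0"
      unfolding rtens_simps
      by (subst add.commute, rule qbinom_nilpotent) (simp_all add: p r2 pw_tens r1(10))
    show "act (rtens M N) Gen_d * act (rtens M N) Gen_a - q *\<^sub>k (act (rtens M N) Gen_a * act (rtens M N) Gen_d)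
      = ide (rtens M N) - act (rtens M N) Gen_b * act (rtens M N) Gen_c"
      by (simp add: distrib_left distrib_right p da1 da2 r1(2-6) r2(2-6) tens_add_left tens_add_right
          tens_diff_left tens_diff_right fm.scale_right_distrib)
  qed (simp_all add: distrib_left distrib_right p r1 r2 fm.scale_right_distrib pw_tens)
qed

text \<open>The antipode dual, chosen such that \<open>X \<otimes> ldual W\<close> is the internal hom of linear maps from
  \<open>W\<close> to \<open>X\<close>.\<close>

definition binv :: "'k rmod \<Rightarrow> 'k fm" where "binv M = pw (act M Gen_b) (n - 1) (ide M)"
definition cinv :: "'k rmod \<Rightarrow> 'k fm" where "cinv M = pw (act M Gen_c) (n - 1) (ide M)"

definition ldual :: "'k rmod \<Rightarrow> 'k rmod" where
  "ldual M = (tr (ide M), \<lambda>g. case g of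
     Gen_a \<Rightarrow> - tr (act M Gen_a * binv M) | Gen_b \<Rightarrow> tr (binv M)
   | Gen_c \<Rightarrow> tr (cinv M) | Gen_d \<Rightarrow> - tr (act M Gen_d * cinv M))"

lemma ldual_simps [simp]:
  "ide (ldual M) = tr (ide M)" "act (ldual M) Gen_a = - tr (act M Gen_a * binv M)"
  "act (ldual M) Gen_b = tr (binv M)" "act (ldual M) Gen_c = tr (cinv M)"
  "act (ldual M) Gen_d = - tr (act M Gen_d * cinv M)"
  by (simp_all add: ldual_def)

lemma inv_facts:
  assumes "rmodule M"
  shows "act M Gen_b * binv M = ide M" "binv M * act M Gen_b = ide M"
    "act M Gen_c * cinv M = ide M" "cinv M * act M Gen_c = ide M"
    "ide M * binv M = binv M" "binv M * ide M = binv M" "ide M * cinv M = cinv M" "cinv M * ide M = cinv M"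
proof -
  note r = rmoduleD[OF assms] and p = premoduleD[OF rmoduleD(1)[OF assms]]
  have n: "n = Suc (n - 1)" using n_gt_2 by simp
  show "act M Gen_b * binv M = ide M" using r(8) n by (metis binv_def pw.simps(2))
  show "act M Gen_c * cinv M = ide M" using r(9) n by (metis cinv_def pw.simps(2))
  have "pw x m (ide M) * x = x * pw x m (ide M)" if "x * ide M = x" "ide M * x = x" for x m
    using that pw_Suc'[of x m "ide M"] by (simp add: pw_mult)
  then show "binv M * act M Gen_b = ide M" "cinv M * act M Gen_c = ide M"
    using \<open>act M Gen_b * binv M = ide M\<close> \<open>act M Gen_c * cinv M = ide M\<close> p by (simp_all add: binv_def cinv_def)
  show "ide M * binv M = binv M" "ide M * cinv M = cinv M"
    unfolding binv_def cinv_def by (rule pw_closed; simp add: p)+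
  show "binv M * ide M = binv M" "cinv M * ide M = cinv M"
    by (simp_all add: binv_def cinv_def pw_mult p)
qed

lemma inv_comm:
  assumes "rmodule M"
  shows "act M Gen_a * binv M = q *\<^sub>k (binv M * act M Gen_a)"
    "binv M * act M Gen_d = q *\<^sub>k (act M Gen_d * binv M)"
    "act M Gen_a * cinv M = q *\<^sub>k (cinv M * act M Gen_a)"
    "cinv M * act M Gen_d = q *\<^sub>k (act M Gen_d * cinv M)"
    "binv M * cinv M = cinv M * binv M"
proof -
  note r = rmoduleD[OF assms] and p = premoduleD[OF rmoduleD(1)[OF assms]] and i = inv_facts[OF assms]
  note ie = i[THEN mult_eq_assoc] and re = r(2-6)[THEN mult_eq_assoc]
  show "act M Gen_a * binv M = q *\<^sub>k (binv M * act M Gen_a)"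
  proof -
    have "binv M * (act M Gen_b * (act M Gen_a * binv M)) = q *\<^sub>k (binv M * (act M Gen_a * (act M Gen_b * binv M)))"
      by (simp only: re(1) smul_mult mult_smul mult.assoc)
    then show ?thesis by (simp add: i ie p)
  qed
  show "act M Gen_a * cinv M = q *\<^sub>k (cinv M * act M Gen_a)"
  proof -
    have "cinv M * (act M Gen_c * (act M Gen_a * cinv M)) = q *\<^sub>k (cinv M * (act M Gen_a * (act M Gen_c * cinv M)))"
      by (simp only: re(3) smul_mult mult_smul mult.assoc)
    then show ?thesis by (simp add: i ie p)
  qed
  show "binv M * act M Gen_d = q *\<^sub>k (act M Gen_d * binv M)"
  proof -
    have "binv M * (act M Gen_d * (act M Gen_b * binv M)) = q *\<^sub>k (binv M * (act M Gen_b * (act M Gen_d * binv M)))"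
      by (simp only: re(2) smul_mult mult_smul mult.assoc)
    then show ?thesis by (simp add: i ie p)
  qed
  show "cinv M * act M Gen_d = q *\<^sub>k (act M Gen_d * cinv M)"
  proof -
    have "cinv M * (act M Gen_d * (act M Gen_c * cinv M)) = q *\<^sub>k (cinv M * (act M Gen_c * (act M Gen_d * cinv M)))"
      by (simp only: re(4) smul_mult mult_smul mult.assoc)
    then show ?thesis by (simp add: i ie p)
  qed
  have "binv M * act M Gen_c = act M Gen_c * binv M"
    unfolding binv_def pw_mult using pw_comm[OF r(6), of "n - 1" "ide M"] by (simp add: p)
  then have "binv M * (act M Gen_c * cinv M) = act M Gen_c * (binv M * cinv M)" by (simp only: mult.assoc[symmetric])
  then have "cinv M * (binv M * (act M Gen_c * cinv M)) = cinv M * (act M Gen_c * (binv M * cinv M))" by simp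
  then show "binv M * cinv M = cinv M * binv M" by (simp add: i ie p)
qed

text \<open>Transposition and the antipode both reverse products, so the relations come back in
  their original order. For the nilpotent generators the inverse of \<open>b\<close> or
  \<open>c\<close> is moved aside by \<open>pw_mult_skew\<close>.\<close>

lemma rmodule_ldual:
  assumes "rmodule M" shows "rmodule (ldual M)"
proof -
  note r = rmoduleD[OF assms] and p = premoduleD[OF rmoduleD(1)[OF assms]] and i = inv_facts[OF assms]
    and c = inv_comm[OF assms]
  note ie = i[THEN mult_eq_assoc] and re = r(2-6)[THEN mult_eq_assoc] and ce = c[THEN mult_eq_assoc]
  have t: "tr x * tr y = tr (y * x)" for x y :: "'k fm" by simp
  have pinv: "pw z n (ide M) = ide M"
    if "x * z = ide M" "pw x n (ide M) = ide M" "ide M * z = z" for x z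
  proof -
    have "pw x m (pw z m (ide M)) = ide M" for m
    proof (induction m)
      case (Suc m)
      have "pw x (Suc m) (pw z (Suc m) (ide M)) = pw x m (x * pw z (Suc m) (ide M))" by (rule pw_Suc')
      also have "\<dots> = pw x m (x * (z * pw z m (ide M)))" by (simp only: pw.simps)
      also have "\<dots> = pw x m (ide M * pw z m (ide M))" by (simp add: mult_eq_assoc[OF that(1)])
      also have "ide M * pw z m (ide M) = pw z m (ide M)" by (rule pw_closed[OF that(3)]) (simp add: p)
      finally show ?case using Suc by simp
    qed simp
    moreover have "pw x n (pw z n (ide M)) = pw x n (ide M) * pw z n (ide M)"
      by (simp add: pw_mult pw_closed[OF that(3) p(1)])
    ultimately show ?thesis using that(2) pw_closed[OF that(3) p(1), of n] by simp
  qed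
  have nil: "pw (- tr (x * z)) n (tr (ide M)) = 0"
    if "x * z = k *\<^sub>k (z * x)" "pw x n (ide M) = 0" "ide M * x = x" "z * ide M = z" for x z k
  proof -
    note sk = pw_mult_skew[OF that(1), of n "ide M"]
    obtain \<kappa> where "pw (x * z) n (ide M) = \<kappa> *\<^sub>k pw z n (pw x n (ide M))"
      using sk by blast
    then have "pw (x * z) n (ide M) = 0" using that(2) by simp
    moreover have "tr (pw (x * z) n (ide M)) = pw (tr (x * z)) n (tr (ide M))"
      by (rule pw_tr) (simp_all only: mult.assoc that(4), simp add: mult.assoc[symmetric] that(3))
    ultimately show ?thesis unfolding fm_uminus pw_scaled by simp
  qed
  have dz: "act M Gen_d * cinv M = inverse q *\<^sub>k (cinv M * act M Gen_d)" using q_nz by (simp add: c(4))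
  have "ide (ldual M) * act (ldual M) g = act (ldual M) g \<and> act (ldual M) g * ide (ldual M) = act (ldual M) g" for g
    by (cases g) (simp_all del: tr_mult add: t mult.assoc i p)
  then have pre: "premodule (ldual M)" by (simp add: premodule_def p flip: tr_mult)
  show ?thesis
  proof (rule rmoduleI[OF pre])
    show "pw (act (ldual M) Gen_b) n (ide (ldual M)) = ide (ldual M)"
      using pw_tr[OF i(5,6), of n] pinv[OF i(1) r(8) i(5)] by simp
    show "pw (act (ldual M) Gen_c) n (ide (ldual M)) = ide (ldual M)"
      using pw_tr[OF i(7,8), of n] pinv[OF i(3) r(9) i(7)] by simp
    show "pw (act (ldual M) Gen_a) n (ide (ldual M)) = 0"
      unfolding ldual_simps by (rule nil[OF c(1) r(7)]) (simp_all add: p i)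
    show "pw (act (ldual M) Gen_d) n (ide (ldual M)) = 0"
      unfolding ldual_simps by (rule nil[OF dz r(10)]) (simp_all add: p i)
    have bc: "act M Gen_b * (act M Gen_c * (binv M * cinv M)) = ide M"
      by (simp add: c(5) ie i)
    have "act (ldual M) Gen_d * act (ldual M) Gen_a - q *\<^sub>k (act (ldual M) Gen_a * act (ldual M) Gen_d)
      = tr (act M Gen_a * binv M * (act M Gen_d * cinv M) - q *\<^sub>k (act M Gen_d * cinv M * (act M Gen_a * binv M)))"
      by simp
    also have "act M Gen_a * binv M * (act M Gen_d * cinv M) = q *\<^sub>k (act M Gen_a * act M Gen_d * (binv M * cinv M))"
      by (simp add: mult.assoc ce(2))
    also have "q *\<^sub>k (act M Gen_d * cinv M * (act M Gen_a * binv M)) = act M Gen_d * act M Gen_a * (binv M * cinv M)"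
    proof -
      have "q *\<^sub>k (cinv M * (act M Gen_a * binv M)) = act M Gen_a * (cinv M * binv M)"
        by (simp add: ce(3) mult.assoc)
      then have "act M Gen_d * (q *\<^sub>k (cinv M * (act M Gen_a * binv M))) = act M Gen_d * (act M Gen_a * (cinv M * binv M))"
        by simp
      then show ?thesis by (simp add: mult.assoc c(5))
    qed
    also have "q *\<^sub>k (act M Gen_a * act M Gen_d * (binv M * cinv M)) - act M Gen_d * act M Gen_a * (binv M * cinv M)
        = - ((act M Gen_d * act M Gen_a - q *\<^sub>k (act M Gen_a * act M Gen_d)) * (binv M * cinv M))"
      by (simp add: left_diff_distrib)
    also have "\<dots> = ide M - binv M * cinv M"
      unfolding r(11) by (simp add: left_diff_distrib mult.assoc bc i ie)
    finally show "act (ldual M) Gen_d * act (ldual M) Gen_a - q *\<^sub>k (act (ldual M) Gen_a * act (ldual M) Gen_d)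
      = ide (ldual M) - act (ldual M) Gen_b * act (ldual M) Gen_c" by (simp add: c(5))
  qed (simp_all del: tr_mult add: t mult.assoc c ce)
qed

lemma rhom_ldual:
  assumes "rhom M N f" shows "rhom (ldual N) (ldual M) (tr f)"
proof -
  note h = homD[OF assms]
  have t: "tr x * tr y = tr (y * x)" for x y :: "'k fm" by simp
  have b: "f * binv M = binv N * f" "f * cinv M = cinv N * f"
    by (simp_all add: binv_def cinv_def pw_mult pw_intertwine[OF h(3)] h)
  have ab: "f * (act M g * binv M) = act N g * (binv N * f)" "f * (act M g * cinv M) = act N g * (cinv N * f)" for g
    by (simp_all only: h(6) b)
  have "tr f * act (ldual N) g = act (ldual M) g * tr f" for g
    by (cases g) (simp_all del: tr_mult add: t mult.assoc ab b)
  then show ?thesis by (simp del: tr_mult add: rhom_def t h)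
qed

lemma rses_ldual:
  assumes "rses A B C i p" shows "rses (ldual C) (ldual B) (ldual A) (tr p) (tr i)"
  using assms by (intro rses_tr[OF assms] rmodule_ldual rhom_ldual) (auto simp: rses_def dest: rmonoD repiD)

text \<open>Over a field the sequence splits linearly: \<open>ide B = i * y + r * p\<close> for some
  matrices \<open>r\<close> and \<open>y\<close>. This splitting can be tensored with
  \<open>ide X\<close>.\<close>

lemma rses_tens:
  assumes X: "rmodule X" and s: "rses A B C i p"
  shows "rses (rtens X A) (rtens X B) (rtens X C) (ide X \<otimes>\<^sub>k i) (ide X \<otimes>\<^sub>k p)"
  unfolding rses_def
proof (intro conjI allI impI)
  from s have m: "rmodule A" "rmodule B" "rmodule C" and i: "rmono A B i" and p: "repi B C p" and pi: "p * i = 0"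
    and ex: "\<And>x. ide B * x = x \<Longrightarrow> p * x = 0 \<Longrightarrow> (\<exists>y. ide A * y = y \<and> i * y = x)"
    by (auto simp: rses_def)
  note hX = hom_ide[OF rmoduleD(1)[OF X]] and pX = premoduleD[OF rmoduleD(1)[OF X]]
    and pB = premoduleD[OF rmoduleD(1)[OF m(2)]]
  show "rmodule (rtens X A)" "rmodule (rtens X B)" "rmodule (rtens X C)" using X m by (auto intro: rmodule_tens)
  obtain l where l: "l * i = ide A" by (rule rmono_left_inverse[OF i rmoduleD(1)[OF m(1)]])
  show "rmono (rtens X A) (rtens X B) (ide X \<otimes>\<^sub>k i)"
    by (rule rmonoI_inverse[OF rhom_tens[OF hX rmonoD[OF i]], of "ide X \<otimes>\<^sub>k l"]) (simp add: l pX)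
  obtain r where r: "ide B * r = r" "p * r = ide C" using p by (rule repiE)
  show "repi (rtens X B) (rtens X C) (ide X \<otimes>\<^sub>k p)"
    unfolding repi_def using rhom_tens[OF hX repiD[OF p]]
    by (intro conjI exI[of _ "ide X \<otimes>\<^sub>k r"]) (simp_all add: r pX)
  show "(ide X \<otimes>\<^sub>k p) * (ide X \<otimes>\<^sub>k i) = 0" by (simp add: pi)
  note hp = homD[OF repiD[OF p]]
  have "ide B * (ide B - r * p) = ide B - r * p" "p * (ide B - r * p) = 0"
    using r by (simp_all add: right_diff_distrib mult.assoc[symmetric] pB(1) hp(1,2))
  from ex[OF this] obtain y where y: "ide A * y = y" "i * y = ide B - r * p" by auto
  fix x assume x: "ide (rtens X B) * x = x" "(ide X \<otimes>\<^sub>k p) * x = 0"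
  have "(ide X \<otimes>\<^sub>k (ide B - r * p)) * x = (ide X \<otimes>\<^sub>k ide B) * x - (ide X \<otimes>\<^sub>k r) * ((ide X \<otimes>\<^sub>k p) * x)"
    by (simp add: tens_diff_right left_diff_distrib pX mult.assoc[symmetric])
  also have "\<dots> = x" using x by simp
  finally have "(ide X \<otimes>\<^sub>k i) * ((ide X \<otimes>\<^sub>k y) * x) = x" by (simp add: mult.assoc[symmetric] y pX)
  moreover have "ide (rtens X A) * ((ide X \<otimes>\<^sub>k y) * x) = (ide X \<otimes>\<^sub>k y) * x"
    by (simp add: mult.assoc[symmetric] y pX)
  ultimately show "\<exists>y. ide (rtens X A) * y = y \<and> (ide X \<otimes>\<^sub>k i) * y = x" by blast
qed

section \<open>The adjunction between tensoring with a module and with its dual\<close>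

lemma curry_corner:
  assumes "e * f * (u \<otimes>\<^sub>k v) = f" "u * u = u" "e * e = e" "v * v = v"
  shows "(e \<otimes>\<^sub>k tr v) * curry_fm f = curry_fm f" "curry_fm f * u = curry_fm f"
proof -
  have F: "curry_fm f = (e \<otimes>\<^sub>k tr v) * curry_fm f * u" using curry_mult[of e f u v] assms(1) by simp
  have vv: "tr v * tr v = tr v" using assms(4) by (simp flip: tr_mult)
  show "curry_fm f * u = curry_fm f" by (subst (1) F, subst (2) F) (simp add: mult.assoc assms(2))
  show "(e \<otimes>\<^sub>k tr v) * curry_fm f = curry_fm f"
    by (subst (1) F, subst (2) F) (simp add: mult.assoc[symmetric] assms(3) vv)
qed

text \<open>The relation expressing that \<open>f\<close> intertwines is multiplied by
  \<open>ide P \<otimes>\<^sub>k z\<close>, with \<open>z\<close> the inverse of the group-like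
  element in the coproduct. This isolates the action on \<open>P\<close>, and currying turns the
  other terms into the antipode action. Fact \<open>B\<close> treats \<open>b\<close> and
  \<open>c\<close>, fact \<open>A\<close> treats \<open>a\<close> and \<open>d\<close>.\<close>

lemma curry_hom:
  assumes P: "rmodule P" and W: "rmodule W" and X: "rmodule X" and f: "rhom (rtens P W) X f"
  shows "rhom P (rtens X (ldual W)) (curry_fm f)"
proof -
  note pP = premoduleD[OF rmoduleD(1)[OF P]] and pW = premoduleD[OF rmoduleD(1)[OF W]]
    and pX = premoduleD[OF rmoduleD(1)[OF X]] and i = inv_facts[OF W] and h = homD[OF f]
  let ?F = "curry_fm f"
  have cf: "ide X * f * (ide P \<otimes>\<^sub>k ide W) = f" using h(1,2) by simp
  note c = curry_corner[OF cf pP(1) pX(1) pW(1)]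
  have cm: "curry_fm (g * f * (u \<otimes>\<^sub>k v)) = (g \<otimes>\<^sub>k tr v) * (?F * u)" for g u v
    by (subst curry_mult) (rule mult.assoc)
  have cm1: "curry_fm (f * (u \<otimes>\<^sub>k v)) = (ide X \<otimes>\<^sub>k tr v) * (?F * u)" for u v
    using cm[of "ide X" u v] h(2) by simp
  have cF: "(ide X \<otimes>\<^sub>k tr (ide W)) * (?F * u) = ?F * u" for u by (rule mult_eq_assoc[OF c(1)])
  have B: "?F * act P g = (act X g \<otimes>\<^sub>k tr z) * ?F"
    if "act (rtens P W) g = act P g \<otimes>\<^sub>k act W g" "act W g * z = ide W" for g z
  proof -
    have "(act X g \<otimes>\<^sub>k tr z) * ?F = curry_fm (act X g * f * (ide P \<otimes>\<^sub>k z))" by (simp add: cm c)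
    also have "act X g * f * (ide P \<otimes>\<^sub>k z) = f * (act P g \<otimes>\<^sub>k ide W)"
      unfolding h(3)[symmetric] that(1) by (simp add: mult.assoc pP that(2))
    finally show ?thesis by (simp add: cm1 cF)
  qed
  have A: "?F * act P g = (act X g \<otimes>\<^sub>k tr z - ide X \<otimes>\<^sub>k tr (act W g * z)) * ?F"
    if "act (rtens P W) g = act P g \<otimes>\<^sub>k act W g' + ide P \<otimes>\<^sub>k act W g" "act W g' * z = ide W" for g g' z
  proof -
    have "(act X g \<otimes>\<^sub>k tr z) * ?F = curry_fm (act X g * f * (ide P \<otimes>\<^sub>k z))" by (simp add: cm c)
    also have "act X g * f * (ide P \<otimes>\<^sub>k z) = f * (act P g \<otimes>\<^sub>k ide W) + f * (ide P \<otimes>\<^sub>k (act W g * z))"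
      unfolding h(3)[symmetric] that(1) by (simp add: mult.assoc pP that(2) distrib_right distrib_left)
    finally show ?thesis by (simp add: curry_add cm1 cF c left_diff_distrib del: tr_mult)
  qed
  have "?F * act P g = act (rtens X (ldual W)) g * ?F" for g
  proof (cases g)
    case Gen_a
    with A[of Gen_a Gen_b "binv W"] i show ?thesis by (simp del: tr_mult)
  next
    case Gen_b
    with B[of Gen_b "binv W"] i show ?thesis by simp
  next
    case Gen_c
    with B[of Gen_c "cinv W"] i show ?thesis by simp
  next
    case Gen_d
    with A[of Gen_d Gen_c "cinv W"] i show ?thesis by (simp del: tr_mult)
  qed
  then show ?thesis using c by (simp add: rhom_def)
qed

lemma curry_inj: "curry_fm x = curry_fm y \<Longrightarrow> x = y"
proof -
  assume h: "curry_fm x = curry_fm y"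
  have "uncurry_fm (curry_fm x) = uncurry_fm (curry_fm y)" by (simp only: h)
  then show ?thesis by (simp only: uncurry_curry)
qed

text \<open>The computation of \<open>curry_hom\<close> backwards: injectivity of currying recovers
  equations for \<open>f\<close>, which are then multiplied by the group-like element to undo its
  inverse.\<close>

lemma uncurry_hom:
  assumes P: "rmodule P" and W: "rmodule W" and X: "rmodule X" and F: "rhom P (rtens X (ldual W)) (curry_fm f)"
  shows "rhom (rtens P W) X f"
proof -
  note pP = premoduleD[OF rmoduleD(1)[OF P]] and pW = premoduleD[OF rmoduleD(1)[OF W]]
    and pX = premoduleD[OF rmoduleD(1)[OF X]] and i = inv_facts[OF W] and h = homD[OF F]
  let ?F = "curry_fm f"
  have "curry_fm (ide X * f * (ide P \<otimes>\<^sub>k ide W)) = ?F"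
    unfolding curry_mult using h(1,2) by simp
  then have cf: "ide X * f * (ide P \<otimes>\<^sub>k ide W) = f" by (rule curry_inj)
  have f2: "ide X * f = f" by (subst (1) cf[symmetric], subst (2) cf[symmetric]) (simp add: mult.assoc[symmetric] pX)
  have f1: "f * (ide P \<otimes>\<^sub>k ide W) = f" using cf f2 by simp
  have cm: "curry_fm (g * f * (u \<otimes>\<^sub>k v)) = (g \<otimes>\<^sub>k tr v) * (?F * u)" for g u v
    by (subst curry_mult) (rule mult.assoc)
  have cm1: "curry_fm (f * (u \<otimes>\<^sub>k v)) = (ide X \<otimes>\<^sub>k tr v) * (?F * u)" for u v
    using cm[of "ide X" u v] f2 by simp
  have cF: "(ide X \<otimes>\<^sub>k tr (ide W)) * (?F * u) = ?F * u" for u using h(5) by simp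
  have B: "f * (act P g \<otimes>\<^sub>k act W g) = act X g * f"
    if "act (rtens X (ldual W)) g = act X g \<otimes>\<^sub>k tr z" "z * act W g = ide W" "z * ide W = z" for g z
  proof -
    have "curry_fm (f * (act P g \<otimes>\<^sub>k ide W)) = ?F * act P g" by (simp add: cm1 cF)
    also have "\<dots> = curry_fm (act X g * f * (ide P \<otimes>\<^sub>k z))" unfolding h(3) that(1) by (simp add: cm h)
    finally have "f * (act P g \<otimes>\<^sub>k ide W) = act X g * f * (ide P \<otimes>\<^sub>k z)" by (rule curry_inj)
    then have "f * (act P g \<otimes>\<^sub>k ide W) * (ide P \<otimes>\<^sub>k act W g) = act X g * f * (ide P \<otimes>\<^sub>k z) * (ide P \<otimes>\<^sub>k act W g)"
      by simp
    then show ?thesis by (simp add: mult.assoc pP pW that(2) f1)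
  qed
  have A: "f * (act P g \<otimes>\<^sub>k act W g' + ide P \<otimes>\<^sub>k act W g) = act X g * f"
    if "act (rtens X (ldual W)) g = act X g \<otimes>\<^sub>k tr z - ide X \<otimes>\<^sub>k tr (act W g * z)" "z * act W g' = ide W" for g g' z
  proof -
    have "curry_fm (f * (act P g \<otimes>\<^sub>k ide W)) = ?F * act P g" by (simp add: cm1 cF)
    also have "\<dots> = curry_fm (act X g * f * (ide P \<otimes>\<^sub>k z)) - curry_fm (f * (ide P \<otimes>\<^sub>k (act W g * z)))"
      unfolding h(3) that(1) by (simp add: cm cm1 h left_diff_distrib del: tr_mult)
    finally have "curry_fm (f * (act P g \<otimes>\<^sub>k ide W) + f * (ide P \<otimes>\<^sub>k (act W g * z))) = curry_fm (act X g * f * (ide P \<otimes>\<^sub>k z))"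
      by (simp add: curry_add)
    then have "f * (act P g \<otimes>\<^sub>k ide W) + f * (ide P \<otimes>\<^sub>k (act W g * z)) = act X g * f * (ide P \<otimes>\<^sub>k z)" by (rule curry_inj)
    then have "(f * (act P g \<otimes>\<^sub>k ide W) + f * (ide P \<otimes>\<^sub>k (act W g * z))) * (ide P \<otimes>\<^sub>k act W g') = act X g * f * (ide P \<otimes>\<^sub>k z) * (ide P \<otimes>\<^sub>k act W g')"
      by simp
    then show ?thesis by (simp add: mult.assoc pP pW that(2) f1 distrib_left distrib_right)
  qed
  have "f * act (rtens P W) g = act X g * f" for g
  proof (cases g)
    case Gen_a
    with A[of Gen_a "binv W" Gen_b] i show ?thesis by (simp del: tr_mult)
  next
    case Gen_b
    with B[of Gen_b "binv W"] i show ?thesis by simp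
  next
    case Gen_c
    with B[of Gen_c "cinv W"] i show ?thesis by simp
  next
    case Gen_d
    with A[of Gen_d "cinv W" Gen_c] i show ?thesis by (simp del: tr_mult)
  qed
  then show ?thesis using f1 f2 by (simp add: rhom_def)
qed

lemma hdim_adjoint:
  assumes "rmodule P" "rmodule W" "rmodule X"
  shows "hdim (rtens P W) X = hdim P (rtens X (ldual W))"
proof -
  have "{F. rhom P (rtens X (ldual W)) F} = curry_fm ` {f. rhom (rtens P W) X f}"
  proof (intro equalityI subsetI)
    fix F assume "F \<in> {F. rhom P (rtens X (ldual W)) F}"
    then have "rhom (rtens P W) X (uncurry_fm F)" by (intro uncurry_hom[OF assms]) simp
    then show "F \<in> curry_fm ` {f. rhom (rtens P W) X f}"
      by (intro image_eqI[of _ _ "uncurry_fm F"]) simp_all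
  qed (auto intro: curry_hom[OF assms])
  moreover have "dimk (curry_fm ` {f. rhom (rtens P W) X f}) = dimk {f. rhom (rtens P W) X f}"
  proof (rule dim_image_inj[OF subspace_hom linear_curry])
    fix x :: "'k fm" assume "curry_fm x = 0"
    moreover have "curry_fm 0 = (0 :: 'k fm)" by (rule fm_eqI) (simp add: ent_curry)
    ultimately show "x = 0" using curry_inj[of x 0] by simp
  qed
  ultimately show ?thesis by (simp add: hdim_def)
qed

text \<open>A lifting problem for \<open>rtens P W\<close> along \<open>p\<close> curries to one for
  \<open>P\<close> along \<open>p\<close> tensored with the dual of \<open>W\<close>, which is still
  surjective.\<close>

lemma rproj_tens:
  assumes P: "rproj P" and W: "rmodule W" shows "rproj (rtens P W)"
  unfolding rproj_def
proof (intro conjI allI impI)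
  note Pm = rprojD[OF P]
  show "rmodule (rtens P W)" by (rule rmodule_tens[OF Pm W])
  fix M N p f assume "rmodule M \<and> rmodule N \<and> repi M N p \<and> rhom (rtens P W) N f"
  then have M: "rmodule M" and N: "rmodule N" and p: "repi M N p" and f: "rhom (rtens P W) N f" by auto
  note D = rmodule_ldual[OF W]
  note pD = premoduleD[OF rmoduleD(1)[OF D]]
  obtain r where r: "ide M * r = r" "p * r = ide N" using p by (rule repiE)
  have e: "repi (rtens M (ldual W)) (rtens N (ldual W)) (p \<otimes>\<^sub>k ide (ldual W))"
    unfolding repi_def using rhom_tens[OF repiD[OF p] hom_ide[OF rmoduleD(1)[OF D]]]
    by (intro conjI exI[of _ "r \<otimes>\<^sub>k ide (ldual W)"]) (simp_all add: r pD(1) del: ldual_simps(1))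
  obtain G where G: "rhom P (rtens M (ldual W)) G" "(p \<otimes>\<^sub>k ide (ldual W)) * G = curry_fm f"
    using rproj_lift[OF P rmodule_tens[OF M D] rmodule_tens[OF N D] e curry_hom[OF Pm W N f]] by blast
  define g where "g = uncurry_fm G"
  have g: "rhom (rtens P W) M g" using G(1) by (intro uncurry_hom[OF Pm W M]) (simp add: g_def)
  have "curry_fm (p * g * (ide P \<otimes>\<^sub>k ide W)) = (p \<otimes>\<^sub>k tr (ide W)) * (G * ide P)"
    unfolding curry_mult by (simp add: g_def mult.assoc)
  also have "\<dots> = curry_fm f" using G by (simp add: homD(1)[OF G(1)])
  finally have "p * g * (ide P \<otimes>\<^sub>k ide W) = f" by (rule curry_inj)
  then have "p * g = f" using homD(1)[OF g] by (simp add: mult.assoc)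
  then show "\<exists>g. rhom (rtens P W) M g \<and> p * g = f" using g by blast
qed

text \<open>By adjunction the sequence enters as its dual, tensored with \<open>X\<close> and placed
  in the second argument of Hom from the projective \<open>P\<close>.\<close>

lemma hdim_tens_ses:
  assumes P: "rproj P" and X: "rmodule X" and s: "rses A B C i p"
  shows "hdim (rtens P B) X = hdim (rtens P A) X + hdim (rtens P C) X"
proof -
  have m: "rmodule A" "rmodule B" "rmodule C" using s by (auto simp: rses_def)
  show ?thesis
    unfolding hdim_adjoint[OF rprojD[OF P] m(1) X] hdim_adjoint[OF rprojD[OF P] m(2) X] hdim_adjoint[OF rprojD[OF P] m(3) X]
    using hdim_ses_right[OF P rses_tens[OF X rses_ldual[OF s]]] by simp
qed

end

section \<open>Tensor products with two-dimensional modules\<close>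

text \<open>\<open>u\<close> has a basis of the column space of \<open>e\<close> as its first
  columns, and \<open>v\<close> is a left inverse of \<open>u\<close> composed with
  \<open>e\<close>. This puts any module into coordinates of its own dimension.\<close>

lemma idem_split:
  fixes e :: "'k::field fm"
  assumes e: "e * e = e"
  shows "\<exists>u v. u * v = e \<and> v * u = idm (dimk {x. e * x = x \<and> x * munit 0 0 = x}) \<and> e * u = u \<and> v * e = v
    \<and> u * idm (dimk {x. e * x = x \<and> x * munit 0 0 = x}) = u \<and> idm (dimk {x. e * x = x \<and> x * munit 0 0 = x}) * v = v"
proof -
  let ?S = "{x. e * x = x \<and> x * munit 0 0 = x}"
  define r where "r = dimk ?S"
  obtain T where T: "finite T" "?S \<subseteq> fm.span T" by (rule fm_subspace_finite_span[OF subspace_columns])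
  obtain B where B: "B \<subseteq> ?S" "fm.independent B" "?S \<subseteq> fm.span B" "card B = dimk ?S" by (rule fm.basis_exists)
  have finB: "finite B" using fm.independent_span_bound[OF T(1) B(2)] B(1) T(2) by auto
  then obtain x where x: "bij_betw x {..<r} B"
    using ex_bij_betw_nat_finite[OF finB] B(4) by (auto simp: r_def atLeast0LessThan)
  have xS: "e * x i = x i" "x i * munit 0 0 = x i" if "i < r" for i
    using that x B(1) by (auto dest: bij_betwE)
  define u where "u = (\<Sum>i<r. x i * munit 0 i)"
  have ui: "u * munit j 0 = x j" if "j < r" for j
  proof -
    have "u * munit j 0 = (\<Sum>i<r. if i = j then x j else 0)"
      unfolding u_def sum_distrib_right by (rule sum.cong) (auto simp: mult.assoc munit_mult xS)
    then show ?thesis using that by (simp add: sum.delta)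
  qed
  have eu: "e * u = u" unfolding u_def sum_distrib_left
    by (rule sum.cong) (auto simp: mult.assoc[symmetric] xS)
  have ur: "u * idm r = u" unfolding u_def sum_distrib_right
    by (rule sum.cong) (auto simp: mult.assoc munit_idm)
  have lin: "u * (\<Sum>i<r. c i *\<^sub>k munit i 0) = (\<Sum>i<r. c i *\<^sub>k x i)" for c
    unfolding sum_distrib_left by (rule sum.cong) (auto simp: ui)
  have inj: "y = 0" if y: "idm r * y = y" "u * y = 0" for y
  proof (rule column_ext)
    fix j
    let ?y = "y * munit j 0"
    have ye: "?y = (\<Sum>i<r. ent ?y i 0 *\<^sub>k munit i 0)"
      by (rule column_expand) (simp_all add: mult.assoc mult_eq_assoc[OF y(1)])
    have "0 = u * ?y" by (simp add: mult_eq_assoc[OF y(2)])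
    also have "\<dots> = (\<Sum>i<r. ent ?y i 0 *\<^sub>k x i)" by (subst ye) (rule lin)
    finally have s0: "(\<Sum>i<r. ent ?y i 0 *\<^sub>k x i) = 0" by simp
    have "ent ?y i 0 = 0" if i: "i < r" for i
    proof -
      let ?c = "\<lambda>b. ent ?y (the_inv_into {..<r} x b) 0"
      have inv: "the_inv_into {..<r} x (x i) = i" if "i < r" for i
        using x that by (simp add: bij_betw_def the_inv_into_f_f)
      have "(\<Sum>b\<in>B. ?c b *\<^sub>k b) = (\<Sum>i<r. ?c (x i) *\<^sub>k x i)"
        using sum.reindex_bij_betw[OF x, of "\<lambda>b. ?c b *\<^sub>k b"] by simp
      also have "\<dots> = (\<Sum>i<r. ent ?y i 0 *\<^sub>k x i)" by (rule sum.cong) (auto simp: inv)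
      also note s0
      finally have z: "(\<Sum>b\<in>B. ?c b *\<^sub>k b) = 0" .
      have "?c (x i) = 0"
      proof (rule ccontr)
        assume "?c (x i) \<noteq> 0"
        moreover have "x i \<in> B" using x i by (auto dest: bij_betwE)
        ultimately have "\<exists>v\<in>B. ?c v \<noteq> 0" by blast
        with z have "fm.dependent B" using fm.dependent_finite[OF finB, THEN iffD2, OF exI[of _ ?c]] by blast
        then show False using B(2) by simp
      qed
      then show ?thesis by (simp add: inv i)
    qed
    then have "(\<Sum>i<r. ent ?y i 0 *\<^sub>k munit i 0) = (0 :: 'k fm)" by (intro sum.neutral) auto
    then show "y * munit j 0 = 0 * munit j 0" using ye by simp
  qed
  have "rhom (idm r, \<lambda>_. 0) (e, \<lambda>_. 0) u" by (simp add: rhom_def ur eu)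
  from left_inverse[OF this] inj obtain l where l: "l * u = idm r" "idm r * l = l" by auto
  have "u * (l * e) = e"
  proof (rule column_ext)
    fix j
    let ?y = "e * munit j 0"
    have "?y \<in> ?S" by (simp add: mult.assoc mult_eq_assoc[OF e])
    then have "?y \<in> fm.span B" using B(3) by auto
    then obtain c where "?y = (\<Sum>b\<in>B. c b *\<^sub>k b)" using finB by (auto simp: fm.span_finite)
    also have "\<dots> = (\<Sum>i<r. c (x i) *\<^sub>k x i)"
      using sum.reindex_bij_betw[OF x, of "\<lambda>b. c b *\<^sub>k b"] by simp
    also have "\<dots> = u * (\<Sum>i<r. c (x i) *\<^sub>k munit i 0)" by (rule lin[symmetric])
    finally obtain z where z: "?y = u * z" by blast
    have "u * (l * e) * munit j 0 = u * (l * u) * z" by (simp add: mult.assoc z)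
    then show "u * (l * e) * munit j 0 = e * munit j 0" by (simp add: l ur z)
  qed
  moreover have "l * e * u = idm r" by (simp add: mult.assoc eu l)
  moreover have "l * e * e = l * e" by (simp add: mult.assoc e)
  moreover have "idm r * (l * e) = l * e" by (rule mult_eq_assoc[OF l(2)])
  ultimately show ?thesis unfolding r_def[symmetric] using eu ur by blast
qed

text \<open>Translates the row-major index \<open>i * r + j\<close> of a Kronecker product into the
  pair code used by \<open>tens\<close>.\<close>

definition grid :: "nat \<Rightarrow> nat \<Rightarrow> nat" where "grid r i = prod_encode (i div r, i mod r)"

lemma inj_grid: "inj_on (grid r) S"
  by (rule inj_onI) (metis grid_def prod_encode_eq prod.inject div_mult_mod_eq)

lemma grid_image: "grid r ` {..<p * r} = prod_encode ` ({..<p} \<times> {..<r})"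
proof (cases "r = 0")
  case False
  show ?thesis
  proof (intro equalityI subsetI)
    fix k assume "k \<in> grid r ` {..<p * r}"
    then obtain i where "i < p * r" "k = grid r i" by auto
    then show "k \<in> prod_encode ` ({..<p} \<times> {..<r})"
      using False by (auto simp: grid_def less_mult_imp_div_less)
  next
    fix k assume "k \<in> prod_encode ` ({..<p} \<times> {..<r})"
    then obtain i j where ij: "i < p" "j < r" "k = prod_encode (i, j)" by auto
    have "i * r + j < p * r"
    proof -
      have "i * r + j < Suc i * r" using ij by simp
      also have "\<dots> \<le> p * r" using ij by (intro mult_right_mono) auto
      finally show ?thesis .
    qed
    moreover have "k = grid r (i * r + j)" using ij by (simp add: grid_def)
    ultimately show "k \<in> grid r ` {..<p * r}" by blast
  qed
qed auto

lemma sum_munit_grid: "(\<Sum>i\<in>grid r ` {..<p * r}. munit i i) = idm p \<otimes>\<^sub>k (idm r :: 'k::field fm)"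
proof (rule fm_eqI)
  fix k l
  have "ent (\<Sum>i\<in>grid r ` {..<p * r}. munit i i :: 'k fm) k l
      = (\<Sum>i\<in>prod_encode ` ({..<p} \<times> {..<r}). if i = k then (if k = l then 1 else 0) else 0)"
    unfolding ent_sum grid_image by (rule sum.cong) (auto simp: ent_munit)
  also have "\<dots> = (if k \<in> prod_encode ` ({..<p} \<times> {..<r}) \<and> k = l then 1 else 0)"
    by (auto simp: sum.delta)
  also have "\<dots> = ent (idm p \<otimes>\<^sub>k idm r) k l"
  proof -
    obtain k1 k2 where k: "k = prod_encode (k1, k2)" by (metis prod_decode_inverse surj_pair)
    obtain l1 l2 where l: "l = prod_encode (l1, l2)" by (metis prod_decode_inverse surj_pair)
    have "k \<in> prod_encode ` ({..<p} \<times> {..<r}) \<longleftrightarrow> k1 < p \<and> k2 < r" unfolding k by auto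
    then show ?thesis unfolding k l by (simp add: ent_idm)
  qed
  finally show "ent (\<Sum>i\<in>grid r ` {..<p * r}. munit i i :: 'k fm) k l = ent (idm p \<otimes>\<^sub>k idm r) k l" .
qed

lemma rk_tens:
  fixes M N :: "'k::field rmod"
  assumes "premodule M" "premodule N" shows "rk (rtens M N) = rk M * rk N"
proof -
  obtain u v where uv: "u * v = ide M" "v * u = idm (rk M)" "ide M * u = u" "v * ide M = v"
    "u * idm (rk M) = u" "idm (rk M) * v = v"
    using idem_split[OF premoduleD(1)[OF assms(1)]] unfolding rk_def by blast
  obtain w z where wz: "w * z = ide N" "z * w = idm (rk N)" "ide N * w = w" "z * ide N = z"
    "w * idm (rk N) = w" "idm (rk N) * z = z"
    using idem_split[OF premoduleD(1)[OF assms(2)]] unfolding rk_def by blast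
  let ?p = "rk M" and ?r = "rk N"
  \<comment> \<open>\<open>rk\<close> sees only the idempotent. With zero actions every matrix
    absorbed by the idempotents is an intertwiner.\<close>
  let ?A = "(ide M \<otimes>\<^sub>k ide N, \<lambda>_. 0) :: 'k rmod" and ?B = "(idm ?p \<otimes>\<^sub>k idm ?r, \<lambda>_. 0) :: 'k rmod"
    and ?C = "(idm (?p * ?r), \<lambda>_. 0) :: 'k rmod"
  have "riso ?B ?A" unfolding riso_def
    by (rule exI[of _ "u \<otimes>\<^sub>k w"], rule exI[of _ "v \<otimes>\<^sub>k z"]) (simp add: rhom_def uv wz)
  moreover have "riso ?C ?B"
  proof -
    let ?U = "perm_fm (grid ?r) {..<?p * ?r} :: 'k fm"
    have 1: "tr ?U * ?U = idm (?p * ?r)"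
      unfolding idm_def by (rule tr_perm_fm_mult[OF _ inj_grid]) simp
    have 2: "?U * tr ?U = idm ?p \<otimes>\<^sub>k idm ?r"
      using perm_fm_tr_mult[OF finite_lessThan inj_grid] sum_munit_grid by metis
    have 3: "?U * idm (?p * ?r) = ?U"
      unfolding perm_fm_def sum_distrib_right by (rule sum.cong) (auto simp: munit_idm)
    then have 4: "idm (?p * ?r) * tr ?U = tr ?U" by (metis tr_idm tr_mult)
    have 5: "(idm ?p \<otimes>\<^sub>k idm ?r) * ?U = ?U" unfolding 2[symmetric] by (simp only: mult.assoc 1 3)
    have 6: "tr ?U * (idm ?p \<otimes>\<^sub>k idm ?r) = tr ?U"
      unfolding 2[symmetric] by (simp only: mult.assoc[symmetric] 1 4)
    show ?thesis unfolding riso_def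
      by (rule exI[of _ ?U], rule exI[of _ "tr ?U"]) (simp add: rhom_def 1 2 3 4 5 6)
  qed
  ultimately have "rk ?A = rk ?C" using rk_iso riso_trans by metis
  then show ?thesis by (simp add: rk_def rk_hwm_idm)
qed

lemma prod_encode_0: "prod_encode (0, 0) = 0"
  by (simp add: prod_encode_def)

text \<open>As 0 codes the pair (0,0), a tensor product of vectors in column 0 is again supported in
  column 0.\<close>

lemma munit_tens: "munit i 0 \<otimes>\<^sub>k munit j 0 = (munit (prod_encode (i, j)) 0 :: 'k::field fm)"
proof (rule fm_eqI)
  fix k l
  obtain k1 k2 where k: "k = prod_encode (k1, k2)" by (metis prod_decode_inverse surj_pair)
  obtain l1 l2 where l: "l = prod_encode (l1, l2)" by (metis prod_decode_inverse surj_pair)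
  have "prod_encode (l1, l2) = 0 \<longleftrightarrow> prod_encode (l1, l2) = prod_encode (0, 0)"
    by (simp only: prod_encode_0)
  then have "prod_encode (l1, l2) = 0 \<longleftrightarrow> l1 = 0 \<and> l2 = 0" by simp
  then show "ent (munit i 0 \<otimes>\<^sub>k munit j 0 :: 'k fm) k l = ent (munit (prod_encode (i, j)) 0) k l"
    unfolding k l ent_tens_enc ent_munit by simp
qed

context taft_double
begin

lemma rses_iso_right:
  assumes "rses A B C i p" "rmodule C'" "riso C C'" shows "\<exists>p'. rses A B C' i p'"
proof -
  obtain f where f: "rmono C C' f" "repi C C' f" by (rule riso_mono_epi[OF assms(3)])
  from assms(1) have p: "repi B C p" by (simp add: rses_def)
  have "rses A B C' i (f * p)"
    unfolding rses_def
  proof (intro conjI allI impI assms(2))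
    show "repi B C' (f * p)" by (rule repi_comp[OF p f(2)])
    show "f * p * i = 0" using assms(1) by (simp add: rses_def mult.assoc)
    fix x assume x: "ide B * x = x" "f * p * x = 0"
    then have "f * (p * x) = 0" by (simp only: mult.assoc)
    then have "p * x = 0" using f(1) homD(5)[OF repiD[OF p]] unfolding rmono_def by blast
    then show "\<exists>y. ide A * y = y \<and> i * y = x" using assms(1) x(1) by (simp add: rses_def)
  qed (use assms(1) in \<open>auto simp: rses_def\<close>)
  then show ?thesis by blast
qed

section \<open>Duals of simple modules and their products with small simple modules\<close>

lemma row_a: "munit 0 j * hw_act p s t Gen_a = (if 0 < j \<and> j < p then munit 0 (j - 1) else 0)"
proof -
  have "munit 0 j * hw_act p s t Gen_a = (\<Sum>i<p - 1. if i = j - 1 then (if 0 < j then munit 0 (j - 1) else 0) else 0)"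
    unfolding hw_act.simps sum_distrib_left by (rule sum.cong) (auto simp: munit_mult)
  then show ?thesis by (auto simp: sum.delta)
qed

lemma row_b: "j < p \<Longrightarrow> munit 0 j * hw_act p s t Gen_b = q powi (t + int j) *\<^sub>k munit 0 j"
proof -
  assume "j < p"
  have "munit 0 j * hw_act p s t Gen_b = (\<Sum>i<p. if i = j then q powi (t + int j) *\<^sub>k munit 0 j else 0)"
    unfolding hw_act.simps sum_distrib_left by (rule sum.cong) (auto simp: munit_mult)
  then show ?thesis using \<open>j < p\<close> by (simp add: sum.delta)
qed

lemma row_c: "j < p \<Longrightarrow> munit 0 j * hw_act p s t Gen_c = q powi (1 - t - int s + int j) *\<^sub>k munit 0 j"
proof -
  assume "j < p"
  have "munit 0 j * hw_act p s t Gen_c = (\<Sum>i<p. if i = j then q powi (1 - t - int s + int j) *\<^sub>k munit 0 j else 0)"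
    unfolding hw_act.simps sum_distrib_left by (rule sum.cong) (auto simp: munit_mult)
  then show ?thesis using \<open>j < p\<close> by (simp add: sum.delta)
qed

lemma row_d: "p \<le> Suc j \<Longrightarrow> munit 0 j * hw_act p s t Gen_d = 0"
  unfolding hw_act.simps sum_distrib_left by (rule sum.neutral) (auto simp: munit_mult)

lemma qpow_cancel: "q powi (- i) * q powi i = 1" "q powi i * q powi (- i) = 1"
  by (simp_all add: qpow_add[symmetric])

lemma qpow_diff_cong:
  assumes "q powi i = q powi j" shows "q powi (k - i) = q powi (k - j)"
proof -
  have "q powi (- i) = q powi (- j)" using assms by (simp add: power_int_minus)
  then show ?thesis using qpow_minus[of k i] qpow_minus[of k j] by simp
qed

text \<open>The last covector is a highest weight vector of the dual, with \<open>b\<close> acting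
  by q^(1 - t - s); there \<open>a\<close> lowers the index up to scalars, so its
  \<open>s\<close>-th power kills that covector. Injectivity and equal dimension finish the
  argument.\<close>

lemma ldual_V_iso:
  assumes s: "1 \<le> s" "s \<le> n" shows "riso (V s (1 - t - int s)) (ldual (V s t))"
proof -
  let ?V = "V s t" let ?D = "ldual ?V"
  have Vm: "rmodule ?V" by (rule rmodule_V[OF s])
  have D: "rmodule ?D" by (rule rmodule_ldual[OF Vm])
  note i = inv_facts[OF Vm, simplified]
  have t: "tr x * munit j 0 = tr (munit 0 j * x)" for x :: "'k fm" and j by simp
  have rb: "munit 0 j * binv ?V = q powi (- (t + int j)) *\<^sub>k munit 0 j" if "j < s" for j
  proof -
    have "munit 0 j * hw_act s s t Gen_b * binv ?V = munit 0 j"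
      using i(1) that by (simp add: mult.assoc munit_idm)
    then have "q powi (- (t + int j)) *\<^sub>k (q powi (t + int j) *\<^sub>k (munit 0 j * binv ?V)) = q powi (- (t + int j)) *\<^sub>k munit 0 j"
      using that by (simp add: row_b)
    then show ?thesis by (simp only: fm.scale_scale qpow_cancel fm.scale_one)
  qed
  have rc: "munit 0 j * cinv ?V = q powi (- (1 - t - int s + int j)) *\<^sub>k munit 0 j" if "j < s" for j
  proof -
    have "munit 0 j * hw_act s s t Gen_c * cinv ?V = munit 0 j"
      using i(3) that by (simp add: mult.assoc munit_idm)
    then have "q powi (- (1 - t - int s + int j)) *\<^sub>k (q powi (1 - t - int s + int j) *\<^sub>k (munit 0 j * cinv ?V))
        = q powi (- (1 - t - int s + int j)) *\<^sub>k munit 0 j"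
      using that by (simp add: row_c)
    then show ?thesis by (simp only: fm.scale_scale qpow_cancel fm.scale_one)
  qed
  have s1: "s - 1 < s" "s \<le> Suc (s - 1)" using s by auto
  have js: "int (s - 1) = int s - 1" using s by simp
  let ?x = "munit (s - 1) 0 :: 'k fm"
  have hw: "hwvec ?D s (1 - t - int s) ?x"
  proof -
    have "act ?D Gen_b * ?x = q powi (1 - t - int s) *\<^sub>k ?x"
      unfolding ldual_simps t rb[OF s1(1)] js by (simp add: algebra_simps)
    moreover have "act ?D Gen_c * ?x = q powi (1 - (1 - t - int s) - int s) *\<^sub>k ?x"
      unfolding ldual_simps t rc[OF s1(1)] js by (simp add: algebra_simps)
    moreover have "munit 0 (s - 1) * (hw_act s s t Gen_d * cinv ?V) = 0"
      using row_d[OF s1(2), of s t] by (simp add: mult.assoc[symmetric])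
    then have "act ?D Gen_d * ?x = 0"
      unfolding ldual_simps hwm_simps minus_mult_left[symmetric] t by simp
    ultimately show ?thesis using s1 by (simp add: hwvec_def wvec_def idm_munit)
  qed
  have "\<exists>\<kappa>. pw (act ?D Gen_a) m ?x = (if m < s then \<kappa> *\<^sub>k munit (s - 1 - m) 0 else 0)" for m
  proof (induction m)
    case 0
    then show ?case using s by (intro exI[of _ 1]) simp
  next
    case (Suc m)
    then obtain \<kappa> where \<kappa>: "pw (act ?D Gen_a) m ?x = (if m < s then \<kappa> *\<^sub>k munit (s - 1 - m) 0 else 0)" by blast
    show ?case
    proof (cases "Suc m < s")
      case True
      have "munit 0 (s - 1 - m) * (hw_act s s t Gen_a * binv ?V) = munit 0 (s - 1 - m - 1) * binv ?V"
        using True by (simp add: mult.assoc[symmetric] row_a)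
      also have "\<dots> = q powi (- (t + int (s - 1 - m - 1))) *\<^sub>k munit 0 (s - 1 - m - 1)"
        by (rule rb) (use True in simp)
      finally have "act ?D Gen_a * munit (s - 1 - m) 0 = - (q powi (- (t + int (s - 1 - m - 1))) *\<^sub>k munit (s - 1 - m - 1) 0)"
        unfolding ldual_simps hwm_simps minus_mult_left[symmetric] t by simp
      then show ?thesis using True \<kappa>
        by (intro exI[of _ "- \<kappa> * q powi (- (t + int (s - 1 - m - 1)))"]) simp
    next
      case False
      have "act ?D Gen_a * munit 0 0 = 0"
        unfolding ldual_simps hwm_simps minus_mult_left[symmetric] t by (simp add: mult.assoc[symmetric] row_a)
      moreover have "m < s \<Longrightarrow> s - 1 - m = 0" using False by simp
      ultimately show ?thesis using False \<kappa> by auto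
    qed
  qed
  from this[of s] have "pw (act ?D Gen_a) s ?x = 0" by simp
  from hw_hom[OF D hw this s(1)] obtain f where f: "rhom (V s (1 - t - int s)) ?D f"
    "\<And>j. j < s \<Longrightarrow> f * munit j 0 = pw (act ?D Gen_a) j ?x" by blast
  have "f * munit 0 0 = ?x" using f(2)[of 0] s by simp
  then have "f \<noteq> 0" by auto
  from mono_rk_iso(2)[OF rmodule_V[OF s] D V_mono[OF D f(1) this s]]
  show ?thesis by (simp add: rk_def rk_hwm_idm)
qed

lemma tens_V1_iso:
  assumes s: "1 \<le> s" "s \<le> n" shows "riso (V s (t + u)) (rtens (V s t) (V 1 u))"
proof -
  let ?M = "rtens (V s t) (V 1 u)"
  have V1: "rmodule (V 1 u)" using n_gt_2 by (intro rmodule_V) auto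
  have M: "rmodule ?M" by (rule rmodule_tens[OF rmodule_V[OF s] V1])
  let ?v = "\<lambda>j. munit j 0 \<otimes>\<^sub>k munit 0 0 :: 'k fm"
  have a: "act ?M Gen_a * ?v j = (if Suc j < s then q powi u *\<^sub>k ?v (Suc j) else 0)" if "j < s" for j
    using that by (simp add: distrib_right hw_col idm_munit)
  have pa: "pw (act ?M Gen_a) m (?v 0) = (if m < s then (q powi u) ^ m *\<^sub>k ?v m else 0)" for m
  proof (induction m)
    case (Suc m)
    then show ?case using a[of m] by (auto simp del: rtens_simps simp: mult.commute)
  qed (use s in simp)
  have hw: "hwvec ?M s (t + u) (?v 0)"
  proof -
    have "act ?M Gen_c * ?v 0 = (q powi (1 - t - int s) * q powi (- u)) *\<^sub>k ?v 0" using s by (simp add: hw_col)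
    moreover have "act ?M Gen_b * ?v 0 = (q powi t * q powi u) *\<^sub>k ?v 0" using s by (simp add: hw_col)
    moreover have "act ?M Gen_d * ?v 0 = 0" using s by (simp add: hw_col distrib_right)
    moreover have "1 - t - int s + - u = 1 - (t + u) - int s" by simp
    moreover have "?v 0 * munit 0 0 = ?v 0" by (simp add: munit_tens)
    moreover have "ide ?M * ?v 0 = ?v 0" using s by (simp add: idm_munit)
    ultimately show ?thesis by (simp only: hwvec_def wvec_def qpow_add[symmetric])
  qed
  from hw_hom[OF M hw _ s(1)] pa[of s] obtain f where f: "rhom (V s (t + u)) ?M f"
    "\<And>j. j < s \<Longrightarrow> f * munit j 0 = pw (act ?M Gen_a) j (?v 0)" by auto
  have "f * munit 0 0 = ?v 0" using f(2)[of 0] s by simp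
  then have "f \<noteq> 0" by (auto simp: munit_tens)
  moreover have "rk ?M = s"
    by (subst rk_tens[OF rmoduleD(1)[OF rmodule_V[OF s]] rmoduleD(1)[OF V1]]) simp
  ultimately show ?thesis
    using mono_rk_iso(2)[OF rmodule_V[OF s] M V_mono[OF M f(1) _ s]] by simp
qed

text \<open>\<open>v\<^sub>j \<otimes> w\<^sub>0\<close> and \<open>v\<^sub>j \<otimes> w\<^sub>1\<close> span \<open>V(s,t) \<otimes> V(2,u)\<close>; the submodule generated by \<open>v\<^sub>0 \<otimes> w\<^sub>0\<close> has a
  cyclic quotient generated by \<open>v\<^sub>0 \<otimes> w\<^sub>1\<close>. For \<open>s = n\<close> both are Verma modules.\<close>

context
  fixes s :: nat and t u :: int
  assumes s: "1 \<le> s" "s \<le> n"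
begin

private abbreviation "M \<equiv> rtens (V s t) (V 2 u)"
private abbreviation "v0 j \<equiv> (munit j 0 \<otimes>\<^sub>k munit 0 0 :: 'k fm)"
private abbreviation "v1 j \<equiv> (munit j 0 \<otimes>\<^sub>k munit (Suc 0) 0 :: 'k fm)"
text \<open>The value of \<open>a^j\<close> on \<open>v0 0\<close>, see \<open>pw_a_v0\<close>. At
  \<open>j = s\<close> only the part along \<open>v1 (s - 1)\<close> remains, with a coefficient
  containing (s)_q: it is nonzero for s < n and zero for s = n, which causes the two different
  sequences below.\<close>

private abbreviation "A j \<equiv> (if j < s then q powi (u * int j) *\<^sub>k v0 j else 0) +
    (if 0 < j \<and> j \<le> s then (q powi (u * (int j - 1)) * qint j) *\<^sub>k v1 (j - 1) else 0)"

private lemma V2: "rmodule (V 2 u)" using n_gt_2 by (intro rmodule_V) auto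
private lemma Mm: "rmodule M" by (rule rmodule_tens[OF rmodule_V[OF s] V2])
private lemma rkM: "rk M = 2 * s"
  by (simp add: rk_tens rmoduleD(1)[OF V2] rmoduleD(1)[OF rmodule_V[OF s]])

private lemma a_v0: "j < s \<Longrightarrow> act M Gen_a * v0 j = (if Suc j < s then q powi u *\<^sub>k v0 (Suc j) else 0) + v1 j"
  by (simp add: distrib_right hw_col idm_munit)

private lemma a_v1: "j < s \<Longrightarrow> act M Gen_a * v1 j = (if Suc j < s then q powi (u + 1) *\<^sub>k v1 (Suc j) else 0)"
  by (simp add: distrib_right hw_col idm_munit)

private lemma pw_a_v0: "pw (act M Gen_a) j (v0 0) = A j"
proof (induction j)
  case 0
  then show ?case using s by simp
next
  case (Suc j)
  show ?case
  proof (cases "j < s")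
    case True
    have 1: "act M Gen_a * (if 0 < j \<and> j \<le> s then (q powi (u * (int j - 1)) * qint j) *\<^sub>k v1 (j - 1) else 0)
        = (q powi (u * int j) * (q * qint j)) *\<^sub>k v1 j"
    proof (cases "j = 0")
      case False
      have "q powi (u * (int j - 1)) * q powi (u + 1) = q powi (u * int j) * q"
        unfolding qpow_add[symmetric] using qpow_add[of "u * int j" 1] by (simp add: algebra_simps)
      then show ?thesis using a_v1[of "j - 1"] False True
        by (simp del: rtens_simps add: mult_ac)
    qed simp
    have 2: "act M Gen_a * (if j < s then q powi (u * int j) *\<^sub>k v0 j else 0)
       = (if Suc j < s then q powi (u * int (Suc j)) *\<^sub>k v0 (Suc j) else 0) + q powi (u * int j) *\<^sub>k v1 j"
    proof -
      have "q powi (u * int j) * q powi u = q powi (u * int (Suc j))"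
        unfolding qpow_add[symmetric] by (simp add: algebra_simps)
      then show ?thesis using a_v0[OF True] True by (simp del: rtens_simps add: fm.scale_right_distrib)
    qed
    have "pw (act M Gen_a) (Suc j) (v0 0) = (if Suc j < s then q powi (u * int (Suc j)) *\<^sub>k v0 (Suc j) else 0)
        + (q powi (u * int j) *\<^sub>k v1 j + (q powi (u * int j) * (q * qint j)) *\<^sub>k v1 j)"
      using Suc by (simp only: pw.simps distrib_left 1 2 add.assoc)
    also have "q powi (u * int j) *\<^sub>k v1 j + (q powi (u * int j) * (q * qint j)) *\<^sub>k v1 j
       = (q powi (u * int j) * qint (Suc j)) *\<^sub>k v1 j"
      unfolding fm.scale_left_distrib[symmetric] qint_Suc' by (simp add: algebra_simps)
    finally show ?thesis using True by simp
  next
    case False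
    show ?thesis
    proof (cases "j = s")
      case True
      then show ?thesis using Suc a_v1[of "s - 1"] s by (simp del: rtens_simps)
    next
      case False
      then show ?thesis using Suc \<open>\<not> j < s\<close> by (simp del: rtens_simps)
    qed
  qed
qed

private lemma pw_a_v1: "pw (act M Gen_a) j (v1 0) = (if j < s then q powi ((u + 1) * int j) *\<^sub>k v1 j else 0)"
proof (induction j)
  case 0
  then show ?case using s by simp
next
  case (Suc j)
  have "q powi ((u + 1) * int j) * q powi (u + 1) = q powi ((u + 1) * int (Suc j))"
    unfolding qpow_add[symmetric] by (simp add: algebra_simps)
  then show ?case using Suc a_v1[of j] by (auto simp del: rtens_simps)
qed

private lemma ent_v: "ent (v0 j) (prod_encode (i, 0)) 0 = (if i = j then 1 else 0)"
    "ent (v1 j) (prod_encode (i, 0)) 0 = 0"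
    "ent (v1 j) (prod_encode (i, Suc 0)) 0 = (if i = j then 1 else 0)"
  by (auto simp: munit_tens ent_munit)

private lemma ent_A: "ent (A i) (prod_encode (j, 0)) 0 = (if i = j \<and> j < s then q powi (u * int j) else 0)"
  by (simp add: ent_v)

private lemma wvec_v0: "wvec M (t + u) (1 - (t + u) - int (s + 1)) (v0 0)"
  and wvec_v1: "wvec M (t + u + 1) (1 - (t + u + 1) - (int s - 1)) (v1 0)"
proof -
  have col: "(munit i 0 \<otimes>\<^sub>k munit j 0) * munit 0 0 = (munit i 0 \<otimes>\<^sub>k munit j 0 :: 'k fm)" for i j
    by (simp add: munit_tens)
  have ide: "ide M * v0 0 = v0 0" "ide M * v1 0 = v1 0" using s by (simp_all add: idm_munit)
  have b: "act M Gen_b * v0 0 = (q powi t * q powi u) *\<^sub>k v0 0"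
    "act M Gen_b * v1 0 = (q powi t * q powi (u + 1)) *\<^sub>k v1 0"
    using s by (simp_all add: hw_col)
  have c: "act M Gen_c * v0 0 = (q powi (1 - t - int s) * q powi (1 - u - 2)) *\<^sub>k v0 0"
    "act M Gen_c * v1 0 = (q powi (1 - t - int s) * q powi (1 - u - 2 + 1)) *\<^sub>k v1 0"
    using s by (simp_all add: hw_col)
  have e: "1 - t - int s + (1 - u - 2) = 1 - (t + u) - int (s + 1)"
    "1 - t - int s + (1 - u - 2 + 1) = 1 - (t + u + 1) - (int s - 1)" "t + (u + 1) = t + u + 1" by simp_all
  show "wvec M (t + u) (1 - (t + u) - int (s + 1)) (v0 0)"
    unfolding wvec_def using ide col b c by (simp only: qpow_add[symmetric] e)
  show "wvec M (t + u + 1) (1 - (t + u + 1) - (int s - 1)) (v1 0)"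
    unfolding wvec_def using ide col b c by (simp only: qpow_add[symmetric] e)
qed

private lemma d_v0: "act M Gen_d * v0 0 = 0" using s by (simp add: hw_col distrib_right)
private lemma d_v1: "act M Gen_d * v1 0 = alpha 2 1 *\<^sub>k v0 0"
  using s by (simp add: hw_col distrib_right idm_munit)

text \<open>Covers both cases: dimensions s + 1 and s - 1 for s < n, and n and n for s = n, with
  \<open>s1\<close> and \<open>s2\<close> congruent to s + 1 and s - 1 modulo n. In the cokernel of
  the first map \<open>d\<close> kills the image of \<open>v1 0\<close>, since \<open>d\<close>
  sends \<open>v1 0\<close> to a multiple of \<open>v0 0\<close>.\<close>

private lemma tens_V2_aux:
  assumes p1: "1 \<le> p1" "p1 \<le> n" "s \<le> p1" "p1 \<le> s + 1" and s1: "q powi (int s1) = q powi (int (s + 1))" "alpha s1 p1 = 0"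
    and z1: "pw (act M Gen_a) p1 (v0 0) = 0" and nz1: "pw (act M Gen_a) (p1 - 1) (v0 0) \<noteq> 0"
  shows "\<exists>f. rmono (hwm p1 s1 (t + u)) M f \<and> (\<forall>j<p1. f * munit j 0 = A j)"
    and "\<lbrakk>1 \<le> p2; p2 \<le> n; p1 + p2 = 2 * s; q powi (int s2) = q powi (int s - 1); alpha s2 p2 = 0;
      p2 < s \<Longrightarrow> p1 = s + 1 \<and> p2 = s - 1 \<and> s < n; s < p1 \<Longrightarrow> p2 < s\<rbrakk>
      \<Longrightarrow> \<exists>i p. rses (hwm p1 s1 (t + u)) M (hwm p2 s2 (t + u + 1)) i p"
proof -
  have hw: "hwvec M s1 (t + u) (v0 0)"
    unfolding hwvec_def using d_v0 wvec_cong[OF wvec_v0 refl qpow_diff_cong[OF s1(1)[symmetric]]] by blast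
  have m1: "rmodule (hwm p1 s1 (t + u))" using p1 s1 by (intro rmodule_hwm) auto
  from hw_hom[OF Mm hw z1 p1(1)] obtain f where f: "rhom (hwm p1 s1 (t + u)) M f"
    "\<And>j. j < p1 \<Longrightarrow> f * munit j 0 = A j" unfolding pw_a_v0 by blast
  have f0: "f * munit 0 0 = v0 0" using f(2)[of 0] p1 s by simp
  have fm: "rmono (hwm p1 s1 (t + u)) M f"
    by (rule hw_mono[OF f(1)]) (use nz1 f0 in simp)
  show "\<exists>f. rmono (hwm p1 s1 (t + u)) M f \<and> (\<forall>j<p1. f * munit j 0 = A j)" using fm f(2) by blast
  assume p2: "1 \<le> p2" "p2 \<le> n" "p1 + p2 = 2 * s" "q powi (int s2) = q powi (int s - 1)" "alpha s2 p2 = 0"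
    and c: "p2 < s \<Longrightarrow> p1 = s + 1 \<and> p2 = s - 1 \<and> s < n" and c': "s < p1 \<Longrightarrow> p2 < s"
  obtain C p where C: "rses (hwm p1 s1 (t + u)) M C f p" using mono_ses[OF m1 Mm fm] by blast
  then have Cm: "rmodule C" and p: "repi M C p" and pf: "p * f = 0"
    and ex: "\<And>x. ide M * x = x \<Longrightarrow> p * x = 0 \<Longrightarrow> (\<exists>y. idm p1 * y = y \<and> f * y = x)"
    by (auto simp: rses_def)
  note hp = homD[OF repiD[OF p]]
  have rkC: "rk C = p2" using rk_ses[OF C] rkM p2(3) by simp
  have wpx: "wvec C t' u' (p * x)" if "wvec M t' u' x" for t' u' x
    using that unfolding wvec_def by (simp del: rtens_simps add: hp(5) hp(6)[symmetric] mult.assoc)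
  have m2: "rmodule (hwm p2 s2 (t + u + 1))" using p2 by (intro rmodule_hwm) auto
  have "act C Gen_d * (p * v1 0) = p * (alpha 2 1 *\<^sub>k (f * munit 0 0))"
    unfolding hp(6)[symmetric] d_v1 f0 ..
  then have dz: "act C Gen_d * (p * v1 0) = 0" using mult_eq_assoc[OF pf, of "munit 0 0"] by simp
  have hw2: "hwvec C s2 (t + u + 1) (p * v1 0)"
    unfolding hwvec_def using dz wvec_cong[OF wpx[OF wvec_v1] refl qpow_diff_cong[OF p2(4)[symmetric]]] by blast
  have pwp: "pw (act C Gen_a) j (p * v1 0) = p * pw (act M Gen_a) j (v1 0)" for j
    by (rule pw_intertwine[OF hp(3), symmetric])
  \<comment> \<open>For p2 = s - 1 the vector \<open>v1 (s - 1)\<close> is, up to a nonzero scalar,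
    \<open>A s\<close>, which lies in the submodule.\<close>
  have z2: "pw (act C Gen_a) p2 (p * v1 0) = 0"
  proof (cases "p2 < s")
    case True
    with c have cc: "p1 = s + 1" "p2 = s - 1" "s < n" by auto
    have "A s = (q powi (u * (int s - 1)) * qint s) *\<^sub>k v1 (s - 1)" using s by simp
    moreover have "f * munit s 0 = A s" by (rule f(2)) (use cc in simp)
    ultimately have "p * ((q powi (u * (int s - 1)) * qint s) *\<^sub>k v1 (s - 1)) = 0"
      using mult_eq_assoc[OF pf, of "munit s 0"] by simp
    then have "p * v1 (s - 1) = 0" using qint_nz[of s] s cc q_nz by simp
    then show ?thesis using s cc unfolding pwp pw_a_v1 by simp
  next
    case False
    then show ?thesis unfolding pwp pw_a_v1 by simp
  qed
  from hw_hom[OF Cm hw2 z2 p2(1)] obtain g where g: "rhom (hwm p2 s2 (t + u + 1)) C g"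
    "\<And>j. j < p2 \<Longrightarrow> g * munit j 0 = pw (act C Gen_a) j (p * v1 0)" by blast
  have g0: "g * munit 0 0 = p * v1 0" using g(2)[of 0] p2 by simp
  have p2s: "p2 - 1 < s" using p2 p1 by simp
  \<comment> \<open>Otherwise \<open>v1 (p2 - 1)\<close> would be a combination of the
    \<open>A i\<close>. The coordinates along \<open>v0 j\<close> force all coefficients below
    \<open>s\<close> to vanish, and \<open>A s\<close>, if it occurs, is a multiple of the different
    vector \<open>v1 (s - 1)\<close>.\<close>
  have "p * v1 (p2 - 1) \<noteq> 0"
  proof
    assume "p * v1 (p2 - 1) = 0"
    moreover have "ide M * v1 (p2 - 1) = v1 (p2 - 1)" using p2s by (simp add: idm_munit)
    ultimately obtain y where y: "idm p1 * y = y" "f * y = v1 (p2 - 1)" using ex by blast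
    let ?y = "y * munit 0 0"
    have ye: "?y = (\<Sum>i<p1. ent ?y i 0 *\<^sub>k munit i 0)"
      by (rule column_expand) (simp_all add: mult.assoc mult_eq_assoc[OF y(1)])
    have "f * ?y = v1 (p2 - 1) * munit 0 0" using y(2) by (simp add: mult.assoc[symmetric])
    also have "\<dots> = v1 (p2 - 1)" by (simp add: munit_tens)
    finally have fy0: "f * ?y = v1 (p2 - 1)" .
    have "(\<Sum>i<p1. ent ?y i 0 *\<^sub>k A i) = (\<Sum>i<p1. f * (ent ?y i 0 *\<^sub>k munit i 0))"
      by (rule sum.cong[OF refl]) (simp only: mult_smul f(2) lessThan_iff)
    also have "\<dots> = f * ?y" by (subst (2) ye) (simp only: sum_distrib_left)
    finally have fy: "(\<Sum>i<p1. ent ?y i 0 *\<^sub>k A i) = v1 (p2 - 1)" by (simp only: fy0)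
    have y0: "ent ?y j 0 = 0" if j: "j < s" for j
    proof -
      have "ent (\<Sum>i<p1. ent ?y i 0 *\<^sub>k A i) (prod_encode (j, 0)) 0 = (\<Sum>i<p1. if i = j then ent ?y j 0 * q powi (u * int j) else 0)"
        unfolding ent_sum ent_smul ent_A by (rule sum.cong) (use j in auto)
      also have "\<dots> = ent ?y j 0 * q powi (u * int j)" using j p1 by (simp add: sum.delta)
      finally show ?thesis unfolding fy ent_v using q_nz by simp
    qed
    show False
    proof (cases "p1 = s")
      case True
      then have "(\<Sum>i<p1. ent ?y i 0 *\<^sub>k A i) = 0" by (intro sum.neutral) (simp add: y0)
      then show False using fy by (simp add: munit_tens)
    next
      case False
      then have ps: "p1 = s + 1" "p2 = s - 1" "s < n" using p1 c c' by auto
      have "(\<Sum>i<p1. ent ?y i 0 *\<^sub>k A i) = ent ?y s 0 *\<^sub>k A s"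
        unfolding ps by (simp add: y0)
      then have "ent (ent ?y s 0 *\<^sub>k A s) (prod_encode (p2 - 1, Suc 0)) 0 = 1" unfolding fy[symmetric] using fy ent_v(3)[of "p2 - 1" "p2 - 1"] by simp
      moreover have "p2 - 1 \<noteq> s - 1" using ps p2 by simp
      ultimately show False using s by (simp add: ent_v(3))
    qed
  qed
  then have "pw (act C Gen_a) (p2 - 1) (g * munit 0 0) \<noteq> 0"
    unfolding g0 pwp pw_a_v1 using p2s q_nz by simp
  from hw_mono[OF g(1) this] have "rmono (hwm p2 s2 (t + u + 1)) C g" .
  from mono_rk_iso(2)[OF m2 Cm this] have "riso (hwm p2 s2 (t + u + 1)) C" by (simp add: rkC)
  from rses_iso_right[OF C m2 riso_sym[OF this]]
  show "\<exists>i p. rses (hwm p1 s1 (t + u)) M (hwm p2 s2 (t + u + 1)) i p" by blast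
qed

lemma tens_V2_ses:
  assumes "2 \<le> s" "s < n"
  shows "\<exists>i p. rses (V (s + 1) (t + u)) (rtens (V s t) (V 2 u)) (V (s - 1) (t + u + 1)) i p"
proof (rule tens_V2_aux(2))
  show "pw (act M Gen_a) (s + 1) (v0 0) = 0" unfolding pw_a_v0 by simp
  show "pw (act M Gen_a) (s + 1 - 1) (v0 0) \<noteq> 0" unfolding pw_a_v0
    using assms qint_nz[of s] q_nz by (simp add: munit_tens)
  show "q powi int (s - 1) = q powi (int s - 1)" using assms by (simp add: of_nat_diff)
qed (use assms in auto)

lemma tens_V2_ses_n:
  assumes "s = n"
  shows "\<exists>i p. rses (Z 1 (t + u)) (rtens (V s t) (V 2 u)) (Z (n - 1) (t + u + 1)) i p"
proof (rule tens_V2_aux(2))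
  show "pw (act M Gen_a) n (v0 0) = 0"
    using rmoduleD(7)[OF Mm] pw_mult[of "act M Gen_a" n "ide M" "v0 0"] wvecD(1)[OF wvec_v0] by simp
  have "ent (A (n - 1)) (prod_encode (n - 1, 0)) 0 \<noteq> 0" unfolding ent_A using assms n_gt_2 q_nz by simp
  then show "pw (act M Gen_a) (n - 1) (v0 0) \<noteq> 0" unfolding pw_a_v0 by (metis ent_zero)
  show "q powi int 1 = q powi int (s + 1)" "q powi int (n - 1) = q powi (int s - 1)"
    unfolding qpow_eq_iff using assms n_gt_2 by (simp_all add: of_nat_diff)
qed (use assms n_gt_2 in auto)

lemma tens_V2_iso_1:
  assumes "s = 1" shows "riso (V 2 (t + u)) (rtens (V s t) (V 2 u))"
proof -
  have "\<exists>f. rmono (hwm 2 2 (t + u)) M f \<and> (\<forall>j<2. f * munit j 0 = A j)"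
  proof (rule tens_V2_aux(1))
    show "pw (act M Gen_a) 2 (v0 0) = 0" unfolding pw_a_v0 using assms by simp
    show "pw (act M Gen_a) (2 - 1) (v0 0) \<noteq> 0" unfolding pw_a_v0
      using assms qint_nz[of 1] n_gt_2 q_nz by (simp add: munit_tens)
  qed (use assms n_gt_2 in auto)
  then obtain f where "rmono (V 2 (t + u)) M f" by blast
  from mono_rk_iso(2)[OF _ Mm this] show ?thesis using rkM assms n_gt_2 rmodule_V[of 2] by simp
qed

end

text \<open>\<open>alpha s s = 0\<close> makes basis vector \<open>s\<close> of the Verma module a
  highest weight vector, with the weight of V(n - s, t + s). Modulo the submodule it generates,
  \<open>a^s\<close> kills the generator, so the quotient receives a map from V(s,t).\<close>

lemma Z_ses:
  assumes s: "1 \<le> s" "s < n"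
  shows "\<exists>i p. rses (V (n - s) (t + int s)) (Z s t) (V s t) i p"
proof -
  have Zm: "rmodule (Z s t)" by (rule rmodule_Z)
  have ns: "1 \<le> n - s" "n - s \<le> n" using s by auto
  have Vm: "rmodule (V (n - s) (t + int s))" by (rule rmodule_V[OF ns])
  have "q powi (1 - t - int s + int s) = q powi (1 - (t + int s) - int (n - s))"
    using s by (simp add: qpow_eq_iff of_nat_diff)
  then have hw: "hwvec (Z s t) (n - s) (t + int s) (munit s 0)"
    using s by (simp add: hwvec_def wvec_def hw_col idm_munit)
  have "pw (act (Z s t) Gen_a) (n - s) (munit s 0) = 0" using s by (simp add: hw_pw_a)
  from hw_hom[OF Zm hw this ns(1)] obtain f where f: "rhom (V (n - s) (t + int s)) (Z s t) f"
    "\<And>j. j < n - s \<Longrightarrow> f * munit j 0 = pw (act (Z s t) Gen_a) j (munit s 0)" by blast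
  have f0: "f * munit 0 0 = munit s 0" using f(2)[of 0] s by simp
  then have "f \<noteq> 0" by auto
  from V_mono[OF Zm f(1) this ns] have fm: "rmono (V (n - s) (t + int s)) (Z s t) f" .
  obtain C p where C: "rses (V (n - s) (t + int s)) (Z s t) C f p" using mono_ses[OF Vm Zm fm] by blast
  then have Cm: "rmodule C" and p: "repi (Z s t) C p" and pf: "p * f = 0" by (auto simp: rses_def)
  note hp = homD[OF repiD[OF p]]
  have rkC: "rk C = s" using rk_ses[OF C] s by simp
  have hw2: "hwvec C s t (p * munit 0 0)" by (rule hw_hom_hwvec[OF repiD[OF p]]) (use s in simp)
  have "pw (act C Gen_a) s (p * munit 0 0) = p * pw (act (Z s t) Gen_a) s (munit 0 0)"
    by (rule pw_intertwine[OF hp(3), symmetric])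
  also have "\<dots> = p * (f * munit 0 0)" using s f0 by (simp add: hw_pw_a)
  also have "\<dots> = 0" using mult_eq_assoc[OF pf] by simp
  finally have z: "pw (act C Gen_a) s (p * munit 0 0) = 0" .
  from hw_hom[OF Cm hw2 z s(1)] obtain g where g: "rhom (V s t) C g"
    "\<And>j. j < s \<Longrightarrow> g * munit j 0 = pw (act C Gen_a) j (p * munit 0 0)" by blast
  have "ide C \<noteq> 0" using rkC rk_eq_0[OF premoduleD(1)[OF rmoduleD(1)[OF Cm]]] s by auto
  then have "p \<noteq> 0" using p by (auto simp: repi_def)
  then have "p * munit 0 0 \<noteq> 0" by (rule hw_hom_nz[OF repiD[OF p]])
  then have "g \<noteq> 0" using g(2)[of 0] s by auto
  have sn: "s \<le> n" using s by simp
  from V_mono[OF Cm g(1) \<open>g \<noteq> 0\<close> s(1) sn] have gm: "rmono (V s t) C g" .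
  have "riso (V s t) C" by (rule mono_rk_iso(2)[OF rmodule_V[OF s(1) sn] Cm gm]) (simp add: rkC)
  from rses_iso_right[OF C rmodule_V[OF s(1) sn] riso_sym[OF this]] show ?thesis by blast
qed

section \<open>Filtrations of projective covers\<close>

lemma rses_iso_left:
  assumes "rses A B C i p" "rmodule A'" "riso A' A" shows "\<exists>i'. rses A' B C i' p"
proof -
  obtain f where f: "rmono A' A f" "repi A' A f" by (rule riso_mono_epi[OF assms(3)])
  from assms(1) have i: "rmono A B i" by (simp add: rses_def)
  have "rses A' B C (i * f) p"
    unfolding rses_def
  proof (intro conjI allI impI assms(2))
    show "rmono A' B (i * f)" by (rule rmono_comp[OF f(1) i])
    show "p * (i * f) = 0" using assms(1) by (simp add: rses_def mult_eq_assoc)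
    fix x assume x: "ide B * x = x" "p * x = 0"
    then obtain y where y: "ide A * y = y" "i * y = x" using assms(1) unfolding rses_def by blast
    obtain z where "ide A' * z = z" "f * z = y" using repi_surj[OF f(2) y(1)] by blast
    then show "\<exists>y. ide A' * y = y \<and> i * f * y = x" using y by (auto simp: mult.assoc)
  qed (use assms(1) in \<open>auto simp: rses_def\<close>)
  then show ?thesis by blast
qed

lemma rses_iso_mid:
  assumes "rses A B C i p" "rmodule B'" "riso B B'" shows "\<exists>i' p'. rses A B' C i' p'"
proof -
  obtain f g where fg: "rhom B B' f" "rhom B' B g" "g * f = ide B" "f * g = ide B'"
    using assms(3) by (auto simp: riso_def)
  from assms(1) have i: "rmono A B i" and p: "repi B C p" and pi: "p * i = 0" by (simp_all add: rses_def)
  have "rmono B B' f" by (rule rmonoI_inverse[OF fg(1,3)])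
  then have m: "rmono A B' (f * i)" by (rule rmono_comp[OF i])
  have "ide B' * f = f" by (rule homD(2)[OF fg(1)])
  then have "repi B' B g" using fg unfolding repi_def by blast
  then have e: "repi B' C (p * g)" using repi_comp p by blast
  have "rses A B' C (f * i) (p * g)"
    unfolding rses_def
  proof (intro conjI allI impI assms(2) m e)
    show "p * g * (f * i) = 0" 
      by (simp add: mult.assoc mult_eq_assoc[OF fg(3)] homD(2)[OF rmonoD[OF i]] pi)
    fix x assume x: "ide B' * x = x" "p * g * x = 0"
    have "ide B * (g * x) = g * x" by (rule homD(5)[OF fg(2)])
    moreover have "p * (g * x) = 0" using x(2) by (simp only: mult.assoc)
    ultimately obtain y where y: "ide A * y = y" "i * y = g * x" using assms(1) unfolding rses_def by blast
    have "f * i * y = x" using x(1) by (simp add: mult.assoc y mult_eq_assoc[OF fg(4)])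
    then show "\<exists>y. ide A * y = y \<and> f * i * y = x" using y by blast
  qed (use assms(1) in \<open>auto simp: rses_def\<close>)
  then show ?thesis by blast
qed

text \<open>The kernel of the composite is an extension of the second kernel by the first. Applied
  to P(s,t) -> Z(s,t) -> V(s,t), it describes the first syzygy.\<close>

lemma ses_comp:
  assumes s1: "rses A B C i p" and s2: "rses A' C C' i' p'"
  shows "\<exists>K j u v. rses K B C' j (p' * p) \<and> rses A K A' u v"
proof -
  from s1 have A: "rmodule A" and B: "rmodule B" and C: "rmodule C" and i: "rmono A B i" and p: "repi B C p" and pi: "p * i = 0"
    and ex: "\<And>x. ide B * x = x \<Longrightarrow> p * x = 0 \<Longrightarrow> (\<exists>y. ide A * y = y \<and> i * y = x)" by (auto simp: rses_def)
  from s2 have A': "rmodule A'" and C': "rmodule C'" and i': "rmono A' C i'" and p': "repi C C' p'" and pi': "p' * i' = 0"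
    and ex': "\<And>x. ide C * x = x \<Longrightarrow> p' * x = 0 \<Longrightarrow> (\<exists>y. ide A' * y = y \<and> i' * y = x)" by (auto simp: rses_def)
  obtain K j where K: "rses K B C' j (p' * p)" using epi_ses[OF B C' repi_comp[OF p p']] by blast
  then have Km: "rmodule K" and j: "rmono K B j" and pj: "p' * p * j = 0"
    and exK: "\<And>x. ide B * x = x \<Longrightarrow> p' * p * x = 0 \<Longrightarrow> (\<exists>y. ide K * y = y \<and> j * y = x)" by (auto simp: rses_def)
  note hi = homD[OF rmonoD[OF i]] and hj = homD[OF rmonoD[OF j]] and hp = homD[OF repiD[OF p]]
  obtain u where u: "ide K * u = u" "j * u = i"
    using exK[OF hi(2)] by (auto simp: mult.assoc pi)
  have hu: "rhom A K u" by (rule mono_factor[OF rmoduleD(1)[OF Km] j rmonoD[OF i] u])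
  have "p' * (p * j) = 0" using pj by (simp only: mult.assoc)
  then obtain v where v: "ide A' * v = v" "i' * v = p * j" using ex'[of "p * j"] hp(5) by blast
  have hv: "rhom K A' v" by (rule mono_factor[OF rmoduleD(1)[OF A'] i' hom_comp[OF rmonoD[OF j] repiD[OF p]] v])
  have "rses A K A' u v"
    unfolding rses_def
  proof (intro conjI allI impI A Km A')
    show "rmono A K u" unfolding rmono_def
    proof (intro conjI allI impI hu)
      fix y assume y: "ide A * y = y" "u * y = 0"
      then have "i * y = 0" using mult_eq_assoc[OF u(2), of y] by simp
      then show "y = 0" using i y(1) unfolding rmono_def by blast
    qed
    show "repi K A' v"
    proof (rule repiI[OF hv _ rmoduleD(1)[OF A']])
      fix x assume x: "ide A' * x = x"
      obtain b where b: "ide B * b = b" "p * b = i' * x"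
        using repi_surj[OF p, of "i' * x"] homD(5)[OF rmonoD[OF i']] by blast
      have "p' * p * b = 0" by (simp add: mult.assoc b mult_eq_assoc[OF pi'])
      then obtain y where y: "ide K * y = y" "j * y = b" using exK[OF b(1)] by blast
      have "i' * (v * y) = i' * x" using mult_eq_assoc[OF v(2), of y] by (simp add: mult.assoc y b)
      moreover have "ide A' * (v * y) = v * y" by (rule mult_eq_assoc[OF v(1)])
      ultimately have "v * y = x" using rmono_cancel[OF i'] x by blast
      then show "\<exists>y. ide K * y = y \<and> v * y = x" using y by blast
    qed
    have "i' * (v * u) = 0" using mult_eq_assoc[OF v(2), of u] by (simp add: mult.assoc u pi)
    then show "v * u = 0" using i' mult_eq_assoc[OF v(1)] unfolding rmono_def by blast
    fix x assume x: "ide K * x = x" "v * x = 0"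
    have "p * (j * x) = 0" using mult_eq_assoc[OF v(2), of x] x by (simp add: mult.assoc)
    then obtain y where y: "ide A * y = y" "i * y = j * x" using ex[of "j * x"] hj(5) by blast
    have "j * (u * y) = j * x" using mult_eq_assoc[OF u(2), of y] y by simp
    then have "u * y = x" using rmono_cancel[OF j _ x(1)] mult_eq_assoc[OF u(1), of y] by blast
    then show "\<exists>y. ide A * y = y \<and> u * y = x" using y by blast
  qed
  then show ?thesis using K by blast
qed

text \<open>\<open>F\<close> is \<open>i * f\<close> on \<open>P\<close> and a lift
  \<open>g'\<close> of \<open>g\<close> along \<open>p\<close> on \<open>Q\<close>, which exists
  because \<open>Q\<close> is projective. The sequence of kernels is then chased with elements.
  Minimality is not part of the claim; it is settled by labels in \<open>GW_syzygy\<close>.\<close>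

lemma horseshoe:
  assumes s: "rses A W C i p" and sA: "rses KA P A kA f" and sC: "rses KC Q C kC g" and Q: "rproj Q"
    and b: "biprod P Q B i1 i2 p1 p2" and B: "rmodule B"
  shows "\<exists>K j F u v. rses K B W j F \<and> rses KA K KC u v"
proof -
  from s have A: "rmodule A" and W: "rmodule W" and C: "rmodule C" and i: "rmono A W i" and p: "repi W C p" and pi: "p * i = 0"
    and ex: "\<And>x. ide W * x = x \<Longrightarrow> p * x = 0 \<Longrightarrow> (\<exists>y. ide A * y = y \<and> i * y = x)" by (auto simp: rses_def)
  from sA have KA: "rmodule KA" and P: "rmodule P" and kA: "rmono KA P kA" and f: "repi P A f" and fk: "f * kA = 0"
    and exA: "\<And>x. ide P * x = x \<Longrightarrow> f * x = 0 \<Longrightarrow> (\<exists>y. ide KA * y = y \<and> kA * y = x)" by (auto simp: rses_def)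
  from sC have KC: "rmodule KC" and Qm: "rmodule Q" and kC: "rmono KC Q kC" and g: "repi Q C g" and gk: "g * kC = 0"
    and exC: "\<And>x. ide Q * x = x \<Longrightarrow> g * x = 0 \<Longrightarrow> (\<exists>y. ide KC * y = y \<and> kC * y = x)" by (auto simp: rses_def)
  note b' = b[unfolded biprod_def]
  have h1: "rhom P B i1" and h2: "rhom Q B i2" and q1: "rhom B P p1" and q2: "rhom B Q p2"
    and e11: "p1 * i1 = ide P" and e22: "p2 * i2 = ide Q" and e12: "p1 * i2 = 0" and e21: "p2 * i1 = 0"
    and sum: "i1 * p1 + i2 * p2 = ide B" using b' by auto
  obtain g' where g': "rhom Q W g'" "p * g' = g" by (rule rproj_lift[OF Q W C p repiD[OF g]])
  define F where "F = i * f * p1 + g' * p2"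
  have hF: "rhom B W F" unfolding F_def
    by (intro hom_add hom_comp[OF q1] hom_comp[OF q2] hom_comp[OF repiD[OF f] rmonoD[OF i]] g'(1))
  have F1: "F * (i1 * x) = i * (f * x)" for x
    by (simp add: F_def distrib_right mult.assoc mult_eq_assoc[OF e11] mult_eq_assoc[OF e21] homD[OF repiD[OF f]])
  have F2: "F * (i2 * x) = g' * x" for x
    by (simp add: F_def distrib_right mult.assoc mult_eq_assoc[OF e22] mult_eq_assoc[OF e12] homD[OF g'(1)])
  have pF: "p * (F * x) = g * (p2 * x)" for x
    by (simp add: F_def distrib_left distrib_right mult.assoc mult_eq_assoc[OF pi] mult_eq_assoc[OF g'(2)])
  have epi: "repi B W F"
  proof (rule repiI[OF hF _ rmoduleD(1)[OF W]])
    fix x assume x: "ide W * x = x"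
    obtain y where y: "ide Q * y = y" "g * y = p * x"
      using repi_surj[OF g, of "p * x"] homD(5)[OF repiD[OF p]] by blast
    have w: "ide W * (x - g' * y) = x - g' * y" by (simp add: right_diff_distrib x homD[OF g'(1)])
    have "p * (x - g' * y) = 0" by (simp add: right_diff_distrib mult_eq_assoc[OF g'(2)] y)
    then obtain a where a: "ide A * a = a" "i * a = x - g' * y" using ex[OF w] by blast
    obtain z where z: "ide P * z = z" "f * z = a" using repi_surj[OF f a(1)] by blast
    have "F * (i1 * z + i2 * y) = x" by (simp add: distrib_left F1 F2 z a)
    moreover have "ide B * (i1 * z + i2 * y) = i1 * z + i2 * y" by (simp add: distrib_left homD(5)[OF h1] homD(5)[OF h2])
    ultimately show "\<exists>y. ide B * y = y \<and> F * y = x" by blast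
  qed
  obtain K j where K: "rses K B W j F" using epi_ses[OF B W epi] by blast
  then have Km: "rmodule K" and j: "rmono K B j" and Fj: "F * j = 0"
    and exK: "\<And>x. ide B * x = x \<Longrightarrow> F * x = 0 \<Longrightarrow> (\<exists>y. ide K * y = y \<and> j * y = x)" by (auto simp: rses_def)
  have hik: "rhom KA B (i1 * kA)" by (rule hom_comp[OF rmonoD[OF kA] h1])
  have "F * (i1 * kA) = 0" by (simp add: F1 fk)
  then obtain u where u: "ide K * u = u" "j * u = i1 * kA" using exK[OF homD(2)[OF hik]] by blast
  have hu: "rhom KA K u" by (rule mono_factor[OF rmoduleD(1)[OF Km] j hik u])
  have hpj: "rhom K Q (p2 * j)" by (rule hom_comp[OF rmonoD[OF j] q2])
  have "g * (p2 * j) = 0" unfolding pF[symmetric] Fj by simp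
  then obtain v where v: "ide KC * v = v" "kC * v = p2 * j" using exC[OF homD(2)[OF hpj]] by blast
  have hv: "rhom K KC v" by (rule mono_factor[OF rmoduleD(1)[OF KC] kC hpj v])
  have jb: "j * x = i1 * (p1 * (j * x)) + i2 * (p2 * (j * x))" for x
  proof -
    have "(i1 * p1 + i2 * p2) * (j * x) = j * x" unfolding sum by (rule homD(5)[OF rmonoD[OF j]])
    then show ?thesis by (simp add: distrib_right mult.assoc)
  qed
  have "rses KA K KC u v"
    unfolding rses_def
  proof (intro conjI allI impI KA Km KC)
    show "rmono KA K u" unfolding rmono_def
    proof (intro conjI allI impI hu)
      fix y assume y: "ide KA * y = y" "u * y = 0"
      then have "i1 * (kA * y) = 0" using mult_eq_assoc[OF u(2), of y] by (simp add: mult.assoc)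
      then have "p1 * (i1 * (kA * y)) = 0" by simp
      then have "kA * y = 0" by (simp add: mult_eq_assoc[OF e11] homD(5)[OF rmonoD[OF kA]])
      then show "y = 0" using kA y(1) unfolding rmono_def by blast
    qed
    show "repi K KC v"
    proof (rule repiI[OF hv _ rmoduleD(1)[OF KC]])
      fix x assume x: "ide KC * x = x"
      let ?y = "kC * x"
      have "p * (g' * ?y) = 0" by (simp add: mult_eq_assoc[OF g'(2)] mult_eq_assoc[OF gk])
      then obtain a where a: "ide A * a = a" "i * a = g' * ?y" using ex[of "g' * ?y"] homD(5)[OF g'(1)] by blast
      obtain z where z: "ide P * z = z" "f * z = a" using repi_surj[OF f a(1)] by blast
      let ?w = "i2 * ?y - i1 * z"
      have "F * ?w = 0" by (simp add: right_diff_distrib F1 F2 z a)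
      moreover have "ide B * ?w = ?w" by (simp add: right_diff_distrib homD(5)[OF h1] homD(5)[OF h2])
      ultimately obtain w where w: "ide K * w = w" "j * w = ?w" using exK by blast
      have "kC * (v * w) = p2 * ?w" using mult_eq_assoc[OF v(2), of w] by (simp add: mult.assoc w)
      also have "\<dots> = kC * x"
        by (simp add: right_diff_distrib mult_eq_assoc[OF e22] mult_eq_assoc[OF e21] homD(5)[OF rmonoD[OF kC]])
      finally have "v * w = x" using rmono_cancel[OF kC _ x] mult_eq_assoc[OF v(1), of w] by blast
      then show "\<exists>y. ide K * y = y \<and> v * y = x" using w by blast
    qed
    have "kC * (v * u) = 0" using mult_eq_assoc[OF v(2), of u] by (simp add: mult.assoc u mult_eq_assoc[OF e21])
    then show "v * u = 0" using kC mult_eq_assoc[OF v(1)] unfolding rmono_def by blast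
    fix x assume x: "ide K * x = x" "v * x = 0"
    have "p2 * (j * x) = 0" using mult_eq_assoc[OF v(2), of x] x by (simp add: mult.assoc)
    then have jx: "j * x = i1 * (p1 * (j * x))" using jb[of x] by simp
    have "i * (f * (p1 * (j * x))) = F * (j * x)" by (subst (2) jx) (simp only: F1)
    also have "\<dots> = 0" by (simp add: mult_eq_assoc[OF Fj])
    finally have "f * (p1 * (j * x)) = 0"
      using i homD(5)[OF repiD[OF f]] unfolding rmono_def by blast
    then obtain y where y: "ide KA * y = y" "kA * y = p1 * (j * x)"
      using exA[of "p1 * (j * x)"] homD(5)[OF q1] by blast
    have "j * (u * y) = j * x" using mult_eq_assoc[OF u(2), of y] jx by (simp add: mult.assoc y)
    then have "u * y = x" using rmono_cancel[OF j _ x(1)] mult_eq_assoc[OF u(1), of y] by blast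
    then show "\<exists>y. ide KA * y = y \<and> u * y = x" using y by blast
  qed
  then show ?thesis using K by blast
qed

lemma biprod_riso:
  assumes "biprod A N Q i1 i2 p1 p2" "biprod A N' Q' j1 j2 r1 r2" "riso N N'"
  shows "riso Q Q'"
proof -
  obtain \<phi> \<psi> where f: "rhom N N' \<phi>" "rhom N' N \<psi>" "\<psi> * \<phi> = ide N" "\<phi> * \<psi> = ide N'"
    using assms(3) by (auto simp: riso_def)
  note a = assms(1)[unfolded biprod_def] and b = assms(2)[unfolded biprod_def]
  have a': "p1 * i1 = ide A" "p2 * i2 = ide N" "p1 * i2 = 0" "p2 * i1 = 0" and sa: "i1 * p1 + i2 * p2 = ide Q"
    and b': "r1 * j1 = ide A" "r2 * j2 = ide N'" "r1 * j2 = 0" "r2 * j1 = 0" and sb: "j1 * r1 + j2 * r2 = ide Q'"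
    and ha: "rhom A Q i1" "rhom N Q i2" "rhom Q A p1" "rhom Q N p2"
    and hb: "rhom A Q' j1" "rhom N' Q' j2" "rhom Q' A r1" "rhom Q' N' r2"
    using a b by auto
  note ea = a'[THEN mult_eq_assoc] and eb = b'[THEN mult_eq_assoc] and ef = f(3,4)[THEN mult_eq_assoc]
  have h1: "rhom Q Q' (j1 * p1 + j2 * (\<phi> * p2))"
    by (intro hom_add hom_comp[OF ha(3) hb(1)] hom_comp[OF _ hb(2)] hom_comp[OF ha(4) f(1)])
  have h2: "rhom Q' Q (i1 * r1 + i2 * (\<psi> * r2))"
    by (intro hom_add hom_comp[OF hb(3) ha(1)] hom_comp[OF _ ha(2)] hom_comp[OF hb(4) f(2)])
  have "(i1 * r1 + i2 * (\<psi> * r2)) * (j1 * p1 + j2 * (\<phi> * p2)) = i1 * p1 + i2 * p2"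
    by (simp add: distrib_left distrib_right mult.assoc eb ef homD[OF f(1)] homD[OF ha(3)] homD[OF ha(4)])
  moreover have "(j1 * p1 + j2 * (\<phi> * p2)) * (i1 * r1 + i2 * (\<psi> * r2)) = j1 * r1 + j2 * r2"
    by (simp add: distrib_left distrib_right mult.assoc ea ef homD[OF f(2)] homD[OF hb(3)] homD[OF hb(4)])
  ultimately show ?thesis unfolding riso_def using h1 h2 sa sb by auto
qed

section \<open>Homomorphisms from projective modules to simple modules\<close>

definition lbl :: "nat \<times> int \<Rightarrow> nat \<Rightarrow> int \<Rightarrow> nat" where
  "lbl x s' t' = (if fst x = s' \<and> q powi (snd x) = q powi t' then 1 else 0)"

lemma ide_V_nz: "1 \<le> s \<Longrightarrow> idm s \<noteq> (0 :: 'k fm)"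
proof
  assume "1 \<le> s" "idm s = (0 :: 'k fm)"
  then have "ent (idm s :: 'k fm) 0 0 = 0" by simp
  then show False using \<open>1 \<le> s\<close> by (simp add: ent_idm)
qed

text \<open>If \<open>f\<close> were nonzero on the kernel of \<open>g\<close>, that kernel would
  map onto V(s,t) and by essentiality be all of \<open>P\<close>. So \<open>f\<close> factors
  through \<open>g\<close>, and the factor between the two simple modules is a nonzero
  scalar.\<close>

lemma cover_hom:
  assumes c: "rcover (V s t) P f" and s: "1 \<le> s" "s \<le> n" "1 \<le> s'" "s' \<le> n"
    and g: "rhom P (V s' t') g" "g \<noteq> 0"
  shows "s = s' \<and> q powi t = q powi t' \<and> (\<exists>\<kappa>. g = \<kappa> *\<^sub>k f)"
proof -
  from c have Vm: "rmodule (V s t)" and P: "rproj P" and f: "repi P (V s t) f"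
    and ess: "\<And>X g r. rmodule X \<Longrightarrow> rhom X P g \<Longrightarrow> f * (g * r) = ide (V s t) \<Longrightarrow> repi X P g"
    by (auto simp: rcover_def)
  have Pm: "rmodule P" by (rule rprojD[OF P])
  have Vm': "rmodule (V s' t')" by (rule rmodule_V[OF s(3,4)])
  have gepi: "repi P (V s' t') g" by (rule V_epi[OF Pm g s(3,4)])
  obtain X j where X: "rses X P (V s' t') j g" using epi_ses[OF Pm Vm' gepi] by blast
  then have Xm: "rmodule X" and j: "rmono X P j" and gj: "g * j = 0"
    and ex: "\<And>x. ide P * x = x \<Longrightarrow> g * x = 0 \<Longrightarrow> (\<exists>y. ide X * y = y \<and> j * y = x)" by (auto simp: rses_def)
  have fj: "f * j = 0"
  proof (rule ccontr)
    assume nz: "f * j \<noteq> 0"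
    have "repi X (V s t) (f * j)"
      by (rule V_epi[OF Xm hom_comp[OF rmonoD[OF j] repiD[OF f]] nz s(1,2)])
    then obtain r where "f * j * r = ide (V s t)" by (rule repiE)
    then have "f * (j * r) = ide (V s t)" by (simp only: mult.assoc)
    from ess[OF Xm rmonoD[OF j] this] have je: "repi X P j" .
    have "g * j = 0 * j" using gj by simp
    from repi_cancel[OF je homD(1)[OF g(1)] _ this] have "g = 0" by simp
    then show False using g(2) by simp
  qed
  have "\<exists>\<phi>. rhom (V s' t') (V s t) \<phi> \<and> \<phi> * g = f"
  proof (rule epi_factor[OF rmoduleD(1)[OF Vm'] rmoduleD(1)[OF Pm] gepi repiD[OF f]])
    fix x assume "ide P * x = x" "g * x = 0"
    then obtain y where "j * y = x" using ex by blast
    then show "f * x = 0" using mult_eq_assoc[OF fj, of y] by simp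
  qed
  then obtain \<phi> where \<phi>: "rhom (V s' t') (V s t) \<phi>" "\<phi> * g = f" by blast
  have "f \<noteq> 0" using f ide_V_nz[OF s(1)] by (auto simp: repi_def)
  then have "\<phi> \<noteq> 0" using \<phi>(2) by auto
  from hom_hwm_V[OF \<phi>(1) this s(3) s(3,4) s(1,2)] obtain \<kappa> where eq: "s' = s" "q powi t' = q powi t"
    and \<kappa>: "\<kappa> \<noteq> 0" "\<phi> * munit 0 0 = \<kappa> *\<^sub>k munit 0 0" by blast
  have VV: "V s' t' = V s t" using hwm_cong[OF eq(2)] eq(1) by simp
  have "\<phi> = \<kappa> *\<^sub>k idm s"
  proof (rule hw_hom_eqI)
    show "rhom (V s t) (V s t) \<phi>" using \<phi>(1) VV by simp
    show "rhom (V s t) (V s t) (\<kappa> *\<^sub>k idm s)"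
      using hom_smul[OF hom_ide[OF rmoduleD(1)[OF Vm]]] by simp
    show "\<phi> * munit 0 0 = \<kappa> *\<^sub>k idm s * munit 0 0" using \<kappa>(2) s by (simp add: idm_munit)
  qed
  then have "f = \<kappa> *\<^sub>k g" using \<phi>(2) homD(2)[OF g(1)] eq(1) by simp
  then have "g = (1 / \<kappa>) *\<^sub>k f" using \<kappa>(1) by simp
  then show ?thesis using eq by auto
qed

lemma hdim_cover:
  assumes c: "rcover (V s t) P f" and s: "1 \<le> s" "s \<le> n" "1 \<le> s'" "s' \<le> n"
  shows "hdim P (V s' t') = lbl (s, t) s' t'"
proof (cases "s = s' \<and> q powi t = q powi t'")
  case True
  then have VV: "V s' t' = V s t" using hwm_cong[of t t'] by simp
  have f: "rhom P (V s t) f" "f \<noteq> 0" using c ide_V_nz[OF s(1)] by (auto simp: rcover_def repi_def)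
  have "{g. rhom P (V s t) g} = range (\<lambda>c. c *\<^sub>k f)"
  proof (intro equalityI subsetI)
    fix g assume "g \<in> {g. rhom P (V s t) g}"
    then show "g \<in> range (\<lambda>c. c *\<^sub>k f)"
      using cover_hom[OF c s(1,2) s(1,2), of t g] by (cases "g = 0") (auto intro: range_eqI[of _ _ 0])
  qed (auto intro: hom_smul[OF f(1)])
  then have "hdim P (V s t) = 1" unfolding hdim_def by (rule dim_line[OF f(2)])
  then show ?thesis using True VV by (simp add: lbl_def)
next
  case False
  then have "hdim P (V s' t') = 0" unfolding hdim_eq_0 using cover_hom[OF c s] by blast
  then show ?thesis using False by (simp add: lbl_def)
qed

lemma cover_V_n: "rcover (V n t) (V n t) (idm n)"
proof -
  have Vn: "rmodule (V n t)" using n_gt_2 by (intro rmodule_V) auto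
  show ?thesis unfolding rcover_def
  proof (intro conjI allI impI Vn rproj_V_n)
    show "repi (V n t) (V n t) (idm n)"
      using hom_ide[OF rmoduleD(1)[OF Vn]] unfolding repi_def by (intro conjI exI[of _ "idm n"]) simp_all
    fix X g r assume "rmodule X \<and> rhom X (V n t) g \<and> idm n * (g * r) = ide (V n t)"
    then have X: "rmodule X" "rhom X (V n t) g" "idm n * (g * r) = idm n" by auto
    have "g * (ide X * r) = ide (V n t)" using X(3) homD[OF X(2)] by simp
    moreover have "ide X * (ide X * r) = ide X * r" by (simp add: premoduleD[OF rmoduleD(1)[OF X(1)]])
    ultimately show "repi X (V n t) g" unfolding repi_def using X(2) by blast
  qed
qed

lemma hdim_tens_V1:
  assumes Q: "rproj Q" and s: "1 \<le> s'" "s' \<le> n"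
  shows "hdim (rtens Q (V 1 u)) (V s' t') = hdim Q (V s' (t' - u))"
proof -
  have V1: "rmodule (V 1 u)" using n_gt_2 by (intro rmodule_V) auto
  have Vs: "rmodule (V s' t')" by (rule rmodule_V[OF s])
  have "riso (V 1 (- u)) (ldual (V 1 u))" using ldual_V_iso[of 1 u] n_gt_2 by simp
  then have "riso (rtens (V s' t') (V 1 (- u))) (rtens (V s' t') (ldual (V 1 u)))"
    by (rule riso_tens[OF riso_refl[OF rmoduleD(1)[OF Vs]]])
  then have "riso (V s' (t' + - u)) (rtens (V s' t') (ldual (V 1 u)))"
    using riso_trans[OF tens_V1_iso[OF s]] by blast
  then show ?thesis
    unfolding hdim_adjoint[OF rprojD[OF Q] V1 Vs] using hdim_iso_right[of _ _ Q] by simp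
qed

text \<open>The adjunction moves V(2,0) to the simple module as its dual V(2,-1), where the
  sequences of \<open>tens_V2_ses\<close> apply. For s' = n there are two Verma modules, each with
  the factors V(n-1,t') and V(1,t'-1); this is the origin of the factor 2.\<close>

lemma hdim_tens_V2:
  assumes Q: "rproj Q" and s: "1 \<le> s'" "s' \<le> n"
  shows "hdim (rtens Q (V 2 0)) (V s' t') =
    (if s' = n then 2 * hdim Q (V (n - 1) t') + 2 * hdim Q (V 1 (t' - 1))
     else hdim Q (V (s' + 1) (t' - 1)) + (if s' = 1 then 0 else hdim Q (V (s' - 1) t')))"
proof -
  have V2: "rmodule (V 2 0)" using n_gt_2 by (intro rmodule_V) auto
  have Vs: "rmodule (V s' t')" by (rule rmodule_V[OF s])
  have "riso (V 2 (- 1)) (ldual (V 2 0))" using ldual_V_iso[of 2 0] n_gt_2 by simp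
  then have "riso (rtens (V s' t') (V 2 (- 1))) (rtens (V s' t') (ldual (V 2 0)))"
    by (rule riso_tens[OF riso_refl[OF rmoduleD(1)[OF Vs]]])
  then have L: "hdim (rtens Q (V 2 0)) (V s' t') = hdim Q (rtens (V s' t') (V 2 (- 1)))"
    unfolding hdim_adjoint[OF rprojD[OF Q] V2 Vs] using hdim_iso_right by metis
  consider "s' = 1" | "2 \<le> s'" "s' < n" | "s' = n" using s by linarith
  then show ?thesis
  proof cases
    case 1
    then have "hdim Q (rtens (V s' t') (V 2 (- 1))) = hdim Q (V 2 (t' + - 1))"
      using hdim_iso_right[OF tens_V2_iso_1[OF s 1, of t' "- 1"]] by simp
    then show ?thesis using L 1 n_gt_2 by (simp add: numeral_2_eq_2)
  next
    case 2
    from tens_V2_ses[OF s 2, of t' "- 1"] obtain i p where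
      "rses (V (s' + 1) (t' + - 1)) (rtens (V s' t') (V 2 (- 1))) (V (s' - 1) (t' + - 1 + 1)) i p" by blast
    from hdim_ses_right[OF Q this] show ?thesis using L 2 by simp
  next
    case 3
    from tens_V2_ses_n[OF s 3, of t' "- 1"] obtain i p where
      "rses (Z 1 (t' + - 1)) (rtens (V s' t') (V 2 (- 1))) (Z (n - 1) (t' + - 1 + 1)) i p" by blast
    from hdim_ses_right[OF Q this] have a: "hdim (rtens Q (V 2 0)) (V s' t') = hdim Q (Z 1 (t' - 1)) + hdim Q (Z (n - 1) t')"
      using L by simp
    have n1: "1 \<le> (1::nat)" "1 < n" "1 \<le> n - 1" "n - 1 < n" using n_gt_2 by auto
    from Z_ses[OF n1(1,2), of "t' - 1"] obtain i p where
      "rses (V (n - 1) (t' - 1 + int 1)) (Z 1 (t' - 1)) (V 1 (t' - 1)) i p" by blast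
    from hdim_ses_right[OF Q this] have b: "hdim Q (Z 1 (t' - 1)) = hdim Q (V (n - 1) t') + hdim Q (V 1 (t' - 1))" by simp
    from Z_ses[OF n1(3,4), of t'] obtain i p where
      "rses (V (n - (n - 1)) (t' + int (n - 1))) (Z (n - 1) t') (V (n - 1) t') i p" by blast
    moreover have "V (n - (n - 1)) (t' + int (n - 1)) = V 1 (t' - 1)"
    proof -
      have "q powi (t' + int (n - 1)) = q powi (t' - 1)" unfolding qpow_eq_iff using n_gt_2 by (simp add: of_nat_diff)
      then show ?thesis using hwm_cong[of "t' + int (n - 1)" "t' - 1"] n_gt_2 by simp
    qed
    ultimately have c: "hdim Q (Z (n - 1) t') = hdim Q (V 1 (t' - 1)) + hdim Q (V (n - 1) t')"
      using hdim_ses_right[OF Q] by metis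
    show ?thesis using 3 a b c by simp
  qed
qed

text \<open>The constants that appear when \<open>a\<close> is moved past powers of \<open>d\<close>
  on the weight space of the generator of V(s,t), see \<open>a_pw_d\<close>. For 1 <= s < n their
  only zeros with 0 <= i < n are 0 and n - s.\<close>

definition theta :: "nat \<Rightarrow> nat \<Rightarrow> 'k" where
  "theta s i = qint i * (1 - q powi (- int s - int i))"

lemma theta_0 [simp]: "theta s 0 = 0" by (simp add: theta_def)

lemma theta_zero: "s < n \<Longrightarrow> theta s (n - s) = 0"
proof -
  assume "s < n"
  then have "q powi (- int s - int (n - s)) = 1" unfolding qpow_eq_1_iff by (simp add: of_nat_diff)
  then show ?thesis by (simp add: theta_def)
qed

lemma theta_nz: "1 \<le> s \<Longrightarrow> s < n \<Longrightarrow> 0 < i \<Longrightarrow> i < n \<Longrightarrow> i \<noteq> n - s \<Longrightarrow> theta s i \<noteq> 0"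
proof -
  assume h: "1 \<le> s" "s < n" "0 < i" "i < n" "i \<noteq> n - s"
  have "\<not> int n dvd (- int s - int i)"
  proof
    assume "int n dvd (- int s - int i)"
    then have "int n dvd - (- int s - int i)" by (simp only: dvd_minus_iff)
    then have "int n dvd int (s + i)" by (simp add: add.commute)
    then have "n dvd s + i" by (simp only: int_dvd_int_iff)
    then obtain k where k: "s + i = n * k" by blast
    have "k = 1"
    proof -
      have "0 < k" using k h by (cases k) auto
      moreover have "k < 2"
      proof (rule ccontr)
        assume "\<not> k < 2"
        then have "n * 2 \<le> n * k" by (intro mult_left_mono) auto
        then show False using k h by linarith
      qed
      ultimately show ?thesis by simp
    qed
    then show False using k h by simp
  qed
  then have "q powi (- int s - int i) \<noteq> 1" by (simp only: qpow_eq_1_iff not_False_eq_True)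
  then show ?thesis using qint_nz[of i] h by (simp add: theta_def)
qed

lemma theta_Suc: "theta s (Suc i) = theta s i + q ^ i * (1 - q powi (- int s - 2 * int i - 1))"
proof -
  let ?y = "q powi (- int s - int (Suc i))"
  have a: "q powi (- int s - int i) = q * ?y"
  proof -
    have "- int s - int i = 1 + (- int s - int (Suc i))" by simp
    then show ?thesis using qpow_add[of 1 "- int s - int (Suc i)"] by (simp only: power_int_1_right)
  qed
  have b: "q ^ i * q powi (- int s - 2 * int i - 1) = ?y"
  proof -
    have "int i + (- int s - 2 * int i - 1) = - int s - int (Suc i)" by simp
    then show ?thesis using qpow_add[of "int i" "- int s - 2 * int i - 1"] by (simp only: power_int_of_nat)
  qed
  have "theta s i + q ^ i * (1 - q powi (- int s - 2 * int i - 1)) = qint i * (1 - q * ?y) + (q ^ i - ?y)"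
    unfolding theta_def a right_diff_distrib[of "q ^ i"] b by simp
  also have "\<dots> = (qint i + q ^ i) - (1 + q * qint i) * ?y" by (simp add: algebra_simps)
  also have "\<dots> = theta s (Suc i)"
    unfolding qint_Suc[symmetric] qint_Suc'[symmetric] theta_def by (simp add: algebra_simps)
  finally show ?thesis by simp
qed

definition adop :: "'k rmod \<Rightarrow> 'k fm" where "adop M = act M Gen_a * act M Gen_d"

lemma wvec_ad: "rmodule M \<Longrightarrow> wvec M t u x \<Longrightarrow> wvec M t u (adop M * x)"
  using wvec_a[OF _ wvec_d] by (fastforce simp: adop_def mult.assoc)

lemma wvec_lin: "wvec M t u x \<Longrightarrow> wvec M t u y \<Longrightarrow> wvec M t u (x - c *\<^sub>k y)"
  by (simp add: wvec_def right_diff_distrib left_diff_distrib fm.scale_right_diff_distrib mult.commute)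

text \<open>Induction on \<open>i\<close>, exchanging \<open>a\<close> with one more
  \<open>d\<close> by \<open>da_wvec\<close> on the weight of \<open>d^(i+1) x\<close>; the
  resulting scalars accumulate to \<open>theta\<close> by \<open>theta_Suc\<close>.\<close>

lemma a_pw_d:
  assumes M: "rmodule M" and x: "wvec M t (1 - t - int s) x"
  shows "act M Gen_a * pw (act M Gen_d) (Suc i) x
    = q powi (- int i) *\<^sub>k pw (act M Gen_d) i (adop M * x - theta s i *\<^sub>k x)"
proof (induction i)
  case 0
  then show ?case by (simp add: adop_def mult.assoc)
next
  case (Suc i)
  let ?d = "act M Gen_d" and ?a = "act M Gen_a"
  let ?y = "pw ?d (Suc i) x"
  let ?c = "1 - q powi (- int s - 2 * int i - 1)"
  have w: "wvec M (t - int (Suc i)) (1 - t - int s - int (Suc i)) ?y" by (rule wvec_pw_d[OF M x])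
  have ex: "t - int (Suc i) + (1 - t - int s - int (Suc i)) = - int s - 2 * int i - 1" by simp
  have "?d * (?a * ?y) = q *\<^sub>k (?a * (?d * ?y)) + ?c *\<^sub>k ?y" using da_wvec[OF M w] unfolding ex .
  then have "q *\<^sub>k (?a * pw ?d (Suc (Suc i)) x) = ?d * (?a * ?y) - ?c *\<^sub>k ?y" by simp
  also have "?d * (?a * ?y) = q powi (- int i) *\<^sub>k pw ?d (Suc i) (adop M * x - theta s i *\<^sub>k x)"
    by (subst Suc) simp
  also have "\<dots> - ?c *\<^sub>k ?y = q powi (- int i) *\<^sub>k pw ?d (Suc i) (adop M * x - theta s (Suc i) *\<^sub>k x)"
  proof -
    have "q powi (- int i) * q ^ i = 1" using qpow_cancel(1)[of "int i"] by simp
    then have c: "?c *\<^sub>k ?y = q powi (- int i) *\<^sub>k pw ?d (Suc i) ((q ^ i * ?c) *\<^sub>k x)"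
      unfolding pw_smul fm.scale_scale mult.assoc[symmetric] by simp
    have "adop M * x - theta s (Suc i) *\<^sub>k x = (adop M * x - theta s i *\<^sub>k x) - (q ^ i * ?c) *\<^sub>k x"
      unfolding theta_Suc by (simp add: fm.scale_left_distrib)
    moreover have "pw ?d (Suc i) (z - z') = pw ?d (Suc i) z - pw ?d (Suc i) z'" for z z'
      using pw_plus[of ?d "Suc i" "z - z'" z'] by simp
    ultimately show ?thesis unfolding c by (simp only: fm.scale_right_diff_distrib)
  qed
  finally have "inverse q *\<^sub>k (q *\<^sub>k (?a * pw ?d (Suc (Suc i)) x))
    = inverse q *\<^sub>k (q powi (- int i) *\<^sub>k pw ?d (Suc i) (adop M * x - theta s (Suc i) *\<^sub>k x))" by simp
  moreover have "inverse q * q powi (- int i) = q powi (- int (Suc i))"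
    using qpow_add[of "- 1" "- int i"] by (simp add: power_int_minus)
  ultimately show ?case using q_nz by (simp only: fm.scale_scale) simp
qed

text \<open>Apply \<open>a_pw_d\<close> first to \<open>adop M * x\<close>, where (ad)^2 x = 0
  leaves only the \<open>theta\<close> term, and then to \<open>x\<close>. Dividing by
  \<open>theta s j\<close> lowers the power of \<open>d\<close> by one.\<close>

lemma ad_descent:
  assumes M: "rmodule M" and x: "wvec M t (1 - t - int s) x" and aa: "adop M * (adop M * x) = 0"
    and th: "theta s j \<noteq> 0"
    and d: "pw (act M Gen_d) (Suc j) x = 0" "pw (act M Gen_d) (Suc j) (adop M * x) = 0"
  shows "pw (act M Gen_d) j x = 0 \<and> pw (act M Gen_d) j (adop M * x) = 0"
proof -
  let ?d = "act M Gen_d"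
  have md: "pw ?d j (z - z') = pw ?d j z - pw ?d j z'" for z z'
    using pw_plus[of ?d j "z - z'" z'] by simp
  have nz: "q powi (- int j) *\<^sub>k z = 0 \<Longrightarrow> z = 0" for z :: "'k fm" using q_nz by simp
  have "q powi (- int j) *\<^sub>k pw ?d j (adop M * (adop M * x) - theta s j *\<^sub>k (adop M * x)) = 0"
    using a_pw_d[OF M wvec_ad[OF M x], of j] d(2) by simp
  then have "pw ?d j (0 - theta s j *\<^sub>k (adop M * x)) = 0" unfolding aa by (rule nz)
  then have 1: "pw ?d j (adop M * x) = 0" using th unfolding md pw_smul by simp
  have "q powi (- int j) *\<^sub>k pw ?d j (adop M * x - theta s j *\<^sub>k x) = 0"
    using a_pw_d[OF M x, of j] d(1) by simp
  then have "pw ?d j (adop M * x - theta s j *\<^sub>k x) = 0" by (rule nz)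
  then have "pw ?d j x = 0" using th 1 unfolding md pw_smul by simp
  then show ?thesis using 1 by simp
qed

lemma ad_descent_range:
  assumes M: "rmodule M" and x: "wvec M t (1 - t - int s) x" and aa: "adop M * (adop M * x) = 0"
    and d: "pw (act M Gen_d) (j + k) x = 0" "pw (act M Gen_d) (j + k) (adop M * x) = 0"
    and th: "\<And>i. j \<le> i \<Longrightarrow> i < j + k \<Longrightarrow> theta s i \<noteq> 0"
  shows "pw (act M Gen_d) j x = 0 \<and> pw (act M Gen_d) j (adop M * x) = 0"
  using d th
proof (induction k)
  case (Suc k)
  have "pw (act M Gen_d) (j + k) x = 0 \<and> pw (act M Gen_d) (j + k) (adop M * x) = 0"
    by (rule ad_descent[OF M x aa]) (use Suc.prems in auto)
  then show ?case using Suc by simp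
qed simp

text \<open>The product of the factors \<open>ad - theta s i\<close> over \<open>i < m\<close> acts on the weight space like
  \<open>a^m d^m\<close>, hence vanishes for \<open>m = n\<close>. Leaving out the two zeros \<open>i = 0\<close> and \<open>i = n - s\<close> of
  \<open>theta s\<close> projects onto the generalized kernel of \<open>ad\<close>.\<close>

primrec adprod :: "'k rmod \<Rightarrow> nat \<Rightarrow> nat set \<Rightarrow> nat \<Rightarrow> 'k fm \<Rightarrow> 'k fm" where
  "adprod M s S 0 x = x"
| "adprod M s S (Suc m) x = adprod M s S m (if m \<in> S then x else adop M * x - theta s m *\<^sub>k x)"

lemma adprod_wvec:
  "rmodule M \<Longrightarrow> wvec M t u x \<Longrightarrow> wvec M t u (adprod M s S m x)"
  by (induction m arbitrary: x) (auto intro: wvec_lin wvec_ad)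

lemma adprod_ad: "adprod M s S m (adop M * x) = adop M * adprod M s S m x"
proof (induction m arbitrary: x)
  case (Suc m)
  have "adop M * (adop M * x) - theta s m *\<^sub>k (adop M * x) = adop M * (adop M * x - theta s m *\<^sub>k x)"
    by (simp add: right_diff_distrib)
  then show ?case using Suc by simp
qed simp

lemma adprod_full:
  assumes M: "rmodule M" and x: "wvec M t (1 - t - int s) x"
  shows "\<exists>\<kappa>. \<kappa> \<noteq> 0 \<and> pw (act M Gen_a) m (pw (act M Gen_d) m x) = \<kappa> *\<^sub>k adprod M s {} m x"
  using x
proof (induction m arbitrary: x)
  case 0
  then show ?case by (intro exI[of _ 1]) simp
next
  case (Suc m)
  let ?L = "adop M * x - theta s m *\<^sub>k x"
  have "wvec M t (1 - t - int s) ?L" by (intro wvec_lin wvec_ad M Suc(2))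
  from Suc.IH[OF this] obtain \<kappa> where \<kappa>: "\<kappa> \<noteq> 0"
    "pw (act M Gen_a) m (pw (act M Gen_d) m ?L) = \<kappa> *\<^sub>k adprod M s {} m ?L" by blast
  have "pw (act M Gen_a) (Suc m) (pw (act M Gen_d) (Suc m) x)
      = pw (act M Gen_a) m (act M Gen_a * pw (act M Gen_d) (Suc m) x)" by (rule pw_Suc')
  also have "\<dots> = (q powi (- int m) * \<kappa>) *\<^sub>k adprod M s {} m ?L"
    unfolding a_pw_d[OF M Suc(2)] pw_smul \<kappa>(2) by simp
  finally show ?case using \<kappa>(1) q_nz by (intro exI[of _ "q powi (- int m) * \<kappa>"]) simp
qed

lemma adprod_split:
  assumes "\<And>i. i \<in> S \<Longrightarrow> theta s i = 0"
  shows "adprod M s {} m x = pw (adop M) (card {i. i < m \<and> i \<in> S}) (adprod M s S m x)"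
proof (induction m arbitrary: x)
  case (Suc m)
  show ?case
  proof (cases "m \<in> S")
    case True
    have "{i. i < Suc m \<and> i \<in> S} = insert m {i. i < m \<and> i \<in> S}" using True by (auto simp: less_Suc_eq)
    then have "card {i. i < Suc m \<and> i \<in> S} = Suc (card {i. i < m \<and> i \<in> S})" by simp
    then show ?thesis using True assms[OF True] Suc[of "adop M * x"]
      by (simp add: adprod_ad pw_Suc' del: pw.simps)
  next
    case False
    have "{i. i < Suc m \<and> i \<in> S} = {i. i < m \<and> i \<in> S}" using False by (auto simp: less_Suc_eq)
    then show ?thesis using False Suc by simp
  qed
qed simp

lemma adprod_hom:
  assumes "rhom M N f" "f * x = v" "adop N * v = 0"
  shows "f * adprod M s S m x = (\<Prod>i\<in>{..<m} - S. - theta s i) *\<^sub>k v"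
  using assms(2,3)
proof (induction m arbitrary: x v)
  case (Suc m)
  note h = homD[OF assms(1)]
  show ?case
  proof (cases "m \<in> S")
    case True
    then have "{..<Suc m} - S = {..<m} - S" by (auto simp: less_Suc_eq)
    then show ?thesis using True Suc by simp
  next
    case False
    have fx: "f * (adop M * x - theta s m *\<^sub>k x) = (- theta s m) *\<^sub>k v"
      using Suc.prems by (simp add: right_diff_distrib adop_def mult.assoc h)
    have "adop N * ((- theta s m) *\<^sub>k v) = 0" using Suc.prems by simp
    from Suc.IH[OF fx this]
    have "f * adprod M s S m (adop M * x - theta s m *\<^sub>k x) = (\<Prod>i\<in>{..<m} - S. - theta s i) *\<^sub>k ((- theta s m) *\<^sub>k v)" .
    moreover have "{..<Suc m} - S = insert m ({..<m} - S)" using False by auto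
    ultimately show ?thesis using False by (simp add: mult.commute)
  qed
qed simp

text \<open>A weight preimage of the generator is corrected by \<open>adprod\<close> with the zeros
  of \<open>theta\<close> left out. The full product vanishes because \<open>d^n = 0\<close>, so
  (ad)^2 kills the result, and its image is the generator times the product of the remaining nonzero
  \<open>- theta s i\<close>.\<close>

lemma cover_generator:
  assumes c: "rcover (V s t) P f" and s: "1 \<le> s" "s < n"
  shows "\<exists>x \<kappa>. wvec P t (1 - t - int s) x \<and> adop P * (adop P * x) = 0 \<and> \<kappa> \<noteq> 0 \<and> f * x = \<kappa> *\<^sub>k munit 0 0"
proof -
  from c have Vm: "rmodule (V s t)" and P: "rmodule P" and f: "repi P (V s t) f"
    by (auto simp: rcover_def dest: rprojD)
  have wv: "wvec (V s t) t (1 - t - int s) (munit 0 0)" using s by (simp add: wvec_def hw_col idm_munit)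
  obtain x0 where x0: "wvec P t (1 - t - int s) x0" "f * x0 = munit 0 0" using wvec_lift[OF P Vm f wv] by blast
  let ?S = "{0, n - s}"
  let ?x = "adprod P s ?S n x0"
  have "pw (act P Gen_d) n x0 = 0"
    using rmoduleD(10)[OF P] pw_mult[of "act P Gen_d" n "ide P" x0] wvecD(1)[OF x0(1)] by simp
  then have "adprod P s {} n x0 = 0" using adprod_full[OF P x0(1), of n] by auto
  moreover have "{i. i < n \<and> i \<in> ?S} = ?S" using s by auto
  then have "card {i. i < n \<and> i \<in> ?S} = 2" using s by simp
  moreover have "theta s i = 0" if "i \<in> ?S" for i using that theta_zero[OF s(2)] by auto
  ultimately have aa: "adop P * (adop P * ?x) = 0"
    using adprod_split[of ?S s P n x0] by (simp add: numeral_2_eq_2)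
  have "adop (V s t) * munit 0 0 = 0" using s by (simp add: adop_def mult.assoc hw_col)
  from adprod_hom[OF repiD[OF f] x0(2) this]
  have fx: "f * ?x = (\<Prod>i\<in>{..<n} - ?S. - theta s i) *\<^sub>k munit 0 0" .
  have "(\<Prod>i\<in>{..<n} - ?S. - theta s i) \<noteq> 0" using theta_nz[OF s] by auto
  then show ?thesis using adprod_wvec[OF P x0(1)] aa fx by blast
qed

text \<open>\<open>d^(n-s) x\<close> is a highest weight vector generating an image \<open>K\<close>
  of Z(n - s, t + s). Modulo \<open>K\<close> the vector \<open>x\<close> itself becomes a highest
  weight vector, which gives the map from Z(s,t). That these surjections are isomorphisms needs the
  dimension of \<open>P\<close> and is shown in \<open>PP_ses\<close>.\<close>

lemma cover_filtration:
  assumes c: "rcover (V s t) P f" and s: "1 \<le> s" "s < n"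
  shows "\<exists>K C j p u g. rses K P C j p \<and> repi (Z (n - s) (t + int s)) K u \<and> repi (Z s t) C g"
proof -
  obtain x \<kappa> where x: "wvec P t (1 - t - int s) x" "adop P * (adop P * x) = 0" "\<kappa> \<noteq> 0"
    "f * x = \<kappa> *\<^sub>k munit 0 0" using cover_generator[OF assms] by blast
  from c have P: "rmodule P" by (auto simp: rcover_def dest: rprojD)
  have nil: "pw (act M Gen_d) n y = 0" "pw (act M Gen_a) n y = 0" if "rmodule M" "ide M * y = y" for M y
    using rmoduleD(7,10)[OF that(1)] pw_mult[of "act M Gen_d" n "ide M" y] pw_mult[of "act M Gen_a" n "ide M" y] that(2)
    by simp_all
  \<comment> \<open>Descent from \<open>d^n = 0\<close>; it stops at n - s + 1 because
    \<open>theta s (n - s)\<close> vanishes.\<close>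
  have "pw (act P Gen_d) (n - s + 1) x = 0 \<and> pw (act P Gen_d) (n - s + 1) (adop P * x) = 0"
  proof (rule ad_descent_range[OF P x(1,2), of _ "s - 1"])
    have e: "n - s + 1 + (s - 1) = n" using s by simp
    show "pw (act P Gen_d) (n - s + 1 + (s - 1)) x = 0" unfolding e by (rule nil[OF P wvecD(1)[OF x(1)]])
    show "pw (act P Gen_d) (n - s + 1 + (s - 1)) (adop P * x) = 0"
      unfolding e by (rule nil[OF P wvecD(1)[OF wvec_ad[OF P x(1)]]])
    fix i assume "n - s + 1 \<le> i" "i < n - s + 1 + (s - 1)"
    then show "theta s i \<noteq> 0" using s by (intro theta_nz) auto
  qed
  then have dz: "pw (act P Gen_d) (Suc (n - s)) x = 0" by simp
  let ?y = "pw (act P Gen_d) (n - s) x"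
  have hy: "hwvec P (n - s) (t + int s) ?y"
    unfolding hwvec_def
  proof
    show "wvec P (t + int s) (1 - (t + int s) - int (n - s)) ?y"
    proof (rule wvec_cong[OF wvec_pw_d[OF P x(1)]])
      show "q powi (t - int (n - s)) = q powi (t + int s)" unfolding qpow_eq_iff using s by (simp add: of_nat_diff)
      show "q powi (1 - t - int s - int (n - s)) = q powi (1 - (t + int s) - int (n - s))" by (simp add: algebra_simps)
    qed
    show "act P Gen_d * ?y = 0" using dz by simp
  qed
  have n1: "1 \<le> n" using n_gt_2 by simp
  from hw_hom[OF P hy nil(2)[OF P] n1] hy obtain u where u: "rhom (Z (n - s) (t + int s)) P u"
    "\<And>j. j < n \<Longrightarrow> u * munit j 0 = pw (act P Gen_a) j ?y" by (auto simp: hwvec_def wvec_def)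
  have u0: "u * munit 0 0 = ?y" using u(2)[of 0] n_gt_2 by simp
  have Zm: "rmodule (Z s' t')" for s' t' by (rule rmodule_Z)
  obtain C p where C: "rmodule C" "repi P C p" "p * u = 0"
    "\<And>x. ide P * x = x \<Longrightarrow> p * x = 0 \<Longrightarrow> \<exists>y. idm n * y = y \<and> u * y = x"
    using cokernel[OF P u(1) Zm] by auto
  note hp = homD[OF repiD[OF C(2)]]
  obtain K j where K: "rses K P C j p" using epi_ses[OF P C(1,2)] by blast
  then have Km: "rmodule K" and j: "rmono K P j"
    and ex: "\<And>x. ide P * x = x \<Longrightarrow> p * x = 0 \<Longrightarrow> (\<exists>y. ide K * y = y \<and> j * y = x)" by (auto simp: rses_def)
  obtain u' where u': "ide K * u' = u'" "j * u' = u" using ex[OF homD(2)[OF u(1)] C(3)] by blast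
  have hu': "rhom (Z (n - s) (t + int s)) K u'" by (rule mono_factor[OF rmoduleD(1)[OF Km] j u(1) u'])
  have eu: "repi (Z (n - s) (t + int s)) K u'"
  proof (rule repiI[OF hu' _ rmoduleD(1)[OF Km]])
    fix z assume z: "ide K * z = z"
    have "ide P * (j * z) = j * z" by (rule homD(5)[OF rmonoD[OF j]])
    moreover have "p * (j * z) = 0" using K by (simp add: rses_def mult_eq_assoc)
    ultimately obtain y where y: "idm n * y = y" "u * y = j * z" using C(4) by blast
    have "j * (u' * y) = j * z" using mult_eq_assoc[OF u'(2), of y] y by simp
    then have "u' * y = z" using rmono_cancel[OF j _ z] mult_eq_assoc[OF u'(1), of y] by blast
    then show "\<exists>y. ide (Z (n - s) (t + int s)) * y = y \<and> u' * y = z" using y by auto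
  qed
  have adp: "p * (adop P * z) = adop C * (p * z)" for z by (simp add: adop_def mult.assoc hp)
  have wx: "wvec C t (1 - t - int s) (p * x)"
    using x(1) unfolding wvec_def by (simp add: hp(5) hp(6)[symmetric] mult.assoc)
  have aax: "adop C * (adop C * (p * x)) = 0" unfolding adp[symmetric] x(2) by simp
  have pwp: "pw (act C Gen_d) i (p * z) = p * pw (act P Gen_d) i z" for i z
    by (rule pw_intertwine[OF hp(3), symmetric])
  have d1: "pw (act C Gen_d) (n - s) (p * x) = 0"
    unfolding pwp u0[symmetric] using mult_eq_assoc[OF C(3)] by simp
  \<comment> \<open>At i = n - s the \<open>theta\<close> term of \<open>a_pw_d\<close> is absent,
    so the hypothesis on \<open>adop C\<close> for the second descent follows from the one on
    \<open>p * x\<close>.\<close>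
  have d2: "pw (act C Gen_d) (n - s) (adop C * (p * x)) = 0"
  proof -
    have "pw (act C Gen_d) (Suc (n - s)) (p * x) = 0" using d1 by simp
    then have "q powi (- int (n - s)) *\<^sub>k pw (act C Gen_d) (n - s) (adop C * (p * x) - theta s (n - s) *\<^sub>k (p * x)) = 0"
      using a_pw_d[OF C(1) wx, of "n - s"] by simp
    then show ?thesis using q_nz by (simp add: theta_zero[OF s(2)])
  qed
  have "pw (act C Gen_d) 1 (p * x) = 0 \<and> pw (act C Gen_d) 1 (adop C * (p * x)) = 0"
  proof (rule ad_descent_range[OF C(1) wx aax, of _ "n - s - 1"])
    have e: "1 + (n - s - 1) = n - s" using s by simp
    show "pw (act C Gen_d) (1 + (n - s - 1)) (p * x) = 0" unfolding e by (rule d1)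
    show "pw (act C Gen_d) (1 + (n - s - 1)) (adop C * (p * x)) = 0" unfolding e by (rule d2)
    fix i assume "1 \<le> i" "i < 1 + (n - s - 1)"
    then show "theta s i \<noteq> 0" using s by (intro theta_nz) auto
  qed
  then have hx: "hwvec C s t (p * x)" using wx by (simp add: hwvec_def)
  from hw_hom[OF C(1) hx nil(2)[OF C(1)] n1] wx obtain g where g: "rhom (Z s t) C g"
    "\<And>j. j < n \<Longrightarrow> g * munit j 0 = pw (act C Gen_a) j (p * x)" by (auto simp: wvec_def)
  have g0: "g * munit 0 0 = p * x" using g(2)[of 0] n_gt_2 by simp
  obtain C' p' where C': "rmodule C'" "repi C C' p'" "p' * g = 0"
    "\<And>x. ide C * x = x \<Longrightarrow> p' * x = 0 \<Longrightarrow> \<exists>y. idm n * y = y \<and> g * y = x"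
    using cokernel[OF C(1) g(1) Zm] by auto
  \<comment> \<open>A simple quotient of \<open>C'\<close> would give a nonzero map from
    \<open>P\<close>, hence a nonzero multiple of \<open>f\<close>; but this map kills
    \<open>x\<close>, while \<open>f * x\<close> is nonzero.\<close>
  have "ide C' = 0"
  proof (rule ccontr)
    assume "ide C' \<noteq> 0"
    from top_hom[OF C'(1) this] obtain s' t' k where k: "1 \<le> s'" "s' \<le> n" "rhom C' (V s' t') k" "k \<noteq> 0" by blast
    have pp: "repi P C' (p' * p)" by (rule repi_comp[OF C(2) C'(2)])
    have h: "rhom P (V s' t') (k * (p' * p))" by (rule hom_comp[OF repiD[OF pp] k(3)])
    have "k * (p' * p) \<noteq> 0"
    proof
      assume "k * (p' * p) = 0"
      then have "k * (p' * p) = 0 * (p' * p)" by simp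
      from repi_cancel[OF pp homD(1)[OF k(3)] _ this] k(4) show False by simp
    qed
    from cover_hom[OF c s(1) _ k(1,2) h this] s obtain \<kappa>' where \<kappa>': "k * (p' * p) = \<kappa>' *\<^sub>k f" by auto
    have "k * (p' * p) * x = k * (p' * (g * munit 0 0))" by (simp add: mult.assoc g0)
    also have "\<dots> = 0" using mult_eq_assoc[OF C'(3)] by simp
    finally have "(\<kappa>' * \<kappa>) *\<^sub>k munit 0 0 = (0 :: 'k fm)" unfolding \<kappa>' by (simp add: x(4))
    then have "\<kappa>' = 0" using x(3) by simp
    then show False using \<kappa>' \<open>k * (p' * p) \<noteq> 0\<close> by simp
  qed
  then have "p' = 0" using homD(2)[OF repiD[OF C'(2)]] by simp
  then have "repi (Z s t) C g" using C'(4) by (intro repiI[OF g(1) _ rmoduleD(1)[OF C(1)]]) auto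
  then show ?thesis using K eu by blast
qed

end

section \<open>Syzygies of simple modules\<close>

text \<open>An arbitrary family of covers, because the theorem determines \<open>P\<close> only
  through the covering property.\<close>

locale taft_covers = taft_double n q for n :: nat and q :: "'k::field" +
  fixes PP :: "nat \<Rightarrow> int \<Rightarrow> 'k rmod"
  assumes cover: "\<And>s t. 1 \<le> s \<Longrightarrow> s \<le> n \<Longrightarrow> \<exists>f. rcover (V s t) (PP s t) f"
begin

lemma PP_proj: "1 \<le> s \<Longrightarrow> s \<le> n \<Longrightarrow> rproj (PP s t)"
  using cover by (auto simp: rcover_def)

lemma hdim_PP:
  "1 \<le> s \<Longrightarrow> s \<le> n \<Longrightarrow> 1 \<le> s' \<Longrightarrow> s' \<le> n \<Longrightarrow> hdim (PP s t) (V s' t') = lbl (s, t) s' t'"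
  using cover[of s t] hdim_cover by blast

text \<open>A nonzero map from \<open>Q\<close> to V(s,t) lifts to the cover, is onto by
  essentiality, and splits because the cover is projective.\<close>

lemma peel:
  assumes Q: "rproj Q" and s: "1 \<le> s" "s \<le> n" and h: "hdim Q (V s t) \<noteq> 0"
  shows "\<exists>N i1 i2 p1 p2. rproj N \<and> biprod (PP s t) N Q i1 i2 p1 p2"
proof -
  have Qm: "rmodule Q" by (rule rprojD[OF Q])
  obtain f where c: "rcover (V s t) (PP s t) f" using cover[OF s] by blast
  then have Vm: "rmodule (V s t)" and P: "rproj (PP s t)" and f: "repi (PP s t) (V s t) f"
    and ess: "\<And>X g r. rmodule X \<Longrightarrow> rhom X (PP s t) g \<Longrightarrow> f * (g * r) = ide (V s t) \<Longrightarrow> repi X (PP s t) g"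
    by (auto simp: rcover_def)
  have Pm: "rmodule (PP s t)" by (rule rprojD[OF P])
  obtain g where g: "rhom Q (V s t) g" "g \<noteq> 0" using h by (auto simp: hdim_eq_0)
  obtain r where r: "g * r = ide (V s t)" using V_epi[OF Qm g s] by (rule repiE)
  obtain e where e: "rhom Q (PP s t) e" "f * e = g" by (rule rproj_lift[OF Q Pm Vm f g(1)])
  have "f * (e * r) = ide (V s t)" using r e(2) by (simp add: mult.assoc[symmetric])
  from ess[OF Qm e(1) this] have epi: "repi Q (PP s t) e" .
  obtain i where i: "rhom (PP s t) Q i" "e * i = ide (PP s t)"
    by (rule rproj_lift[OF P Qm Pm epi hom_ide[OF rmoduleD(1)[OF Pm]]])
  obtain N i2 p2 where N: "rmodule N" "biprod (PP s t) N Q i i2 e p2"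
    using retract_biprod[OF Pm Qm i(1) e(1) i(2)] by blast
  have "rproj N"
    by (rule rproj_retract[OF Q N(1), of i2 p2]) (use N(2) in \<open>auto simp: biprod_def\<close>)
  then show ?thesis using N(2) by blast
qed

lemma rk_biprod:
  assumes "biprod M N B i1 i2 p1 p2" "rmodule M" "rmodule N" "rmodule B" shows "rk B = rk M + rk N"
  using rk_ses[OF biprod_rses[OF assms]] .

lemma rk_PP_pos: "1 \<le> s \<Longrightarrow> s \<le> n \<Longrightarrow> rk (PP s t) > 0"
proof -
  assume s: "1 \<le> s" "s \<le> n"
  obtain f where "rcover (V s t) (PP s t) f" using cover[OF s] by blast
  then have "rk (V s t) \<le> rk (PP s t)"
    by (intro rk_epi_le[of _ _ f]) (auto simp: rcover_def dest: rprojD)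
  then show ?thesis using s by simp
qed

lemma hdim_zero_ide: "ide Q = 0 \<Longrightarrow> hdim Q X = 0"
  unfolding hdim_eq_0 by (auto dest: homD(1))

text \<open>Induction on the dimension: both modules have a common simple quotient, hence a common
  summand, and the complements again have equal Hom dimensions.\<close>

theorem proj_iso:
  assumes "rproj Q" "rproj Q'"
    and "\<And>s t. 1 \<le> s \<Longrightarrow> s \<le> n \<Longrightarrow> hdim Q (V s t) = hdim Q' (V s t)"
  shows "riso Q Q'"
  using assms
proof (induction "rk Q" arbitrary: Q Q' rule: less_induct)
  case less
  note Q = rprojD[OF less(2)] and Q' = rprojD[OF less(3)]
  show ?case
  proof (cases "ide Q = 0")
    case True
    have "ide Q' = 0"
    proof (rule ccontr)
      assume "ide Q' \<noteq> 0"
      from top_hom[OF Q' this] obtain s t f where st: "1 \<le> s" "s \<le> n" "rhom Q' (V s t) f" "f \<noteq> 0" by blast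
      then have "hdim Q' (V s t) \<noteq> 0" by (auto simp: hdim_eq_0)
      then show False using less(4)[OF st(1,2)] hdim_zero_ide[OF True] by simp
    qed
    then show ?thesis using True by (auto simp: riso_def intro!: exI[of _ 0])
  next
    case False
    from top_hom[OF Q this] obtain s t f where st: "1 \<le> s" "s \<le> n" "rhom Q (V s t) f" "f \<noteq> 0" by blast
    then have h: "hdim Q (V s t) \<noteq> 0" by (auto simp: hdim_eq_0)
    obtain N i1 i2 p1 p2 where N: "rproj N" "biprod (PP s t) N Q i1 i2 p1 p2"
      using peel[OF less(2) st(1,2) h] by blast
    have h': "hdim Q' (V s t) \<noteq> 0" using h less(4)[OF st(1,2)] by simp
    obtain N' j1 j2 r1 r2 where N': "rproj N'" "biprod (PP s t) N' Q' j1 j2 r1 r2"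
      using peel[OF less(3) st(1,2) h'] by blast
    have Pm: "rmodule (PP s t)" by (rule rprojD[OF PP_proj[OF st(1,2)]])
    have "rk N < rk Q" using rk_biprod[OF N(2) Pm rprojD[OF N(1)] Q] rk_PP_pos[OF st(1,2), of t] by simp
    moreover have "hdim N (V s' t') = hdim N' (V s' t')" if "1 \<le> s'" "s' \<le> n" for s' t'
      using less(4)[OF that, of t'] hdim_biprod_left[OF N(2), of "V s' t'"] hdim_biprod_left[OF N'(2), of "V s' t'"] by simp
    ultimately have "riso N N'" using less(1) N(1) N'(1) by blast
    then show ?thesis by (rule biprod_riso[OF N(2) N'(2)])
  qed
qed

text \<open>The peeling of \<open>proj_iso\<close> along a given list of labels; it turns Hom
  dimensions into dimensions of modules.\<close>

lemma rk_of_labels: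
  assumes "rproj Q" "\<forall>x\<in>set xs. 1 \<le> fst x \<and> fst x \<le> n"
    and "\<And>s' t'. 1 \<le> s' \<Longrightarrow> s' \<le> n \<Longrightarrow> hdim Q (V s' t') = (\<Sum>x\<leftarrow>xs. lbl x s' t')"
  shows "rk Q = (\<Sum>x\<leftarrow>xs. rk (PP (fst x) (snd x)))"
  using assms
proof (induction xs arbitrary: Q)
  case Nil
  note Q = rprojD[OF Nil(1)]
  have "ide Q = 0"
  proof (rule ccontr)
    assume "ide Q \<noteq> 0"
    from top_hom[OF Q this] obtain s t f where st: "1 \<le> s" "s \<le> n" "rhom Q (V s t) f" "f \<noteq> 0" by blast
    then have "hdim Q (V s t) \<noteq> 0" by (auto simp: hdim_eq_0)
    then show False using Nil(3)[OF st(1,2)] by simp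
  qed
  then show ?case using rk_eq_0[OF premoduleD(1)[OF rmoduleD(1)[OF Q]]] by simp
next
  case (Cons x xs)
  obtain s t where x: "x = (s, t)" by (cases x)
  have st: "1 \<le> s" "s \<le> n" using Cons.prems(2) x by auto
  have "hdim Q (V s t) \<noteq> 0" using Cons.prems(3)[OF st, of t] x by (simp add: lbl_def)
  from peel[OF Cons.prems(1) st this] obtain N i1 i2 p1 p2 where N: "rproj N" "biprod (PP s t) N Q i1 i2 p1 p2" by blast
  have "rk N = (\<Sum>x\<leftarrow>xs. rk (PP (fst x) (snd x)))"
  proof (rule Cons.IH[OF N(1)])
    fix s' t' assume s': "1 \<le> s'" "s' \<le> n"
    show "hdim N (V s' t') = (\<Sum>x\<leftarrow>xs. lbl x s' t')"
      using Cons.prems(3)[OF s', of t'] hdim_biprod_left[OF N(2), of "V s' t'"] hdim_PP[OF st s', of t t'] x by simp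
  qed (use Cons.prems(2) in auto)
  then show ?case
    using rk_biprod[OF N(2) rprojD[OF PP_proj[OF st]] rprojD[OF N(1)] rprojD[OF Cons.prems(1)]] x by simp
qed

lemma rk_PP_n: "rk (PP n t) = n"
proof -
  have n: "1 \<le> n" "n \<le> n" using n_gt_2 by auto
  have "riso (V n t) (PP n t)"
    by (rule proj_iso[OF rproj_V_n PP_proj[OF n]]) (use hdim_cover[OF cover_V_n n] hdim_PP[OF n] in simp)
  then show ?thesis using rk_iso by fastforce
qed

lemma lbl_cong: "q powi t = q powi t'' \<Longrightarrow> lbl (s, t) s' t' = lbl (s, t'') s' t'"
  by (simp add: lbl_def)

lemma qpow_shift: "q powi (t + c) = q powi t' \<longleftrightarrow> q powi t = q powi (t' - c)"
  by (simp add: qpow_eq_iff algebra_simps)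

lemma rmodule_V2: "rmodule (V 2 u)" using n_gt_2 by (intro rmodule_V) auto

text \<open>Downward induction on s. Tensoring P(s+1,t-1) with V(2,0) doubles the dimension and
  gives P(s,t) if s + 1 = n, P(s,t) with two copies of P(n,t-1) if s + 2 = n, and P(s,t) with
  P(s+2,t-1) otherwise. In each case 2n is left for P(s,t).\<close>

lemma rk_PP_aux:
  assumes "1 \<le> s" "s < n" shows "rk (PP s t) = 2 * n"
  using assms
proof (induction "n - s" arbitrary: s t rule: less_induct)
  case less
  have s1: "1 \<le> s + 1" "s + 1 \<le> n" using less.prems by auto
  let ?Q = "rtens (PP (s + 1) (t - 1)) (V 2 0)"
  have P: "rproj (PP (s + 1) (t - 1))" by (rule PP_proj[OF s1])
  have Q: "rproj ?Q" by (rule rproj_tens[OF P rmodule_V2])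
  have rkQ: "rk ?Q = 2 * rk (PP (s + 1) (t - 1))"
    by (subst rk_tens) (use rmoduleD(1)[OF rprojD[OF P]] rmoduleD(1)[OF rmodule_V2] in simp_all)
  have t1: "q powi (t - 1) = q powi (t' - 1) \<longleftrightarrow> q powi t = q powi t'" for t'
    by (simp add: qpow_eq_iff)
  have H: "hdim ?Q (V s' t') = (if s' = n then 2 * lbl (s + 1, t - 1) (n - 1) t' + 2 * lbl (s + 1, t - 1) 1 (t' - 1)
     else lbl (s + 1, t - 1) (s' + 1) (t' - 1) + (if s' = 1 then 0 else lbl (s + 1, t - 1) (s' - 1) t'))"
    if s': "1 \<le> s'" "s' \<le> n" for s' t'
  proof -
    note h = hdim_PP[OF s1, simplified]
    show ?thesis unfolding hdim_tens_V2[OF P s'] using s' n_gt_2 by (auto simp: h)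
  qed
  consider "s + 1 = n" | "s + 2 = n" | "s + 2 < n" using less.prems by linarith
  then show ?case
  proof cases
    case 1
    have "rk ?Q = (\<Sum>x\<leftarrow>[(s, t)]. rk (PP (fst x) (snd x)))"
    proof (rule rk_of_labels[OF Q])
      fix s' t' assume s': "1 \<le> s'" "s' \<le> n"
      show "hdim ?Q (V s' t') = (\<Sum>x\<leftarrow>[(s, t)]. lbl x s' t')"
        unfolding H[OF s'] using 1 s' less.prems n_gt_2 by (auto simp: lbl_def t1)
    qed (use less.prems in auto)
    then show ?thesis using rkQ 1 rk_PP_n[of "t - 1"] by simp
  next
    case 2
    have "rk (PP (s + 1) (t - 1)) = 2 * n" by (rule less.hyps) (use less.prems 2 in auto)
    moreover have "rk ?Q = (\<Sum>x\<leftarrow>[(s, t), (n, t - 1), (n, t - 1)]. rk (PP (fst x) (snd x)))"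
    proof (rule rk_of_labels[OF Q])
      fix s' t' assume s': "1 \<le> s'" "s' \<le> n"
      show "hdim ?Q (V s' t') = (\<Sum>x\<leftarrow>[(s, t), (n, t - 1), (n, t - 1)]. lbl x s' t')"
        unfolding H[OF s'] using 2 s' less.prems n_gt_2 by (auto simp: lbl_def t1)
    qed (use less.prems in auto)
    ultimately show ?thesis using rkQ rk_PP_n[of "t - 1"] by simp
  next
    case 3
    have "rk (PP (s + 1) (t - 1)) = 2 * n" "rk (PP (s + 2) (t - 1)) = 2 * n"
      by (rule less.hyps; use less.prems 3 in auto)+
    moreover have "rk ?Q = (\<Sum>x\<leftarrow>[(s, t), (s + 2, t - 1)]. rk (PP (fst x) (snd x)))"
    proof (rule rk_of_labels[OF Q])
      fix s' t' assume s': "1 \<le> s'" "s' \<le> n"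
      show "hdim ?Q (V s' t') = (\<Sum>x\<leftarrow>[(s, t), (s + 2, t - 1)]. lbl x s' t')"
        unfolding H[OF s'] using 3 s' less.prems n_gt_2 by (auto simp: lbl_def t1)
    qed (use less.prems 3 in auto)
    ultimately show ?thesis using rkQ by simp
  qed
qed

text \<open>The two layers of \<open>cover_filtration\<close> have dimension at most n and together
  2n, so both surjections from Verma modules are isomorphisms.\<close>

lemma PP_ses:
  assumes s: "1 \<le> s" "s < n"
  shows "\<exists>i p. rses (Z (n - s) (t + int s)) (PP s t) (Z s t) i p"
proof -
  have sn: "s \<le> n" using s by simp
  obtain f where c: "rcover (V s t) (PP s t) f" using cover[OF s(1) sn] by blast
  obtain K C j p u g where K: "rses K (PP s t) C j p" and u: "repi (Z (n - s) (t + int s)) K u"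
    and g: "repi (Z s t) C g" using cover_filtration[OF c s] by blast
  from K have Km: "rmodule K" and Cm: "rmodule C" by (auto simp: rses_def)
  have "rk K \<le> n" "rk C \<le> n"
    using rk_epi_le[OF rmodule_Z Km u] rk_epi_le[OF rmodule_Z Cm g] by simp_all
  moreover have "rk K + rk C = 2 * n" using rk_ses[OF K] rk_PP_aux[OF s] by simp
  ultimately have "rk K = n" "rk C = n" by linarith+
  then have "riso (Z (n - s) (t + int s)) K" "riso (Z s t) C"
    using epi_rk_iso(2)[OF rmodule_Z Km u] epi_rk_iso(2)[OF rmodule_Z Cm g] by simp_all
  from rses_iso_left[OF K rmodule_Z this(1)] rses_iso_right[OF _ rmodule_Z riso_sym[OF this(2)]]
  show ?thesis by blast
qed

text \<open>The label of the submodule V(n - s, t + s) of the Verma module with top V(s,t). It is an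
  involution up to a multiple of n in the second entry, see \<open>bar_bar\<close>.\<close>

definition bar :: "nat \<times> int \<Rightarrow> nat \<times> int" where "bar x = (n - fst x, snd x + int (fst x))"
text \<open>The label of all simple quotients of an m-th syzygy; it alternates because taking
  kernels passes from the tops of Verma modules to their socles.\<close>

definition top_lbl :: "nat \<Rightarrow> nat \<times> int \<Rightarrow> nat \<times> int" where "top_lbl m x = (if even m then x else bar x)"

abbreviation VL :: "nat \<times> int \<Rightarrow> 'k rmod" where "VL x \<equiv> V (fst x) (snd x)"
abbreviation ZL :: "nat \<times> int \<Rightarrow> 'k rmod" where "ZL x \<equiv> Z (fst x) (snd x)"
abbreviation PL :: "nat \<times> int \<Rightarrow> 'k rmod" where "PL x \<equiv> PP (fst x) (snd x)"
abbreviation rngL :: "nat \<times> int \<Rightarrow> bool" where "rngL x \<equiv> 1 \<le> fst x \<and> fst x < n"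

lemma rng_bar: "rngL x \<Longrightarrow> rngL (bar x)" by (auto simp: bar_def)
lemma rng_top: "rngL x \<Longrightarrow> rngL (top_lbl m x)" by (auto simp: top_lbl_def bar_def)

lemma bar_bar:
  assumes "rngL x"
  shows "VL (bar (bar x)) = VL x" "ZL (bar (bar x)) = ZL x" "lbl (bar (bar x)) s' t' = lbl x s' t'"
proof -
  have f: "fst (bar (bar x)) = fst x" using assms by (simp add: bar_def)
  have p: "q powi (snd (bar (bar x))) = q powi (snd x)"
    unfolding qpow_eq_iff using assms by (simp add: bar_def of_nat_diff)
  show "VL (bar (bar x)) = VL x" "ZL (bar (bar x)) = ZL x" using hwm_cong[OF p] f by simp_all
  show "lbl (bar (bar x)) s' t' = lbl x s' t'" using f p by (simp add: lbl_def)
qed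

lemma top_lbl_bar:
  assumes "rngL x"
  shows "ZL (top_lbl m (bar x)) = ZL (top_lbl (Suc m) x)" "lbl (top_lbl m (bar x)) s' t' = lbl (top_lbl (Suc m) x) s' t'"
    "ZL (bar (top_lbl m x)) = ZL (top_lbl (Suc m) x)"
  using bar_bar[OF assms] by (simp_all add: top_lbl_def)

text \<open>The class \<open>GW m x\<close> contains the \<open>m\<close>-th syzygies of the simple module with label \<open>x\<close>: such a
  syzygy is an iterated extension of Verma modules ending in a simple module, and it is tracked
  through the resolution by the horseshoe lemma. The resolutions obtained in this way are minimal
  because the tops of consecutive syzygies have different labels.\<close>

primrec GW :: "nat \<Rightarrow> nat \<times> int \<Rightarrow> 'k rmod \<Rightarrow> bool" where
  "GW 0 x W \<longleftrightarrow> rmodule W \<and> riso (VL x) W"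
| "GW (Suc m) x W \<longleftrightarrow> (\<exists>W' i p. GW m (bar x) W' \<and> rses (ZL (top_lbl (Suc m) x)) W W' i p)"

text \<open>The Verma layer is covered by one further P with kernel the linked Verma module, and the
  horseshoe combines this with the resolution of the rest. \<open>Q\<close> is not yet known to be a
  projective cover; the count of its simple quotients is recorded for that purpose.\<close>

lemma GW_cover:
  assumes "rngL x" "GW m x W"
  shows "\<exists>K Q i f. rses K Q W i f \<and> rproj Q \<and> GW (Suc m) x K \<and>
    (\<forall>s' t'. 1 \<le> s' \<longrightarrow> s' \<le> n \<longrightarrow> hdim Q (V s' t') = (m + 1) * lbl (top_lbl m x) s' t')"
  using assms
proof (induction m arbitrary: x W)
  case 0
  obtain s t where x: "x = (s, t)" by (cases x)
  have s: "1 \<le> s" "s < n" "s \<le> n" using 0(1) x by auto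
  have W: "rmodule W" "riso (V s t) W" using 0(2) x by auto
  obtain i p where a: "rses (Z (n - s) (t + int s)) (PP s t) (Z s t) i p" using PP_ses[OF s(1,2)] by blast
  obtain i' p' where b: "rses (V (n - s) (t + int s)) (Z s t) (V s t) i' p'" using Z_ses[OF s(1,2)] by blast
  obtain K j u v where K: "rses K (PP s t) (V s t) j (p' * p)" "rses (Z (n - s) (t + int s)) K (V (n - s) (t + int s)) u v"
    using ses_comp[OF a b] by blast
  obtain f where "rses K (PP s t) W j f" using rses_iso_right[OF K(1) W] by blast
  moreover have "GW (Suc 0) x K"
  proof -
    have "rmodule (V (n - s) (t + int s))" using s by (intro rmodule_V) auto
    then have "GW 0 (bar x) (V (n - s) (t + int s))"
      using riso_refl[OF rmoduleD(1)] by (simp add: x bar_def)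
    moreover have "ZL (top_lbl (Suc 0) x) = Z (n - s) (t + int s)" by (simp add: x bar_def top_lbl_def)
    ultimately show ?thesis using K(2) unfolding GW.simps(2)[of 0] by metis
  qed
  moreover have "hdim (PP s t) (V s' t') = (0 + 1) * lbl (top_lbl 0 x) s' t'" if "1 \<le> s'" "s' \<le> n" for s' t'
    using hdim_PP[OF s(1,3) that] by (simp add: x top_lbl_def)
  ultimately show ?case using PP_proj[OF s(1,3)] by blast
next
  case (Suc m)
  let ?y = "top_lbl (Suc m) x"
  have y: "rngL ?y" by (rule rng_top[OF Suc.prems(1)])
  have y': "1 \<le> fst ?y" "fst ?y \<le> n" "fst ?y < n" using y by auto
  obtain W' i p where W': "GW m (bar x) W'" "rses (ZL ?y) W W' i p" using Suc.prems(2) by auto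
  obtain K' Q' k g where K': "rses K' Q' W' k g" "rproj Q'" "GW (Suc m) (bar x) K'"
    "\<And>s' t'. 1 \<le> s' \<Longrightarrow> s' \<le> n \<Longrightarrow> hdim Q' (V s' t') = (m + 1) * lbl (top_lbl m (bar x)) s' t'"
    using Suc.IH[OF rng_bar[OF Suc.prems(1)] W'(1)] by blast
  obtain i' p' where a: "rses (ZL (bar ?y)) (PL ?y) (ZL ?y) i' p'"
    using PP_ses[OF y'(1,3), of "snd ?y"] by (auto simp: bar_def)
  have PLm: "rmodule (PL ?y)" by (rule rprojD[OF PP_proj[OF y'(1,2)]])
  obtain B i1 i2 p1 p2 where B: "rmodule B" "biprod (PL ?y) Q' B i1 i2 p1 p2"
    using biprod_exists[OF PLm rprojD[OF K'(2)]] by blast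
  obtain K j F u v where K: "rses K B W j F" "rses (ZL (bar ?y)) K K' u v"
    using horseshoe[OF W'(2) a K'(1,2) B(2,1)] by blast
  have "rproj B" by (rule rproj_biprod[OF PP_proj[OF y'(1,2)] K'(2) B(2,1)])
  moreover have "GW (Suc (Suc m)) x K"
    using K(2) K'(3) top_lbl_bar(3)[OF Suc.prems(1), of "Suc m"] unfolding GW.simps(2)[of "Suc m"] by metis
  moreover have "hdim B (V s' t') = (Suc m + 1) * lbl ?y s' t'" if "1 \<le> s'" "s' \<le> n" for s' t'
    using hdim_biprod_left[OF B(2), of "V s' t'"] K'(4)[OF that, of t'] hdim_PP[OF y'(1,2) that, of "snd ?y" t']
      top_lbl_bar(2)[OF Suc.prems(1), of m s' t'] by simp
  ultimately show ?case using K(1) by blast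
qed

lemma lbl_nz: "lbl x s' t' \<noteq> 0 \<longleftrightarrow> fst x = s' \<and> q powi (snd x) = q powi t'"
  by (simp add: lbl_def)

text \<open>All layers of \<open>W\<close>, Verma or simple, have the same top label. A map to
  another simple module vanishes on the first layer, hence factors through the rest.\<close>

lemma GW_hom_zero:
  assumes "rngL x" "GW m x W" "1 \<le> s'" "s' \<le> n" "lbl (top_lbl m x) s' t' = 0" "rhom W (V s' t') g"
  shows "g = 0"
  using assms
proof (induction m arbitrary: x W g)
  case 0
  obtain f where f: "rmono (VL x) W f" "repi (VL x) W f" using riso_mono_epi 0(2) by (metis GW.simps(1))
  have "g * f = 0"
  proof (rule ccontr)
    assume nz: "g * f \<noteq> 0"
    have h: "rhom (VL x) (V s' t') (g * f)" by (rule hom_comp[OF rmonoD[OF f(1)] 0(6)])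
    have "1 \<le> fst x" "fst x \<le> n" using 0(1) by auto
    from hom_hwm_V(1,2)[OF h nz this(1) this 0(3,4)] show False using 0(5) by (simp add: lbl_def top_lbl_def)
  qed
  then have "g * f = 0 * f" by simp
  from repi_cancel[OF f(2) homD(1)[OF 0(6)] _ this] show ?case by simp
next
  case (Suc m)
  let ?y = "top_lbl (Suc m) x"
  obtain W' i p where W': "GW m (bar x) W'" "rses (ZL ?y) W W' i p" using Suc.prems(2) by auto
  then have i: "rmono (ZL ?y) W i" and p: "repi W W' p" and Wm: "rmodule W" "rmodule W'"
    and ex: "\<And>x. ide W * x = x \<Longrightarrow> p * x = 0 \<Longrightarrow> (\<exists>z. ide (ZL ?y) * z = z \<and> i * z = x)" by (auto simp: rses_def)
  have gi: "g * i = 0"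
  proof (rule ccontr)
    assume nz: "g * i \<noteq> 0"
    have h: "rhom (ZL ?y) (V s' t') (g * i)" by (rule hom_comp[OF rmonoD[OF i] Suc.prems(6)])
    have "1 \<le> n" "1 \<le> fst ?y" "fst ?y \<le> n" using rng_top[OF Suc.prems(1), of "Suc m"] n_gt_2 by auto
    from hom_hwm_V(1,2)[OF h nz this Suc.prems(3,4)] show False using Suc.prems(5) by (simp add: lbl_def)
  qed
  have "\<exists>v. rhom W' (V s' t') v \<and> v * p = g"
  proof (rule epi_factor[OF rmoduleD(1)[OF Wm(2)] rmoduleD(1)[OF Wm(1)] p Suc.prems(6)])
    fix z assume "ide W * z = z" "p * z = 0"
    then obtain y where "i * y = z" using ex by blast
    then show "g * z = 0" using mult_eq_assoc[OF gi, of y] by simp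
  qed
  then obtain v where v: "rhom W' (V s' t') v" "v * p = g" by blast
  have "v = 0"
    by (rule Suc.IH[OF rng_bar[OF Suc.prems(1)] W'(1) Suc.prems(3,4) _ v(1)])
      (use Suc.prems(5) top_lbl_bar(2)[OF Suc.prems(1), of m s' t'] in simp)
  then show ?case using v(2) by simp
qed

text \<open>A label and its \<open>bar\<close> differ even when 2s = n, because t and t + s are not
  congruent modulo n for 0 < s < n.\<close>

lemma top_lbl_distinct:
  assumes "rngL x" "lbl (top_lbl m x) s' t' \<noteq> 0" shows "lbl (top_lbl (Suc m) x) s' t' = 0"
proof (rule ccontr)
  assume "lbl (top_lbl (Suc m) x) s' t' \<noteq> 0"
  with assms(2) have "fst x = n - fst x" "q powi (snd x) = q powi (snd x + int (fst x))"
    unfolding lbl_nz top_lbl_def bar_def by (auto split: if_splits)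
  then have "int n dvd (snd x - (snd x + int (fst x)))" by (simp only: qpow_eq_iff)
  then have "int n dvd int (fst x)" by simp
  then have "n dvd fst x" by (simp only: int_dvd_int_iff)
  then show False using assms(1) by (auto dest: dvd_imp_le)
qed

lemma GW_iso: "GW (Suc m) x K \<Longrightarrow> riso K K' \<Longrightarrow> rmodule K' \<Longrightarrow> GW (Suc m) x K'"
  unfolding GW.simps using rses_iso_mid by blast

text \<open>The true cover \<open>P0\<close> is a summand of the \<open>Q\<close> built in
  \<open>GW_cover\<close>. Once the complement \<open>N\<close> is seen to vanish, \<open>Q\<close>
  and \<open>P0\<close> are isomorphic over \<open>W\<close>, and so are the kernels.\<close>

lemma GW_syzygy:
  assumes x: "rngL x" and W: "GW m x W" and c: "rcover W P0 f0" and K0: "rses K0 P0 W i0 f0"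
  shows "GW (Suc m) x K0"
proof -
  obtain K Q i f where K: "rses K Q W i f" and Q: "rproj Q" and GK: "GW (Suc m) x K"
    and hQ: "\<And>s' t'. 1 \<le> s' \<Longrightarrow> s' \<le> n \<Longrightarrow> hdim Q (V s' t') = (m + 1) * lbl (top_lbl m x) s' t'"
    using GW_cover[OF x W] by blast
  from K have Km: "rmodule K" and Qm: "rmodule Q" and Wm: "rmodule W" and i: "rmono K Q i" and f: "repi Q W f" and fi: "f * i = 0"
    and ex: "\<And>x. ide Q * x = x \<Longrightarrow> f * x = 0 \<Longrightarrow> (\<exists>z. ide K * z = z \<and> i * z = x)" by (auto simp: rses_def)
  from K0 have K0m: "rmodule K0" and P0m: "rmodule P0" and i0: "rmono K0 P0 i0" and fi0: "f0 * i0 = 0"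
    and ex0: "\<And>x. ide P0 * x = x \<Longrightarrow> f0 * x = 0 \<Longrightarrow> (\<exists>z. ide K0 * z = z \<and> i0 * z = x)" by (auto simp: rses_def)
  from c have P0: "rproj P0" and f0: "repi P0 W f0"
    and ess: "\<And>X g r. rmodule X \<Longrightarrow> rhom X P0 g \<Longrightarrow> f0 * (g * r) = ide W \<Longrightarrow> repi X P0 g"
    by (auto simp: rcover_def)
  obtain g where g: "rhom Q P0 g" "f0 * g = f" by (rule rproj_lift[OF Q P0m Wm f0 repiD[OF f]])
  obtain r where "f * r = ide W" using f by (rule repiE)
  then have "f0 * (g * r) = ide W" using g(2) by (simp add: mult.assoc[symmetric])
  from ess[OF Qm g(1) this] have epi: "repi Q P0 g" .
  obtain h where h: "rhom P0 Q h" "g * h = ide P0"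
    by (rule rproj_lift[OF P0 Qm P0m epi hom_ide[OF rmoduleD(1)[OF P0m]]])
  obtain N i2 p2 where N: "rmodule N" "biprod P0 N Q h i2 g p2"
    using retract_biprod[OF P0m Qm h(1) g(1) h(2)] by blast
  then have b: "rhom N Q i2" "rhom Q N p2" "p2 * i2 = ide N" "g * i2 = 0" "h * g + i2 * p2 = ide Q"
    by (auto simp: biprod_def)
  \<comment> \<open>A simple quotient of \<open>N\<close> has the top label of \<open>W\<close>, so
    the induced map on \<open>Q\<close> vanishes on \<open>K\<close>, whose top label is the other
    one. But \<open>N\<close> lies in the kernel of \<open>f\<close>, the image of \<open>K\<close>,
    so the quotient map would be 0.\<close>
  have "ide N = 0"
  proof (rule ccontr)
    assume "ide N \<noteq> 0"
    from top_hom[OF N(1) this] obtain s' t' k where k: "1 \<le> s'" "s' \<le> n" "rhom N (V s' t') k" "k \<noteq> 0" by blast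
    have hk: "rhom Q (V s' t') (k * p2)" by (rule hom_comp[OF b(2) k(3)])
    have kk: "k * p2 * i2 = k" by (simp add: mult.assoc b(3) homD(1)[OF k(3)])
    then have "k * p2 \<noteq> 0" using k(4) by auto
    then have "hdim Q (V s' t') \<noteq> 0" using hk by (auto simp: hdim_eq_0)
    then have "lbl (top_lbl m x) s' t' \<noteq> 0" using hQ[OF k(1,2), of t'] by auto
    then have "lbl (top_lbl (Suc m) x) s' t' = 0" by (rule top_lbl_distinct[OF x])
    from GW_hom_zero[OF x GK k(1,2) this hom_comp[OF rmonoD[OF i] hk]] have z: "k * p2 * i = 0" .
    have "f * i2 = 0" using g(2) b(4) by (metis mult.assoc mult_zero_right)
    then obtain y where "i * y = i2" using ex[OF homD(2)[OF b(1)]] by blast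
    then have "k * p2 * i2 = k * p2 * i * y" by (simp add: mult.assoc)
    then show False using kk z k(4) by simp
  qed
  then have "i2 = 0" using homD(1)[OF b(1)] by simp
  then have hg: "h * g = ide Q" using b(5) by simp
  have fh: "f * h = f0"
    unfolding g(2)[symmetric] mult.assoc h(2) by (rule homD(1)[OF repiD[OF f0]])
  have hgi: "rhom K P0 (g * i)" by (rule hom_comp[OF rmonoD[OF i] g(1)])
  have "f0 * (g * i) = 0" by (simp add: mult_eq_assoc[OF g(2)] fi)
  then obtain u where u: "ide K0 * u = u" "i0 * u = g * i" using ex0[OF homD(2)[OF hgi]] by blast
  have hu: "rhom K K0 u" by (rule mono_factor[OF rmoduleD(1)[OF K0m] i0 hgi u])
  have um: "rmono K K0 u" unfolding rmono_def
  proof (intro conjI allI impI hu)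
    fix y assume y: "ide K * y = y" "u * y = 0"
    then have "g * (i * y) = 0" using mult_eq_assoc[OF u(2), of y] by (simp add: mult.assoc)
    then have "h * (g * (i * y)) = 0" by simp
    then have "i * y = 0" by (simp add: mult_eq_assoc[OF hg] homD(5)[OF rmonoD[OF i]])
    then show "y = 0" using i y(1) unfolding rmono_def by blast
  qed
  have ue: "repi K K0 u"
  proof (rule repiI[OF hu _ rmoduleD(1)[OF K0m]])
    fix z assume z: "ide K0 * z = z"
    have "f * (h * (i0 * z)) = 0" by (simp add: mult_eq_assoc[OF fh] mult_eq_assoc[OF fi0])
    then obtain y where y: "ide K * y = y" "i * y = h * (i0 * z)"
      using ex[of "h * (i0 * z)"] homD(5)[OF h(1)] by blast
    have "i0 * (u * y) = g * (i * y)" using mult_eq_assoc[OF u(2), of y] by (simp add: mult.assoc)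
    also have "\<dots> = i0 * z" by (simp add: y mult_eq_assoc[OF h(2)] homD(5)[OF rmonoD[OF i0]])
    finally have "u * y = z" using rmono_cancel[OF i0 _ z] mult_eq_assoc[OF u(1), of y] by blast
    then show "\<exists>y. ide K * y = y \<and> u * y = z" using y by blast
  qed
  have "riso K K0" by (rule mono_epi_iso[OF rmoduleD(1)[OF Km] rmoduleD(1)[OF K0m] um ue])
  then show ?thesis using GW_iso[OF GK _ K0m] by blast
qed

definition rsyz :: "'k rmod \<Rightarrow> 'k rmod \<Rightarrow> bool" where
  "rsyz M K \<longleftrightarrow> (\<exists>P f i. rcover M P f \<and> rses K P M i f)"

lemma rsyz_GW:
  assumes "rngL x" "(rsyz ^^ m) M W" "GW 0 x M" shows "GW m x W"
  using assms(2)
proof (induction m arbitrary: W)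
  case (Suc m)
  then obtain W1 where W1: "(rsyz ^^ m) M W1" "rsyz W1 W" by auto
  then obtain P f i where "rcover W1 P f" "rses W P W1 i f" unfolding rsyz_def by blast
  then show ?case by (rule GW_syzygy[OF assms(1) Suc.IH[OF W1(1)]])
qed (use assms(3) in simp)

text \<open>Stands in for counting composition factors. It is applied to the Hom dimensions of
  \<open>rtens (PP l r)\<close>, and for cosyzygies to the same function composed with
  \<open>flip\<close>.\<close>

lemma GW_additive:
  fixes \<mu> :: "'k rmod \<Rightarrow> nat"
  assumes "rngL x" "GW m x W"
    and ses: "\<And>A B C i p. rses A B C i p \<Longrightarrow> \<mu> B = \<mu> A + \<mu> C"
    and iso: "\<And>A B. riso A B \<Longrightarrow> rmodule A \<Longrightarrow> rmodule B \<Longrightarrow> \<mu> A = \<mu> B"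
  shows "\<mu> W = (m + (if even m then 1 else 0)) * \<mu> (VL x) + (m + (if odd m then 1 else 0)) * \<mu> (VL (bar x))"
  using assms(1,2)
proof (induction m arbitrary: x W)
  case 0
  have "rmodule (VL x)" using 0(1) by (intro rmodule_V) auto
  then show ?case using iso[of "VL x" W] 0(2) by simp
next
  case (Suc m)
  let ?y = "top_lbl (Suc m) x"
  obtain W' i p where W': "GW m (bar x) W'" "rses (ZL ?y) W W' i p" using Suc.prems(2) by auto
  have Zb: "\<mu> (ZL z) = \<mu> (VL (bar z)) + \<mu> (VL z)" if z: "rngL z" for z
  proof -
    obtain i p where "rses (VL (bar z)) (ZL z) (VL z) i p" using Z_ses[of "fst z" "snd z"] z by (auto simp: bar_def)
    then show ?thesis by (rule ses)
  qed
  have "\<mu> (ZL ?y) = \<mu> (VL x) + \<mu> (VL (bar x))"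
    using Zb[OF rng_top[OF Suc.prems(1)], of "Suc m"] bar_bar(1)[OF Suc.prems(1)] by (simp add: top_lbl_def)
  moreover have "\<mu> W = \<mu> (ZL ?y) + \<mu> W'" by (rule ses[OF W'(2)])
  moreover note Suc.IH[OF rng_bar[OF Suc.prems(1)] W'(1)] bar_bar(1)[OF Suc.prems(1)]
  ultimately show ?case by (simp add: algebra_simps)
qed

end

section \<open>Multiplicities\<close>

context taft_double
begin

definition ilbl :: "int \<Rightarrow> int \<Rightarrow> nat \<Rightarrow> int \<Rightarrow> int" where
  "ilbl p t s' t' = (if p = int s' \<and> q powi t = q powi t' then 1 else 0)"

text \<open>For \<open>p > 0\<close> this is the class of \<open>P(p,t)\<close>; the values for \<open>p \<le> 0\<close> are chosen such that tensoring
  with \<open>V(2,0)\<close> takes the class at \<open>(p,t)\<close> to the sum of the classes at \<open>(p+1,t)\<close> and \<open>(p-1,t+1)\<close>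
  throughout.\<close>

definition vlbl :: "int \<Rightarrow> int \<Rightarrow> nat \<Rightarrow> int \<Rightarrow> int" where
  "vlbl p t s' t' = (if p > 0 then ilbl p t s' t' else 2 * ilbl (int n + p) t s' t' - ilbl (- p) (t + p) s' t')"

text \<open>The right side of \<open>hdim_tens_V2\<close> as an operator on multiplicity
  functions.\<close>

definition tensor2 :: "(nat \<Rightarrow> int \<Rightarrow> int) \<Rightarrow> nat \<Rightarrow> int \<Rightarrow> int" where
  "tensor2 F s' t' = (if s' = n then 2 * F (n - 1) t' + 2 * F 1 (t' - 1)
     else F (s' + 1) (t' - 1) + (if s' = 1 then 0 else F (s' - 1) t'))"

lemma tensor2_sum: "tensor2 (\<lambda>s' t'. \<Sum>i\<in>S. F i s' t') s' t' = (\<Sum>i\<in>S. tensor2 (F i) s' t')"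
  by (simp add: tensor2_def sum.distrib sum_distrib_left)

lemma int_lbl: "int (lbl x s' t') = ilbl (int (fst x)) (snd x) s' t'"
  by (simp add: lbl_def ilbl_def)

text \<open>A case check over s' = n, s' = 1 and the rest. The range of \<open>p\<close> keeps both
  p - 1 and p + 1 strictly between -n and n.\<close>

lemma tensor2_vlbl:
  assumes s: "1 \<le> s'" "s' \<le> n" and p: "- int n + 1 < p" "p < int n - 1"
  shows "tensor2 (vlbl p t) s' t' = vlbl (p + 1) t s' t' + vlbl (p - 1) (t + 1) s' t'"
proof -
  have c1: "q powi a = q powi (t' - 1) \<longleftrightarrow> q powi (a + 1) = q powi t'" for a
    by (simp add: qpow_eq_iff algebra_simps)
  have c2: "t + 1 + (p - 1) = t + p" "t + (p + 1) = t + p + 1" by simp_all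
  define b0 where "b0 = (q powi t = q powi t')"
  define b1 where "b1 = (q powi (t + 1) = q powi t')"
  define c0 where "c0 = (q powi (t + p) = q powi t')"
  define d1 where "d1 = (q powi (t + p + 1) = q powi t')"
  note b = b0_def[symmetric] b1_def[symmetric] c0_def[symmetric] d1_def[symmetric]
  \<comment> \<open>Near p = 0, where the definition of \<open>vlbl\<close> changes, some of the
    four congruences coincide.\<close>
  have pm: "p = -1 \<Longrightarrow> d1 = b0" "p = 0 \<Longrightarrow> c0 = b0" "p = 0 \<Longrightarrow> d1 = b1" "p = 1 \<Longrightarrow> c0 = b1"
    by (simp_all add: b0_def b1_def c0_def d1_def)
  consider "s' = n" | "s' = 1" "s' \<noteq> n" | "s' \<noteq> 1" "s' \<noteq> n" by blast
  then show ?thesis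
  proof cases
    case 1
    then show ?thesis unfolding tensor2_def vlbl_def ilbl_def c1 c2 b
      using p n_gt_2 pm by (auto split: if_splits)
  next
    case 2
    then show ?thesis unfolding tensor2_def vlbl_def ilbl_def c1 c2 b
      using p n_gt_2 pm by (auto split: if_splits)
  next
    case 3
    then show ?thesis unfolding tensor2_def vlbl_def ilbl_def c1 c2 b
      using p s n_gt_2 pm by (auto split: if_splits)
  qed
qed

text \<open>The reflection i -> l + k - 1 - i exchanges p and -p. The terms subtracted for p <= 0
  therefore cancel the positive terms with i >= l, and the doubled terms remain.\<close>

lemma vlbl_fold:
  assumes l: "1 \<le> l" "l \<le> k" and s: "1 \<le> s'"
  shows "(\<Sum>i<k. vlbl (int l + int k - 1 - 2 * int i) (v + int i) s' t') =
    (\<Sum>i<l. ilbl (int l + int k - 1 - 2 * int i) (v + int i) s' t') +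
    (\<Sum>i\<in>{(l + k) div 2..<k}. 2 * ilbl (int n + int l + int k - 1 - 2 * int i) (v + int i) s' t')"
proof -
  define h where "h = (l + k) div 2"
  have h: "l \<le> h" "h \<le> k" using l by (auto simp: h_def)
  define e where "e i = ilbl (int l + int k - 1 - 2 * int i) (v + int i) s' t'" for i
  define g where "g i = ilbl (int n + int l + int k - 1 - 2 * int i) (v + int i) s' t'" for i
  define m where "m i = ilbl (- (int l + int k - 1 - 2 * int i)) (v + int i + (int l + int k - 1 - 2 * int i)) s' t'" for i
  have e0: "e i = 0" if "l + k \<le> 2 * i + 1" for i using that s by (auto simp: e_def ilbl_def)
  have "(\<Sum>i<k. vlbl (int l + int k - 1 - 2 * int i) (v + int i) s' t')
      = (\<Sum>i<k. if i < h then e i else 2 * g i - m i)"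
  proof (rule sum.cong[OF refl])
    fix i
    have "int l + int k - 1 - 2 * int i > 0 \<longleftrightarrow> i < h" unfolding h_def by presburger
    then show "vlbl (int l + int k - 1 - 2 * int i) (v + int i) s' t' = (if i < h then e i else 2 * g i - m i)"
      by (simp add: vlbl_def e_def g_def m_def algebra_simps)
  qed
  also have "\<dots> = (\<Sum>i<h. e i) + (\<Sum>i\<in>{h..<k}. 2 * g i - m i)"
  proof -
    have "{..<k} = {..<h} \<union> {h..<k}" using h by auto
    then have "(\<Sum>i<k. if i < h then e i else 2 * g i - m i) = (\<Sum>i<h. if i < h then e i else 2 * g i - m i)
       + (\<Sum>i\<in>{h..<k}. if i < h then e i else 2 * g i - m i)" by (simp add: sum.union_disjoint ivl_disj_int)
    then show ?thesis by simp
  qed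
  also have "(\<Sum>i\<in>{h..<k}. 2 * g i - m i) = (\<Sum>i\<in>{h..<k}. 2 * g i) - (\<Sum>i\<in>{h..<k}. m i)"
    by (simp add: sum_subtractf)
  also have "(\<Sum>i\<in>{h..<k}. m i) = (\<Sum>j\<in>{l..<l + k - h}. e j)"
  proof (rule sum.reindex_bij_witness[of _ "\<lambda>j. l + k - 1 - j" "\<lambda>i. l + k - 1 - i"])
    fix i assume i: "i \<in> {h..<k}"
    then have "int (l + k - 1 - i) = int l + int k - 1 - int i" using l by (auto simp: of_nat_diff)
    then show "e (l + k - 1 - i) = m i" by (simp add: e_def m_def algebra_simps)
  qed (use h l in auto)
  also have "\<dots> = (\<Sum>j\<in>{l..<h}. e j)"
  proof (cases "even (l + k)")
    case True
    then obtain c where "l + k = 2 * c" by (rule evenE)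
    then have "l + k - h = h" by (simp add: h_def)
    then show ?thesis by simp
  next
    case False
    then obtain c where c: "l + k = 2 * c + 1" by (rule oddE)
    then have "h = c" by (simp add: h_def)
    \<comment> \<open>For odd l + k the middle index \<open>h\<close> belongs to p = 0, whose term
      is 0.\<close>
    with c have "l + k - h = Suc h" "l + k = 2 * h + 1" by simp_all
    then show ?thesis using h e0[of h] by (simp add: atLeastLessThanSuc)
  qed
  also have "(\<Sum>i<h. e i) = (\<Sum>i<l. e i) + (\<Sum>j\<in>{l..<h}. e j)"
  proof -
    have "{..<h} = {..<l} \<union> {l..<h}" using h by auto
    then show ?thesis by (simp add: sum.union_disjoint ivl_disj_int)
  qed
  finally show ?thesis unfolding e_def g_def h_def by simp
qed

end

context taft_covers
begin

text \<open>V(k-1,u) \<otimes> V(2,0) has the layers V(k,u) and V(k-2,u+1). So the sum for k - 1,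
  with each term replaced by its two neighbours, minus the sum for k - 2, telescopes to the sum for
  k.\<close>

lemma hdim_tens_V:
  assumes l: "1 \<le> l" and k: "1 \<le> k" "l + k \<le> n" and s: "1 \<le> s'" "s' \<le> n"
  shows "int (hdim (rtens (PP l r) (V k u)) (V s' t')) =
    (\<Sum>i<k. vlbl (int l + int k - 1 - 2 * int i) (r + u + int i) s' t')"
  using k s
proof (induction k arbitrary: u s' t' rule: less_induct)
  case (less k)
  have ln: "1 \<le> l" "l \<le> n" using l less.prems by auto
  note P = PP_proj[OF ln]
  have pm: "premodule (PP l r)" by (rule rmoduleD(1)[OF rprojD[OF P]])
  show ?case
  proof (cases "k = 1")
    case True
    have "hdim (rtens (PP l r) (V 1 u)) (V s' t') = lbl (l, r) s' (t' - u)"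
      unfolding hdim_tens_V1[OF P less.prems(3,4)] by (rule hdim_PP[OF ln less.prems(3,4)])
    moreover have "q powi r = q powi (t' - u) \<longleftrightarrow> q powi (r + u) = q powi t'" by (simp add: qpow_shift)
    ultimately show ?thesis using True l by (simp add: lbl_def vlbl_def ilbl_def)
  next
    case False
    define j where "j = k - 1"
    have j: "k = j + 1" "1 \<le> j" "j < k" "l + j \<le> n" "j \<le> n" "j < n" using False less.prems l by (auto simp: j_def)
    let ?Q = "rtens (PP l r) (V j u)"
    let ?T = "rtens (V j u) (V 2 0)"
    have Vj: "rmodule (V j u)" by (rule rmodule_V[OF j(2,5)])
    have Vs: "rmodule (V s' t')" by (rule rmodule_V[OF less.prems(3,4)])
    have Q: "rproj ?Q" by (rule rproj_tens[OF P Vj])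
    define G where "G i = vlbl (int l + int k - 1 - 2 * int i) (r + u + int i) s' t'" for i
    have "hdim (rtens (PP l r) ?T) (V s' t') = hdim (rtens ?Q (V 2 0)) (V s' t')"
      using hdim_iso_left[OF rtens_assoc[OF pm rmoduleD(1)[OF Vj] rmoduleD(1)[OF rmodule_V2]]] by simp
    also have "int \<dots> = tensor2 (\<lambda>s' t'. \<Sum>i<j. vlbl (int l + int j - 1 - 2 * int i) (r + u + int i) s' t') s' t'"
      unfolding hdim_tens_V2[OF Q less.prems(3,4)] tensor2_def
      using less.IH[OF j(3,2,4)] less.prems(3,4) n_gt_2 by auto
    also have "\<dots> = (\<Sum>i<j. tensor2 (vlbl (int l + int j - 1 - 2 * int i) (r + u + int i)) s' t')"
      by (rule tensor2_sum)
    also have "\<dots> = (\<Sum>i<j. G i + G (Suc i))"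
    proof (rule sum.cong[OF refl])
      fix i assume i: "i \<in> {..<j}"
      have "tensor2 (vlbl (int l + int j - 1 - 2 * int i) (r + u + int i)) s' t'
          = vlbl (int l + int j - 1 - 2 * int i + 1) (r + u + int i) s' t'
          + vlbl (int l + int j - 1 - 2 * int i - 1) (r + u + int i + 1) s' t'"
        by (rule tensor2_vlbl[OF less.prems(3,4)]) (use i l less.prems j in auto)
      moreover have "int l + int j - 1 - 2 * int i + 1 = int l + int k - 1 - 2 * int i"
        "int l + int j - 1 - 2 * int i - 1 = int l + int k - 1 - 2 * int (Suc i)"
        "r + u + int i + 1 = r + u + int (Suc i)" using j(1) by simp_all
      ultimately show "tensor2 (vlbl (int l + int j - 1 - 2 * int i) (r + u + int i)) s' t' = G i + G (Suc i)"
        by (simp only: G_def)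
    qed
    finally have T: "int (hdim (rtens (PP l r) ?T) (V s' t')) = (\<Sum>i<j. G i + G (Suc i))" .
    show ?thesis
    proof (cases "j = 1")
      case True
      have "riso (V 2 (u + 0)) ?T" by (rule tens_V2_iso_1[OF j(2,5) True])
      then have "riso (rtens (PP l r) (V 2 u)) (rtens (PP l r) ?T)"
        using riso_tens[OF riso_refl[OF pm]] by simp
      from hdim_iso_left[OF this] T show ?thesis
        using True j(1) by (simp add: G_def numeral_2_eq_2 algebra_simps)
    next
      case False
      then have j2: "2 \<le> j" using j by simp
      obtain i p where "rses (V (j + 1) (u + 0)) ?T (V (j - 1) (u + 0 + 1)) i p"
        using tens_V2_ses[OF j(2,5) j2 j(6)] by blast
      from hdim_tens_ses[OF P Vs this]
      have "hdim (rtens (PP l r) ?T) (V s' t') = hdim (rtens (PP l r) (V k u)) (V s' t')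
          + hdim (rtens (PP l r) (V (j - 1) (u + 1))) (V s' t')" using j(1) by simp
      moreover have "int (hdim (rtens (PP l r) (V (j - 1) (u + 1))) (V s' t')) = (\<Sum>i<j - 1. G (Suc i))"
      proof -
        have "int (hdim (rtens (PP l r) (V (j - 1) (u + 1))) (V s' t'))
            = (\<Sum>i<j - 1. vlbl (int l + int (j - 1) - 1 - 2 * int i) (r + (u + 1) + int i) s' t')"
          by (rule less.IH) (use j j2 less.prems in auto)
        also have "\<dots> = (\<Sum>i<j - 1. G (Suc i))"
          by (rule sum.cong) (use j j2 in \<open>auto simp: G_def of_nat_diff algebra_simps\<close>)
        finally show ?thesis .
      qed
      ultimately have "int (hdim (rtens (PP l r) (V k u)) (V s' t')) = (\<Sum>i<j. G i + G (Suc i)) - (\<Sum>i<j - 1. G (Suc i))"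
        using T by simp
      also have "(\<Sum>i<j. G i + G (Suc i)) = (\<Sum>i<j. G i) + (\<Sum>i<Suc (j - 1). G (Suc i))"
        using j2 by (simp add: sum.distrib)
      also have "(\<Sum>i<Suc (j - 1). G (Suc i)) = (\<Sum>i<j - 1. G (Suc i)) + G j"
        using sum.lessThan_Suc[of "\<lambda>i. G (Suc i)" "j - 1"] j2 by simp
      also have "(\<Sum>i<j. G i) + ((\<Sum>i<j - 1. G (Suc i)) + G j) - (\<Sum>i<j - 1. G (Suc i)) = (\<Sum>i<k. G i)"
        using j(1) by simp
      finally show ?thesis by (simp add: G_def)
    qed
  qed
qed

lemma hdim_tens_V_lbl:
  assumes l: "1 \<le> l" "l \<le> k" "l + k \<le> n" and s: "1 \<le> s'" "s' \<le> n"
  shows "hdim (rtens (PP l r) (V k u)) (V s' t') =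
    (\<Sum>i<l. lbl (l + k - 1 - 2 * i, r + u + int i) s' t') +
    (\<Sum>i\<in>{(l + k) div 2..<k}. 2 * lbl (n + l + k - 1 - 2 * i, r + u + int i) s' t')"
proof -
  have "1 \<le> k" using l by simp
  have "int (hdim (rtens (PP l r) (V k u)) (V s' t')) =
    (\<Sum>i<l. ilbl (int l + int k - 1 - 2 * int i) (r + u + int i) s' t') +
    (\<Sum>i\<in>{(l + k) div 2..<k}. 2 * ilbl (int n + int l + int k - 1 - 2 * int i) (r + u + int i) s' t')"
    unfolding hdim_tens_V[OF l(1) \<open>1 \<le> k\<close> l(3) s] by (rule vlbl_fold[OF l(1,2) s(1)])
  also have "(\<Sum>i<l. ilbl (int l + int k - 1 - 2 * int i) (r + u + int i) s' t')
    = int (\<Sum>i<l. lbl (l + k - 1 - 2 * i, r + u + int i) s' t')"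
    unfolding of_nat_sum int_lbl
  proof (rule sum.cong[OF refl])
    fix i assume "i \<in> {..<l}"
    then have e: "int (l + k - 1 - 2 * i) = int l + int k - 1 - 2 * int i" using l by auto
    show "ilbl (int l + int k - 1 - 2 * int i) (r + u + int i) s' t'
      = ilbl (int (fst (l + k - 1 - 2 * i, r + u + int i))) (snd (l + k - 1 - 2 * i, r + u + int i)) s' t'"
      by (simp only: e fst_conv snd_conv)
  qed
  also have "(\<Sum>i\<in>{(l + k) div 2..<k}. 2 * ilbl (int n + int l + int k - 1 - 2 * int i) (r + u + int i) s' t')
    = int (\<Sum>i\<in>{(l + k) div 2..<k}. 2 * lbl (n + l + k - 1 - 2 * i, r + u + int i) s' t')"
    unfolding of_nat_sum of_nat_mult int_lbl
  proof (rule sum.cong[OF refl])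
    fix i assume "i \<in> {(l + k) div 2..<k}"
    then have e: "int (n + l + k - 1 - 2 * i) = int n + int l + int k - 1 - 2 * int i" using l by auto
    show "2 * ilbl (int n + int l + int k - 1 - 2 * int i) (r + u + int i) s' t'
      = int 2 * ilbl (int (fst (n + l + k - 1 - 2 * i, r + u + int i))) (snd (n + l + k - 1 - 2 * i, r + u + int i)) s' t'"
      by (simp only: e fst_conv snd_conv of_nat_numeral)
  qed
  finally show ?thesis by linarith
qed

text \<open>Combines the two composition factors V(l',r') and V(n-l',r'+l'). The hypotheses l <= l'
  and l <= n - l' make \<open>hdim_tens_V_lbl\<close> apply to both.\<close>

lemma hdim_tens_GW:
  assumes l: "1 \<le> l" "l \<le> l'" "l' < n" "l + l' \<le> n" and s: "1 \<le> s'" "s' \<le> n"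
    and W: "GW m (l', r') W \<or> GW m (l', r') (flip W)" "rmodule W"
  shows "hdim (rtens (PP l r) W) (V s' t') =
    (\<Sum>i<l. (m + (if even m then 1 else 0)) * lbl (l + l' - 1 - 2 * i, r + r' + int i) s' t') +
    (\<Sum>i\<in>{l'..<l + l'}. (m + (if odd m then 1 else 0)) * lbl (n + l + l' - 1 - 2 * i, r + r' + int i) s' t') +
    (\<Sum>i\<in>{(l + l') div 2..<l'}. 2 * (m + (if even m then 1 else 0)) * lbl (n + l + l' - 1 - 2 * i, r + r' + int i) s' t') +
    (\<Sum>i\<in>{1..<(n - l - l' + 1) div 2 + 1}. 2 * (m + (if odd m then 1 else 0)) * lbl (l + l' - 1 + 2 * i, r + r' - int i) s' t')"
proof -
  have ln: "1 \<le> l" "l \<le> n" using l by auto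
  note P = PP_proj[OF ln]
  have pm: "premodule (PP l r)" by (rule rmoduleD(1)[OF rprojD[OF P]])
  have Vs: "rmodule (V s' t')" by (rule rmodule_V[OF s])
  let ?A = "m + (if even m then 1 else 0)" and ?B = "m + (if odd m then 1 else 0)"
  define \<mu> where "\<mu> W = hdim (rtens (PP l r) W) (V s' t')" for W
  have ses: "\<mu> B = \<mu> A + \<mu> C" if "rses A B C i p" for A B C i p
    unfolding \<mu>_def by (rule hdim_tens_ses[OF P Vs that])
  have iso: "\<mu> A = \<mu> B" if "riso A B" for A B
    unfolding \<mu>_def by (rule hdim_iso_left[OF riso_tens[OF riso_refl[OF pm] that]])
  have x: "rngL (l', r')" using l by simp
  have flipV: "\<mu> (flip (V k u)) = \<mu> (V k u)" if "1 \<le> k" "k \<le> n" for k u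
    using iso[OF flip_V_iso[OF that]] by simp
  \<comment> \<open>Matches the lower bound of the doubled terms for V(n-l',r'+l') with the upper
    bound of the fourth sum under i -> n - l' - i.\<close>
  have half: "(l + (n - l')) div 2 + (n - l - l' + 1) div 2 = n - l'"
  proof -
    obtain d where d: "n = l + l' + d" using l(4) by (metis le_iff_add)
    have "(2 * l + d) div 2 + (d + 1) div 2 = l + d" by presburger
    then show ?thesis unfolding d by (simp add: add_ac)
  qed
  have "\<mu> W = ?A * \<mu> (V l' r') + ?B * \<mu> (V (n - l') (r' + int l'))"
    using W(1)
  proof
    assume "GW m (l', r') W"
    from GW_additive[where \<mu> = \<mu>, OF x this ses iso] show ?thesis by (simp add: bar_def)
  next
    \<comment> \<open>Composition with \<open>flip\<close> keeps the function additive and does not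
      change its values on simple modules.\<close>
    assume "GW m (l', r') (flip W)"
    moreover have "\<mu> (flip B) = \<mu> (flip A) + \<mu> (flip C)" if "rses A B C i p" for A B C i p
      using ses[OF rses_flip[OF that]] by simp
    moreover have "\<mu> (flip A) = \<mu> (flip B)" if "riso A B" for A B
    proof -
      obtain f g where f: "rhom A B f" "rhom B A g" "g * f = ide A" "f * g = ide B" using \<open>riso A B\<close> by (auto simp: riso_def)
      have "riso (flip A) (flip B)" unfolding riso_def
        by (rule exI[of _ "tr g"], rule exI[of _ "tr f"])
          (use rhom_flip[OF f(1)] rhom_flip[OF f(2)] f(3,4) in \<open>simp del: tr_mult add: tr_mult[symmetric]\<close>)
      then show ?thesis by (rule iso)
    qed
    ultimately have "\<mu> (flip (flip W)) = ?A * \<mu> (flip (VL (l', r'))) + ?B * \<mu> (flip (VL (bar (l', r'))))"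
      using GW_additive[OF x, of m "flip W" "\<lambda>M. \<mu> (flip M)"] by blast
    then show ?thesis using flipV[of l' r'] flipV[of "n - l'" "r' + int l'"] l by (simp add: bar_def)
  qed
  also have "\<mu> (V l' r') = (\<Sum>i<l. lbl (l + l' - 1 - 2 * i, r + r' + int i) s' t') +
    (\<Sum>i\<in>{(l + l') div 2..<l'}. 2 * lbl (n + l + l' - 1 - 2 * i, r + r' + int i) s' t')"
    unfolding \<mu>_def by (rule hdim_tens_V_lbl[OF l(1,2,4) s])
  also have "\<mu> (V (n - l') (r' + int l')) = 
    (\<Sum>i<l. lbl (l + (n - l') - 1 - 2 * i, r + (r' + int l') + int i) s' t') +
    (\<Sum>i\<in>{(l + (n - l')) div 2..<n - l'}. 2 * lbl (n + l + (n - l') - 1 - 2 * i, r + (r' + int l') + int i) s' t')"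
    unfolding \<mu>_def by (rule hdim_tens_V_lbl) (use l s in auto)
  also have "(\<Sum>i<l. lbl (l + (n - l') - 1 - 2 * i, r + (r' + int l') + int i) s' t')
    = (\<Sum>i\<in>{l'..<l + l'}. lbl (n + l + l' - 1 - 2 * i, r + r' + int i) s' t')"
  proof (rule sum.reindex_bij_witness[of _ "\<lambda>j. j - l'" "\<lambda>i. i + l'"])
    fix i assume "i \<in> {..<l}"
    have a: "n + l + l' - 1 - 2 * (i + l') = l + (n - l') - 1 - 2 * i" using l by simp
    have b: "r + r' + int (i + l') = r + (r' + int l') + int i" by simp
    show "lbl (n + l + l' - 1 - 2 * (i + l'), r + r' + int (i + l')) s' t'
        = lbl (l + (n - l') - 1 - 2 * i, r + (r' + int l') + int i) s' t'" unfolding a b ..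
  qed auto
  \<comment> \<open>The reversal i -> n - l' - i; the second label changes by n, which
    \<open>lbl\<close> does not see.\<close>
  also have "(\<Sum>i\<in>{(l + (n - l')) div 2..<n - l'}. 2 * lbl (n + l + (n - l') - 1 - 2 * i, r + (r' + int l') + int i) s' t')
    = (\<Sum>i\<in>{1..<(n - l - l' + 1) div 2 + 1}. 2 * lbl (l + l' - 1 + 2 * i, r + r' - int i) s' t')"
  proof (rule sum.reindex_bij_witness[of _ "\<lambda>j. n - l' - j" "\<lambda>i. n - l' - i"])
    fix i assume i: "i \<in> {(l + (n - l')) div 2..<n - l'}"
    show "n - l' - (n - l' - i) = i" by (rule diff_diff_cancel) (use i in auto)
    have "(l + (n - l')) div 2 \<le> i" "i < n - l'" using i by auto
    with half show "n - l' - i \<in> {1..<(n - l - l' + 1) div 2 + 1}"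
      unfolding atLeastLessThan_iff by linarith
    have a: "l + l' - 1 + 2 * (n - l' - i) = n + l + (n - l') - 1 - 2 * i"
    proof -
      from i have "i + l' < n" by auto
      with l show ?thesis by linarith
    qed
    have "q powi (r + r' - int (n - l' - i)) = q powi (r + (r' + int l') + int i)"
    proof -
      from i have "l' + i \<le> n" by auto
      then have "r + r' - int (n - l' - i) - (r + (r' + int l') + int i) = - int n" by (simp add: of_nat_diff)
      then show ?thesis unfolding qpow_eq_iff by simp
    qed
    from lbl_cong[OF this] show "2 * lbl (l + l' - 1 + 2 * (n - l' - i), r + r' - int (n - l' - i)) s' t'
        = 2 * lbl (n + l + (n - l') - 1 - 2 * i, r + (r' + int l') + int i) s' t'" unfolding a by simp
  next
    fix j assume j: "j \<in> {1..<(n - l - l' + 1) div 2 + 1}"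
    have j': "1 \<le> j" "j < (n - l - l' + 1) div 2 + 1" using j by auto
    with half show "n - l' - j \<in> {(l + (n - l')) div 2..<n - l'}"
      unfolding atLeastLessThan_iff by linarith
    from j' half have "j \<le> n - l'" by linarith
    then show "n - l' - (n - l' - j) = j" by (rule diff_diff_cancel)
  qed
  finally show ?thesis unfolding \<mu>_def
    by (simp add: distrib_left sum_distrib_left mult.assoc mult.left_commute add_ac)
qed

end

section \<open>Transfer from matrix representations\<close>

lift_definition from_mat :: "'k::field mat \<Rightarrow> 'k fm"
  is "\<lambda>A i j. if i < dim_row A \<and> j < dim_col A then A $$ (i, j) else 0"
proof -
  fix A :: "'k mat"
  show "\<exists>N. \<forall>i j. N \<le> i \<or> N \<le> j \<longrightarrow> (if i < dim_row A \<and> j < dim_col A then A $$ (i, j) else 0) = 0"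
    by (rule exI[of _ "max (dim_row A) (dim_col A)"]) auto
qed

lift_definition from_vec :: "'k::field vec \<Rightarrow> 'k fm"
  is "\<lambda>v i j. if i < dim_vec v \<and> j = 0 then v $ i else 0"
proof -
  fix v :: "'k vec"
  show "\<exists>N. \<forall>i j. N \<le> i \<or> N \<le> j \<longrightarrow> (if i < dim_vec v \<and> j = 0 then v $ i else 0) = 0"
    by (rule exI[of _ "Suc (dim_vec v)"]) auto
qed

definition to_mat :: "nat \<Rightarrow> nat \<Rightarrow> 'k::field fm \<Rightarrow> 'k mat" where
  "to_mat r c x = mat r c (\<lambda>(i, j). ent x i j)"
definition to_vec :: "nat \<Rightarrow> 'k::field fm \<Rightarrow> 'k vec" where
  "to_vec r x = vec r (\<lambda>i. ent x i 0)"

lemma ent_from_mat: "ent (from_mat A) i j = (if i < dim_row A \<and> j < dim_col A then A $$ (i, j) else 0)"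
  by (simp add: from_mat.rep_eq)
lemma ent_from_vec: "ent (from_vec v) i j = (if i < dim_vec v \<and> j = 0 then v $ i else 0)"
  by (simp add: from_vec.rep_eq)
lemma to_mat_carrier [simp]: "to_mat r c x \<in> carrier_mat r c" by (simp add: to_mat_def)
lemma to_vec_carrier [simp]: "to_vec r x \<in> carrier_vec r" by (simp add: to_vec_def)

lemma idm_from_mat:
  assumes "A \<in> carrier_mat r c" shows "idm r * from_mat A = from_mat A" "from_mat A * idm c = from_mat A"
  using assms by (auto intro!: fm_eqI simp: ent_idm_mult ent_mult_idm ent_from_mat)

lemma idm_from_vec:
  assumes "v \<in> carrier_vec r"
  shows "idm r * from_vec v = from_vec v" "from_vec v * munit 0 0 = from_vec v"
  using assms by (auto intro!: fm_eqI simp: ent_idm_mult ent_mult_munit ent_from_vec)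

lemma from_to_mat:
  assumes "idm r * x = x" "x * idm c = x" shows "from_mat (to_mat r c x) = x"
proof (rule fm_eqI)
  fix i j
  show "ent (from_mat (to_mat r c x)) i j = ent x i j"
    using arg_cong[OF assms(1), of "\<lambda>z. ent z i j"] arg_cong[OF assms(2), of "\<lambda>z. ent z i j"]
    by (auto simp: ent_from_mat to_mat_def ent_idm_mult ent_mult_idm split: if_splits)
qed

lemma from_to_vec:
  assumes "idm r * x = x" "x * munit 0 0 = x" shows "from_vec (to_vec r x) = x"
proof (rule fm_eqI)
  fix i j
  show "ent (from_vec (to_vec r x)) i j = ent x i j"
    using arg_cong[OF assms(1), of "\<lambda>z. ent z i j"] arg_cong[OF assms(2), of "\<lambda>z. ent z i j"]
    by (auto simp: ent_from_vec to_vec_def ent_idm_mult ent_mult_munit split: if_splits)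
qed

lemma from_mat_inject:
  assumes "A \<in> carrier_mat r c" "B \<in> carrier_mat r c" shows "from_mat A = from_mat B \<longleftrightarrow> A = B"
proof
  assume eq: "from_mat A = from_mat B"
  show "A = B"
  proof (rule eq_matI)
    fix i j assume "i < dim_row B" "j < dim_col B"
    then show "A $$ (i, j) = B $$ (i, j)"
      using arg_cong[OF eq, of "\<lambda>z. ent z i j"] assms by (simp add: ent_from_mat)
  qed (use assms in auto)
qed simp

lemma from_vec_inject:
  assumes "v \<in> carrier_vec r" "w \<in> carrier_vec r" shows "from_vec v = from_vec w \<longleftrightarrow> v = w"
proof
  assume eq: "from_vec v = from_vec w"
  show "v = w"
  proof (rule eq_vecI)
    fix i assume "i < dim_vec w"
    then show "v $ i = w $ i"
      using arg_cong[OF eq, of "\<lambda>z. ent z i 0"] assms by (simp add: ent_from_vec)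
  qed (use assms in auto)
qed simp

lemma from_mat_mult:
  assumes "A \<in> carrier_mat r m" "B \<in> carrier_mat m c"
  shows "from_mat (A * B) = from_mat A * from_mat B"
proof (rule fm_eqI)
  fix i j
  have "ent (from_mat A * from_mat B) i j = (\<Sum>k<m. ent (from_mat A) i k * ent (from_mat B) k j)"
    by (rule ent_times_on) (use assms in \<open>auto simp: ent_from_mat\<close>)
  then show "ent (from_mat (A * B)) i j = ent (from_mat A * from_mat B) i j"
    using assms by (auto simp: ent_from_mat scalar_prod_def atLeast0LessThan)
qed

lemma from_mat_vec:
  assumes "A \<in> carrier_mat r m" "v \<in> carrier_vec m"
  shows "from_vec (A *\<^sub>v v) = from_mat A * from_vec v"
proof (rule fm_eqI)
  fix i j
  have "ent (from_mat A * from_vec v) i j = (\<Sum>k<m. ent (from_mat A) i k * ent (from_vec v) k j)"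
    by (rule ent_times_on) (use assms in \<open>auto simp: ent_from_mat\<close>)
  then show "ent (from_vec (A *\<^sub>v v)) i j = ent (from_mat A * from_vec v) i j"
    using assms by (auto simp: ent_from_mat ent_from_vec scalar_prod_def atLeast0LessThan)
qed

lemma from_mat_add:
  "A \<in> carrier_mat r c \<Longrightarrow> B \<in> carrier_mat r c \<Longrightarrow> from_mat (A + B) = from_mat A + from_mat B"
  by (rule fm_eqI) (auto simp: ent_from_mat)
lemma from_mat_diff:
  "A \<in> carrier_mat r c \<Longrightarrow> B \<in> carrier_mat r c \<Longrightarrow> from_mat (A - B) = from_mat A - from_mat B"
  by (rule fm_eqI) (auto simp: ent_from_mat)
lemma from_mat_smult: "from_mat (x \<cdot>\<^sub>m A) = x *\<^sub>k from_mat A"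
  by (rule fm_eqI) (auto simp: ent_from_mat)
lemma from_mat_one [simp]: "from_mat (1\<^sub>m r) = idm r"
  by (rule fm_eqI) (auto simp: ent_from_mat ent_idm)
lemma from_mat_zero [simp]: "from_mat (0\<^sub>m r c) = 0"
  by (rule fm_eqI) (auto simp: ent_from_mat)
lemma from_vec_zero [simp]: "from_vec (0\<^sub>v r) = 0"
  by (rule fm_eqI) (auto simp: ent_from_vec)
lemma from_vec_unit: "i < r \<Longrightarrow> from_vec (unit_vec r i) = munit i 0"
  by (rule fm_eqI) (auto simp: ent_from_vec ent_munit)
lemma from_vec_add: "v \<in> carrier_vec r \<Longrightarrow> w \<in> carrier_vec r \<Longrightarrow> from_vec (v + w) = from_vec v + from_vec w"
  by (rule fm_eqI) (auto simp: ent_from_vec)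
lemma from_vec_smult: "from_vec (x \<cdot>\<^sub>v v) = x *\<^sub>k from_vec v"
  by (rule fm_eqI) (auto simp: ent_from_vec)

lemma from_mat_pow:
  assumes "A \<in> carrier_mat r r" shows "from_mat (A ^\<^sub>m k) = pw (from_mat A) k (idm r)"
proof (induction k)
  case 0
  then show ?case using assms by simp
next
  case (Suc k)
  have "from_mat (A ^\<^sub>m Suc k) = from_mat (A ^\<^sub>m k) * from_mat A"
    using assms by (simp add: from_mat_mult[of _ r r _ r] pow_carrier_mat)
  also have "\<dots> = pw (from_mat A) k (from_mat A * idm r)"
    using idm_from_mat[OF assms] by (simp add: Suc pw_mult)
  finally show ?case by (simp only: pw_Suc')
qed

text \<open>Preimages may be chosen column by column, since \<open>x\<close> has only finitely many
  nonzero columns. This links surjectivity on vectors with generalized elements.\<close>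

lemma column_choice:
  fixes x :: "'k::field fm"
  assumes "\<And>j. \<exists>y. e * y = y \<and> f * y = x * munit j 0" shows "\<exists>y. e * y = y \<and> f * y = x"
proof -
  obtain y where y: "\<And>j. e * y j = y j" "\<And>j. f * y j = x * munit j 0" using assms by metis
  obtain N where N: "x * idm N = x" by (rule idm_bound)
  have "f * (\<Sum>j<N. y j * munit 0 j) = (\<Sum>j<N. x * munit j j)"
    unfolding sum_distrib_left by (rule sum.cong) (simp_all add: mult.assoc[symmetric] y, simp add: mult.assoc)
  also have "\<dots> = x" using N by (simp add: idm_def sum_distrib_left)
  finally have "f * (\<Sum>j<N. y j * munit 0 j) = x" .
  moreover have "e * (\<Sum>j<N. y j * munit 0 j) = (\<Sum>j<N. y j * munit 0 j)"
    unfolding sum_distrib_left by (simp add: mult.assoc[symmetric] y)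
  ultimately show ?thesis by blast
qed

lemma column_vec:
  assumes "idm r * x = x" obtains v where "v \<in> carrier_vec r" "from_vec v = x * munit j 0"
proof
  show "from_vec (to_vec r (x * munit j 0)) = x * munit j 0"
    by (rule from_to_vec) (simp_all add: mult.assoc mult_eq_assoc[OF assms])
qed simp

section \<open>Coordinate modules as idempotents with operators\<close>

definition wf_rep :: "'k::field rep \<Rightarrow> bool" where
  "wf_rep M \<longleftrightarrow> (\<forall>g. ract M g \<in> carrier_mat (rdim M) (rdim M))"

definition fmod :: "'k::field rep \<Rightarrow> 'k rmod" where
  "fmod M = (idm (rdim M), \<lambda>g. from_mat (ract M g))"

lemma fmod_simps [simp]: "ide (fmod M) = idm (rdim M)" "act (fmod M) g = from_mat (ract M g)"
  by (simp_all add: fmod_def)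

lemma wf_repD: "wf_rep M \<Longrightarrow> ract M g \<in> carrier_mat (rdim M) (rdim M)" by (simp add: wf_rep_def)

lemma premodule_fmod: "wf_rep M \<Longrightarrow> premodule (fmod M)"
  by (simp add: premodule_def idm_from_mat[OF wf_repD])

lemma rhom_from_mat:
  assumes "wf_rep M" "wf_rep N" "f \<in> carrier_mat (rdim N) (rdim M)"
  shows "rhom (fmod M) (fmod N) (from_mat f) \<longleftrightarrow> H_hom M N f"
proof -
  have "from_mat f * from_mat (ract M g) = from_mat (ract N g) * from_mat f \<longleftrightarrow> f * ract M g = ract N g * f" for g
    using from_mat_mult[OF assms(3) wf_repD[OF assms(1)], of g] from_mat_mult[OF wf_repD[OF assms(2)] assms(3), of g]
      from_mat_inject[OF mult_carrier_mat[OF assms(3) wf_repD[OF assms(1), of g]] mult_carrier_mat[OF wf_repD[OF assms(2), of g] assms(3)]]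
    by simp
  then show ?thesis using assms(3) by (simp add: rhom_def H_hom_def idm_from_mat)
qed

lemma H_homD: "H_hom M N f \<Longrightarrow> f \<in> carrier_mat (rdim N) (rdim M)" by (simp add: H_hom_def)

lemma H_hom_rhom: "wf_rep M \<Longrightarrow> wf_rep N \<Longrightarrow> H_hom M N f \<Longrightarrow> rhom (fmod M) (fmod N) (from_mat f)"
  using rhom_from_mat H_homD by blast

lemma rhom_H_hom:
  assumes "wf_rep M" "wf_rep N" "rhom (fmod M) (fmod N) g"
  obtains f where "H_hom M N f" "from_mat f = g"
proof
  show eq: "from_mat (to_mat (rdim N) (rdim M) g) = g"
    using homD(1,2)[OF assms(3)] by (intro from_to_mat) simp_all
  show "H_hom M N (to_mat (rdim N) (rdim M) g)"
    using rhom_from_mat[OF assms(1,2) to_mat_carrier, of g] assms(3) by (simp add: eq)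
qed

lemma H_surj_iff:
  assumes "wf_rep M" "wf_rep N" "H_hom M N f"
  shows "H_surj M N f \<longleftrightarrow> repi (fmod M) (fmod N) (from_mat f)"
proof
  note h = H_hom_rhom[OF assms] and c = H_homD[OF assms(3)]
  show "repi (fmod M) (fmod N) (from_mat f)" if "H_surj M N f"
  proof (rule repiI[OF h _ premodule_fmod[OF assms(2)]], rule column_choice)
    fix x :: "'a fm" and j assume "ide (fmod N) * x = x"
    then have "idm (rdim N) * x = x" by simp
    then obtain v where v: "v \<in> rspace N" "from_vec v = x * munit j 0" by (rule column_vec)
    then have "v \<in> (*\<^sub>v) f ` rspace M" using that by (simp add: H_surj_def)
    then obtain w where w: "w \<in> rspace M" "v = f *\<^sub>v w" by (rule imageE)
    then show "\<exists>y. ide (fmod M) * y = y \<and> from_mat f * y = x * munit j 0"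
      using from_mat_vec[OF c w(1)] v(2) w(2) by (intro exI[of _ "from_vec w"]) (simp add: idm_from_vec(1)[OF w(1)])
  qed
  show "H_surj M N f" if e: "repi (fmod M) (fmod N) (from_mat f)"
  proof -
    have "v \<in> (*\<^sub>v) f ` rspace M" if v: "v \<in> rspace N" for v
    proof -
      obtain r where r: "ide (fmod M) * r = r" "from_mat f * r = ide (fmod N)" using e by (rule repiE)
      define y where "y = r * from_vec v"
      have "from_vec (to_vec (rdim M) y) = y"
        using r(1) by (intro from_to_vec) (simp_all add: y_def mult.assoc[symmetric], simp add: mult.assoc idm_from_vec(2)[OF v])
      moreover have "from_mat f * y = from_vec v"
        using r(2) by (simp add: y_def mult.assoc[symmetric] idm_from_vec(1)[OF v])
      ultimately have "from_vec (f *\<^sub>v to_vec (rdim M) y) = from_vec v"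
        by (simp add: from_mat_vec[OF c to_vec_carrier])
      then have "f *\<^sub>v to_vec (rdim M) y = v"
        using from_vec_inject[OF mult_mat_vec_carrier[OF c to_vec_carrier] v] by blast
      then show ?thesis by (metis imageI to_vec_carrier)
    qed
    moreover have "(*\<^sub>v) f ` rspace M \<subseteq> rspace N" using mult_mat_vec_carrier[OF c] by auto
    ultimately show ?thesis using assms(3) by (auto simp: H_surj_def)
  qed
qed

lemma rmono_columns:
  assumes "rhom (fmod M) N f" "\<And>v. v \<in> rspace M \<Longrightarrow> f * from_vec v = 0 \<Longrightarrow> v = 0\<^sub>v (rdim M)"
  shows "rmono (fmod M) N f"
  unfolding rmono_def
proof (intro conjI allI impI)
  fix y :: "'a fm" assume y: "ide (fmod M) * y = y" "f * y = 0"
  show "y = 0"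
  proof (rule column_ext)
    fix j
    have "idm (rdim M) * y = y" using y(1) by simp
    then obtain v where v: "v \<in> rspace M" "from_vec v = y * munit j 0" by (rule column_vec)
    have "f * from_vec v = 0" unfolding v(2) by (simp add: mult.assoc[symmetric] y(2))
    from assms(2)[OF v(1) this] v(2) show "y * munit j 0 = 0 * munit j 0" by simp
  qed
qed (rule assms(1))

lemma H_inj_iff:
  assumes "wf_rep M" "wf_rep N" "H_hom M N f"
  shows "H_inj M N f \<longleftrightarrow> rmono (fmod M) (fmod N) (from_mat f)"
proof
  note h = H_hom_rhom[OF assms] and c = H_homD[OF assms(3)]
  show "rmono (fmod M) (fmod N) (from_mat f)" if i: "H_inj M N f"
  proof (rule rmono_columns[OF h])
    fix v assume v: "v \<in> rspace M" "from_mat f * from_vec v = 0"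
    have "from_vec (f *\<^sub>v v) = from_vec (f *\<^sub>v 0\<^sub>v (rdim M))"
      using v by (simp add: from_mat_vec[OF c])
    then have "f *\<^sub>v v = f *\<^sub>v 0\<^sub>v (rdim M)"
      using from_vec_inject[OF mult_mat_vec_carrier[OF c v(1)] mult_mat_vec_carrier[OF c zero_carrier_vec]] by blast
    then show "v = 0\<^sub>v (rdim M)" using i v(1) by (auto simp: H_inj_def inj_on_def)
  qed
  show "H_inj M N f" if m: "rmono (fmod M) (fmod N) (from_mat f)"
  proof -
    have "v = w" if v: "v \<in> rspace M" "w \<in> rspace M" "f *\<^sub>v v = f *\<^sub>v w" for v w
    proof -
      have "from_vec v = from_vec w"
        by (rule rmono_cancel[OF m]) (simp_all add: idm_from_vec v from_mat_vec[OF c, symmetric])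
      then show ?thesis using from_vec_inject[OF v(1,2)] by blast
    qed
    then show ?thesis using assms(3) by (auto simp: H_inj_def inj_on_def)
  qed
qed

lemma H_iso_riso:
  assumes "wf_rep M" "wf_rep N" "riso (fmod M) (fmod N)" shows "H_iso M N"
proof -
  obtain g where g: "rmono (fmod M) (fmod N) g" "repi (fmod M) (fmod N) g"
    using riso_mono_epi[OF assms(3)] by blast
  obtain f where f: "H_hom M N f" "from_mat f = g" by (rule rhom_H_hom[OF assms(1,2) repiD[OF g(2)]])
  have "H_inj M N f" "H_surj M N f"
    using H_inj_iff[OF assms(1,2) f(1)] H_surj_iff[OF assms(1,2) f(1)] g f(2) by simp_all
  then show ?thesis by (auto simp: H_iso_def H_inj_def H_surj_def bij_betw_def)
qed

lemma exact_columns: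
  assumes "wf_rep K" "wf_rep P" "wf_rep M" "H_hom K P i" "H_hom P M f"
    and eq: "(*\<^sub>v) i ` rspace K = mat_kernel f"
  shows "from_mat f * from_mat i = 0"
    "ide (fmod P) * x = x \<Longrightarrow> from_mat f * x = 0 \<Longrightarrow> \<exists>y. ide (fmod K) * y = y \<and> from_mat i * y = x"
proof -
  note ci = H_homD[OF assms(4)] and cf = H_homD[OF assms(5)]
  show "from_mat f * from_mat i = 0"
  proof (rule column_ext_idm[of _ "rdim K"])
    fix j assume j: "j < rdim K"
    have "i *\<^sub>v unit_vec (rdim K) j \<in> mat_kernel f" unfolding eq[symmetric] by (rule imageI) simp
    then have "f *\<^sub>v (i *\<^sub>v unit_vec (rdim K) j) = 0\<^sub>v (rdim M)" by (rule mat_kernelD(2)[OF cf])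
    then have "from_vec (f *\<^sub>v (i *\<^sub>v unit_vec (rdim K) j)) = 0" by simp
    then show "from_mat f * from_mat i * munit j 0 = 0 * munit j 0"
      by (simp add: from_mat_vec[OF cf mult_mat_vec_carrier[OF ci]] from_mat_vec[OF ci] from_vec_unit[OF j] mult.assoc)
  qed (simp_all add: mult.assoc idm_from_mat[OF ci])
  assume x: "ide (fmod P) * x = x" "from_mat f * x = 0"
  show "\<exists>y. ide (fmod K) * y = y \<and> from_mat i * y = x"
  proof (rule column_choice)
    fix j
    have "idm (rdim P) * x = x" using x(1) by simp
    then obtain v where v: "v \<in> rspace P" "from_vec v = x * munit j 0" by (rule column_vec)
    have "from_vec (f *\<^sub>v v) = from_vec (0\<^sub>v (rdim M))"
      by (simp add: from_mat_vec[OF cf v(1)] v(2) mult.assoc[symmetric] x(2))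
    then have "f *\<^sub>v v = 0\<^sub>v (rdim M)"
      using from_vec_inject[OF mult_mat_vec_carrier[OF cf v(1)] zero_carrier_vec] by blast
    then have "v \<in> (*\<^sub>v) i ` rspace K" unfolding eq by (rule mat_kernelI[OF cf v(1)])
    then obtain w where w: "w \<in> rspace K" "v = i *\<^sub>v w" by (rule imageE)
    then show "\<exists>y. ide (fmod K) * y = y \<and> from_mat i * y = x * munit j 0"
      using from_mat_vec[OF ci w(1)] v(2) by (intro exI[of _ "from_vec w"]) (simp add: idm_from_vec)
  qed
qed

context taft_double
begin

lemma H_module_iff: "H_module n q M \<longleftrightarrow> wf_rep M \<and> rmodule (fmod M)"
proof (cases "wf_rep M")
  case True
  note c = wf_repD[OF True]
  let ?r = "rdim M"
  have eq: "A = B \<longleftrightarrow> from_mat A = from_mat B" if "A \<in> carrier_mat ?r ?r" "B \<in> carrier_mat ?r ?r" for A B :: "'k mat"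
    using from_mat_inject[OF that] by simp
  have cm: "ract M g * ract M h \<in> carrier_mat ?r ?r" for g h using mult_carrier_mat[OF c c] .
  note m = from_mat_mult[OF c c]
  have p: "ract M g ^\<^sub>m n \<in> carrier_mat ?r ?r" for g using pow_carrier_mat[OF c] .
  have d1: "from_mat (ract M Gen_d * ract M Gen_a - q \<cdot>\<^sub>m (ract M Gen_a * ract M Gen_d))
     = from_mat (ract M Gen_d) * from_mat (ract M Gen_a) - q *\<^sub>k (from_mat (ract M Gen_a) * from_mat (ract M Gen_d))"
    by (simp add: from_mat_diff[OF cm smult_carrier_mat[OF cm]] m from_mat_smult)
  have d2: "from_mat (1\<^sub>m ?r - ract M Gen_b * ract M Gen_c)
     = idm ?r - from_mat (ract M Gen_b) * from_mat (ract M Gen_c)"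
    by (simp add: from_mat_diff[OF one_carrier_mat cm] m)
  show ?thesis
    unfolding H_module_def rmodule_def Let_def
      eq[OF cm smult_carrier_mat[OF cm]] eq[OF cm cm] eq[OF p one_carrier_mat] eq[OF p zero_carrier_mat]
      eq[OF minus_carrier_mat[OF smult_carrier_mat[OF cm]] minus_carrier_mat[OF cm]] d1 d2
    using c premodule_fmod[OF True] True by (simp add: m from_mat_smult from_mat_pow[OF c])
next
  case False
  then show ?thesis unfolding H_module_def wf_rep_def by blast
qed

lemma H_moduleD: "H_module n q M \<Longrightarrow> wf_rep M" "H_module n q M \<Longrightarrow> rmodule (fmod M)"
  by (simp_all add: H_module_iff)

text \<open>Projectivity and injectivity in coordinates quantify over coordinate modules only. This
  lemma moves arbitrary lifting problems there.\<close>

lemma rmodule_fmod_exists: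
  assumes "rmodule X"
  obtains M a b where "H_module n q M" "rhom (fmod M) X a" "rhom X (fmod M) b" "a * b = ide X" "b * a = ide (fmod M)"
proof -
  note p = premoduleD[OF rmoduleD(1)[OF assms]]
  from idem_split[OF p(1)] obtain u v r where u: "u * v = ide X" "v * u = idm r" "ide X * u = u" "v * ide X = v"
      "u * idm r = u" "idm r * v = v" by blast
  define M :: "'k rep" where "M = \<lparr>rdim = r, ract = \<lambda>g. to_mat r r (v * act X g * u)\<rparr>"
  have fM: "ide (fmod M) = idm r" "act (fmod M) g = v * act X g * u" for g
  proof -
    have "idm r * (v * act X g * u) = v * act X g * u" by (simp add: mult.assoc mult_eq_assoc[OF u(6)])
    moreover have "v * act X g * u * idm r = v * act X g * u" by (simp add: mult.assoc u(5))
    ultimately show "ide (fmod M) = idm r" "act (fmod M) g = v * act X g * u"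
      by (simp_all add: M_def from_to_mat)
  qed
  have wf: "wf_rep M" by (simp add: wf_rep_def M_def)
  have vx: "v * (act X g * (u * v)) = v * act X g" "u * (v * (act X g * u)) = act X g * u" for g
    using p by (simp_all add: u(1) mult.assoc[symmetric])
  have hu: "rhom (fmod M) X u" unfolding rhom_def fM using u vx by (simp add: mult.assoc)
  have hv: "rhom X (fmod M) v" unfolding rhom_def fM using u vx by (simp add: mult.assoc)
  have "rmono (fmod M) X u" by (rule rmonoI_inverse[OF hu, of v]) (simp only: fM u)
  then have "rmodule (fmod M)" by (rule rmodule_mono[OF premodule_fmod[OF wf] assms])
  then show thesis using that[OF _ hu hv u(1)] wf u(2) by (simp add: H_module_iff M_def)
qed

section \<open>Transfer of projective covers and injective envelopes\<close>

lemma rproj_fmod: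
  assumes "H_projective n q P" shows "rproj (fmod P)"
  unfolding rproj_def
proof (intro conjI allI impI)
  have P: "H_module n q P" using assms by (simp add: H_projective_def)
  note wP = H_moduleD(1)[OF P]
  show "rmodule (fmod P)" by (rule H_moduleD(2)[OF P])
  fix M N p f assume "rmodule M \<and> rmodule N \<and> repi M N p \<and> rhom (fmod P) N f"
  then have M: "rmodule M" and N: "rmodule N" and p: "repi M N p" and f: "rhom (fmod P) N f" by auto
  obtain M0 a a' where M0: "H_module n q M0" and a: "rhom (fmod M0) M a" "rhom M (fmod M0) a'"
    "a * a' = ide M" "a' * a = ide (fmod M0)" using rmodule_fmod_exists[OF M] by blast
  obtain N0 b b' where N0: "H_module n q N0" and b: "rhom (fmod N0) N b" "rhom N (fmod N0) b'"
    "b * b' = ide N" "b' * b = ide (fmod N0)" using rmodule_fmod_exists[OF N] by blast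
  note wM = H_moduleD(1)[OF M0] and wN = H_moduleD(1)[OF N0]
  note ha = homD[OF a(1)] homD[OF a(2)] and hb = homD[OF b(1)] homD[OF b(2)] and hp = homD[OF repiD[OF p]]
  have e: "repi (fmod M0) M a" "repi N (fmod N0) b'" using a b ha hb by (auto simp: repi_def)
  obtain p0 where p0: "H_hom M0 N0 p0" "from_mat p0 = b' * (p * a)"
    by (rule rhom_H_hom[OF wM wN hom_comp[OF hom_comp[OF a(1) repiD[OF p]] b(2)]]) 
  obtain f0 where f0: "H_hom P N0 f0" "from_mat f0 = b' * f" by (rule rhom_H_hom[OF wP wN hom_comp[OF f b(2)]])
  have "H_surj M0 N0 p0"
    unfolding H_surj_iff[OF wM wN p0(1)] p0(2) by (rule repi_comp[OF repi_comp[OF e(1) p] e(2)])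
  then obtain h where h: "H_hom P M0 h" "p0 * h = f0" using assms M0 N0 f0(1) unfolding H_projective_def by blast
  note hh = H_hom_rhom[OF wP wM h(1)]
  have "b' * (p * (a * from_mat h)) = b' * f"
    using arg_cong[OF h(2), of from_mat] by (simp add: from_mat_mult[OF H_homD[OF p0(1)] H_homD[OF h(1)]] p0 f0 mult.assoc)
  then have "b * (b' * (p * (a * from_mat h))) = b * (b' * f)" by simp
  then have "p * (a * from_mat h) = f"
    unfolding mult_eq_assoc[OF b(3)] using homD[OF f] by (simp add: hp)
  then show "\<exists>g. rhom (fmod P) M g \<and> p * g = f" using hom_comp[OF hh a(1)] by blast
qed

text \<open>The lifting problem for the transposed module is the transpose of an extension problem
  along an injective map into \<open>E\<close>.\<close>

lemma rproj_flip_fmod: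
  assumes "H_injective n q E" shows "rproj (flip (fmod E))"
  unfolding rproj_def
proof (intro conjI allI impI)
  have E: "H_module n q E" using assms by (simp add: H_injective_def)
  note wE = H_moduleD(1)[OF E]
  show "rmodule (flip (fmod E))" by (rule rmodule_flip[OF H_moduleD(2)[OF E]])
  fix M N p f assume "rmodule M \<and> rmodule N \<and> repi M N p \<and> rhom (flip (fmod E)) N f"
  then have M: "rmodule M" and N: "rmodule N" and p: "repi M N p" and f: "rhom (flip (fmod E)) N f" by auto
  have tf: "rhom (flip N) (fmod E) (tr f)" using rhom_flip[OF f] by simp
  have tp: "rmono (flip N) (flip M) (tr p)" by (rule repi_flip[OF p])
  obtain M0 a a' where M0: "H_module n q M0" and a: "rhom (fmod M0) (flip M) a" "rhom (flip M) (fmod M0) a'"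
    "a * a' = ide (flip M)" "a' * a = ide (fmod M0)" using rmodule_fmod_exists[OF rmodule_flip[OF M]] by blast
  obtain N0 b b' where N0: "H_module n q N0" and b: "rhom (fmod N0) (flip N) b" "rhom (flip N) (fmod N0) b'"
    "b * b' = ide (flip N)" "b' * b = ide (fmod N0)" using rmodule_fmod_exists[OF rmodule_flip[OF N]] by blast
  note wM = H_moduleD(1)[OF M0] and wN = H_moduleD(1)[OF N0]
  obtain i where i: "H_hom N0 M0 i" "from_mat i = a' * (tr p * b)"
    by (rule rhom_H_hom[OF wN wM hom_comp[OF hom_comp[OF b(1) rmonoD[OF tp]] a(2)]])
  obtain f0 where f0: "H_hom N0 E f0" "from_mat f0 = tr f * b" by (rule rhom_H_hom[OF wN wE hom_comp[OF b(1) tf]])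
  have m: "rmono (fmod N0) (flip N) b" "rmono (flip M) (fmod M0) a'"
    by (rule rmonoI_inverse[OF b(1) b(4)], rule rmonoI_inverse[OF a(2) a(3)])
  have "H_inj N0 M0 i"
    unfolding H_inj_iff[OF wN wM i(1)] i(2) by (rule rmono_comp[OF rmono_comp[OF m(1) tp] m(2)])
  then obtain h where h: "H_hom M0 E h" "h * i = f0" using assms M0 N0 f0(1) unfolding H_injective_def by blast
  note hh = hom_comp[OF a(2) H_hom_rhom[OF wM wE h(1)]]
  have "from_mat h * (a' * (tr p * b)) = tr f * b"
    using arg_cong[OF h(2), of from_mat] by (simp add: from_mat_mult[OF H_homD[OF h(1)] H_homD[OF i(1)]] i f0)
  then have "from_mat h * (a' * (tr p * b)) * b' = tr f * b * b'" by simp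
  then have "from_mat h * a' * tr p = tr f"
    using homD(1)[OF tf] homD(1)[OF rmonoD[OF tp]] by (simp add: mult.assoc b(3))
  then have "tr (from_mat h * a' * tr p) = f" by simp
  then have "p * tr (from_mat h * a') = f" by (simp add: mult.assoc)
  moreover have "rhom (flip (fmod E)) M (tr (from_mat h * a'))" using rhom_flip[OF hh] by simp
  ultimately show "\<exists>g. rhom (flip (fmod E)) M g \<and> p * g = f" by blast
qed

text \<open>The submodule tested is the image of \<open>g\<close>, and \<open>r\<close> shows that
  it maps onto \<open>M\<close>.\<close>

lemma rcover_fmod:
  assumes "projective_cover n q M P f" shows "rcover (fmod M) (fmod P) (from_mat f)"
  unfolding rcover_def
proof (intro conjI allI impI)
  have M: "H_module n q M" and P: "H_projective n q P" and f: "H_surj P M f"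
    and ess: "\<And>U. H_submodule P U \<Longrightarrow> (*\<^sub>v) f ` U = rspace M \<Longrightarrow> U = rspace P"
    using assms by (auto simp: projective_cover_def)
  have PM: "H_module n q P" using P by (simp add: H_projective_def)
  note wM = H_moduleD(1)[OF M] and wP = H_moduleD(1)[OF PM]
  have hf: "H_hom P M f" using f by (simp add: H_surj_def)
  note cf = H_homD[OF hf]
  show "rmodule (fmod M)" by (rule H_moduleD(2)[OF M])
  show "rproj (fmod P)" by (rule rproj_fmod[OF P])
  show "repi (fmod P) (fmod M) (from_mat f)" using f H_surj_iff[OF wP wM hf] by simp
  fix X g r assume "rmodule X \<and> rhom X (fmod P) g \<and> from_mat f * (g * r) = ide (fmod M)"
  then have X: "rmodule X" and g: "rhom X (fmod P) g" and r: "from_mat f * (g * r) = idm (rdim M)" by auto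
  note hg = homD[OF g] and pX = premoduleD[OF rmoduleD(1)[OF X]]
  define U where "U = {v \<in> rspace P. \<exists>y. ide X * y = y \<and> g * y = from_vec v}"
  have "H_submodule P U"
    unfolding H_submodule_def
  proof (intro conjI ballI allI)
    show "0\<^sub>v (rdim P) \<in> U" by (auto simp: U_def intro!: exI[of _ 0])
  next
    fix v w assume "v \<in> U" "w \<in> U"
    then obtain y z where "v \<in> rspace P" "w \<in> rspace P" "ide X * y = y" "g * y = from_vec v"
      "ide X * z = z" "g * z = from_vec w" by (auto simp: U_def)
    then show "v + w \<in> U" by (auto simp: U_def from_vec_add distrib_left intro!: exI[of _ "y + z"])
  next
    fix x v assume "v \<in> U"
    then obtain y where "v \<in> rspace P" "ide X * y = y" "g * y = from_vec v" by (auto simp: U_def)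
    then show "x \<cdot>\<^sub>v v \<in> U" by (auto simp: U_def from_vec_smult intro!: exI[of _ "x *\<^sub>k y"])
  next
    fix h v assume "v \<in> U"
    then obtain y where y: "v \<in> rspace P" "ide X * y = y" "g * y = from_vec v" by (auto simp: U_def)
    then have "g * (act X h * y) = from_vec (ract P h *\<^sub>v v)"
      using hg(6)[of h y] by (simp add: from_mat_vec[OF wf_repD[OF wP]])
    then show "ract P h *\<^sub>v v \<in> U"
      using mult_mat_vec_carrier[OF wf_repD[OF wP] y(1)] by (auto simp: U_def pX intro!: exI[of _ "act X h * y"])
  qed (auto simp: U_def)
  moreover have "(*\<^sub>v) f ` U = rspace M"
  proof (intro equalityI subsetI)
    fix w assume w: "w \<in> rspace M"
    define y where "y = ide X * (r * from_vec w)"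
    have y: "ide X * y = y" "y * munit 0 0 = y"
      by (simp_all add: y_def pX mult.assoc idm_from_vec(2)[OF w])
    define v where "v = to_vec (rdim P) (g * y)"
    have v: "v \<in> rspace P" "from_vec v = g * y"
      unfolding v_def using hg(5)[of y] by (auto intro!: from_to_vec simp: mult.assoc y(2))
    have "from_mat f * (g * y) = from_vec w"
      using mult_eq_assoc[OF r] by (simp add: y_def hg mult.assoc idm_from_vec(1)[OF w])
    then have "from_vec (f *\<^sub>v v) = from_vec w" by (simp add: from_mat_vec[OF cf v(1)] v(2))
    then have "f *\<^sub>v v = w" using from_vec_inject[OF mult_mat_vec_carrier[OF cf v(1)] w] by blast
    moreover have "v \<in> U" using v y(1) by (auto simp: U_def)
    ultimately show "w \<in> (*\<^sub>v) f ` U" by blast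
  next
    fix w assume "w \<in> (*\<^sub>v) f ` U"
    then show "w \<in> rspace M" using mult_mat_vec_carrier[OF cf] by (auto simp: U_def)
  qed
  ultimately have U: "U = rspace P" by (rule ess)
  show "repi X (fmod P) g"
  proof (rule repiI[OF g _ premodule_fmod[OF wP]], rule column_choice)
    fix x :: "'k fm" and j assume "ide (fmod P) * x = x"
    then have "idm (rdim P) * x = x" by simp
    then obtain v where v: "v \<in> rspace P" "from_vec v = x * munit j 0" by (rule column_vec)
    then have "v \<in> U" using U by simp
    then show "\<exists>y. ide X * y = y \<and> g * y = x * munit j 0" using v(2) by (auto simp: U_def)
  qed
qed

text \<open>The submodule tested is the kernel of the transpose of \<open>g\<close>. It meets the
  image of \<open>M\<close> trivially because the transpose of \<open>r\<close> is a left inverse on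
  that image.\<close>

lemma rcover_flip_fmod:
  assumes "injective_envelope n q M E f"
  shows "rcover (flip (fmod M)) (flip (fmod E)) (tr (from_mat f))"
  unfolding rcover_def
proof (intro conjI allI impI)
  have M: "H_module n q M" and E: "H_injective n q E" and f: "H_inj M E f"
    and ess: "\<And>U. H_submodule E U \<Longrightarrow> U \<inter> (*\<^sub>v) f ` rspace M = {0\<^sub>v (rdim E)} \<Longrightarrow> U = {0\<^sub>v (rdim E)}"
    using assms by (auto simp: injective_envelope_def)
  have EM: "H_module n q E" using E by (simp add: H_injective_def)
  note wM = H_moduleD(1)[OF M] and wE = H_moduleD(1)[OF EM]
  have hf: "H_hom M E f" using f by (simp add: H_inj_def)
  note cf = H_homD[OF hf]
  show "rmodule (flip (fmod M))" by (rule rmodule_flip[OF H_moduleD(2)[OF M]])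
  show "rproj (flip (fmod E))" by (rule rproj_flip_fmod[OF E])
  have "rmono (fmod M) (fmod E) (from_mat f)" using f H_inj_iff[OF wM wE hf] by simp
  then show "repi (flip (fmod E)) (flip (fmod M)) (tr (from_mat f))"
    by (rule rmono_flip[OF _ premodule_fmod[OF wM] premodule_fmod[OF wE]])
  fix X g r assume "rmodule X \<and> rhom X (flip (fmod E)) g \<and> tr (from_mat f) * (g * r) = ide (flip (fmod M))"
  then have X: "rmodule X" and g: "rhom X (flip (fmod E)) g"
    and r: "tr (from_mat f) * (g * r) = idm (rdim M)" by auto
  define G where "G = tr g"
  have G: "rhom (fmod E) (flip X) G" unfolding G_def using rhom_flip[OF g] by simp
  note hG = homD[OF G]
  have rG: "tr r * G * from_mat f = idm (rdim M)"
    using arg_cong[OF r, of tr] by (simp add: G_def)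
  define U where "U = {v \<in> rspace E. G * from_vec v = 0}"
  have "H_submodule E U"
    unfolding H_submodule_def
  proof (intro conjI ballI allI)
    fix h v assume "v \<in> U"
    then have v: "v \<in> rspace E" "G * from_vec v = 0" by (auto simp: U_def)
    have "G * (from_mat (ract E h) * from_vec v) = act (flip X) h * (G * from_vec v)"
      using hG(6)[of h "from_vec v"] by simp
    then show "ract E h *\<^sub>v v \<in> U"
      using mult_mat_vec_carrier[OF wf_repD[OF wE] v(1)] v
      by (simp add: U_def from_mat_vec[OF wf_repD[OF wE] v(1)])
  qed (auto simp: U_def from_vec_add from_vec_smult distrib_left)
  moreover have "U \<inter> (*\<^sub>v) f ` rspace M = {0\<^sub>v (rdim E)}"
  proof (intro equalityI subsetI)
    fix v assume "v \<in> U \<inter> (*\<^sub>v) f ` rspace M"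
    then obtain w where w: "w \<in> rspace M" "v = f *\<^sub>v w" "G * from_vec v = 0" by (auto simp: U_def)
    have "from_vec w = tr r * G * from_mat f * from_vec w" by (simp only: rG idm_from_vec(1)[OF w(1)])
    also have "\<dots> = tr r * (G * from_vec v)" by (simp only: w(2) from_mat_vec[OF cf w(1)] mult.assoc)
    finally have "from_vec w = from_vec (0\<^sub>v (rdim M))" using w(3) by simp
    then have "w = 0\<^sub>v (rdim M)" using from_vec_inject[OF w(1) zero_carrier_vec] by blast
    then show "v \<in> {0\<^sub>v (rdim E)}" using w(2) cf by (auto intro!: eq_vecI)
  next
    fix v :: "'k vec" assume "v \<in> {0\<^sub>v (rdim E)}"
    then have v: "v = 0\<^sub>v (rdim E)" by simp
    have "v = f *\<^sub>v 0\<^sub>v (rdim M)" unfolding v using cf by (auto intro!: eq_vecI)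
    then have "v \<in> (*\<^sub>v) f ` rspace M" by (rule image_eqI) simp
    then show "v \<in> U \<inter> (*\<^sub>v) f ` rspace M" by (simp add: U_def v)
  qed
  ultimately have U: "U = {0\<^sub>v (rdim E)}" by (rule ess)
  have "rmono (fmod E) (flip X) G"
    by (rule rmono_columns[OF G]) (use U in \<open>auto simp: U_def\<close>)
  from rmono_flip[OF this premodule_fmod[OF wE] premodule_flip[OF rmoduleD(1)[OF X]]]
  show "repi X (flip (fmod E)) g" by (simp add: G_def)
qed

lemma rses_fmod:
  assumes "H_module n q K" "H_module n q P" "H_module n q M" "H_inj K P i" "H_surj P M f"
    and eq: "(*\<^sub>v) i ` rspace K = mat_kernel f"
  shows "rses (fmod K) (fmod P) (fmod M) (from_mat i) (from_mat f)"
proof -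
  note w = H_moduleD(1)[OF assms(1)] H_moduleD(1)[OF assms(2)] H_moduleD(1)[OF assms(3)]
  have h: "H_hom K P i" "H_hom P M f" using assms(4,5) by (auto simp: H_inj_def H_surj_def)
  show ?thesis
    unfolding rses_def using exact_columns[OF w h eq] assms(4,5) H_inj_iff[OF w(1,2) h(1)]
      H_surj_iff[OF w(2,3) h(2)] H_moduleD(2)[OF assms(1)] H_moduleD(2)[OF assms(2)] H_moduleD(2)[OF assms(3)]
    by blast
qed

end

context taft_covers
begin

lemma rsyz_fmod:
  assumes "syzygy n q M K" shows "rsyz (fmod M) (fmod K)"
proof -
  obtain P f i where K: "H_module n q K" and c: "projective_cover n q M P f" and i: "H_inj K P i"
    and eq: "(*\<^sub>v) i ` rspace K = mat_kernel f" using assms by (auto simp: syzygy_def)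
  have "rses (fmod K) (fmod P) (fmod M) (from_mat i) (from_mat f)"
    by (rule rses_fmod[OF K _ _ i _ eq]) (use c in \<open>auto simp: projective_cover_def H_projective_def\<close>)
  then show ?thesis using rcover_fmod[OF c] unfolding rsyz_def by blast
qed

lemma rsyz_flip_fmod:
  assumes "cosyzygy n q M C" shows "rsyz (flip (fmod M)) (flip (fmod C))"
proof -
  obtain E f p where C: "H_module n q C" and c: "injective_envelope n q M E f" and p: "H_surj E C p"
    and eq: "mat_kernel p = (*\<^sub>v) f ` rspace M" using assms by (auto simp: cosyzygy_def)
  have "rses (fmod M) (fmod E) (fmod C) (from_mat f) (from_mat p)"
    by (rule rses_fmod[OF _ _ C _ p eq[symmetric]]) (use c in \<open>auto simp: injective_envelope_def H_injective_def\<close>)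
  then show ?thesis using rcover_flip_fmod[OF c] rses_flip unfolding rsyz_def by blast
qed

lemma rsyz_fmod_power: "(syzygy n q ^^ m) M K \<Longrightarrow> (rsyz ^^ m) (fmod M) (fmod K)"
  by (induction m arbitrary: K) (auto intro: rsyz_fmod)

lemma rsyz_flip_fmod_power: "(cosyzygy n q ^^ m) M C \<Longrightarrow> (rsyz ^^ m) (flip (fmod M)) (flip (fmod C))"
  by (induction m arbitrary: C) (auto intro: rsyz_flip_fmod)

end

context taft_double
begin

section \<open>Simple modules, tensor products and direct sums in coordinates\<close>

lemma fmod_V_mod: "fmod (V_mod q l r) = V l r"
proof -
  have "from_mat (V_act q l r g) = hw_act l l r g" for g
  proof (rule column_ext_idm[of _ l])
    show "from_mat (V_act q l r g) * idm l = from_mat (V_act q l r g)"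
      by (rule idm_from_mat(2)[of _ l]) (cases g; simp)
    show "hw_act l l r g * idm l = hw_act l l r g" using premoduleD(3)[OF premodule_hwm[of l l r], of g] by simp
    fix j assume j: "j < l"
    show "from_mat (V_act q l r g) * munit j 0 = hw_act l l r g * munit j 0"
      by (rule fm_eqI, cases g; cases j)
        (use j in \<open>auto simp: hw_col ent_mult_munit ent_from_mat ent_munit algebra_simps\<close>)
  qed
  then show ?thesis by (simp add: fmod_def hwm_def V_mod_def)
qed

lemma wf_V_mod: "wf_rep (V_mod q l r)"
  unfolding wf_rep_def
proof
  fix g show "ract (V_mod q l r) g \<in> carrier_mat (rdim (V_mod q l r)) (rdim (V_mod q l r))"
    by (cases g) (simp_all add: V_mod_def)
qed

end

lemma kron_carrier: "A \<in> carrier_mat p p \<Longrightarrow> B \<in> carrier_mat s s \<Longrightarrow> kron A B \<in> carrier_mat (p * s) (p * s)"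
  by (auto simp: kron_def)

lemma wf_tensor: "wf_rep M \<Longrightarrow> wf_rep N \<Longrightarrow> wf_rep (H_tensor M N)"
  unfolding wf_rep_def
proof
  fix g assume "\<forall>g. ract M g \<in> carrier_mat (rdim M) (rdim M)" "\<forall>g. ract N g \<in> carrier_mat (rdim N) (rdim N)"
  then show "ract (H_tensor M N) g \<in> carrier_mat (rdim (H_tensor M N)) (rdim (H_tensor M N))"
    by (cases g) (auto simp: H_tensor_def kron_carrier intro!: add_carrier_mat)
qed

lemma kron_intertwine:
  assumes A: "A \<in> carrier_mat p p" and B: "B \<in> carrier_mat s s"
  shows "perm_fm (grid s) {..<p * s} * from_mat (kron A B)
    = (from_mat A \<otimes>\<^sub>k from_mat B) * perm_fm (grid s) {..<p * s}"
proof (rule perm_fm_intertwine)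
  show "inj_on (grid s) {..<p * s}" "inj_on (grid s) {..<p * s}" by (rule inj_grid)+
  show "ent (from_mat (kron A B)) i j = 0" if "i \<notin> {..<p * s} \<or> j \<notin> {..<p * s}" for i j
    using that A B by (auto simp: ent_from_mat kron_def)
  show "ent (from_mat A \<otimes>\<^sub>k from_mat B) (grid s i) (grid s j) = ent (from_mat (kron A B)) i j"
    if "i \<in> {..<p * s}" "j \<in> {..<p * s}" for i j
  proof -
    have "s > 0" using that by (cases s) auto
    then show ?thesis using that A B by (auto simp: grid_def ent_from_mat kron_def less_mult_imp_div_less)
  qed
  show "ent (from_mat A \<otimes>\<^sub>k from_mat B) i j = 0" if "i \<notin> grid s ` {..<p * s} \<or> j \<notin> grid s ` {..<p * s}" for i j
  proof -
    obtain i1 i2 j1 j2 where i: "i = prod_encode (i1, i2)" and j: "j = prod_encode (j1, j2)"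
      by (metis prod_decode_inverse surj_pair)
    have "\<not> (i1 < p \<and> i2 < s) \<or> \<not> (j1 < p \<and> j2 < s)" using that unfolding grid_image i j by auto
    then show ?thesis unfolding i j using A B by (auto simp: ent_from_mat)
  qed
qed simp_all

lemma riso_fmod_tensor:
  assumes "wf_rep M" "wf_rep N" shows "riso (fmod (H_tensor M N)) (rtens (fmod M) (fmod N))"
proof -
  let ?p = "rdim M" and ?s = "rdim N"
  define u where "u = (perm_fm (grid ?s) {..<?p * ?s} :: 'a fm)"
  have tu: "tr u * u = idm (?p * ?s)" unfolding u_def idm_def by (rule tr_perm_fm_mult) (simp_all add: inj_grid)
  have ut: "u * tr u = idm ?p \<otimes>\<^sub>k idm ?s"
    unfolding u_def sum_munit_grid[symmetric] by (rule perm_fm_tr_mult) (simp_all add: inj_grid)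
  have ui: "u * idm (?p * ?s) = u" by (simp add: u_def perm_fm_def sum_distrib_right munit_idm)
  have iu: "(idm ?p \<otimes>\<^sub>k idm ?s) * u = u" using ui by (simp add: ut[symmetric] mult.assoc tu)
  note k = kron_intertwine[OF wf_repD[OF assms(1)] wf_repD[OF assms(2)], folded u_def]
  note k1 = kron_intertwine[OF one_carrier_mat[of ?p] wf_repD[OF assms(2)], folded u_def, unfolded from_mat_one]
  note c = kron_carrier[OF wf_repD[OF assms(1)] wf_repD[OF assms(2)]]
  note c1 = kron_carrier[OF one_carrier_mat wf_repD[OF assms(2)]]
  have a: "u * act (fmod (H_tensor M N)) g = act (rtens (fmod M) (fmod N)) g * u" for g
    by (cases g) (simp_all add: H_tensor_def k k1 from_mat_add[OF c c1] distrib_left distrib_right)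
  have h: "rhom (fmod (H_tensor M N)) (rtens (fmod M) (fmod N)) u"
    unfolding rhom_def using a ui iu by (simp add: H_tensor_def)
  have p: "premodule (fmod (H_tensor M N))" "premodule (rtens (fmod M) (fmod N))"
    using premodule_fmod[OF wf_tensor[OF assms]] premodule_tens[OF premodule_fmod[OF assms(1)] premodule_fmod[OF assms(2)]] .
  have "idm (?p * ?s) * tr u = tr u" using arg_cong[OF ui, of tr] by simp
  then have "repi (fmod (H_tensor M N)) (rtens (fmod M) (fmod N)) u"
    unfolding repi_def using h ut by (auto simp: H_tensor_def intro!: exI[of _ "tr u"])
  moreover have "rmono (fmod (H_tensor M N)) (rtens (fmod M) (fmod N)) u"
    by (rule rmonoI_inverse[OF h, of "tr u"]) (simp add: tu H_tensor_def)
  ultimately show ?thesis by (rule mono_epi_iso[OF p, rotated])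
qed

text \<open>The embedding of a block of size \<open>R\<close> behind the first \<open>p\<close>
  coordinates; its transpose is the projection back.\<close>

definition shift :: "nat \<Rightarrow> nat \<Rightarrow> 'k::field fm" where "shift p R = perm_fm ((+) p) {..<R}"

lemma ent_mult_shift: "ent (y * shift p R) k j = (if j < R then ent y k (p + j) else 0)"
proof -
  have "ent (y * shift p R) k j = (\<Sum>i<R. if i = j then ent y k (p + i) else 0)"
    unfolding shift_def perm_fm_def sum_distrib_left ent_sum by (rule sum.cong) (auto simp: ent_mult_munit)
  then show ?thesis by (simp add: sum.delta)
qed

lemma ent_shift_mult: "ent (shift p R * x) k j = (if p \<le> k \<and> k < p + R then ent x (k - p) j else 0)"
proof -
  have "ent (shift p R * x) k j = (\<Sum>i<R. if i = k - p then (if p \<le> k then ent x (k - p) j else 0) else 0)"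
    unfolding shift_def perm_fm_def sum_distrib_right ent_sum by (rule sum.cong) (auto simp: ent_munit_mult)
  then show ?thesis by (auto simp: sum.delta)
qed

lemma ent_shift: "ent (shift p R) i j = (if j < R \<and> i = p + j then 1 else 0)"
proof -
  have "ent (shift p R * idm R :: 'a fm) i j = (if j < R \<and> i = p + j then 1 else 0)"
    unfolding ent_shift_mult by (auto simp: ent_idm)
  moreover have "shift p R * idm R = (shift p R :: 'a fm)"
    by (simp add: shift_def perm_fm_def sum_distrib_right munit_idm)
  ultimately show ?thesis by simp
qed

lemma ent_tr_shift_mult: "ent (tr (shift p R) * y) k j = (if k < R then ent y (p + k) j else (0 :: 'k::field))"
  using ent_mult_shift[of "tr y" p R j k] unfolding ent_tr[of "tr y * shift p R", symmetric] by simp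

lemma ent_mult_tr_shift: "ent (y * tr (shift p R)) k j = (if p \<le> j \<and> j < p + R then ent y k (j - p) else (0 :: 'k::field))"
  using ent_shift_mult[of p R "tr y" j k] unfolding ent_tr[of "shift p R * tr y", symmetric] by simp

lemma wf_direct_sum: "(\<And>M. M \<in> set Ms \<Longrightarrow> wf_rep M) \<Longrightarrow> wf_rep (H_direct_sum Ms)"
proof (induction Ms)
  case (Cons M Ms)
  then have "wf_rep M" "wf_rep (H_direct_sum Ms)" by simp_all
  then show ?case by (auto simp: wf_rep_def H_direct_sum_def Let_def)
qed (simp add: wf_rep_def H_direct_sum_def)

lemma biprod_direct_sum:
  assumes "\<And>N. N \<in> set (M # Ms) \<Longrightarrow> wf_rep N"
  shows "\<exists>i1 i2 p1 p2. biprod (fmod M) (fmod (H_direct_sum Ms)) (fmod (H_direct_sum (M # Ms))) i1 i2 p1 p2"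
proof -
  let ?p = "rdim M" and ?R = "sum_list (map rdim Ms)"
  have wM: "wf_rep M" and wS: "wf_rep (H_direct_sum Ms)" using assms by (auto intro: wf_direct_sum)
  have c: "ract M g \<in> carrier_mat ?p ?p" "diag_block_mat (map (\<lambda>M. ract M g) Ms) \<in> carrier_mat ?R ?R" for g
    using wf_repD[OF wM] wf_repD[OF wS] by (auto simp: H_direct_sum_def)
  have e: "ent (from_mat (ract (H_direct_sum (M # Ms)) g)) i j =
      (if i < ?p \<and> j < ?p then ract M g $$ (i, j)
       else if ?p \<le> i \<and> ?p \<le> j \<and> i < ?p + ?R \<and> j < ?p + ?R then diag_block_mat (map (\<lambda>M. ract M g) Ms) $$ (i - ?p, j - ?p)
       else 0)" for g i j
    using c[of g] by (auto simp: ent_from_mat H_direct_sum_def Let_def)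
  have e1: "ent (from_mat (ract M g)) i j = (if i < ?p \<and> j < ?p then ract M g $$ (i, j) else 0)" for g i j
    using c(1)[of g] by (auto simp: ent_from_mat)
  have e2: "ent (from_mat (ract (H_direct_sum Ms) g)) i j = (if i < ?R \<and> j < ?R then diag_block_mat (map (\<lambda>M. ract M g) Ms) $$ (i, j) else 0)" for g i j
    using c(2)[of g] by (auto simp: ent_from_mat H_direct_sum_def)
  have d: "rdim (H_direct_sum Ms) = ?R" "rdim (H_direct_sum (M # Ms)) = ?p + ?R" by (simp_all add: H_direct_sum_def)
  note s = ent_mult_shift ent_shift_mult ent_tr_shift_mult ent_mult_tr_shift ent_idm_mult ent_mult_idm ent_idm ent_shift
  have "biprod (fmod M) (fmod (H_direct_sum Ms)) (fmod (H_direct_sum (M # Ms))) (idm ?p) (shift ?p ?R) (idm ?p) (tr (shift ?p ?R))"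
    unfolding biprod_def rhom_def fmod_simps d
    by (intro conjI allI fm_eqI) (auto simp: s e e1 e2)
  then show ?thesis by blast
qed

context taft_double
begin

lemma direct_sum_proj:
  assumes "\<And>M. M \<in> set Ms \<Longrightarrow> wf_rep M" "\<And>M. M \<in> set Ms \<Longrightarrow> rproj (fmod M)"
  shows "rproj (fmod (H_direct_sum Ms)) \<and> hdim (fmod (H_direct_sum Ms)) X = (\<Sum>M\<leftarrow>Ms. hdim (fmod M) X)"
  using assms
proof (induction Ms)
  case Nil
  have z: "ide (fmod (H_direct_sum [])) = (0 :: 'k fm)" "act (fmod (H_direct_sum [])) g = (0 :: 'k fm)" for g
    by (auto simp: H_direct_sum_def idm_def intro!: fm_eqI simp: ent_from_mat)
  have p: "premodule (fmod (H_direct_sum []) :: 'k rmod)" by (rule premodule_fmod[OF wf_direct_sum]) simp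
  have "rmodule (fmod (H_direct_sum []))" by (rule rmoduleI[OF p]) (simp_all only: z, simp_all)
  moreover have "rhom (fmod (H_direct_sum [])) N f \<Longrightarrow> f = 0" for N and f :: "'k fm"
    by (drule homD(1), unfold z) simp
  ultimately show ?case unfolding rproj_def by (auto simp: hdim_eq_0 intro: hom_zero)
next
  case (Cons M Ms)
  have w: "wf_rep N" if "N \<in> set (M # Ms)" for N using Cons.prems that by blast
  obtain i1 i2 p1 p2 where b: "biprod (fmod M) (fmod (H_direct_sum Ms)) (fmod (H_direct_sum (M # Ms))) i1 i2 p1 p2"
    using biprod_direct_sum[OF w] by blast
  have IH: "rproj (fmod (H_direct_sum Ms))" "hdim (fmod (H_direct_sum Ms)) X = (\<Sum>M\<leftarrow>Ms. hdim (fmod M) X)"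
    using Cons by auto
  have M: "rproj (fmod M)" using Cons.prems by simp
  have B: "rmodule (fmod (H_direct_sum (M # Ms)))"
    by (rule rmodule_biprod[OF premodule_fmod[OF wf_direct_sum[OF w]] rprojD[OF M] rprojD[OF IH(1)] b])
  show ?case using rproj_biprod[OF M IH(1) b] hdim_biprod_left[OF b] B IH by simp
qed

end

lemma wf_copies: "wf_rep M \<Longrightarrow> wf_rep (H_copies k M)"
  unfolding H_copies_def by (rule wf_direct_sum) (simp add: set_replicate_conv_if split: if_splits)

context taft_double
begin

lemma copies_proj:
  assumes "wf_rep M" "rproj (fmod M)"
  shows "rproj (fmod (H_copies k M))" "hdim (fmod (H_copies k M)) X = k * hdim (fmod M) X"
proof -
  have "rproj (fmod (H_copies k M)) \<and> hdim (fmod (H_copies k M)) X = (\<Sum>M\<leftarrow>replicate k M. hdim (fmod M) X)"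
    unfolding H_copies_def by (rule direct_sum_proj) (use assms in \<open>auto simp: set_replicate_conv_if split: if_splits\<close>)
  then show "rproj (fmod (H_copies k M))" "hdim (fmod (H_copies k M)) X = k * hdim (fmod M) X"
    by (simp_all add: sum_list_replicate)
qed

end

theorem proposition4p1:
  fixes q :: "'k::alg_closed_field"
    and n l l' m :: nat
    and r r' :: int
    and P :: "nat \<Rightarrow> int \<Rightarrow> 'k rep"
    and W :: "'k rep"
  assumes "n > 2"
    and "q ^ n = 1" and "\<forall>j. 0 < j \<and> j < n \<longrightarrow> q ^ j \<noteq> 1"
    and "\<forall>s t. 1 \<le> s \<and> s < n \<longrightarrow> (\<exists>f. projective_cover n q (V_mod q s t) (P s t) f)"
    and "\<forall>t. P n t = V_mod q n t"
    and "1 \<le> l" and "l \<le> l'" and "l' < n" and "l + l' \<le> n"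
    and "m \<ge> 1"
    and "(syzygy n q ^^ m) (V_mod q l' r') W \<or> (cosyzygy n q ^^ m) (V_mod q l' r') W"
  shows "H_iso (H_tensor (P l r) W)
    (H_direct_sum
      (map (\<lambda>i. H_copies (m + (if even m then 1 else 0))
                  (P (l + l' - 1 - 2 * i) (r + r' + int i))) [0..<l] @
       map (\<lambda>i. H_copies (m + (if odd m then 1 else 0))
                  (P (n + l + l' - 1 - 2 * i) (r + r' + int i))) [l'..<l + l'] @
       map (\<lambda>i. H_copies (2 * (m + (if even m then 1 else 0)))
                  (P (n + l + l' - 1 - 2 * i) (r + r' + int i))) [half_up (l + l' - 1)..<l'] @
       map (\<lambda>i. H_copies (2 * (m + (if odd m then 1 else 0)))
                  (P (l + l' - 1 + 2 * i) (r + r' - int i))) [1..<half_up (n - l - l') + 1]))"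
proof -
  interpret taft_double n q by unfold_locales (use assms(1-3) in auto)
  have P: "wf_rep (P s t)" "\<exists>f. rcover (V s t) (fmod (P s t)) f" if "1 \<le> s" "s \<le> n" for s t
  proof -
    have "wf_rep (P s t) \<and> (\<exists>f. rcover (V s t) (fmod (P s t)) f)"
    proof (cases "s = n")
      case True
      then show ?thesis using assms(5) cover_V_n[of t] wf_V_mod[of n t] by (auto simp: fmod_V_mod)
    next
      case False
      with \<open>s \<le> n\<close> have "s < n" by simp
      with assms(4) \<open>1 \<le> s\<close> obtain f where f: "projective_cover n q (V_mod q s t) (P s t) f" by blast
      have "H_module n q (P s t)" using f by (simp add: projective_cover_def H_projective_def)
      then show ?thesis using rcover_fmod[OF f] H_moduleD(1) by (auto simp: fmod_V_mod)
    qed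
    then show "wf_rep (P s t)" "\<exists>f. rcover (V s t) (fmod (P s t)) f" by auto
  qed
  interpret taft_covers n q "\<lambda>s t. fmod (P s t)" by unfold_locales (rule P(2))
  have l': "1 \<le> l'" "l' \<le> n" and l: "1 \<le> l" "l \<le> n" using assms(6-9) by auto
  have x: "rngL (l', r')" using l' assms(8) by simp
  \<comment> \<open>For cosyzygies the whole coresolution is transposed: it becomes a resolution of
    \<open>flip (V l' r')\<close>, which is again the simple module with label (l',r').\<close>
  have W: "GW m (l', r') (fmod W) \<or> GW m (l', r') (flip (fmod W))"
    using assms(11)
  proof
    assume "(syzygy n q ^^ m) (V_mod q l' r') W"
    from rsyz_fmod_power[OF this] have "(rsyz ^^ m) (V l' r') (fmod W)" by (simp only: fmod_V_mod)
    moreover have "GW 0 (l', r') (V l' r')" using rmodule_V[OF l'] by (simp add: riso_refl premodule_hwm)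
    ultimately show ?thesis using rsyz_GW[OF x] by blast
  next
    assume "(cosyzygy n q ^^ m) (V_mod q l' r') W"
    from rsyz_flip_fmod_power[OF this] have "(rsyz ^^ m) (flip (V l' r')) (flip (fmod W))" by (simp only: fmod_V_mod)
    moreover have "GW 0 (l', r') (flip (V l' r'))"
      using rmodule_flip[OF rmodule_V[OF l']] flip_V_iso[OF l'] by simp
    ultimately show ?thesis using rsyz_GW[OF x] by blast
  qed
  obtain k where k: "m = Suc k" using assms(10) by (cases m) auto
  \<comment> \<open>As m > 0, the module \<open>W\<close> is the result of at least one step, which
    supplies the module relations.\<close>
  have WM: "H_module n q W" using assms(11) unfolding k by (auto simp: syzygy_def cosyzygy_def)
  note wW = H_moduleD(1)[OF WM] and mW = H_moduleD(2)[OF WM]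
  define Ms where "Ms = map (\<lambda>i. (m + (if even m then 1 else 0), l + l' - 1 - 2 * i, r + r' + int i)) [0..<l] @
     map (\<lambda>i. (m + (if odd m then 1 else 0), n + l + l' - 1 - 2 * i, r + r' + int i)) [l'..<l + l'] @
     map (\<lambda>i. (2 * (m + (if even m then 1 else 0)), n + l + l' - 1 - 2 * i, r + r' + int i)) [half_up (l + l' - 1)..<l'] @
     map (\<lambda>i. (2 * (m + (if odd m then 1 else 0)), l + l' - 1 + 2 * i, r + r' - int i)) [1..<half_up (n - l - l') + 1]"
  define S where "S = (\<lambda>(k, s, t). H_copies k (P s t))"
  \<comment> \<open>Every label in the list lies in 1, ..., n, so the truncated subtractions agree
    with those over the integers and each entry of \<open>P\<close> is one of the given
    covers.\<close>
  have rng: "1 \<le> s \<and> s \<le> n" if "(k, s, t) \<in> set Ms" for k s t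
  proof -
    have "2 * half_up (n - l - l') \<le> n - l - l' + 1" by (simp add: half_up_def)
    then have "l + l' - 1 + 2 * i \<le> n" if "i < half_up (n - l - l') + 1" for i
      using that assms(6,9) by linarith
    moreover have "l + l' - 1 \<le> 2 * half_up (l + l' - 1)" unfolding half_up_def by presburger
    then have "n + l + l' - 1 - 2 * i \<le> n" if "half_up (l + l' - 1) \<le> i" for i using that by linarith
    ultimately show ?thesis
      using that assms(6-9) unfolding Ms_def by auto
  qed
  have cp: "wf_rep (S y)" "rproj (fmod (S y))" "hdim (fmod (S y)) X = fst y * hdim (fmod (P (fst (snd y)) (snd (snd y)))) X"
    if "y \<in> set Ms" for y X
  proof -
    obtain k s t where y: "y = (k, s, t)" by (cases y)
    from rng that y have s: "1 \<le> s" "s \<le> n" by auto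
    show "wf_rep (S y)" "rproj (fmod (S y))" "hdim (fmod (S y)) X = fst y * hdim (fmod (P (fst (snd y)) (snd (snd y)))) X"
      unfolding S_def y using wf_copies[OF P(1)[OF s]] copies_proj[OF P(1)[OF s] PP_proj[OF s]] by auto
  qed
  have wS: "wf_rep (H_direct_sum (map S Ms))" by (rule wf_direct_sum) (use cp in auto)
  have S: "rproj (fmod (H_direct_sum (map S Ms)))"
    "hdim (fmod (H_direct_sum (map S Ms))) X = (\<Sum>M\<leftarrow>map S Ms. hdim (fmod M) X)" for X
  proof -
    have "wf_rep M \<and> rproj (fmod M)" if "M \<in> set (map S Ms)" for M
    proof -
      from that obtain y where "y \<in> set Ms" "M = S y" by auto
      then show ?thesis using cp(1,2) by blast
    qed
    then show "rproj (fmod (H_direct_sum (map S Ms)))"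
      "hdim (fmod (H_direct_sum (map S Ms))) X = (\<Sum>M\<leftarrow>map S Ms. hdim (fmod M) X)"
      using direct_sum_proj[of "map S Ms" X] by blast+
  qed
  have "riso (rtens (fmod (P l r)) (fmod W)) (fmod (H_direct_sum (map S Ms)))"
  proof (rule proj_iso[OF rproj_tens[OF PP_proj[OF l] mW] S(1)])
    fix s' t' assume s': "1 \<le> s'" "s' \<le> n"
    have "hdim (fmod (H_direct_sum (map S Ms))) (V s' t') = (\<Sum>y\<leftarrow>Ms. fst y * lbl (snd y) s' t')"
      unfolding S(2) map_map
    proof (intro arg_cong[where f = sum_list] map_cong refl)
      fix y assume y: "y \<in> set Ms"
      obtain k s t where kst: "y = (k, s, t)" by (cases y)
      from rng y kst have s: "1 \<le> s" "s \<le> n" by auto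
      show "((\<lambda>M. hdim (fmod M) (V s' t')) \<circ> S) y = fst y * lbl (snd y) s' t'"
        using cp(3)[OF y, of "V s' t'"] hdim_PP[OF s s'] by (simp add: kst)
    qed
    also have "\<dots> = hdim (rtens (fmod (P l r)) (fmod W)) (V s' t')"
    proof -
      have h: "half_up (l + l' - 1) = (l + l') div 2" "half_up (n - l - l') + 1 = (n - l - l' + 1) div 2 + 1"
        using l by (simp_all add: half_up_def)
      show ?thesis
        unfolding hdim_tens_GW[OF assms(6-9) s' W mW] Ms_def h
        by (simp only: map_append map_map sum_list_append comp_def fst_conv snd_conv
            interv_sum_list_conv_sum_set_nat set_upt atLeast0LessThan add.assoc)
    qed
    finally show "hdim (rtens (fmod (P l r)) (fmod W)) (V s' t') = hdim (fmod (H_direct_sum (map S Ms))) (V s' t')" ..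
  qed
  then have "riso (fmod (H_tensor (P l r) W)) (fmod (H_direct_sum (map S Ms)))"
    using riso_trans[OF riso_fmod_tensor[OF P(1)[OF l] wW]] by blast
  from H_iso_riso[OF wf_tensor[OF P(1)[OF l] wW] wS this]
  show ?thesis unfolding Ms_def S_def by (simp add: comp_def)
qed

end
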